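(* Let $G\colon\mathbb{R}^n\times\mathbb{R}^n\times[0,\infty)\to[0,\infty)$ be a generalized Young function satisfying (H1), (H2) and (H3) with exponents $1<p^-\le p^+<\infty$ (as defined in the context). Then for any $u\in W^{1,p^-}(\mathbb{R}^n)\cap W^{1,p^+}(\mathbb{R}^n)$, $$\lim_{s\uparrow 1}(1-s)\,\mathcal{J}_{s,G}(u)=\int_{\mathbb{R}^n}H_0(x,|\nabla u(x)|)\,dx,$$ where $$\mathcal{J}_{s,G}(u)=\iint_{\mathbb{R}^n\times\mathbb{R}^n}G\left(x,y,\frac{|u(x)-u(y)|}{|x-y|^s}\right)\frac{dx\,dy}{|x-y|^n}$$ and $$H_0(x,t)=\int_0^1\int_{\mathbb{S}^{n-1}}G(x,x,t|w_n|r)\,dS_w\,\frac{dr}{r}.$$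
   Context: Let $n\ge 1$ be an integer and $s\in(0,1)$. A generalized Young function is a function $G\colon\mathbb{R}^n\times\mathbb{R}^n\times[0,\infty)\to[0,\infty)$ of the form $G(x,y,t)=\int_0^t g(x,y,\tau)\,d\tau$, where $g\colon\mathbb{R}^n\times\mathbb{R}^n\times[0,\infty)\to[0,\infty)$ satisfies, for every $(x,y)$: (i) $g(x,y,0)=0$ and $g(x,y,t)>0$ for $t>0$; (ii) $t\mapsto g(x,y,t)$ is nondecreasing on $[0,\infty)$; (iii) $t\mapsto g(x,y,t)$ is right continuous on $[0,\infty)$ and $\lim_{t\to\infty}g(x,y,t)=\infty$. It is understood that $(x,y)\mapsto G(x,y,t)$ is measurable for each $t$. Hypotheses: (H1) there exist constants $0<C_1\le C_2<\infty$ such that $C_1\le G(x,y,1)\le C_2$ for all $x,y\in\mathbb{R}^n$; (H2) for every $x\in\mathbb{R}^n$ and $t\ge0$, the map $y\mapsto G(x,y,t)$ is continuous on $\mathbb{R}^n$; (H3) there exist constants $1<p^-\le p^+<\infty$ such that $p^-\le \frac{t\,g(x,y,t)}{G(x,y,t)}\le p^+$ for all $x,y\in\mathbb{R}^n$ and $t>0$. $\mathbb{S}^{n-1}$ is the unit sphere of $\mathbb{R}^n$, $dS$ is its $(n-1)$-dimensional Hausdorff (surface) measure, and $w_n$ is the $n$-th coordinate of $w\in\mathbb{S}^{n-1}$. $W^{1,p}(\mathbb{R}^n)$ is the usual Sobolev space of real-valued $L^p$ functions with weak gradient in $L^p$. *)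

theory Defs
  imports "HOL-Analysis.Analysis"
begin

section \<open>Generalized Young functions\<close>

text \<open>
  The argument \<open>t \<in> [0, \<infinity>)\<close> is a real number, and every requirement is relativised to
  \<open>t \<ge> 0\<close>; values at negative arguments are irrelevant.  The measurability of
  \<open>(x, y) \<mapsto> G(x, y, t)\<close> is Lebesgue measurability on the product space.
\<close>

definition generalized_young_function ::
  "(real^'n \<Rightarrow> real^'n \<Rightarrow> real \<Rightarrow> real) \<Rightarrow> (real^'n \<Rightarrow> real^'n \<Rightarrow> real \<Rightarrow> real) \<Rightarrow> bool" where
  "generalized_young_function G g \<longleftrightarrow>
     (\<forall>x y. g x y 0 = 0 \<and>
            (\<forall>t>0. g x y t > 0) \<and>
            mono_on {0..} (g x y) \<and>
            (\<forall>t\<ge>0. continuous (at_right t) (g x y)) \<and>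
            filterlim (g x y) at_top at_top \<and>
            (\<forall>t\<ge>0. G x y t = integral {0..t} (g x y))) \<and>
     (\<forall>t\<ge>0. (\<lambda>(x, y). G x y t) \<in> borel_measurable lebesgue)"

section \<open>Sobolev spaces\<close>

primrec C_k :: "nat \<Rightarrow> ('a::euclidean_space \<Rightarrow> real) \<Rightarrow> bool" where
  "C_k 0 f \<longleftrightarrow> continuous_on UNIV f"
| "C_k (Suc k) f \<longleftrightarrow>
     (\<exists>Df. (\<forall>x. GDERIV f x :> Df x) \<and> (\<forall>b\<in>Basis. C_k k (\<lambda>x. Df x \<bullet> b)))"

definition test_function :: "('a::euclidean_space \<Rightarrow> real) \<Rightarrow> bool" where
  "test_function \<phi> \<longleftrightarrow> (\<forall>k. C_k k \<phi>) \<and> compact (closure {x. \<phi> x \<noteq> 0})"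

definition locally_integrable ::
  "('a::euclidean_space \<Rightarrow> 'b::{banach, second_countable_topology}) \<Rightarrow> bool" where
  "locally_integrable f \<longleftrightarrow> (\<forall>K. compact K \<longrightarrow> set_integrable lebesgue K f)"

text \<open>Integration by parts against all test functions, written for the whole gradient at once.\<close>

definition has_weak_gradient :: "('a::euclidean_space \<Rightarrow> real) \<Rightarrow> ('a \<Rightarrow> 'a) \<Rightarrow> bool" where
  "has_weak_gradient u v \<longleftrightarrow>
     locally_integrable u \<and> locally_integrable v \<and>
     (\<forall>\<phi> D\<phi>. test_function \<phi> \<longrightarrow> (\<forall>x. GDERIV \<phi> x :> D\<phi> x) \<longrightarrow>
        (\<integral>x. u x *\<^sub>R D\<phi> x \<partial>lebesgue) = - (\<integral>x. \<phi> x *\<^sub>R v x \<partial>lebesgue))"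

definition Lp_function :: "real \<Rightarrow> ('a::euclidean_space \<Rightarrow> 'b::euclidean_space) \<Rightarrow> bool" where
  "Lp_function p f \<longleftrightarrow>
     f \<in> borel_measurable lebesgue \<and> integrable lebesgue (\<lambda>x. norm (f x) powr p)"

definition sobolev_W1 :: "real \<Rightarrow> ('a::euclidean_space \<Rightarrow> real) set" where
  "sobolev_W1 p = {u. Lp_function p u \<and> (\<exists>v. has_weak_gradient u v \<and> Lp_function p v)}"

section \<open>Hausdorff measure\<close>

text \<open>
  The normalising factor \<open>unit_ball_vol d / 2 ^ d\<close> makes the \<open>d\<close>-dimensional Hausdorff measure
  of \<open>\<real>\<^sup>d\<close> agree with Lebesgue measure, so that on smooth hypersurfaces it is surface measure.
  The empty set is treated separately because of \<open>d = 0\<close> (counting measure), and boundedness is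
  explicit because \<^const>\<open>diameter\<close> has no meaningful value on unbounded sets.
\<close>

definition hausdorff_gauge :: "nat \<Rightarrow> 'a::metric_space set \<Rightarrow> ennreal" where
  "hausdorff_gauge d C =
     (if C = {} then 0 else ennreal (unit_ball_vol (real d) * (diameter C / 2) ^ d))"

definition hausdorff_pre :: "nat \<Rightarrow> real \<Rightarrow> 'a::metric_space set \<Rightarrow> ennreal" where
  "hausdorff_pre d \<delta> A =
     (INF C\<in>{C :: nat \<Rightarrow> 'a set. A \<subseteq> (\<Union>i. C i) \<and> (\<forall>i. bounded (C i) \<and> diameter (C i) \<le> \<delta>)}.
        \<Sum>i. hausdorff_gauge d (C i))"

definition hausdorff_outer :: "nat \<Rightarrow> 'a::metric_space set \<Rightarrow> ennreal" where
  "hausdorff_outer d A = (SUP \<delta>\<in>{0<..}. hausdorff_pre d \<delta> A)"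

text \<open>
  The restriction of the outer measure to the Borel sets, on which it is countably additive
  by Caratheodory's criterion for metric outer measures.
\<close>

definition hausdorff_measure :: "nat \<Rightarrow> 'a::metric_space measure" where
  "hausdorff_measure d = measure_of UNIV (sets borel) (hausdorff_outer d)"

section \<open>The nonlocal energy and the limit density\<close>

text \<open>Both take values in \<open>[0, \<infinity>]\<close>.\<close>

definition J_energy ::
  "real \<Rightarrow> (real^'n \<Rightarrow> real^'n \<Rightarrow> real \<Rightarrow> real) \<Rightarrow> (real^'n \<Rightarrow> real) \<Rightarrow> ennreal" where
  "J_energy s G u =
     (\<integral>\<^sup>+(x, y). ennreal (G x y (\<bar>u x - u y\<bar> / norm (x - y) powr s) / norm (x - y) ^ CARD('n))
        \<partial>lebesgue)"

text \<open>
  The index type \<open>'n\<close> carries no order, so the distinguished (\<open>n\<close>-th) coordinate is an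
  index \<open>k\<close>.
\<close>

definition H0 ::
  "'n \<Rightarrow> (real^'n \<Rightarrow> real^'n \<Rightarrow> real \<Rightarrow> real) \<Rightarrow> real^'n \<Rightarrow> real \<Rightarrow> ennreal" where
  "H0 k G x t =
     (\<integral>\<^sup>+r\<in>{0<..<1}.
        (\<integral>\<^sup>+w\<in>sphere 0 1. ennreal (G x x (t * \<bar>w $ k\<bar> * r)) \<partial>hausdorff_measure (CARD('n) - 1))
          / ennreal r
      \<partial>lebesgue)"

end

theory Submission
  imports Defs
begin

text \<open>
  Let \<open>u\<close> have weak gradient \<open>v\<close>.  Write a pair of points as \<open>x\<close>, \<open>x + r w\<close> with \<open>r > 0\<close> and \<open>w\<close> on
  the unit sphere.  Since \<open>\<bar>u (x + r w) - u x\<bar> / r\<^sup>s\<close> is \<open>r\<^sup>1\<^sup>-\<^sup>s\<close> times the difference quotient, polar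
  coordinates give
    \<open>J s = \<integral>\<^sub>0\<^sup>\<infinity> (\<integral> P r (r\<^sup>1\<^sup>-\<^sup>s) w dw) dr / r\<close>, where
    \<open>P r \<rho> w = \<integral> G x (x + r w) (\<rho> \<bar>u (x + r w) - u x\<bar> / r) dx\<close>
  (\<open>energy_polar\<close>).  The exponents \<open>p\<^sup>-\<close> and \<open>p\<^sup>+\<close> control \<open>G\<close> by \<open>G x y t \<le> G x y 1 (t\<^bsup>p-\<^esup> + t\<^bsup>p+\<^esup>)\<close> (\<open>young_growth\<close>), and
  the two scales behave differently.

  \<^item> For \<open>r \<ge> 1\<close> the norms of \<open>u\<close> alone bound the integral uniformly in \<open>s \<ge> 1/2\<close>, so the factor
    \<open>1 - s\<close> sends this part to \<open>0\<close> (\<open>large_scales_tendsto\<close>).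

  \<^item> For \<open>r < 1\<close> the substitution \<open>\<rho> = r\<^sup>1\<^sup>-\<^sup>s\<close> turns \<open>(1 - s) dr / r\<close> into \<open>d\<rho> / \<rho>\<close> and absorbs the
    factor: this part equals \<open>\<integral>\<^sub>0\<^sup>1 (\<integral> P (\<rho>\<^bsup>1/(1-s)\<^esup>) \<rho> w dw) d\<rho> / \<rho>\<close>.  For fixed \<open>\<rho> < 1\<close> the step
    \<open>\<rho>\<^bsup>1/(1-s)\<^esup>\<close> tends to \<open>0\<close>, so that \<open>P\<close> tends to \<open>\<integral> G x x (\<rho> \<bar>v x \<bullet> w\<bar>) dx\<close>
    (\<open>quotient_energy_tendsto\<close>), while \<open>P \<le> const \<rho>\<close> because both exponents exceed \<open>1\<close>; dominated
    convergence applies (\<open>small_scales_tendsto\<close>).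

  Rotation invariance of the surface measure replaces \<open>\<bar>v x \<bullet> w\<bar>\<close> by \<open>\<bar>v x\<bar> \<bar>w\<^sub>k\<bar>\<close>, and the
  limit is the integral of \<open>H0\<close> (\<open>limit_energy_eq\<close>).

  Three ingredients carry this computation.

  \<^item> Difference quotients.  For each \<open>h\<close>, \<open>u (x + h) - u x\<close> is for almost every \<open>x\<close> the integral of
    \<open>v \<bullet> h\<close> along the segment from \<open>x\<close> to \<open>x + h\<close> (\<open>weak_derivative_difference\<close>): move the derivative to
    a test function and use Fubini.  Averaging along segments contracts the \<open>L\<^sup>p\<close> norms and, by
    continuity of translations, converges to the identity as \<open>h\<close> tends to \<open>0\<close>.  The contraction gives the
    bounds for small \<open>r\<close>, the convergence gives the limit.

  \<^item> Measurability.  \<open>G\<close> is Lebesgue measurable in \<open>(x, y)\<close> for each fixed \<open>t\<close> only.  Continuity in \<open>y\<close> and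
    in \<open>t\<close> makes \<open>G\<close> jointly Borel once a null set of points \<open>x\<close> is removed
    (\<open>borel_modification_joint\<close>), so that compositions and Fubini are available.

  \<^item> The surface measure.  Polar coordinates and rotation invariance are easy for the cone measure
    \<open>surface_measure\<close>, which assigns to a subset of the sphere \<open>n\<close> times the volume of the cone over it.
    It agrees with \<open>(n - 1)\<close>-dimensional Hausdorff measure (\<open>hausdorff_measure_sphere\<close>).  A small
    cap has nearly the measure of a flat ball of the same radius, so Vitali coverings by caps bound the
    Hausdorff measure from above; the isodiametric inequality, applied to the slices of cones, shows that no covering by other
    sets is cheaper.
\<close>

section \<open>The isodiametric inequality\<close>

text \<open>
  If no two points had distance above \<open>a + b\<close>, then \<open>Sup S - Inf T\<close> and \<open>Sup T - Inf S\<close> would be at most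
  \<open>a + b\<close>.  Their sum is the sum of the lengths of the hulls of \<open>S\<close> and \<open>T\<close>, which exceeds \<open>2 a + 2 b\<close>.
\<close>

lemma exists_far_points:
  fixes S T :: "real set"
  assumes S: "S \<in> sets borel" "emeasure lborel S > ennreal (2 * a)" and a: "a \<ge> 0"
    and T: "T \<in> sets borel" "emeasure lborel T > ennreal (2 * b)" and b: "b \<ge> 0"
  shows "\<exists>s\<in>S. \<exists>t\<in>T. a + b < \<bar>s - t\<bar>"
proof (rule ccontr)
  assume "\<not> ?thesis"
  then have le: "\<bar>s - t\<bar> \<le> a + b" if "s \<in> S" "t \<in> T" for s t
    using that by force
  have ne: "S \<noteq> {}" "T \<noteq> {}"
    using S T by auto
  then obtain s0 t0 where st0: "s0 \<in> S" "t0 \<in> T" by auto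
  have bS: "bdd_above S" "bdd_below S"
    using le[OF _ st0(2)] by (auto intro!: bdd_aboveI[of _ "t0 + a + b"] bdd_belowI[of _ "t0 - a - b"] simp: abs_le_iff) (smt (verit))+
  have bT: "bdd_above T" "bdd_below T"
    using le[OF st0(1)] by (auto intro!: bdd_aboveI[of _ "s0 + a + b"] bdd_belowI[of _ "s0 - a - b"] simp: abs_le_iff) (smt (verit))+
  have len: "2 * c < Sup X - Inf X"
    if "X \<noteq> {}" "bdd_above X" "bdd_below X" "emeasure lborel X > ennreal (2 * c)" "c \<ge> 0" for X :: "real set" and c
  proof -
    have sub: "X \<subseteq> {Inf X..Sup X}"
      using that by (auto intro: cInf_lower cSup_upper)
    have "Inf X \<le> Sup X" using sub that(1) by fastforce
    have "ennreal (2 * c) < emeasure lborel {Inf X..Sup X}"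
      using that(4) emeasure_mono[OF sub, of lborel] by (auto intro: less_le_trans)
    then show ?thesis
      using \<open>Inf X \<le> Sup X\<close> that(5) by (simp add: ennreal_less_iff)
  qed
  have "Sup S - Inf T \<le> a + b"
  proof -
    have "Sup S \<le> t + a + b" if "t \<in> T" for t
      using le[OF _ that] ne by (intro cSup_least) (auto simp: abs_le_iff, smt (verit))
    then have "Sup S - a - b \<le> Inf T" using ne by (intro cInf_greatest) (auto, smt (verit))
    then show ?thesis by simp
  qed
  moreover have "Sup T - Inf S \<le> a + b"
  proof -
    have "Sup T \<le> s + a + b" if "s \<in> S" for s
      using le[OF that] ne by (intro cSup_least) (auto simp: abs_le_iff, smt (verit))
    then have "Sup T - a - b \<le> Inf S" using ne by (intro cInf_greatest) (auto, smt (verit))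
    then show ?thesis by simp
  qed
  ultimately show False
    using len[OF ne(1) bS S(2) a] len[OF ne(2) bT T(2) b] by linarith
qed

lemma emeasure_symmetric_interval: "emeasure lborel {y::real. ennreal (2 * \<bar>y\<bar>) < c} = c"
proof (cases c)
  case (real r)
  have "{y::real. ennreal (2 * \<bar>y\<bar>) < c} = {- (r/2)<..<r/2}"
    using real by (auto simp: ennreal_less_iff abs_if)
  then show ?thesis using real by simp
next
  case top
  then show ?thesis by (simp add: ennreal_less_top)
qed

text \<open>
  Coordinate space over an arbitrary finite index set, so that hyperplanes can be treated as the
  coordinate spaces of all but one basis vector.
\<close>

abbreviation coord_lborel :: "'i set \<Rightarrow> ('i \<Rightarrow> real) measure" where
  "coord_lborel I \<equiv> Pi\<^sub>M I (\<lambda>_. lborel)"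

text \<open>
  Steiner symmetrisation along the \<open>i\<close>-th axis: every section in this direction is replaced by the
  centred open interval of the same length.  The section through \<open>f\<close> does not depend on \<open>f i\<close>.
\<close>

definition steiner :: "'i set \<Rightarrow> 'i \<Rightarrow> ('i \<Rightarrow> real) set \<Rightarrow> ('i \<Rightarrow> real) set" where
  "steiner I i E = {f \<in> space (coord_lborel I).
      ennreal (2 * \<bar>f i\<bar>) < emeasure lborel {t. f(i := t) \<in> E}}"

lemma section_measurable:
  assumes [measurable]: "E \<in> sets (coord_lborel I)" and "i \<in> I" "f \<in> space (coord_lborel I)"
  shows "{t. f(i := t) \<in> E} \<in> sets borel"
proof -
  have 1: "(\<lambda>t. f(i := t)) \<in> borel \<rightarrow>\<^sub>M coord_lborel I"
    by (rule measurable_fun_upd[where J=I]) (use assms in auto)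
  have "(\<lambda>t. f(i := t)) -` E \<inter> space borel \<in> sets borel"
    by (rule measurable_sets[OF 1]) simp
  then show ?thesis by (simp add: vimage_def)
qed

lemma section_emeasure_measurable:
  assumes [measurable]: "E \<in> sets (coord_lborel I)" and "i \<in> I"
  shows "(\<lambda>f. emeasure lborel {t. f(i := t) \<in> E}) \<in> borel_measurable (coord_lborel I)"
proof -
  have 1: "(\<lambda>(f, t). f(i := t)) \<in> coord_lborel I \<Otimes>\<^sub>M lborel \<rightarrow>\<^sub>M coord_lborel I"
    unfolding case_prod_beta
    by (rule measurable_fun_upd[where J=I]) (use assms in auto)
  have [measurable]: "(\<lambda>(f, t). indicator E (f(i := t)) :: ennreal) \<in> borel_measurable (coord_lborel I \<Otimes>\<^sub>M lborel)"
    using measurable_compose[OF 1, of "indicator E :: _ \<Rightarrow> ennreal" borel] by (simp add: case_prod_beta)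
  have "(\<lambda>f. \<integral>\<^sup>+t. indicator E (f(i := t)) \<partial>lborel) \<in> borel_measurable (coord_lborel I)"
    by measurable
  also have "?this \<longleftrightarrow> ?thesis"
  proof (rule measurable_cong)
    fix f assume f: "f \<in> space (coord_lborel I)"
    have "(\<integral>\<^sup>+t. indicator E (f(i := t)) \<partial>lborel) = (\<integral>\<^sup>+t. indicator {t. f(i := t) \<in> E} t \<partial>lborel)"
      by (intro nn_integral_cong) (auto simp: indicator_def)
    then show "(\<integral>\<^sup>+t. indicator E (f(i := t)) \<partial>lborel) = emeasure lborel {t. f(i := t) \<in> E}"
      using section_measurable[OF assms f] by simp
  qed
  finally show ?thesis .
qed

lemma steiner_measurable:
  assumes "E \<in> sets (coord_lborel I)" "i \<in> I"
  shows "steiner I i E \<in> sets (coord_lborel I)"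
proof -
  note [measurable] = section_emeasure_measurable[OF assms]
  have [measurable]: "(\<lambda>f. f i) \<in> borel_measurable (coord_lborel I)"
    using measurable_component_singleton[OF assms(2), of "\<lambda>_. lborel"] by simp
  show ?thesis unfolding steiner_def by measurable
qed

text \<open>
  Cavalieri's principle: corresponding sections have the same length.
\<close>

lemma emeasure_steiner:
  assumes I: "finite I" "i \<in> I" and E: "E \<in> sets (coord_lborel I)"
  shows "emeasure (coord_lborel I) (steiner I i E) = emeasure (coord_lborel I) E"
proof -
  interpret product_sigma_finite "\<lambda>_. lborel :: real measure" by standard
  obtain J where J: "I = insert i J" "i \<notin> J" "finite J"
    using I by (metis finite_insert mk_disjoint_insert)
  have S: "steiner I i E \<in> sets (coord_lborel I)" by (rule steiner_measurable) fact+
  have in_sp: "x(i := y) \<in> space (coord_lborel I)" if "x \<in> space (coord_lborel J)" for x y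
    using that J by (auto simp: space_PiM PiE_def extensional_def)
  have "emeasure (coord_lborel I) (steiner I i E)
     = (\<integral>\<^sup>+f. indicator (steiner I i E) f \<partial>coord_lborel I)"
    using S by simp
  also have "\<dots> = (\<integral>\<^sup>+x. \<integral>\<^sup>+y. indicator (steiner I i E) (x(i := y)) \<partial>lborel \<partial>coord_lborel J)"
    unfolding J(1) by (rule product_nn_integral_insert) (use J S in \<open>auto\<close>)
  also have "\<dots> = (\<integral>\<^sup>+x. \<integral>\<^sup>+y. indicator E (x(i := y)) \<partial>lborel \<partial>coord_lborel J)"
  proof (rule nn_integral_cong)
    fix x assume x: "x \<in> space (coord_lborel J)"
    let ?c = "emeasure lborel {t. x(i := t) \<in> E}"
    have "(\<integral>\<^sup>+y. indicator (steiner I i E) (x(i := y)) \<partial>lborel) = (\<integral>\<^sup>+y. indicator {y. ennreal (2 * \<bar>y\<bar>) < ?c} y \<partial>lborel)"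
      using in_sp[OF x] by (intro nn_integral_cong) (auto simp: steiner_def indicator_def)
    also have "\<dots> = ?c"
      by (subst nn_integral_indicator) (auto simp: emeasure_symmetric_interval)
    also have "\<dots> = (\<integral>\<^sup>+y. indicator {t. x(i := t) \<in> E} y \<partial>lborel)"
    proof -
      \<comment> \<open>Sections are measured through points of the full space; the value at \<open>i\<close> is
        overwritten, so any will do.\<close>
      have "{t. (x(i := undefined))(i := t) \<in> E} \<in> sets borel"
        by (rule section_measurable[OF E]) (use I in_sp[OF x] in auto)
      then show ?thesis by simp
    qed
    also have "\<dots> = (\<integral>\<^sup>+y. indicator E (x(i := y)) \<partial>lborel)"
      by (intro nn_integral_cong) (auto simp: indicator_def)
    finally show "(\<integral>\<^sup>+y. indicator (steiner I i E) (x(i := y)) \<partial>lborel) = (\<integral>\<^sup>+y. indicator E (x(i := y)) \<partial>lborel)" .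
  qed
  also have "\<dots> = (\<integral>\<^sup>+f. indicator E f \<partial>coord_lborel I)"
    unfolding J(1) by (rule product_nn_integral_insert[symmetric]) (use J E in auto)
  also have "\<dots> = emeasure (coord_lborel I) E" using E by simp
  finally show ?thesis .
qed

text \<open>
  The sections of \<open>E\<close> through \<open>f\<close> and \<open>g\<close> are longer than \<open>2 \<bar>f i\<bar>\<close> and \<open>2 \<bar>g i\<bar>\<close>, so they contain two
  points whose distance is at least \<open>\<bar>f i - g i\<bar>\<close>; replacing the \<open>i\<close>-th coordinates by these
  only increases the distance.
\<close>

lemma steiner_diameter:
  assumes I: "finite I" "i \<in> I" and E: "E \<in> sets (coord_lborel I)"
    and d: "\<And>f g. f \<in> E \<Longrightarrow> g \<in> E \<Longrightarrow> (\<Sum>j\<in>I. (f j - g j)\<^sup>2) \<le> c"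
    and fg: "f \<in> steiner I i E" "g \<in> steiner I i E"
  shows "(\<Sum>j\<in>I. (f j - g j)\<^sup>2) \<le> c"
proof -
  obtain s t where st: "f(i := s) \<in> E" "g(i := t) \<in> E" "\<bar>f i\<bar> + \<bar>g i\<bar> < \<bar>s - t\<bar>"
    using exists_far_points[of "{t. f(i := t) \<in> E}" "\<bar>f i\<bar>" "{t. g(i := t) \<in> E}" "\<bar>g i\<bar>"]
      section_measurable[OF E I(2)] fg by (auto simp: steiner_def)
  have "(\<Sum>j\<in>I. (f j - g j)\<^sup>2) = (f i - g i)\<^sup>2 + (\<Sum>j\<in>I-{i}. (f j - g j)\<^sup>2)"
    using I by (simp add: sum.remove)
  also have "(f i - g i)\<^sup>2 \<le> (s - t)\<^sup>2"
    using st(3) by (simp add: abs_le_square_iff[symmetric])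
  also have "(s - t)\<^sup>2 + (\<Sum>j\<in>I-{i}. (f j - g j)\<^sup>2) = (\<Sum>j\<in>I. ((f(i := s)) j - (g(i := t)) j)\<^sup>2)"
    using I by (simp add: sum.remove)
  also have "\<dots> \<le> c" by (rule d) fact+
  finally show ?thesis by simp
qed

lemma steiner_reflect: "f \<in> steiner I i E \<Longrightarrow> i \<in> I \<Longrightarrow> f(i := - f i) \<in> steiner I i E"
  by (auto simp: steiner_def space_PiM PiE_def extensional_def)

text \<open>
  If \<open>E\<close> is symmetric in another axis \<open>j\<close>, reflected points have the same section.  Hence symmetries
  already obtained survive further symmetrisations.
\<close>

lemma steiner_keeps_reflection:
  assumes "\<And>f. f \<in> E \<Longrightarrow> f(j := - f j) \<in> E" "j \<noteq> i" "j \<in> I" "f \<in> steiner I i E"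
  shows "f(j := - f j) \<in> steiner I i E"
proof -
  have "f(i := t, j := - f j) \<in> E \<longleftrightarrow> f(i := t) \<in> E" for t
  proof -
    have 1: "(f(i := t, j := - f j))(j := - (f(i := t, j := - f j)) j) = f(i := t)"
      "(f(i := t))(j := - (f(i := t)) j) = f(i := t, j := - f j)" using assms(2) by auto
    show ?thesis
      using assms(1)[of "f(i := t)", unfolded 1] assms(1)[of "f(i := t, j := - f j)", unfolded 1] by blast
  qed
  then have "{t. f(j := - f j, i := t) \<in> E} = {t. f(i := t) \<in> E}"
    using assms(2) by (auto simp: fun_upd_twist)
  then show ?thesis
    using assms by (auto simp: steiner_def space_PiM PiE_def extensional_def)
qed

lemma steiner_symmetrize:
  assumes "finite I" "B \<subseteq> I" "E \<in> sets (coord_lborel I)"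
    and "\<And>f g. f \<in> E \<Longrightarrow> g \<in> E \<Longrightarrow> (\<Sum>j\<in>I. (f j - g j)\<^sup>2) \<le> c"
  shows "\<exists>E'\<in>sets (coord_lborel I). emeasure (coord_lborel I) E' = emeasure (coord_lborel I) E \<and>
     (\<forall>f\<in>E'. \<forall>g\<in>E'. (\<Sum>j\<in>I. (f j - g j)\<^sup>2) \<le> c) \<and> (\<forall>j\<in>B. \<forall>f\<in>E'. f(j := - f j) \<in> E')"
proof -
  have "finite B" using assms(1,2) finite_subset by auto
  then show ?thesis using assms(2)
  proof induction
    case empty
    then show ?case using assms by auto
  next
    case (insert i B)
    then have "B \<subseteq> I" by simp
    from insert.IH[OF this] obtain E' where E'0: "E' \<in> sets (coord_lborel I)"
       "emeasure (coord_lborel I) E' = emeasure (coord_lborel I) E \<and>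
     (\<forall>f\<in>E'. \<forall>g\<in>E'. (\<Sum>j\<in>I. (f j - g j)\<^sup>2) \<le> c) \<and> (\<forall>j\<in>B. \<forall>f\<in>E'. f(j := - f j) \<in> E')"
      by (rule bexE)
    note E' = E'0(1) E'0(2)[THEN conjunct1]
       E'0(2)[THEN conjunct2, THEN conjunct1, rule_format]
       E'0(2)[THEN conjunct2, THEN conjunct2, rule_format]
    have i: "i \<in> I" using insert by simp
    show ?case
    proof (rule bexI[of _ "steiner I i E'"], intro conjI ballI)
      show "steiner I i E' \<in> sets (coord_lborel I)" by (rule steiner_measurable[OF E'(1) i])
      show "emeasure (coord_lborel I) (steiner I i E') = emeasure (coord_lborel I) E"
        using emeasure_steiner[OF assms(1) i E'(1)] E' by simp
      show "(\<Sum>j\<in>I. (f j - g j)\<^sup>2) \<le> c" if "f \<in> steiner I i E'" "g \<in> steiner I i E'" for f g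
        using steiner_diameter[OF assms(1) i E'(1,3) that] .
      show "f(j := - f j) \<in> steiner I i E'" if "j \<in> insert i B" "f \<in> steiner I i E'" for j f
      proof (cases "j = i")
        case True
        then show ?thesis using steiner_reflect[OF that(2) i] by simp
      next
        case False
        then show ?thesis
          by (intro steiner_keeps_reflection) (use that E' insert in auto)
      qed
    qed
  qed
qed

text \<open>
  After symmetrisation along all axes the set contains \<open>- f\<close> together with \<open>f\<close>, so \<open>2 \<bar>f\<bar> \<le> d\<close> and
  the set lies in the ball of radius \<open>d / 2\<close>.  The original set need not lie in any such ball.
\<close>

lemma isodiametric_pos:
  assumes I: "finite I" and E: "E \<in> sets (coord_lborel I)"
    and diam: "\<And>f g. f \<in> E \<Longrightarrow> g \<in> E \<Longrightarrow> (\<Sum>j\<in>I. (f j - g j)\<^sup>2) \<le> d\<^sup>2" and d: "d > 0"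
  shows "emeasure (coord_lborel I) E \<le> ennreal (unit_ball_vol (real (card I)) * (d / 2) ^ card I)"
proof -
  obtain F where F: "F \<in> sets (coord_lborel I)"
       "emeasure (coord_lborel I) F = emeasure (coord_lborel I) E"
       "\<And>f g. f \<in> F \<Longrightarrow> g \<in> F \<Longrightarrow> (\<Sum>j\<in>I. (f j - g j)\<^sup>2) \<le> d\<^sup>2"
       "\<And>j f. j \<in> I \<Longrightarrow> f \<in> F \<Longrightarrow> f(j := - f j) \<in> F"
  proof -
    from steiner_symmetrize[OF I order_refl E diam] obtain F where F: "F \<in> sets (coord_lborel I)"
       "emeasure (coord_lborel I) F = emeasure (coord_lborel I) E \<and>
     (\<forall>f\<in>F. \<forall>g\<in>F. (\<Sum>j\<in>I. (f j - g j)\<^sup>2) \<le> d\<^sup>2) \<and> (\<forall>j\<in>I. \<forall>f\<in>F. f(j := - f j) \<in> F)"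
      by (rule bexE)
    note F' = F(1) F(2)[THEN conjunct1]
       F(2)[THEN conjunct2, THEN conjunct1, rule_format]
       F(2)[THEN conjunct2, THEN conjunct2, rule_format]
    show thesis by (rule that[OF F'])
  qed
  have neg: "(\<lambda>j. if j \<in> B then - f j else f j) \<in> F" if "f \<in> F" "B \<subseteq> I" for f B
  proof -
    have "finite B" using that I finite_subset by auto
    then show ?thesis using that(2)
    proof induction
      case empty then show ?case using that by simp
    next
      case (insert j B)
      have "(\<lambda>k. if k \<in> insert j B then - f k else f k) =
        (\<lambda>k. if k \<in> B then - f k else f k)(j := - (if j \<in> B then - f j else f j))"
        using insert by auto
      then show ?case using F(4)[of j "\<lambda>k. if k \<in> B then - f k else f k"] insert by auto
    qed
  qed
  have "F \<subseteq> {f. sqrt (\<Sum>i\<in>I. (f i)\<^sup>2) \<le> d / 2} \<inter> space (coord_lborel I)"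
  proof
    fix f assume f: "f \<in> F"
    have "(\<Sum>j\<in>I. (f j - (if j \<in> I then - f j else f j))\<^sup>2) \<le> d\<^sup>2"
      using F(3)[OF f neg[OF f order_refl]] .
    also have "(\<Sum>j\<in>I. (f j - (if j \<in> I then - f j else f j))\<^sup>2) = (\<Sum>j\<in>I. 4 * (f j)\<^sup>2)"
      by (intro sum.cong) (auto simp: power2_eq_square)
    finally have "(\<Sum>j\<in>I. (f j)\<^sup>2) \<le> (d / 2)\<^sup>2"
      by (simp add: sum_distrib_left[symmetric] power_divide)
    then have "sqrt (\<Sum>j\<in>I. (f j)\<^sup>2) \<le> d / 2"
      using d by (intro real_le_lsqrt) (auto simp: sum_nonneg)
    then show "f \<in> {f. sqrt (\<Sum>i\<in>I. (f i)\<^sup>2) \<le> d / 2} \<inter> space (coord_lborel I)"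
      using f sets.sets_into_space[OF F(1)] by auto
  qed
  then have "emeasure (coord_lborel I) F \<le> emeasure (coord_lborel I) ({f. sqrt (\<Sum>i\<in>I. (f i)\<^sup>2) \<le> d / 2} \<inter> space (coord_lborel I))"
    using I by (intro emeasure_mono) auto
  also have "\<dots> = ennreal (unit_ball_vol (real (card I)) * (d / 2) ^ card I)"
    by (rule emeasure_cball_aux) (use I d in auto)
  finally show ?thesis using F(2) by simp
qed

text \<open>
  The degenerate case \<open>d = 0\<close> is the limit of positive \<open>d\<close>.
\<close>

theorem isodiametric:
  assumes I: "finite I" and E: "E \<in> sets (coord_lborel I)"
    and diam: "\<And>f g. f \<in> E \<Longrightarrow> g \<in> E \<Longrightarrow> (\<Sum>j\<in>I. (f j - g j)\<^sup>2) \<le> d\<^sup>2" and d: "d \<ge> 0"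
  shows "emeasure (coord_lborel I) E \<le> ennreal (unit_ball_vol (real (card I)) * (d / 2) ^ card I)"
proof -
  let ?g = "\<lambda>m::nat. ennreal (unit_ball_vol (real (card I)) * ((d + inverse (Suc m)) / 2) ^ card I)"
  have le: "emeasure (coord_lborel I) E \<le> ?g m" for m
  proof (rule isodiametric_pos[OF I E])
    fix f g assume "f \<in> E" "g \<in> E"
    then have "(\<Sum>j\<in>I. (f j - g j)\<^sup>2) \<le> d\<^sup>2" by (rule diam)
    also have "\<dots> \<le> (d + inverse (Suc m))\<^sup>2" using d by (intro power_mono) auto
    finally show "(\<Sum>j\<in>I. (f j - g j)\<^sup>2) \<le> (d + inverse (Suc m))\<^sup>2" .
  qed (use d in \<open>auto intro: add_nonneg_pos\<close>)
  have "?g \<longlonglongrightarrow> ennreal (unit_ball_vol (real (card I)) * ((d + 0) / 2) ^ card I)"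
    by (intro tendsto_ennrealI tendsto_intros LIMSEQ_inverse_real_of_nat) auto
  then show ?thesis
    using le by (intro LIMSEQ_le_const) auto
qed

section \<open>Polar coordinates and the cone measure of the unit sphere\<close>

text \<open>
  The cone measure: \<open>n\<close> times the volume of the unit ball, projected radially.  It is a measure on the
  whole space, concentrated on the sphere; the centre of the ball, where the projection has the
  default value \<open>0\<close>, is a null set.
\<close>

definition surface_measure :: "'a::euclidean_space measure" where
  "surface_measure = distr (density lborel (\<lambda>x. ennreal (real DIM('a)) * indicator (ball 0 1) x)) borel (\<lambda>x. x /\<^sub>R norm x)"

lemma sets_surface_measure [simp, measurable_cong]: "sets surface_measure = sets borel"
  by (simp add: surface_measure_def)

lemma space_surface_measure [simp]: "space surface_measure = UNIV"
  by (simp add: surface_measure_def)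

lemma ball_borel_measurable [measurable]: "ball (a::'a::euclidean_space) r \<in> sets borel"
  by simp

lemma normalize_measurable [measurable]: "(\<lambda>x::'a::euclidean_space. x /\<^sub>R norm x) \<in> borel \<rightarrow>\<^sub>M borel"
  by measurable

lemma nn_integral_surface_measure:
  fixes f :: "'a::euclidean_space \<Rightarrow> ennreal"
  assumes [measurable]: "f \<in> borel_measurable borel"
  shows "(\<integral>\<^sup>+w. f w \<partial>surface_measure) = ennreal (real DIM('a)) * (\<integral>\<^sup>+x. indicator (ball 0 1) x * f (x /\<^sub>R norm x) \<partial>lborel)"
proof -
  have [measurable]: "(\<lambda>x. f (x /\<^sub>R norm x)) \<in> borel_measurable borel"
    by (rule measurable_compose[OF normalize_measurable assms])
  have "(\<integral>\<^sup>+w. f w \<partial>surface_measure) = (\<integral>\<^sup>+x. ennreal (real DIM('a)) * indicator (ball 0 1) x * f (x /\<^sub>R norm x) \<partial>lborel)"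
    unfolding surface_measure_def
    by (subst nn_integral_distr, simp, simp, rule nn_integral_density) measurable
  also have "\<dots> = (\<integral>\<^sup>+x. ennreal (real DIM('a)) * (indicator (ball 0 1) x * f (x /\<^sub>R norm x)) \<partial>lborel)"
    by (simp only: mult.assoc)
  also have "\<dots> = ennreal (real DIM('a)) * (\<integral>\<^sup>+x. indicator (ball 0 1) x * f (x /\<^sub>R norm x) \<partial>lborel)"
    by (rule nn_integral_cmult) measurable
  finally show ?thesis .
qed

lemma emeasure_surface_measure:
  fixes A :: "'a::euclidean_space set"
  assumes [measurable]: "A \<in> sets borel"
  shows "emeasure surface_measure A = ennreal (real DIM('a)) * emeasure lborel {x \<in> ball 0 1. x /\<^sub>R norm x \<in> A}"
proof -
  have "emeasure surface_measure A = (\<integral>\<^sup>+w. indicator A w \<partial>surface_measure)" by simp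
  also have "\<dots> = ennreal (real DIM('a)) * (\<integral>\<^sup>+x. indicator {x \<in> ball 0 1. x /\<^sub>R norm x \<in> A} x \<partial>lborel)"
    by (subst nn_integral_surface_measure)
       (auto intro!: arg_cong2[where f="(*)"] nn_integral_cong split: split_indicator simp del: nn_integral_indicator)
  also have "(\<integral>\<^sup>+x. indicator {x \<in> ball 0 1. x /\<^sub>R norm x \<in> A} x \<partial>lborel) = emeasure lborel {x \<in> ball 0 1. x /\<^sub>R norm x \<in> A}"
    by (rule nn_integral_indicator) measurable
  finally show ?thesis by simp
qed

lemma finite_measure_surface_measure: "finite_measure (surface_measure :: 'a::euclidean_space measure)"
proof
  have "emeasure (surface_measure :: 'a measure) UNIV \<le> ennreal (real DIM('a)) * emeasure lborel (ball (0::'a) 1)"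
    by (subst emeasure_surface_measure) (auto intro!: mult_left_mono emeasure_mono)
  also have "\<dots> < \<infinity>"
    using emeasure_lborel_ball_finite[of "0::'a" 1] by (simp add: ennreal_mult_less_top less_top)
  finally show "emeasure (surface_measure :: 'a measure) (space surface_measure) \<noteq> \<infinity>" by simp
qed

interpretation surface_measure: finite_measure "surface_measure :: 'a::euclidean_space measure"
  by (rule finite_measure_surface_measure)

lemma AE_surface_measure: "AE w in (surface_measure :: 'a::euclidean_space measure). norm w = 1"
proof -
  have "AE x in lborel. x \<noteq> (0::'a)"
    by (rule AE_lborel_singleton)
  then show ?thesis
    unfolding surface_measure_def
    by (subst AE_distr_iff, simp, simp, subst AE_density, measurable) (auto elim: eventually_mono)
qed

lemma emeasure_surface_measure_Int:
  "A \<in> sets borel \<Longrightarrow> emeasure surface_measure (A \<inter> sphere 0 1) = emeasure surface_measure (A :: 'a::euclidean_space set)"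
  by (rule emeasure_eq_AE) (use AE_surface_measure in \<open>auto elim!: eventually_mono\<close>)

lemma nn_integral_lborel_scaleR:
  fixes f :: "'a::euclidean_space \<Rightarrow> ennreal"
  assumes [measurable]: "f \<in> borel_measurable borel" and c: "c > 0"
  shows "(\<integral>\<^sup>+x. f (c *\<^sub>R x) \<partial>lborel) = ennreal (1 / c ^ DIM('a)) * (\<integral>\<^sup>+x. f x \<partial>lborel)"
proof -
  have "(\<integral>\<^sup>+x. f x \<partial>lborel) = ennreal (c ^ DIM('a)) * (\<integral>\<^sup>+x. f (c *\<^sub>R x) \<partial>lborel)"
    by (subst lborel_affine[of c 0]) (use c in \<open>auto simp: nn_integral_density nn_integral_distr nn_integral_cmult\<close>)
  then show ?thesis
    using c by (simp add: mult.assoc[symmetric] ennreal_mult'[symmetric])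
qed

lemma nn_integral_inverse_power_atLeast:
  assumes a: "a > (0::real)" and n: "n > 0"
  shows "(\<integral>\<^sup>+t. ennreal (real n / t ^ (n + 1)) * indicator {a..} t \<partial>lborel) = ennreal (1 / a ^ n)"
proof -
  have "(\<integral>\<^sup>+t. ennreal (real n / t ^ (n + 1)) * indicator {a..} t \<partial>lborel) = ennreal (0 - (- inverse (a ^ n)))"
  proof (rule nn_integral_FTC_atLeast)
    fix x :: real assume x: "a \<le> x"
    show "((\<lambda>t. - inverse (t ^ n)) has_real_derivative real n / x ^ (n + 1)) (at x)"
    proof -
      obtain m where m: "n = Suc m" using n by (cases n) auto
      have "x \<noteq> 0" using x a by auto
      then show ?thesis unfolding m
        by (intro DERIV_cong[OF DERIV_minus[OF DERIV_inverse_fun[OF DERIV_pow]]]) (simp_all add: field_simps)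
    qed
    show "0 \<le> real n / x ^ (n + 1)" using x a by simp
  next
    have "filterlim (\<lambda>t::real. t ^ n) at_top at_top"
      using n by (intro filterlim_pow_at_top filterlim_ident) auto
    then have "((\<lambda>t::real. inverse (t ^ n)) \<longlongrightarrow> 0) at_top"
      by (rule tendsto_inverse_0_at_top)
    then show "((\<lambda>t::real. - inverse (t ^ n)) \<longlongrightarrow> 0) at_top"
      using tendsto_minus by fastforce
  qed simp
  then show ?thesis by (simp add: divide_inverse)
qed

text \<open>
  Insert the definition of the cone measure and substitute \<open>r = t \<bar>y\<bar>\<close> for fixed \<open>y\<close>, then \<open>z = t y\<close>
  for fixed \<open>t\<close>.  Both substitutions are dilations.  The \<open>t\<close>-integral that remains is
  \<open>n / t\<^bsup>n + 1\<^esup>\<close> over \<open>t > \<bar>z\<bar>\<close>, and it cancels the factor \<open>\<bar>z\<bar>\<^sup>n\<close>.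
\<close>

theorem nn_integral_polar:
  fixes f :: "'a::euclidean_space \<Rightarrow> ennreal"
  assumes [measurable]: "f \<in> borel_measurable borel"
  shows "(\<integral>\<^sup>+x. f x \<partial>lborel) =
    (\<integral>\<^sup>+r\<in>{0<..}. ennreal (r ^ (DIM('a) - 1)) * (\<integral>\<^sup>+w. f (r *\<^sub>R w) \<partial>surface_measure) \<partial>lborel)"
proof -
  let ?n = "DIM('a)"
  have n: "?n > 0" by simp
  then obtain m where m: "?n = Suc m" using gr0_implies_Suc by blast
  have "(\<integral>\<^sup>+r\<in>{0<..}. ennreal (r ^ (?n - 1)) * (\<integral>\<^sup>+w. f (r *\<^sub>R w) \<partial>surface_measure) \<partial>lborel)
     = (\<integral>\<^sup>+r. (\<integral>\<^sup>+y. ennreal (real ?n) * ennreal (r ^ (?n - 1)) * indicator {0<..} r * (indicator (ball 0 1) y * f (r *\<^sub>R (y /\<^sub>R norm y))) \<partial>lborel) \<partial>lborel)"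
  proof (rule nn_integral_cong)
    fix r :: real
    have "(\<integral>\<^sup>+y. ennreal (real ?n) * ennreal (r ^ (?n - 1)) * indicator {0<..} r * (indicator (ball 0 1) y * f (r *\<^sub>R (y /\<^sub>R norm y))) \<partial>lborel)
       = ennreal (real ?n) * ennreal (r ^ (?n - 1)) * indicator {0<..} r * (\<integral>\<^sup>+y. indicator (ball 0 1) y * f (r *\<^sub>R (y /\<^sub>R norm y)) \<partial>lborel)"
      by (rule nn_integral_cmult) measurable
    then show "ennreal (r ^ (?n - 1)) * (\<integral>\<^sup>+w. f (r *\<^sub>R w) \<partial>surface_measure) * indicator {0<..} r
      = (\<integral>\<^sup>+y. ennreal (real ?n) * ennreal (r ^ (?n - 1)) * indicator {0<..} r * (indicator (ball 0 1) y * f (r *\<^sub>R (y /\<^sub>R norm y))) \<partial>lborel)"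
      by (simp add: nn_integral_surface_measure ac_simps)
  qed
  also have "\<dots> = (\<integral>\<^sup>+y. (\<integral>\<^sup>+r. ennreal (real ?n) * ennreal (r ^ (?n - 1)) * indicator {0<..} r * (indicator (ball 0 1) y * f (r *\<^sub>R (y /\<^sub>R norm y))) \<partial>lborel) \<partial>(lborel :: 'a measure))"
    by (rule lborel_pair.Fubini') simp
  also have "\<dots> = (\<integral>\<^sup>+y. (\<integral>\<^sup>+t. ennreal (real ?n) * ennreal (t ^ (?n - 1)) * indicator {0<..} t * (ennreal (norm y ^ ?n) * indicator (ball 0 1) y * f (t *\<^sub>R y)) \<partial>lborel) \<partial>(lborel :: 'a measure))"
  proof (rule nn_integral_cong_AE, rule AE_mp[OF AE_lborel_singleton[of 0]], rule AE_I2, rule impI)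
    fix y :: 'a assume y: "y \<noteq> 0"
    let ?F = "\<lambda>r. ennreal (real ?n) * ennreal (r ^ (?n - 1)) * indicator {0<..} r * (indicator (ball 0 1) y * f (r *\<^sub>R (y /\<^sub>R norm y)))"
    have "(\<integral>\<^sup>+r. ?F r \<partial>lborel) = ennreal (norm y) * (\<integral>\<^sup>+t. ?F (0 + norm y * t) \<partial>lborel)"
      by (subst nn_integral_real_affine[where c="norm y" and t=0]) (use y in auto)
    also have "\<dots> = (\<integral>\<^sup>+t. ennreal (norm y) * ?F (0 + norm y * t) \<partial>lborel)"
      by (rule nn_integral_cmult[symmetric]) simp
    also have "\<dots> = (\<integral>\<^sup>+t. ennreal (real ?n) * ennreal (t ^ (?n - 1)) * indicator {0<..} t * (ennreal (norm y ^ ?n) * indicator (ball 0 1) y * f (t *\<^sub>R y)) \<partial>lborel)"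
    proof (rule nn_integral_cong)
      fix t :: real
      have p: "ennreal (norm y) * ennreal ((norm y * t) ^ (?n - 1)) = ennreal (t ^ (?n - 1)) * ennreal (norm y ^ ?n)" if "t > 0"
      proof -
        have "norm y * (norm y * t) ^ (?n - 1) = t ^ (?n - 1) * norm y ^ ?n"
          unfolding m by (simp add: power_mult_distrib)
        then show ?thesis using that by (simp add: ennreal_mult'[symmetric])
      qed
      have i: "indicator {0<..} (norm y * t) = (indicator {0<..} t :: ennreal)"
        using y by (auto simp: indicator_def zero_less_mult_iff)
      have s: "(norm y * t) *\<^sub>R (y /\<^sub>R norm y) = t *\<^sub>R y" using y by simp
      show "ennreal (norm y) * ?F (0 + norm y * t) = ennreal (real ?n) * ennreal (t ^ (?n - 1)) * indicator {0<..} t * (ennreal (norm y ^ ?n) * indicator (ball 0 1) y * f (t *\<^sub>R y))"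
      proof (cases "t > 0")
        case True
        have "ennreal (norm y) * ?F (0 + norm y * t) = ennreal (real ?n) * (ennreal (norm y) * ennreal ((norm y * t) ^ (?n - 1))) * indicator {0<..} t * (indicator (ball 0 1) y * f (t *\<^sub>R y))"
          unfolding add_0 i s by (simp only: ac_simps)
        then show ?thesis unfolding p[OF True] by (simp only: ac_simps)
      next
        case False
        then show ?thesis unfolding add_0 i by simp
      qed
    qed
    finally show "(\<integral>\<^sup>+r. ?F r \<partial>lborel) = (\<integral>\<^sup>+t. ennreal (real ?n) * ennreal (t ^ (?n - 1)) * indicator {0<..} t * (ennreal (norm y ^ ?n) * indicator (ball 0 1) y * f (t *\<^sub>R y)) \<partial>lborel)" .
  qed
  also have "\<dots> = (\<integral>\<^sup>+t. (\<integral>\<^sup>+y. ennreal (real ?n) * ennreal (t ^ (?n - 1)) * indicator {0<..} t * (ennreal (norm y ^ ?n) * indicator (ball 0 1) y * f (t *\<^sub>R y)) \<partial>(lborel :: 'a measure)) \<partial>lborel)"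
    by (rule lborel_pair.Fubini') simp
  also have "\<dots> = (\<integral>\<^sup>+t. (\<integral>\<^sup>+z. ennreal (real ?n / t ^ (?n + 1)) * (if norm z < t then 1 else 0) * (ennreal (norm z ^ ?n) * f z) \<partial>(lborel :: 'a measure)) \<partial>lborel)"
  proof (rule nn_integral_cong)
    fix t :: real
    show "(\<integral>\<^sup>+y. ennreal (real ?n) * ennreal (t ^ (?n - 1)) * indicator {0<..} t * (ennreal (norm y ^ ?n) * indicator (ball 0 1) y * f (t *\<^sub>R y)) \<partial>(lborel :: 'a measure))
       = (\<integral>\<^sup>+z. ennreal (real ?n / t ^ (?n + 1)) * (if norm z < t then 1 else 0) * (ennreal (norm z ^ ?n) * f z) \<partial>(lborel :: 'a measure))"
    proof (cases "t > 0")
      case True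
      let ?G = "\<lambda>z::'a. ennreal (real ?n) * ennreal (t ^ (?n - 1)) * (ennreal ((norm z / t) ^ ?n) * (if norm z < t then 1 else 0) * f z)"
      have "(\<integral>\<^sup>+y. ennreal (real ?n) * ennreal (t ^ (?n - 1)) * indicator {0<..} t * (ennreal (norm y ^ ?n) * indicator (ball 0 1) y * f (t *\<^sub>R y)) \<partial>(lborel :: 'a measure))
         = (\<integral>\<^sup>+y. ?G (t *\<^sub>R y) \<partial>lborel)"
        using True by (intro nn_integral_cong) (auto simp: indicator_def)
      also have "\<dots> = ennreal (1 / t ^ ?n) * (\<integral>\<^sup>+y. ?G y \<partial>lborel)"
        by (rule nn_integral_lborel_scaleR) (use True in auto)
      also have "\<dots> = (\<integral>\<^sup>+y. ennreal (1 / t ^ ?n) * ?G y \<partial>lborel)"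
        by (rule nn_integral_cmult[symmetric]) simp
      also have "\<dots> = (\<integral>\<^sup>+z. ennreal (real ?n / t ^ (?n + 1)) * (if norm z < t then 1 else 0) * (ennreal (norm z ^ ?n) * f z) \<partial>(lborel :: 'a measure))"
      proof (rule nn_integral_cong)
        fix z :: 'a
        have "1 / t ^ ?n * (real ?n * (t ^ (?n - 1) * (norm z / t) ^ ?n)) = real ?n / t ^ (?n + 1) * norm z ^ ?n"
          using True unfolding m by (simp add: power_divide field_simps)
        then have e: "ennreal (1 / t ^ ?n) * (ennreal (real ?n) * (ennreal (t ^ (?n - 1)) * ennreal ((norm z / t) ^ ?n))) = ennreal (real ?n / t ^ (?n + 1)) * ennreal (norm z ^ ?n)"
          using True by (simp add: ennreal_mult'[symmetric])
        have "ennreal (1 / t ^ ?n) * ?G z = (ennreal (1 / t ^ ?n) * (ennreal (real ?n) * (ennreal (t ^ (?n - 1)) * ennreal ((norm z / t) ^ ?n)))) * ((if norm z < t then 1 else 0) * f z)"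
          by (simp only: ac_simps)
        then show "ennreal (1 / t ^ ?n) * ?G z = ennreal (real ?n / t ^ (?n + 1)) * (if norm z < t then 1 else 0) * (ennreal (norm z ^ ?n) * f z)"
          unfolding e by (simp only: ac_simps)
      qed
      finally show ?thesis .
    next
      case False
      have "\<not> norm z < t" for z :: 'a using False order_trans[of t 0 "norm z"] by auto
      then show ?thesis using False by simp
    qed
  qed
  also have "\<dots> = (\<integral>\<^sup>+z. (\<integral>\<^sup>+t. ennreal (real ?n / t ^ (?n + 1)) * (if norm z < t then 1 else 0) * (ennreal (norm z ^ ?n) * f z) \<partial>lborel) \<partial>(lborel :: 'a measure))"
    by (rule lborel_pair.Fubini') simp
  also have "\<dots> = (\<integral>\<^sup>+z. f z \<partial>lborel)"
  proof (rule nn_integral_cong_AE, rule AE_mp[OF AE_lborel_singleton[of 0]], rule AE_I2, rule impI)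
    fix z :: 'a assume z: "z \<noteq> 0"
    have "(\<integral>\<^sup>+t. ennreal (real ?n / t ^ (?n + 1)) * (if norm z < t then 1 else 0) * (ennreal (norm z ^ ?n) * f z) \<partial>lborel)
      = (\<integral>\<^sup>+t. ennreal (real ?n / t ^ (?n + 1)) * (if norm z < t then 1 else 0) \<partial>lborel) * (ennreal (norm z ^ ?n) * f z)"
      by (rule nn_integral_multc) simp
    also have "(\<integral>\<^sup>+t. ennreal (real ?n / t ^ (?n + 1)) * (if norm z < t then 1 else 0) \<partial>lborel) = (\<integral>\<^sup>+t. ennreal (real ?n / t ^ (?n + 1)) * indicator {norm z..} t \<partial>lborel)"
      by (rule nn_integral_cong_AE, rule AE_mp[OF AE_lborel_singleton[of "norm z"]], rule AE_I2) (auto simp: indicator_def)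
    also have "\<dots> = ennreal (1 / norm z ^ ?n)"
      by (rule nn_integral_inverse_power_atLeast) (use z in auto)
    also have "\<dots> * (ennreal (norm z ^ ?n) * f z) = f z"
      using z by (simp add: mult.assoc[symmetric] ennreal_mult'[symmetric])
    finally show "(\<integral>\<^sup>+t. ennreal (real ?n / t ^ (?n + 1)) * (if norm z < t then 1 else 0) * (ennreal (norm z ^ ?n) * f z) \<partial>lborel) = f z" .
  qed
  finally show ?thesis ..
qed

lemma nn_integral_lborel_shift:
  fixes f :: "'a::euclidean_space \<Rightarrow> ennreal"
  assumes [measurable]: "f \<in> borel_measurable borel"
  shows "(\<integral>\<^sup>+x. f (x + a) \<partial>lborel) = (\<integral>\<^sup>+x. f x \<partial>lborel)"
proof -
  have "(\<integral>\<^sup>+x. f x \<partial>lborel) = (\<integral>\<^sup>+x. f x \<partial>distr lborel borel ((+) a))"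
    by (simp add: lborel_distr_plus)
  then show ?thesis by (simp add: nn_integral_distr add.commute)
qed

lemma nn_integral_lborel_reflect:
  fixes f :: "'a::euclidean_space \<Rightarrow> ennreal"
  assumes [measurable]: "f \<in> borel_measurable borel"
  shows "(\<integral>\<^sup>+x. f (a - x) \<partial>lborel) = (\<integral>\<^sup>+x. f x \<partial>lborel)"
  by (subst (2) lborel_affine[of "-1" a]) (auto simp: nn_integral_density nn_integral_distr)

text \<open>
  Uniqueness of translation invariant measures, made concrete: by Fubini and translation invariance,
  the image measure of \<open>A\<close> times the volume of the unit ball equals the volume of \<open>A\<close> times the image
  measure of the ball, and \<open>T\<close> preserves the ball.
\<close>

lemma lborel_distr_orthogonal:
  fixes T :: "'a::euclidean_space \<Rightarrow> 'a"
  assumes T: "orthogonal_transformation T"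
  shows "distr lborel borel T = lborel"
proof (rule measure_eqI)
  have lin: "linear T" using T by (rule orthogonal_transformation_linear)
  then have cont: "continuous_on UNIV T"
    by (simp add: linear_continuous_on linear_linear)
  then have [measurable]: "T \<in> borel \<rightarrow>\<^sub>M borel" by (rule borel_measurable_continuous_onI)
  let ?B = "ball (0::'a) 1"
  have pre: "(\<integral>\<^sup>+x. indicator C (T x) \<partial>lborel) = emeasure (distr lborel borel T) C" if "C \<in> sets borel" for C
  proof -
    have "emeasure (distr lborel borel T) C = (\<integral>\<^sup>+x. indicator C x \<partial>distr lborel borel T)" using that by simp
    also have "\<dots> = (\<integral>\<^sup>+x. indicator C (T x) \<partial>lborel)" using that by (subst nn_integral_distr) auto
    finally show ?thesis ..
  qed
  fix A assume "A \<in> sets (distr lborel borel T)"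
  then have [measurable]: "A \<in> sets borel" by simp
  let ?m = "\<lambda>C. emeasure (distr lborel borel T) C"
  have "?m A * emeasure lborel ?B = (\<integral>\<^sup>+x. indicator A (T x) * emeasure lborel ?B \<partial>lborel)"
    by (simp add: nn_integral_multc pre)
  also have "\<dots> = (\<integral>\<^sup>+x. (\<integral>\<^sup>+y. indicator A (T x) * indicator ?B (y + T x) \<partial>lborel) \<partial>lborel)"
    by (intro nn_integral_cong, subst nn_integral_cmult, measurable, subst nn_integral_lborel_shift) auto
  also have "\<dots> = (\<integral>\<^sup>+y. (\<integral>\<^sup>+x. indicator A (T x) * indicator ?B (y + T x) \<partial>lborel) \<partial>lborel)"
    by (rule lborel_pair.Fubini') simp
  \<comment> \<open>Shift \<open>x\<close> by a preimage of \<open>y\<close>, so that \<open>y\<close> moves from the ball to \<open>A\<close>.\<close>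
  also have "\<dots> = (\<integral>\<^sup>+y. (\<integral>\<^sup>+x. indicator A (T x - y) * indicator ?B (T x) \<partial>lborel) \<partial>lborel)"
  proof (rule nn_integral_cong)
    fix y
    obtain z where z: "T z = y" using orthogonal_transformation_surj[OF T] by (metis surj_def)
    have "(\<integral>\<^sup>+x. indicator A (T x) * indicator ?B (y + T x) \<partial>lborel)
       = (\<integral>\<^sup>+x. indicator A (T (x + (- z))) * indicator ?B (y + T (x + (- z))) \<partial>lborel)"
      by (rule nn_integral_lborel_shift[symmetric]) simp
    then show "(\<integral>\<^sup>+x. indicator A (T x) * indicator ?B (y + T x) \<partial>lborel) = (\<integral>\<^sup>+x. indicator A (T x - y) * indicator ?B (T x) \<partial>lborel)"
      using z by (simp add: linear_diff[OF lin])
  qed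
  also have "\<dots> = (\<integral>\<^sup>+x. (\<integral>\<^sup>+y. indicator A (T x - y) * indicator ?B (T x) \<partial>lborel) \<partial>lborel)"
    by (rule lborel_pair.Fubini') simp
  also have "\<dots> = (\<integral>\<^sup>+x. emeasure lborel A * indicator ?B (T x) \<partial>lborel)"
    by (intro nn_integral_cong, subst nn_integral_multc, measurable, subst nn_integral_lborel_reflect) auto
  also have "\<dots> = emeasure lborel A * ?m ?B"
    by (simp add: nn_integral_cmult pre)
  also have "?m ?B = emeasure lborel ?B"
    using T by (subst emeasure_distr) (auto intro!: arg_cong[where f="emeasure lborel"] simp: orthogonal_transformation_norm)
  finally have "emeasure lborel ?B * ?m A = emeasure lborel ?B * emeasure lborel A"
    by (simp add: mult.commute)
  moreover have "emeasure lborel ?B \<noteq> \<infinity>" "emeasure lborel ?B \<noteq> 0"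
    using emeasure_lborel_ball_finite[of "0::'a" 1] content_ball_pos[of 1 "0::'a"]
    by (auto simp: emeasure_eq_ennreal_measure)
  ultimately show "?m A = emeasure lborel A" by (simp add: ennreal_mult_cancel_left)
qed simp

lemma nn_integral_surface_measure_orthogonal:
  fixes T :: "'a::euclidean_space \<Rightarrow> 'a"
  assumes T: "orthogonal_transformation T" and [measurable]: "f \<in> borel_measurable borel"
  shows "(\<integral>\<^sup>+w. f (T w) \<partial>surface_measure) = (\<integral>\<^sup>+w. f w \<partial>surface_measure)"
proof -
  have cont: "continuous_on UNIV T"
    using T by (simp add: linear_continuous_on orthogonal_transformation_linear linear_linear)
  then have [measurable]: "T \<in> borel \<rightarrow>\<^sub>M borel" by (rule borel_measurable_continuous_onI)
  have "(\<integral>\<^sup>+x. indicator (ball 0 1) x * f (x /\<^sub>R norm x) \<partial>lborel)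
    = (\<integral>\<^sup>+x. indicator (ball 0 1) x * f (x /\<^sub>R norm x) \<partial>distr lborel borel T)"
    by (simp add: lborel_distr_orthogonal[OF T])
  also have "\<dots> = (\<integral>\<^sup>+x. indicator (ball 0 1) x * f (T (x /\<^sub>R norm x)) \<partial>lborel)"
    using T by (subst nn_integral_distr) (auto intro!: nn_integral_cong simp: indicator_def orthogonal_transformation_norm orthogonal_transformation_scaleR)
  finally show ?thesis by (simp add: nn_integral_surface_measure)
qed

text \<open>
  Rotate \<open>v\<close> to a multiple of the \<open>k\<close>-th basis vector.  This is why the limit density depends on the
  gradient only through its norm, and not on the choice of \<open>k\<close>.
\<close>

lemma nn_integral_surface_measure_inner:
  fixes v :: "real^'n" and k :: 'n
  assumes [measurable]: "f \<in> borel_measurable borel"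
  shows "(\<integral>\<^sup>+w. f (v \<bullet> w) \<partial>surface_measure) = (\<integral>\<^sup>+w. f (norm v * w $ k) \<partial>surface_measure)"
proof -
  have "norm (norm v *\<^sub>R axis k 1 :: real^'n) = norm v" by simp
  then obtain T where T: "orthogonal_transformation T" "T (norm v *\<^sub>R axis k 1 :: real^'n) = v"
    by (rule orthogonal_transformation_exists) (erule that)
  have "(\<integral>\<^sup>+w. f (v \<bullet> w) \<partial>surface_measure) = (\<integral>\<^sup>+w. f (v \<bullet> T w) \<partial>surface_measure)"
    by (rule nn_integral_surface_measure_orthogonal[OF T(1), symmetric]) simp
  also have "\<dots> = (\<integral>\<^sup>+w. f (norm v * w $ k) \<partial>surface_measure)"
  proof (rule nn_integral_cong)
    fix w :: "real^'n"
    have "v \<bullet> T w = (norm v *\<^sub>R axis k 1) \<bullet> w"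
    proof -
      have "T (norm v *\<^sub>R axis k 1) \<bullet> T w = (norm v *\<^sub>R axis k 1) \<bullet> w"
        using T(1) unfolding orthogonal_transformation_def by blast
      then show ?thesis unfolding T(2) .
    qed
    then show "f (v \<bullet> T w) = f (norm v * w $ k)" by (simp add: inner_axis')
  qed
  finally show ?thesis .
qed

section \<open>The Hausdorff measure is a Borel measure\<close>

lemma hausdorff_gauge_empty [simp]: "hausdorff_gauge d {} = 0"
  by (simp add: hausdorff_gauge_def)

lemma hausdorff_pre_le:
  assumes "A \<subseteq> (\<Union>i. C i)" "\<And>i. bounded (C i)" "\<And>i. diameter (C i) \<le> \<delta>"
  shows "hausdorff_pre d \<delta> A \<le> (\<Sum>i. hausdorff_gauge d (C i))"
  unfolding hausdorff_pre_def by (rule INF_lower) (use assms in auto)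

lemma hausdorff_pre_less:
  assumes "hausdorff_pre d \<delta> A < c"
  obtains C where "A \<subseteq> (\<Union>i. C i)" "\<And>i. bounded (C i)" "\<And>i. diameter (C i) \<le> \<delta>"
    "(\<Sum>i. hausdorff_gauge d (C i)) < c"
  using assms unfolding hausdorff_pre_def INF_less_iff by auto

lemma hausdorff_pre_empty:
  assumes "\<delta> > 0" shows "hausdorff_pre d \<delta> {} = 0"
proof -
  have "hausdorff_pre d \<delta> ({} :: 'a::metric_space set) \<le> (\<Sum>i::nat. hausdorff_gauge d ({} :: 'a set))"
    by (rule hausdorff_pre_le) (use assms in auto)
  then show ?thesis by simp
qed

lemma hausdorff_pre_mono: "A \<subseteq> B \<Longrightarrow> hausdorff_pre d \<delta> A \<le> hausdorff_pre d \<delta> B"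
  unfolding hausdorff_pre_def by (rule INF_superset_mono) auto

lemma hausdorff_pre_antimono: "\<delta> \<le> \<epsilon> \<Longrightarrow> hausdorff_pre d \<epsilon> A \<le> hausdorff_pre d \<delta> A"
  unfolding hausdorff_pre_def by (rule INF_superset_mono) (auto intro: order_trans)

lemma hausdorff_pre_countable_subadditive:
  "hausdorff_pre d \<delta> (\<Union>i. A i) \<le> (\<Sum>i::nat. hausdorff_pre d \<delta> (A i))"
proof (rule ennreal_le_epsilon)
  fix e :: real assume fin: "(\<Sum>i. hausdorff_pre d \<delta> (A i)) < top" and e: "0 < e"
  have "\<exists>C. A i \<subseteq> (\<Union>j. C j) \<and> (\<forall>j. bounded (C j) \<and> diameter (C j) \<le> \<delta>) \<and>
     (\<Sum>j::nat. hausdorff_gauge d (C j)) \<le> hausdorff_pre d \<delta> (A i) + ennreal (e * (1/2) ^ Suc i)" for i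
  proof -
    have "hausdorff_pre d \<delta> (A i) \<noteq> top"
    proof
      assume "hausdorff_pre d \<delta> (A i) = top"
      then show False using fin ennreal_suminf_lessD[OF fin, of i] by simp
    qed
    then have "hausdorff_pre d \<delta> (A i) < hausdorff_pre d \<delta> (A i) + ennreal (e * (1/2) ^ Suc i)"
      using e by (simp add: ennreal_add_left_cancel_less[of _ 0, simplified])
    then show ?thesis
    proof (rule hausdorff_pre_less, goal_cases)
      case (1 C)
      then show ?case by (intro exI[of _ C] conjI allI) (auto intro: less_imp_le)
    qed
  qed
  then obtain C where C: "\<And>i. A i \<subseteq> (\<Union>j. C i j)" "\<And>i j. bounded (C i j)" "\<And>i j. diameter (C i j) \<le> \<delta>"
     "\<And>i. (\<Sum>j::nat. hausdorff_gauge d (C i j)) \<le> hausdorff_pre d \<delta> (A i) + ennreal (e * (1/2) ^ Suc i)"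
    by metis
  define D where "D m = (case prod_decode m of (i, j) \<Rightarrow> C i j)" for m
  have "hausdorff_pre d \<delta> (\<Union>i. A i) \<le> (\<Sum>m. hausdorff_gauge d (D m))"
  proof (rule hausdorff_pre_le)
    show "(\<Union>i. A i) \<subseteq> (\<Union>m. D m)"
    proof
      fix x assume "x \<in> (\<Union>i. A i)"
      then obtain i j where "x \<in> C i j" using C(1) by blast
      then have "x \<in> D (prod_encode (i, j))" by (simp add: D_def)
      then show "x \<in> (\<Union>m. D m)" by blast
    qed
  qed (use C in \<open>auto simp: D_def split: prod.split\<close>)
  also have "\<dots> = (\<Sum>i. \<Sum>j. hausdorff_gauge d (C i j))"
  proof -
    have "(\<Sum>m. hausdorff_gauge d (D m)) = (\<Sum>m. case prod_decode m of (i, j) \<Rightarrow> hausdorff_gauge d (C i j))"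
      unfolding D_def by (intro suminf_cong) (auto split: prod.split)
    also have "\<dots> = (\<Sum>i. \<Sum>j. hausdorff_gauge d (C i j))"
      using suminf_ennreal_2dimen[of "\<lambda>i. \<Sum>j. hausdorff_gauge d (C i j)" "\<lambda>(i, j). hausdorff_gauge d (C i j)"]
      by (simp add: comp_def)
    finally show ?thesis .
  qed
  also have "\<dots> \<le> (\<Sum>i. hausdorff_pre d \<delta> (A i) + ennreal (e * (1/2) ^ Suc i))"
    by (intro suminf_le C summableI)
  also have "\<dots> = (\<Sum>i. hausdorff_pre d \<delta> (A i)) + (\<Sum>i. ennreal (e * (1/2) ^ Suc i))"
    by (intro suminf_add[symmetric] summableI)
  also have "(\<Sum>i. ennreal (e * (1/2) ^ Suc i)) = ennreal e"
    using sums_mult[OF power_half_series, of e] e by (intro suminf_ennreal_eq) auto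
  finally show "hausdorff_pre d \<delta> (\<Union>i. A i) \<le> (\<Sum>i. hausdorff_pre d \<delta> (A i)) + ennreal e" .
qed

lemma hausdorff_outer_ge: "\<delta> > 0 \<Longrightarrow> hausdorff_pre d \<delta> A \<le> hausdorff_outer d A"
  unfolding hausdorff_outer_def by (rule SUP_upper) simp

lemma hausdorff_outer_le: "(\<And>\<delta>. \<delta> > 0 \<Longrightarrow> hausdorff_pre d \<delta> A \<le> c) \<Longrightarrow> hausdorff_outer d A \<le> c"
  unfolding hausdorff_outer_def by (rule SUP_least) simp

lemma hausdorff_outer_empty [simp]: "hausdorff_outer d {} = 0"
proof -
  have "hausdorff_outer d {} \<le> (0::ennreal)" by (rule hausdorff_outer_le) (simp add: hausdorff_pre_empty)
  then show ?thesis by simp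
qed

lemma hausdorff_outer_mono: "A \<subseteq> B \<Longrightarrow> hausdorff_outer d A \<le> hausdorff_outer d B"
  unfolding hausdorff_outer_def by (intro SUP_mono') (rule hausdorff_pre_mono)

lemma hausdorff_outer_countable_subadditive:
  "hausdorff_outer d (\<Union>i. A i) \<le> (\<Sum>i::nat. hausdorff_outer d (A i))"
proof (rule hausdorff_outer_le)
  fix \<delta> :: real assume "\<delta> > 0"
  have "hausdorff_pre d \<delta> (\<Union>i. A i) \<le> (\<Sum>i. hausdorff_pre d \<delta> (A i))"
    by (rule hausdorff_pre_countable_subadditive)
  also have "\<dots> \<le> (\<Sum>i. hausdorff_outer d (A i))"
    by (intro suminf_le hausdorff_outer_ge summableI) fact
  finally show "hausdorff_pre d \<delta> (\<Union>i. A i) \<le> (\<Sum>i. hausdorff_outer d (A i))" .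
qed

lemma hausdorff_pre_Un: "\<delta> > 0 \<Longrightarrow> hausdorff_pre d \<delta> (A \<union> B) \<le> hausdorff_pre d \<delta> A + hausdorff_pre d \<delta> B"
proof -
  assume d: "\<delta> > 0"
  let ?F = "\<lambda>i::nat. if i = 0 then A else if i = 1 then B else {}"
  have "(\<Union>i. ?F i) = A \<union> B" by (auto split: if_splits)
  then have "hausdorff_pre d \<delta> (A \<union> B) \<le> (\<Sum>i. hausdorff_pre d \<delta> (?F i))"
    using hausdorff_pre_countable_subadditive[of d \<delta> ?F] by simp
  also have "\<dots> = (\<Sum>i<2. hausdorff_pre d \<delta> (?F i))"
    by (rule suminf_finite) (auto simp: hausdorff_pre_empty[OF d])
  also have "\<dots> = hausdorff_pre d \<delta> A + hausdorff_pre d \<delta> B" by (simp add: numeral_2_eq_2)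
  finally show ?thesis .
qed

lemma hausdorff_outer_Un: "hausdorff_outer d (A \<union> B) \<le> hausdorff_outer d A + hausdorff_outer d B"
proof (rule hausdorff_outer_le)
  fix \<delta> :: real assume d: "\<delta> > 0"
  show "hausdorff_pre d \<delta> (A \<union> B) \<le> hausdorff_outer d A + hausdorff_outer d B"
    using hausdorff_pre_Un[OF d, of d A B] hausdorff_outer_ge[OF d, of d A] hausdorff_outer_ge[OF d, of d B]
    by (meson add_mono order_trans)
qed

text \<open>
  A covering set of diameter at most \<open>\<delta>\<close> cannot meet both \<open>A\<close> and \<open>B\<close>, so a covering of the union
  splits into a covering of \<open>A\<close> and one of \<open>B\<close>.
\<close>

lemma hausdorff_pre_separated:
  assumes sep: "\<And>x y. x \<in> A \<Longrightarrow> y \<in> B \<Longrightarrow> \<delta> < dist x y" and d: "\<delta> > 0"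
  shows "hausdorff_pre d \<delta> A + hausdorff_pre d \<delta> B \<le> hausdorff_pre d \<delta> (A \<union> B)"
  unfolding hausdorff_pre_def[of _ _ "A \<union> B"]
proof (rule INF_greatest)
  fix C :: "nat \<Rightarrow> 'a set" assume "C \<in> {C. A \<union> B \<subseteq> (\<Union>i. C i) \<and> (\<forall>i. bounded (C i) \<and> diameter (C i) \<le> \<delta>)}"
  then have C: "A \<subseteq> (\<Union>i. C i)" "B \<subseteq> (\<Union>i. C i)" "\<And>i. bounded (C i)" "\<And>i. diameter (C i) \<le> \<delta>" by auto
  define CA where "CA i = (if C i \<inter> A = {} then {} else C i)" for i
  define CB where "CB i = (if C i \<inter> A = {} then C i else {})" for i
  have "B \<subseteq> (\<Union>i. CB i)"
  proof
    fix y assume y: "y \<in> B"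
    then obtain i where i: "y \<in> C i" using C(2) by auto
    have "C i \<inter> A = {}"
    proof (rule ccontr)
      assume "C i \<inter> A \<noteq> {}"
      then obtain x where x: "x \<in> C i" "x \<in> A" by auto
      have "dist x y \<le> \<delta>" using diameter_bounded_bound[OF C(3) x(1) i] C(4)[of i] by linarith
      with sep[OF x(2) y] show False by simp
    qed
    then show "y \<in> (\<Union>i. CB i)" using i by (auto simp: CB_def)
  qed
  moreover have "A \<subseteq> (\<Union>i. CA i)" using C(1) by (fastforce simp: CA_def)
  moreover have "bounded (CA i)" "bounded (CB i)" "diameter (CA i) \<le> \<delta>" "diameter (CB i) \<le> \<delta>" for i
    using C(3,4)[of i] d by (auto simp: CA_def CB_def)
  ultimately have "hausdorff_pre d \<delta> A + hausdorff_pre d \<delta> B \<le> (\<Sum>i. hausdorff_gauge d (CA i)) + (\<Sum>i. hausdorff_gauge d (CB i))"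
    by (intro add_mono hausdorff_pre_le) auto
  also have "\<dots> = (\<Sum>i. hausdorff_gauge d (CA i) + hausdorff_gauge d (CB i))"
    by (intro suminf_add summableI)
  also have "\<dots> = (\<Sum>i. hausdorff_gauge d (C i))"
    by (intro suminf_cong) (auto simp: CA_def CB_def)
  finally show "hausdorff_pre d \<delta> A + hausdorff_pre d \<delta> B \<le> (\<Sum>i. hausdorff_gauge d (C i))" .
qed

lemma hausdorff_outer_separated:
  assumes sep: "\<And>x y. x \<in> A \<Longrightarrow> y \<in> B \<Longrightarrow> \<epsilon> \<le> dist x y" and e: "\<epsilon> > 0"
  shows "hausdorff_outer d A + hausdorff_outer d B \<le> hausdorff_outer d (A \<union> B)"
proof -
  have half: "hausdorff_pre d a A + hausdorff_pre d b B \<le> hausdorff_outer d (A \<union> B)" if "a > 0" "b > 0" for a b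
  proof -
    define c where "c = min (\<epsilon>/2) (min a b)"
    have c: "c > 0" "c < \<epsilon>" "c \<le> a" "c \<le> b" using that e by (auto simp: c_def)
    have "hausdorff_pre d a A + hausdorff_pre d b B \<le> hausdorff_pre d c A + hausdorff_pre d c B"
      by (intro add_mono hausdorff_pre_antimono c)
    also have "\<dots> \<le> hausdorff_pre d c (A \<union> B)"
    proof (rule hausdorff_pre_separated[OF _ c(1)])
      fix x y assume "x \<in> A" "y \<in> B"
      then show "c < dist x y" using sep[of x y] c(2) by linarith
    qed
    also have "\<dots> \<le> hausdorff_outer d (A \<union> B)" by (rule hausdorff_outer_ge) fact
    finally show ?thesis .
  qed
  have 1: "hausdorff_outer d A + hausdorff_pre d b B \<le> hausdorff_outer d (A \<union> B)" if "b > 0" for b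
    unfolding hausdorff_outer_def[of d A]
    by (subst ennreal_SUP_add_left[symmetric]) (auto intro!: SUP_least half that simp: add_top)
  show ?thesis
    using 1 unfolding hausdorff_outer_def[of d B]
    by (subst add.commute, subst ennreal_SUP_add_left[symmetric]) (auto intro!: SUP_least simp: add.commute)
qed

text \<open>
  Caratheodory's argument for metric outer measures.  The points of \<open>X\<close> at distance at least
  \<open>1 / (m + 1)\<close> from \<open>F\<close> are separated from \<open>F\<close>; the rest of \<open>X - F\<close> is cut into layers by the
  distance from \<open>F\<close>.  Layers whose indices differ by at least two are separated from each other, so the
  outer measures of the even layers, and of the odd layers, have sum at most that of \<open>X\<close>.  When this is
  finite, the tail of the sum over all layers tends to \<open>0\<close>.
\<close>

lemma hausdorff_outer_closed_split:
  fixes F :: "'a::metric_space set"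
  assumes F: "closed F"
  shows "hausdorff_outer d (F \<inter> X) + hausdorff_outer d (X - F) \<le> hausdorff_outer d X"
proof (cases "F = {} \<or> hausdorff_outer d X = top")
  case True
  then show ?thesis by auto
next
  case False
  then have ne: "F \<noteq> {}" and fin: "hausdorff_outer d X < top" by (auto simp: less_top)
  \<comment> \<open>The part of \<open>X\<close> away from \<open>F\<close>, and the layers that accumulate at \<open>F\<close>.\<close>
  define P where "P m = {x \<in> X. inverse (real (Suc m)) \<le> infdist x F}" for m
  define R where "R m = {x \<in> X. inverse (real (Suc (Suc m))) \<le> infdist x F \<and> infdist x F < inverse (real (Suc m))}" for m
  have P_le: "hausdorff_outer d (F \<inter> X) + hausdorff_outer d (P m) \<le> hausdorff_outer d X" for m
  proof -
    have "hausdorff_outer d (F \<inter> X) + hausdorff_outer d (P m) \<le> hausdorff_outer d (F \<inter> X \<union> P m)"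
    proof (rule hausdorff_outer_separated)
      fix x y assume "x \<in> F \<inter> X" "y \<in> P m"
      then show "inverse (real (Suc m)) \<le> dist x y"
        using infdist_le[of x F y] by (auto simp: P_def dist_commute)
    qed simp
    also have "\<dots> \<le> hausdorff_outer d X" by (rule hausdorff_outer_mono) (auto simp: P_def)
    finally show ?thesis .
  qed
  have XF: "X - F \<subseteq> P m \<union> (\<Union>j. R (m + j))" for m
  proof
    fix x assume x: "x \<in> X - F"
    then have pos: "infdist x F > 0"
      using F ne by (simp add: in_closed_iff_infdist_zero infdist_nonneg less_le)
    show "x \<in> P m \<union> (\<Union>j. R (m + j))"
    proof (cases "inverse (real (Suc m)) \<le> infdist x F")
      case True then show ?thesis using x by (auto simp: P_def)
    next
      case F': False
      obtain N where N: "inverse (real (Suc N)) < infdist x F" using reals_Archimedean[OF pos] by auto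
      define k where "k = (LEAST k. inverse (real (Suc k)) \<le> infdist x F)"
      have k: "inverse (real (Suc k)) \<le> infdist x F"
        unfolding k_def by (rule LeastI[of _ N]) (use N in simp)
      have least: "\<not> inverse (real (Suc j)) \<le> infdist x F" if "j < k" for j
        using that not_less_Least unfolding k_def by blast
      have "m < k"
      proof (rule ccontr)
        assume "\<not> m < k"
        then have "inverse (real (Suc m)) \<le> inverse (real (Suc k))" by (intro le_imp_inverse_le) auto
        with k F' show False by linarith
      qed
      then obtain j where j: "k = Suc (m + j)" using less_imp_Suc_add by auto
      have "x \<in> R (m + j)" using k least[of "m + j"] x unfolding R_def j by (auto simp: not_le)
      then show ?thesis by blast
    qed
  qed
  have sumR: "(\<Sum>i\<in>I. hausdorff_outer d (R i)) \<le> hausdorff_outer d (\<Union>i\<in>I. R i)"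
    if "finite I" "\<forall>i\<in>I. \<forall>j\<in>I. i < j \<longrightarrow> i + 2 \<le> j" for I
    using that
  proof (induction I rule: finite_linorder_max_induct)
    case empty then show ?case by simp
  next
    case (insert b I)
    have sep: "inverse (real (Suc b)) < infdist y F" if "i \<in> I" "y \<in> R i" for i y
    proof -
      have "Suc (Suc i) \<le> b" using insert that by auto
      then have "inverse (real (Suc b)) < inverse (real (Suc (Suc i)))"
        by (intro less_imp_inverse_less) auto
      also have "\<dots> \<le> infdist y F" using that by (simp add: R_def)
      finally show ?thesis .
    qed
    have sep2: "inverse (real (Suc b)) \<ge> infdist y F" if "y \<in> R b" for y
      using that by (simp add: R_def)
    have bI: "Suc (Suc i) \<le> b" if "i \<in> I" for i using insert that by auto
    define \<epsilon> where "\<epsilon> = inverse (real b) - inverse (real (Suc b))"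
    show ?case
    proof (cases "I = {}")
      case True then show ?thesis by simp
    next
      case False
      then have b2: "b \<ge> 2" using bI by fastforce
      have e: "\<epsilon> > 0" unfolding \<epsilon>_def using b2 by (simp add: less_imp_inverse_less)
      have "b \<notin> I" using insert.hyps(2) by auto
      have "hausdorff_outer d (\<Union>i\<in>I. R i) + hausdorff_outer d (R b) \<le> hausdorff_outer d ((\<Union>i\<in>I. R i) \<union> R b)"
      proof (rule hausdorff_outer_separated[OF _ e])
        fix x y assume "x \<in> (\<Union>i\<in>I. R i)" and y: "y \<in> R b"
        then obtain i where i: "i \<in> I" "x \<in> R i" by auto
        have "inverse (real b) \<le> inverse (real (Suc (Suc i)))"
          using bI[OF i(1)] by (intro le_imp_inverse_le) auto
        then have "inverse (real b) \<le> infdist x F" using i(2) by (simp add: R_def)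
        moreover have "infdist x F \<le> infdist y F + dist x y"
          by (rule infdist_triangle)
        ultimately show "\<epsilon> \<le> dist x y" using sep2[OF y] unfolding \<epsilon>_def by linarith
      qed
      moreover have "(\<Sum>i\<in>I. hausdorff_outer d (R i)) \<le> hausdorff_outer d (\<Union>i\<in>I. R i)"
        using insert by simp
      ultimately have "hausdorff_outer d (R b) + (\<Sum>i\<in>I. hausdorff_outer d (R i)) \<le> hausdorff_outer d ((\<Union>i\<in>I. R i) \<union> R b)"
        by (auto intro: order_trans[OF add_left_mono] simp: add.commute)
      with \<open>b \<notin> I\<close> show ?thesis using \<open>finite I\<close> by (simp add: Un_commute)
    qed
  qed
  \<comment> \<open>Even layers for \<open>c = 0\<close>, odd layers for \<open>c = 1\<close>.\<close>
  have fin_half: "(\<Sum>j. hausdorff_outer d (R (2 * j + c))) \<le> hausdorff_outer d X" for c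
  proof (rule suminf_le_const[OF summableI])
    fix N
    let ?I = "(\<lambda>j. 2 * j + c) ` {..<N}"
    have "(\<Sum>j<N. hausdorff_outer d (R (2 * j + c))) = (\<Sum>i\<in>?I. hausdorff_outer d (R i))"
      by (subst sum.reindex) (auto simp: inj_on_def)
    also have "\<dots> \<le> hausdorff_outer d (\<Union>i\<in>?I. R i)" by (rule sumR) auto
    also have "\<dots> \<le> hausdorff_outer d X" by (rule hausdorff_outer_mono) (auto simp: R_def)
    finally show "(\<Sum>j<N. hausdorff_outer d (R (2 * j + c))) \<le> hausdorff_outer d X" .
  qed
  have fin_tot: "(\<Sum>i. hausdorff_outer d (R i)) \<noteq> top"
  proof -
    have "(\<Sum>i. hausdorff_outer d (R i)) \<le> hausdorff_outer d X + hausdorff_outer d X"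
    proof (rule suminf_le_const[OF summableI])
      fix N
      have "(\<Sum>i<N. hausdorff_outer d (R i)) \<le> (\<Sum>i<2*N. hausdorff_outer d (R i))"
        by (intro sum_mono2) auto
      also have "\<dots> = (\<Sum>j<N. hausdorff_outer d (R (2 * j + 0))) + (\<Sum>j<N. hausdorff_outer d (R (2 * j + 1)))"
        by (induction N) (auto simp: ac_simps)
      also have "\<dots> \<le> hausdorff_outer d X + hausdorff_outer d X"
        by (intro add_mono order_trans[OF sum_le_suminf fin_half] summableI) auto
      finally show "(\<Sum>i<N. hausdorff_outer d (R i)) \<le> hausdorff_outer d X + hausdorff_outer d X" .
    qed
    then show ?thesis using fin by (auto simp: top_unique)
  qed
  have "(\<lambda>m. \<Sum>j. hausdorff_outer d (R (m + j))) \<longlonglongrightarrow> 0"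
  proof -
    define a where "a i = enn2real (hausdorff_outer d (R i))" for i
    have finR: "hausdorff_outer d (R i) < top" for i
      using ennreal_suminf_lessD[of "\<lambda>i. hausdorff_outer d (R i)" top i] fin_tot by (auto simp: less_top)
    have a: "hausdorff_outer d (R i) = ennreal (a i)" for i
      using finR[of i] by (simp add: a_def)
    have a0: "0 \<le> a i" for i by (simp add: a_def)
    have sa: "summable a" using fin_tot unfolding a by (intro summable_suminf_not_top a0) auto
    have "(\<lambda>m. ennreal (\<Sum>j. a (j + m))) \<longlonglongrightarrow> ennreal 0"
      by (intro tendsto_ennrealI suminf_exist_split2 sa)
    moreover have "(\<Sum>j. hausdorff_outer d (R (m + j))) = ennreal (\<Sum>j. a (j + m))" for m
      unfolding a using sa a0 by (subst suminf_ennreal2) (auto simp: add.commute summable_iff_shift)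
    ultimately show ?thesis by simp
  qed
  then have lim: "(\<lambda>m. hausdorff_outer d X + (\<Sum>j. hausdorff_outer d (R (m + j)))) \<longlonglongrightarrow> hausdorff_outer d X + 0"
    by (intro tendsto_add tendsto_const)
  have "hausdorff_outer d (F \<inter> X) + hausdorff_outer d (X - F) \<le> hausdorff_outer d X + (\<Sum>j. hausdorff_outer d (R (m + j)))" for m
  proof -
    have "hausdorff_outer d (X - F) \<le> hausdorff_outer d (P m \<union> (\<Union>j. R (m + j)))"
      by (rule hausdorff_outer_mono[OF XF])
    also have "\<dots> \<le> hausdorff_outer d (P m) + hausdorff_outer d (\<Union>j. R (m + j))"
      by (rule hausdorff_outer_Un)
    also have "\<dots> \<le> hausdorff_outer d (P m) + (\<Sum>j. hausdorff_outer d (R (m + j)))"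
      by (intro add_left_mono hausdorff_outer_countable_subadditive)
    finally have "hausdorff_outer d (F \<inter> X) + hausdorff_outer d (X - F)
       \<le> hausdorff_outer d (F \<inter> X) + hausdorff_outer d (P m) + (\<Sum>j. hausdorff_outer d (R (m + j)))"
      by (simp add: add.assoc add_left_mono)
    also have "\<dots> \<le> hausdorff_outer d X + (\<Sum>j. hausdorff_outer d (R (m + j)))"
      by (intro add_right_mono P_le)
    finally show ?thesis .
  qed
  then show ?thesis using LIMSEQ_le_const[OF lim] by auto
qed

text \<open>
  The sets that split every set additively form a sigma-algebra on which the outer measure is a
  measure.  It contains the closed sets, hence the Borel sets.
\<close>

theorem emeasure_hausdorff_measure:
  fixes A :: "'a::metric_space set"
  assumes A: "A \<in> sets borel"
  shows "emeasure (hausdorff_measure d) A = hausdorff_outer d A"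
proof -
  let ?h = "hausdorff_outer d :: 'a set \<Rightarrow> ennreal"
  interpret P: sigma_algebra UNIV "Pow (UNIV :: 'a set)" by (rule sigma_algebra_Pow)
  have oms: "outer_measure_space (Pow UNIV) ?h"
    unfolding outer_measure_space_def positive_def increasing_def countably_subadditive_def
    by (auto intro: hausdorff_outer_mono hausdorff_outer_countable_subadditive)
  define L where "L = lambda_system UNIV (Pow UNIV) ?h"
  have ms: "measure_space UNIV L ?h"
    unfolding L_def by (rule P.caratheodory_lemma[OF oms])
  then interpret L: sigma_algebra UNIV L by (simp add: measure_space_def)
  have closed_L: "F \<in> L" if "closed F" for F
  proof -
    have "?h (F \<inter> X) + ?h ((UNIV - F) \<inter> X) = ?h X" for X
    proof (rule antisym)
      have eq: "(UNIV - F) \<inter> X = X - F" by auto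
      show "?h (F \<inter> X) + ?h ((UNIV - F) \<inter> X) \<le> ?h X"
        unfolding eq by (rule hausdorff_outer_closed_split) fact
      have "?h X = ?h (F \<inter> X \<union> (UNIV - F) \<inter> X)" by (rule arg_cong[of _ _ ?h]) auto
      also have "\<dots> \<le> ?h (F \<inter> X) + ?h ((UNIV - F) \<inter> X)" by (rule hausdorff_outer_Un)
      finally show "?h X \<le> ?h (F \<inter> X) + ?h ((UNIV - F) \<inter> X)" .
    qed
    then show ?thesis by (simp add: L_def lambda_system_def)
  qed
  have "sets (borel :: 'a measure) = sigma_sets UNIV (Collect closed)"
    by (simp add: borel_eq_closed)
  also have "\<dots> \<subseteq> L" using closed_L by (intro L.sigma_sets_subset) auto
  finally have sub: "sets (borel :: 'a measure) \<subseteq> L" .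
  have sa: "sigma_algebra UNIV (sets (borel :: 'a measure))"
    using sets.sigma_algebra_axioms[of "borel :: 'a measure"] by simp
  have msb: "measure_space UNIV (sets borel) ?h"
    using ms sub sa unfolding measure_space_def positive_def countably_additive_def by blast
  have "emeasure (measure_of UNIV (sets borel) ?h) A = ?h A"
    by (rule emeasure_measure_of_sigma) (use msb A in \<open>auto simp: measure_space_def\<close>)
  then show ?thesis by (simp add: hausdorff_measure_def)
qed

lemma sets_hausdorff_measure [simp, measurable_cong]: "sets (hausdorff_measure d :: 'a::metric_space measure) = sets borel"
proof -
  have "sigma_sets UNIV (sets (borel :: 'a measure)) = sets borel"
    using sets.sigma_sets_eq[of "borel :: 'a measure"] by simp
  then show ?thesis by (simp add: hausdorff_measure_def)
qed

lemma space_hausdorff_measure [simp]: "space (hausdorff_measure d) = UNIV"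
  by (simp add: hausdorff_measure_def)

section \<open>Cones and spherical caps\<close>

lemma nn_integral_power_Icc:
  assumes c: "0 \<le> c"
  shows "(\<integral>\<^sup>+z. ennreal (z ^ m) * indicator {0..c} z \<partial>lborel) = ennreal (c ^ (m + 1) / real (m + 1))"
proof -
  have "(\<integral>\<^sup>+z. ennreal (z ^ m) * indicator {0..c} z \<partial>lborel) = ennreal (c ^ (m + 1) / real (m + 1) - 0 ^ (m + 1) / real (m + 1))"
  proof (rule nn_integral_FTC_Icc)
    fix z :: real
    have "((\<lambda>z. z ^ (m + 1) / real (m + 1)) has_real_derivative (real (m + 1) * z ^ m) / real (m + 1)) (at z)"
      by (rule DERIV_cdivide) (use DERIV_pow[of "m + 1" z] in simp)
    then have "((\<lambda>z. z ^ (m + 1) / real (m + 1)) has_real_derivative z ^ m) (at z)" by (simp del: of_nat_Suc of_nat_add)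
    then show "((\<lambda>z. z ^ (m + 1) / real (m + 1)) has_real_derivative z ^ m) (at z)" .
  qed (use c in auto)
  then show ?thesis by simp
qed

lemma norm_sum_subset_Basis:
  fixes f :: "'a::euclidean_space \<Rightarrow> real"
  assumes "A \<subseteq> Basis"
  shows "(norm (\<Sum>j\<in>A. f j *\<^sub>R j))\<^sup>2 = (\<Sum>j\<in>A. (f j)\<^sup>2)"
proof -
  have fin: "finite A" using assms finite_subset finite_Basis by blast
  have *: "(\<Sum>i\<in>A. f i * (i \<bullet> j)) = f j" if "j \<in> A" for j
  proof -
    have "(\<Sum>i\<in>A. f i * (i \<bullet> j)) = (\<Sum>i\<in>A. if j = i then f j else 0)"
    proof (rule sum.cong[OF refl])
      fix i assume "i \<in> A"
      then have "i \<bullet> j = (if i = j then 1 else 0)" using assms that by (intro inner_Basis) auto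
      then show "f i * (i \<bullet> j) = (if j = i then f j else 0)" by simp
    qed
    then show ?thesis using that fin by simp
  qed
  then show ?thesis
    unfolding power2_norm_eq_inner by (simp add: inner_sum_left inner_sum_right * power2_eq_square)
qed

context
  fixes b :: "'a::euclidean_space"
  assumes b: "b \<in> Basis"
begin

abbreviation "hyper \<equiv> coord_lborel (Basis - {b})"

abbreviation lift_slice :: "('a \<Rightarrow> real) \<Rightarrow> real \<Rightarrow> 'a" where
  "lift_slice f z \<equiv> (\<Sum>j\<in>Basis - {b}. f j *\<^sub>R j) + z *\<^sub>R b"

lemma lift_slice_inner: "lift_slice f z \<bullet> b = z"
proof -
  have "(\<Sum>j\<in>Basis - {b}. f j * (j \<bullet> b)) = 0"
    using b by (intro sum.neutral) (auto simp: inner_Basis)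
  then show ?thesis using b by (simp add: inner_add_left inner_sum_left)
qed

lemma lift_slice_measurable [measurable]: "(\<lambda>f. lift_slice f z) \<in> hyper \<rightarrow>\<^sub>M borel"
  by measurable

lemma emeasure_lborel_slices:
  assumes E: "E \<in> sets borel"
  shows "emeasure lborel E = (\<integral>\<^sup>+z. emeasure hyper {f \<in> space hyper. lift_slice f z \<in> E} \<partial>lborel)"
proof -
  interpret product_sigma_finite "\<lambda>_::'a. lborel :: real measure" by standard
  have ins: "Basis = insert b (Basis - {b})" using b by auto
  have meas: "(\<lambda>f. indicator E (\<Sum>j\<in>insert b (Basis - {b}). f j *\<^sub>R j) :: ennreal) \<in> borel_measurable (coord_lborel (insert b (Basis - {b})))"
    using E by measurable
  have "emeasure lborel E = (\<integral>\<^sup>+x. indicator E x \<partial>(lborel :: 'a measure))" using E by simp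
  also have "\<dots> = (\<integral>\<^sup>+f. indicator E (\<Sum>j\<in>Basis. f j *\<^sub>R j) \<partial>coord_lborel Basis)"
    by (subst lborel_eq, subst nn_integral_distr) (use E in auto)
  also have "\<dots> = (\<integral>\<^sup>+f. indicator E (\<Sum>j\<in>insert b (Basis - {b}). f j *\<^sub>R j) \<partial>coord_lborel (insert b (Basis - {b})))"
    using ins by simp
  also have "\<dots> = (\<integral>\<^sup>+z. (\<integral>\<^sup>+f. indicator E (\<Sum>j\<in>insert b (Basis - {b}). (f(b := z)) j *\<^sub>R j) \<partial>hyper) \<partial>lborel)"
    by (rule product_nn_integral_insert_rev) (use meas in auto)
  also have "\<dots> = (\<integral>\<^sup>+z. emeasure hyper {f \<in> space hyper. lift_slice f z \<in> E} \<partial>lborel)"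
  proof (rule nn_integral_cong)
    fix z :: real
    have "(\<integral>\<^sup>+f. indicator E (\<Sum>j\<in>insert b (Basis - {b}). (f(b := z)) j *\<^sub>R j) \<partial>hyper)
      = (\<integral>\<^sup>+f. indicator {f \<in> space hyper. lift_slice f z \<in> E} f \<partial>hyper)"
    proof (rule nn_integral_cong)
      fix f assume f: "f \<in> space hyper"
      have "(\<Sum>j\<in>insert b (Basis - {b}). (f(b := z)) j *\<^sub>R j) = lift_slice f z"
        by (subst sum.insert) (auto intro!: sum.cong simp: add.commute)
      then show "(indicator E (\<Sum>j\<in>insert b (Basis - {b}). (f(b := z)) j *\<^sub>R j) :: ennreal) = indicator {f \<in> space hyper. lift_slice f z \<in> E} f"
        using f by (simp add: indicator_def)
    qed
    also have "\<dots> = emeasure hyper {f \<in> space hyper. lift_slice f z \<in> E}"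
    proof (rule nn_integral_indicator)
      show "{f \<in> space hyper. lift_slice f z \<in> E} \<in> sets hyper"
        using measurable_sets[OF lift_slice_measurable E, of z] by (simp add: vimage_def Int_def conj_commute)
    qed
    finally show "(\<integral>\<^sup>+f. indicator E (\<Sum>j\<in>insert b (Basis - {b}). (f(b := z)) j *\<^sub>R j) \<partial>hyper) = emeasure hyper {f \<in> space hyper. lift_slice f z \<in> E}" .
  qed
  finally show ?thesis .
qed

lemma card_hyper: "card (Basis - {b}) = DIM('a) - 1"
  using b by simp

text \<open>
  The slice at height \<open>z\<close> has diameter at most \<open>L z\<close>, so the isodiametric inequality bounds its volume by
  that of a ball of radius \<open>L z / 2\<close>.  Integrating \<open>z\<^bsup>n - 1\<^esup>\<close> over the heights gives \<open>1 / n\<close>.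
\<close>

lemma emeasure_cone_le:
  assumes E: "E \<in> sets borel" "\<And>x. x \<in> E \<Longrightarrow> 0 < x \<bullet> b \<and> x \<bullet> b < 1" and L: "0 \<le> L"
    and diam: "\<And>x y. x \<in> E \<Longrightarrow> y \<in> E \<Longrightarrow> x \<bullet> b = y \<bullet> b \<Longrightarrow> norm (x - y) \<le> L * (x \<bullet> b)"
  shows "ennreal (real DIM('a)) * emeasure lborel E \<le> ennreal (unit_ball_vol (real (DIM('a) - 1)) * (L / 2) ^ (DIM('a) - 1))"
proof -
  let ?d = "DIM('a) - 1" and ?w = "unit_ball_vol (real (DIM('a) - 1))"
  have d: "DIM('a) = ?d + 1" by simp
  have slice: "emeasure hyper {f \<in> space hyper. lift_slice f z \<in> E} \<le> ennreal (?w * (L / 2) ^ ?d) * (ennreal (z ^ ?d) * indicator {0..1} z)" for z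
  proof (cases "0 < z \<and> z < 1")
    case True
    have "emeasure hyper {f \<in> space hyper. lift_slice f z \<in> E} \<le> ennreal (unit_ball_vol (real (card (Basis - {b}))) * (L * z / 2) ^ card (Basis - {b}))"
    proof (rule isodiametric)
      show "{f \<in> space hyper. lift_slice f z \<in> E} \<in> sets hyper"
        using measurable_sets[OF lift_slice_measurable E(1), of z] by (simp add: vimage_def Int_def conj_commute)
      fix f g assume fg: "f \<in> {f \<in> space hyper. lift_slice f z \<in> E}" "g \<in> {f \<in> space hyper. lift_slice f z \<in> E}"
      have "(\<Sum>j\<in>Basis - {b}. (f j - g j)\<^sup>2) = (norm (\<Sum>j\<in>Basis - {b}. (f j - g j) *\<^sub>R j))\<^sup>2"
        by (rule norm_sum_subset_Basis[symmetric]) auto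
      also have "(\<Sum>j\<in>Basis - {b}. (f j - g j) *\<^sub>R j) = lift_slice f z - lift_slice g z"
        by (simp add: scaleR_diff_left sum_subtractf)
      also have "(norm (lift_slice f z - lift_slice g z))\<^sup>2 \<le> (L * z)\<^sup>2"
        using diam[of "lift_slice f z" "lift_slice g z"] fg unfolding lift_slice_inner
        by (intro power_mono) auto
      finally show "(\<Sum>j\<in>Basis - {b}. (f j - g j)\<^sup>2) \<le> (L * z)\<^sup>2" .
    qed (use L True in auto)
    also have "\<dots> = ennreal (?w * (L / 2) ^ ?d) * (ennreal (z ^ ?d) * indicator {0..1} z)"
      using True L unfolding card_hyper by (simp add: ennreal_mult'[symmetric] power_mult_distrib power_divide)
    finally show ?thesis .
  next
    case False
    then have "{f \<in> space hyper. lift_slice f z \<in> E} = {}"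
      using E(2) lift_slice_inner by fastforce
    then show ?thesis by (simp only: emeasure_empty zero_le)
  qed
  have "emeasure lborel E \<le> (\<integral>\<^sup>+z. ennreal (?w * (L / 2) ^ ?d) * (ennreal (z ^ ?d) * indicator {0..1} z) \<partial>lborel)"
    unfolding emeasure_lborel_slices[OF E(1)] by (intro nn_integral_mono slice)
  also have "\<dots> = ennreal (?w * (L / 2) ^ ?d) * ennreal (1 / real (?d + 1))"
    by (subst nn_integral_cmult) (auto simp: nn_integral_power_Icc[of 1 ?d, simplified])
  finally have "ennreal (real DIM('a)) * emeasure lborel E \<le> ennreal (real DIM('a)) * (ennreal (?w * (L / 2) ^ ?d) * ennreal (1 / real (?d + 1)))"
    by (rule mult_left_mono) simp
  also have "\<dots> = ennreal (?w * (L / 2) ^ ?d)"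
    using L by (simp add: ennreal_mult'[symmetric])
  finally show ?thesis .
qed

text \<open>
  Every slice of a round cone is a ball, so its volume is known exactly.
\<close>

lemma emeasure_cone_ge:
  assumes c: "0 < c" and k: "0 < \<kappa>"
  shows "ennreal (unit_ball_vol (real (DIM('a) - 1)) * \<kappa> ^ (DIM('a) - 1) * c ^ DIM('a))
    \<le> ennreal (real DIM('a)) * emeasure lborel {x. 0 < x \<bullet> b \<and> x \<bullet> b < c \<and> norm (x - (x \<bullet> b) *\<^sub>R b) \<le> \<kappa> * (x \<bullet> b)}"
    (is "_ \<le> _ * emeasure lborel ?E")
proof -
  let ?d = "DIM('a) - 1" and ?w = "unit_ball_vol (real (DIM('a) - 1))"
  have E: "?E \<in> sets borel" by measurable
  have slice: "emeasure hyper {f \<in> space hyper. lift_slice f z \<in> ?E} \<ge> ennreal (?w * \<kappa> ^ ?d) * (ennreal (z ^ ?d) * indicator {0<..<c} z)" for z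
  proof (cases "0 < z \<and> z < c")
    case True
    have "ennreal (?w * \<kappa> ^ ?d) * (ennreal (z ^ ?d) * indicator {0<..<c} z) = ennreal (unit_ball_vol (real (card (Basis - {b}))) * (\<kappa> * z) ^ card (Basis - {b}))"
      using True k unfolding card_hyper by (simp add: ennreal_mult'[symmetric] power_mult_distrib mult.assoc)
    also have "\<dots> = emeasure hyper ({f. sqrt (\<Sum>i\<in>Basis - {b}. (f i)\<^sup>2) \<le> \<kappa> * z} \<inter> space hyper)"
      by (rule emeasure_cball_aux[symmetric]) (use True k in auto)
    also have "{f. sqrt (\<Sum>i\<in>Basis - {b}. (f i)\<^sup>2) \<le> \<kappa> * z} \<inter> space hyper = {f \<in> space hyper. lift_slice f z \<in> ?E}"
    proof -
      have "norm (\<Sum>j\<in>Basis - {b}. f j *\<^sub>R j) = sqrt (\<Sum>i\<in>Basis - {b}. (f i)\<^sup>2)" for f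
        by (rule real_sqrt_unique[symmetric, OF norm_sum_subset_Basis norm_ge_zero]) auto
      then show ?thesis using True by (auto simp: lift_slice_inner)
    qed
    finally show ?thesis by simp
  qed auto
  have "ennreal (?w * \<kappa> ^ ?d * c ^ DIM('a)) = ennreal (real DIM('a)) * (ennreal (?w * \<kappa> ^ ?d) * ennreal (c ^ (?d + 1) / real (?d + 1)))"
    using c k by (simp add: ennreal_mult'[symmetric])
  also have "ennreal (?w * \<kappa> ^ ?d) * ennreal (c ^ (?d + 1) / real (?d + 1)) = (\<integral>\<^sup>+z. ennreal (?w * \<kappa> ^ ?d) * (ennreal (z ^ ?d) * indicator {0..c} z) \<partial>lborel)"
    using c by (subst nn_integral_cmult) (auto simp: nn_integral_power_Icc[of c ?d, simplified])
  also have "\<dots> = (\<integral>\<^sup>+z. ennreal (?w * \<kappa> ^ ?d) * (ennreal (z ^ ?d) * indicator {0<..<c} z) \<partial>lborel)"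
  proof (rule nn_integral_cong_AE)
    have "AE z in lborel. z \<noteq> 0 \<and> z \<noteq> c" using AE_lborel_singleton[of 0] AE_lborel_singleton[of c] by eventually_elim simp
    then show "AE z in lborel. ennreal (?w * \<kappa> ^ ?d) * (ennreal (z ^ ?d) * indicator {0..c} z) = ennreal (?w * \<kappa> ^ ?d) * (ennreal (z ^ ?d) * indicator {0<..<c} z)"
      by eventually_elim (auto simp: indicator_def)
  qed
  also have "\<dots> \<le> emeasure lborel ?E"
    unfolding emeasure_lborel_slices[OF E] by (intro nn_integral_mono slice)
  finally show ?thesis by (simp add: mult_left_mono)
qed

end

lemma inner_normalized_eq:
  fixes w b :: "'a::real_inner"
  assumes "norm w = 1" "norm b = 1"
  shows "w \<bullet> b = 1 - (norm (w - b))\<^sup>2 / 2"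
proof -
  have "(norm (w - b))\<^sup>2 = w \<bullet> w + b \<bullet> b - 2 * (w \<bullet> b)"
    by (simp add: power2_norm_eq_inner inner_diff_left inner_diff_right inner_commute)
  moreover have "w \<bullet> w = 1" "b \<bullet> b = 1" using assms by (auto simp: norm_eq_1)
  ultimately show ?thesis by linarith
qed

text \<open>
  Central projection to the tangent plane at \<open>b\<close> is nearly isometric close to \<open>b\<close>, because the
  heights of \<open>w\<close> and \<open>v\<close> differ only to second order: \<open>w - v\<close> is orthogonal to \<open>w + v\<close>, so
  \<open>w \<bullet> b - v \<bullet> b = (w - v) \<bullet> (b - (w + v) / 2)\<close>, and the second factor has norm at most \<open>\<delta>\<close>.
\<close>

lemma central_projection_lipschitz:
  fixes w v b :: "'a::real_inner"
  assumes n: "norm w = 1" "norm v = 1" "norm b = 1"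
    and D: "norm (w - v) \<le> D" and wb: "norm (w - b) \<le> \<delta>" and vb: "norm (v - b) \<le> \<delta>"
    and c: "c = 1 - \<delta>\<^sup>2 / 2" "c > 0" and \<delta>: "0 \<le> \<delta>"
  shows "norm (w /\<^sub>R (w \<bullet> b) - v /\<^sub>R (v \<bullet> b)) \<le> D * (1 / c + \<delta> / c\<^sup>2)"
proof -
  define p q where "p = w \<bullet> b" and "q = v \<bullet> b"
  have D0: "0 \<le> D" using D norm_ge_zero order_trans by blast
  have p: "p \<ge> c"
    using power_mono[OF wb norm_ge_zero, of 2] inner_normalized_eq[OF n(1,3)] by (simp add: p_def c)
  have q: "q \<ge> c"
    using power_mono[OF vb norm_ge_zero, of 2] inner_normalized_eq[OF n(2,3)] by (simp add: q_def c)
  have pq: "p > 0" "q > 0" using p q c by auto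
  have orth: "(w - v) \<bullet> (w + v) = 0"
    using n by (simp add: inner_diff_left inner_add_right inner_commute[of v w] norm_eq_1)
  have "p - q = (w - v) \<bullet> (b - (1/2) *\<^sub>R (w + v))"
    using orth by (simp add: p_def q_def inner_diff_right inner_diff_left[of w v b])
  then have "\<bar>p - q\<bar> \<le> norm (w - v) * norm (b - (1/2) *\<^sub>R (w + v))"
    by (simp add: Cauchy_Schwarz_ineq2)
  also have "norm (b - (1/2) *\<^sub>R (w + v)) \<le> \<delta>"
  proof -
    have "b - (1/2) *\<^sub>R (w + v) = (1/2) *\<^sub>R (b - w) + (1/2) *\<^sub>R (b - v)"
      by (simp add: algebra_simps flip: scaleR_add_left)
    then have "norm (b - (1/2) *\<^sub>R (w + v)) \<le> (1/2) * norm (b - w) + (1/2) * norm (b - v)"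
      by (metis (no_types, lifting) norm_triangle_ineq norm_scaleR abs_of_nonneg zero_le_divide_1_iff zero_le_numeral)
    then show ?thesis using wb vb by (simp add: norm_minus_commute)
  qed
  also have "norm (w - v) * \<delta> \<le> D * \<delta>" using D \<delta> by (rule mult_right_mono)
  finally have pq_le: "\<bar>p - q\<bar> \<le> D * \<delta>" using norm_ge_zero[of "w - v"] by (simp add: mult_left_mono)
  have "w /\<^sub>R p - v /\<^sub>R q = (w - v) /\<^sub>R p + ((q - p) / (p * q)) *\<^sub>R v"
  proof -
    have "(q - p) / (p * q) = inverse p - inverse q" using pq by (simp add: field_simps)
    then show ?thesis unfolding \<open>(q - p) / (p * q) = inverse p - inverse q\<close> by (simp add: scaleR_diff_left scaleR_diff_right)
  qed
  then have "norm (w /\<^sub>R p - v /\<^sub>R q) \<le> norm ((w - v) /\<^sub>R p) + norm (((q - p) / (p * q)) *\<^sub>R v)"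
    by (simp only: norm_triangle_ineq)
  also have "\<dots> = norm (w - v) / p + \<bar>p - q\<bar> / (p * q)"
    using pq n by (simp add: abs_mult abs_minus_commute divide_inverse)
  also have "\<dots> \<le> D / c + D * \<delta> / (c * c)"
    using pq p q c D D0 \<delta> pq_le by (intro add_mono frac_le mult_mono mult_pos_pos) auto
  finally show ?thesis by (simp add: p_def q_def power2_eq_square algebra_simps)
qed

text \<open>
  A Lipschitz constant of central projection from the cap of radius \<open>\<delta>\<close>; it tends to \<open>1\<close> as \<open>\<delta>\<close>
  tends to \<open>0\<close>.
\<close>

definition cap_distortion :: "real \<Rightarrow> real" where
  "cap_distortion \<delta> = 1 / (1 - \<delta>\<^sup>2 / 2) + \<delta> / (1 - \<delta>\<^sup>2 / 2)\<^sup>2"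

text \<open>
  A lower bound for the ratio between the surface measure of a cap of radius \<open>r\<close> and the volume of the
  flat \<open>d\<close>-dimensional ball of radius \<open>r\<close>; it tends to \<open>1\<close> as \<open>r\<close> tends to \<open>0\<close>.
\<close>

definition cap_deficit :: "nat \<Rightarrow> real \<Rightarrow> real" where
  "cap_deficit d r = sqrt (1 - r\<^sup>2 / 4) ^ d * (1 - r\<^sup>2 / 2)"

lemma rotation_to_basis_vector:
  fixes w :: "real^'n"
  assumes w: "norm w = 1"
  obtains b :: "real^'n" and T where "b \<in> Basis" "orthogonal_transformation T" "T b = w"
    "\<And>C. C \<in> sets borel \<Longrightarrow> T -` C \<in> sets borel"
    "\<And>C. C \<in> sets borel \<Longrightarrow> emeasure surface_measure (T -` C) = emeasure surface_measure C"
proof -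
  obtain b :: "real^'n" where b: "b \<in> Basis" using nonempty_Basis by blast
  obtain T where T: "orthogonal_transformation T" "T b = w"
    by (rule orthogonal_transformation_exists[of b w]) (use w b in auto)
  have "continuous_on UNIV T"
    using T(1) by (simp add: linear_continuous_on orthogonal_transformation_linear linear_linear)
  then have Tm: "T \<in> borel \<rightarrow>\<^sub>M borel" by (rule borel_measurable_continuous_onI)
  have s: "T -` C \<in> sets borel" if "C \<in> sets borel" for C
    using measurable_sets[OF Tm that] by simp
  have e: "emeasure surface_measure (T -` C) = emeasure surface_measure C" if C: "C \<in> sets borel" for C
  proof -
    have "emeasure surface_measure (T -` C) = (\<integral>\<^sup>+w. indicator (T -` C) w \<partial>surface_measure)"
      using s[OF C] by simp
    also have "\<dots> = (\<integral>\<^sup>+w. indicator C (T w) \<partial>surface_measure)"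
      by (intro nn_integral_cong) (simp add: indicator_def)
    also have "\<dots> = (\<integral>\<^sup>+w. indicator C w \<partial>surface_measure)"
      by (rule nn_integral_surface_measure_orthogonal[OF T(1)]) (use C in auto)
    finally show ?thesis using C by simp
  qed
  show thesis by (rule that[OF b T s e])
qed

text \<open>
  Rotate a point of \<open>C\<close> to a basis vector \<open>b\<close>.  The slice at height \<open>z\<close> of the cone over \<open>C\<close> is contained in
  \<open>z\<close> times the central projection of \<open>C\<close>, whose diameter is at most \<open>D\<close> times the distortion.
\<close>

lemma surface_measure_le_diameter:
  fixes C :: "(real^'n) set"
  assumes C: "C \<in> sets borel" "C \<subseteq> sphere 0 1"
    and D: "\<And>w v. w \<in> C \<Longrightarrow> v \<in> C \<Longrightarrow> norm (w - v) \<le> D" and \<delta>: "D \<le> \<delta>" "\<delta> \<le> 1"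
  shows "emeasure surface_measure C \<le> ennreal (unit_ball_vol (real (CARD('n) - 1)) * (D * cap_distortion \<delta> / 2) ^ (CARD('n) - 1))"
proof (cases "C = {}")
  case False
  then obtain w0 where w0: "w0 \<in> C" by auto
  have D0: "0 \<le> D" using D[OF w0 w0] by simp
  have n0: "norm w0 = 1" using w0 C by auto
  obtain b :: "real^'n" and T where b: "b \<in> Basis" and T: "orthogonal_transformation T" "T b = w0"
    and s: "\<And>C. C \<in> sets borel \<Longrightarrow> T -` C \<in> sets borel"
    and e: "\<And>C. C \<in> sets borel \<Longrightarrow> emeasure surface_measure (T -` C) = emeasure surface_measure C"
    by (rule rotation_to_basis_vector[OF n0]) auto
  define K where "K = T -` C"
  have K: "K \<in> sets borel" using s[OF C(1)] by (simp add: K_def)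
  have lin: "linear T" using T(1) by (rule orthogonal_transformation_linear)
  have bK: "b \<in> K" using T w0 by (simp add: K_def)
  have nK: "norm w = 1" if "w \<in> K" for w
    using that C(2) orthogonal_transformation_norm[OF T(1), of w] by (auto simp: K_def)
  have DK: "norm (w - v) \<le> D" if "w \<in> K" "v \<in> K" for w v
    using D[of "T w" "T v"] that orthogonal_transformation_norm[OF T(1), of "w - v"] linear_diff[OF lin, of w v]
    by (simp add: K_def)
  define c where "c = 1 - \<delta>\<^sup>2 / 2"
  have d0: "0 \<le> \<delta>" using D0 \<delta> by simp
  have "\<delta>\<^sup>2 \<le> 1" using d0 \<delta> by (simp add: power_le_one)
  then have c: "c > 0" by (simp add: c_def)
  have Kb: "w \<bullet> b > 0 \<and> w \<bullet> b \<le> 1" if "w \<in> K" for w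
  proof -
    have "(norm (w - b))\<^sup>2 \<le> \<delta>\<^sup>2" using DK[OF that bK] \<delta> by (intro power_mono) auto
    then show ?thesis using inner_normalized_eq[OF nK[OF that] norm_Basis[OF b]] c by (simp add: c_def)
  qed
  define E where "E = {x \<in> ball 0 1. x /\<^sub>R norm x \<in> K}"
  have "emeasure surface_measure C = emeasure surface_measure K" using e[OF C(1)] by (simp add: K_def)
  also have "\<dots> = ennreal (real DIM(real^'n)) * emeasure lborel E"
    using K by (simp add: emeasure_surface_measure E_def)
  also have "\<dots> \<le> ennreal (unit_ball_vol (real (DIM(real^'n) - 1)) * ((D * cap_distortion \<delta>) / 2) ^ (DIM(real^'n) - 1))"
  proof (rule emeasure_cone_le[OF b])
    show "E \<in> sets borel" unfolding E_def using K by measurable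
    have ex: "x \<noteq> 0 \<and> norm x < 1 \<and> x \<bullet> b = norm x * ((x /\<^sub>R norm x) \<bullet> b)" if "x \<in> E" for x
    proof -
      have x: "x /\<^sub>R norm x \<in> K" "norm x < 1" using that by (auto simp: E_def)
      have "x \<noteq> 0" using nK[OF x(1)] by auto
      then show ?thesis using x by simp
    qed
    show pos: "0 < x \<bullet> b \<and> x \<bullet> b < 1" if x: "x \<in> E" for x
    proof -
      let ?w = "x /\<^sub>R norm x"
      have w: "?w \<in> K" using x by (simp add: E_def)
      have "0 < norm x * (?w \<bullet> b)" using ex[OF x] Kb[OF w] by (intro mult_pos_pos) auto
      moreover have "norm x * (?w \<bullet> b) < 1"
      proof -
        have "norm x * (?w \<bullet> b) \<le> norm x * 1" using Kb[OF w] by (intro mult_left_mono) auto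
        then show ?thesis using ex[OF x] by linarith
      qed
      ultimately show ?thesis using ex[OF x] by metis
    qed
    show "0 \<le> D * cap_distortion \<delta>"
      using D0 d0 c unfolding cap_distortion_def c_def by (intro mult_nonneg_nonneg add_nonneg_nonneg divide_nonneg_nonneg) auto
    fix x y assume xy: "x \<in> E" "y \<in> E" "x \<bullet> b = y \<bullet> b"
    let ?w = "x /\<^sub>R norm x" and ?v = "y /\<^sub>R norm y"
    have wv: "?w \<in> K" "?v \<in> K" using xy by (auto simp: E_def)
    have cancel: "(n * a) * inverse a = n" if "a > 0" for a n :: real using that by simp
    have eq: "z = (z \<bullet> b) *\<^sub>R ((z /\<^sub>R norm z) /\<^sub>R ((z /\<^sub>R norm z) \<bullet> b))" if "z \<in> E" for z
    proof -
      let ?u = "z /\<^sub>R norm z"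
      have u: "?u \<bullet> b > 0" using that Kb[of ?u] by (simp add: E_def)
      have "(z \<bullet> b) *\<^sub>R (?u /\<^sub>R (?u \<bullet> b)) = ((z \<bullet> b) * inverse (?u \<bullet> b)) *\<^sub>R ?u"
        by (rule scaleR_scaleR)
      also have "(z \<bullet> b) * inverse (?u \<bullet> b) = norm z"
        by (subst ex[OF that, THEN conjunct2, THEN conjunct2]) (rule cancel[OF u])
      also have "norm z *\<^sub>R ?u = z" using ex[OF that] by simp
      finally show ?thesis ..
    qed
    have zpos: "0 < x \<bullet> b" using pos[OF xy(1)] by simp
    have "x - y = (x \<bullet> b) *\<^sub>R (?w /\<^sub>R (?w \<bullet> b) - ?v /\<^sub>R (?v \<bullet> b))"
      using eq[OF xy(1)] eq[OF xy(2)] xy(3) by (metis scaleR_diff_right)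
    then have "norm (x - y) = (x \<bullet> b) * norm (?w /\<^sub>R (?w \<bullet> b) - ?v /\<^sub>R (?v \<bullet> b))"
      using zpos by (metis abs_of_pos norm_scaleR)
    also have "\<dots> \<le> (x \<bullet> b) * (D * (1 / c + \<delta> / c\<^sup>2))"
    proof (intro mult_left_mono central_projection_lipschitz[OF _ _ _ _ _ _ c_def c d0])
      show "norm ?w = 1" "norm ?v = 1" "norm b = 1" using nK[OF wv(1)] nK[OF wv(2)] b by simp_all
      show "norm (?w - ?v) \<le> D" "norm (?w - b) \<le> \<delta>" "norm (?v - b) \<le> \<delta>"
        using DK[OF wv] DK[OF wv(1) bK] DK[OF wv(2) bK] \<delta> by auto
    qed (use zpos in auto)
    finally show "norm (x - y) \<le> D * cap_distortion \<delta> * (x \<bullet> b)"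
      by (simp add: cap_distortion_def c_def mult.commute)
  qed
  finally show ?thesis by simp
qed simp

text \<open>
  The rim of the cap lies at height \<open>c = 1 - r\<^sup>2 / 2\<close>, and \<open>sqrt (1 - c\<^sup>2)\<close> is the radius of the flat disc
  that it bounds.  The round cone over this disc lies inside the part of the unit ball over the cap.
\<close>

lemma surface_measure_cap_ge:
  fixes x :: "real^'n"
  assumes x: "norm x = 1" and r: "0 < r" "r \<le> 1"
  shows "ennreal (unit_ball_vol (real (CARD('n) - 1)) * r ^ (CARD('n) - 1) * cap_deficit (CARD('n) - 1) r) \<le> emeasure surface_measure (cball x r)"
proof -
  let ?d = "CARD('n) - 1"
  obtain b :: "real^'n" and T where b: "b \<in> Basis" and T: "orthogonal_transformation T" "T b = x"
    and s: "\<And>C. C \<in> sets borel \<Longrightarrow> T -` C \<in> sets borel"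
    and e: "\<And>C. C \<in> sets borel \<Longrightarrow> emeasure surface_measure (T -` C) = emeasure surface_measure C"
    by (rule rotation_to_basis_vector[OF x]) auto
  have lin: "linear T" using T(1) by (rule orthogonal_transformation_linear)
  have pre: "T -` cball x r = cball b r"
    using orthogonal_transformation_norm[OF T(1)] linear_diff[OF lin] T(2)
    by (auto simp: dist_norm) (metis+)
  define c where "c = 1 - r\<^sup>2 / 2"
  define \<kappa> where "\<kappa> = sqrt (1 - c\<^sup>2) / c"
  have r2: "r\<^sup>2 \<le> 1" "0 < r\<^sup>2" using r by (auto simp: power_le_one)
  have c: "0 < c" "c < 1" using r2 by (auto simp: c_def)
  have c2: "c\<^sup>2 < 1" using c by (simp add: power2_less_1_iff)
  have k: "0 < \<kappa>" using c c2 by (simp add: \<kappa>_def)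
  have "1 - c\<^sup>2 = r\<^sup>2 * (1 - r\<^sup>2 / 4)" by (simp add: c_def power2_eq_square algebra_simps)
  then have sq: "sqrt (1 - c\<^sup>2) = r * sqrt (1 - r\<^sup>2 / 4)"
    using r by (simp add: real_sqrt_mult)
  have "\<kappa> ^ ?d * c ^ CARD('n) = (\<kappa> * c) ^ ?d * c"
  proof -
    have "c ^ CARD('n) = c ^ ?d * c" by (rule power_minus_mult[symmetric]) simp
    then show ?thesis by (simp add: power_mult_distrib)
  qed
  also have "\<kappa> * c = r * sqrt (1 - r\<^sup>2 / 4)" using c sq by (simp add: \<kappa>_def)
  finally have val: "\<kappa> ^ ?d * c ^ CARD('n) = r ^ ?d * cap_deficit ?d r"
    by (simp add: cap_deficit_def c_def power_mult_distrib mult.assoc)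
  have "ennreal (unit_ball_vol (real ?d) * r ^ ?d * cap_deficit ?d r) = ennreal (unit_ball_vol (real (DIM(real^'n) - 1)) * \<kappa> ^ (DIM(real^'n) - 1) * c ^ DIM(real^'n))"
    using val by (simp add: mult.assoc)
  also have "\<dots> \<le> ennreal (real DIM(real^'n)) * emeasure lborel {x. 0 < x \<bullet> b \<and> x \<bullet> b < c \<and> norm (x - (x \<bullet> b) *\<^sub>R b) \<le> \<kappa> * (x \<bullet> b)}"
    by (rule emeasure_cone_ge[OF b c(1) k])
  also have "\<dots> \<le> ennreal (real DIM(real^'n)) * emeasure lborel {x \<in> ball 0 1. x /\<^sub>R norm x \<in> cball b r}"
  proof (intro mult_left_mono emeasure_mono subsetI)
    show "{x \<in> ball 0 1. x /\<^sub>R norm x \<in> cball b r} \<in> sets lborel"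
    proof -
      have [measurable]: "cball b r \<in> sets borel" by simp
      show ?thesis by measurable
    qed
    fix y assume "y \<in> {x. 0 < x \<bullet> b \<and> x \<bullet> b < c \<and> norm (x - (x \<bullet> b) *\<^sub>R b) \<le> \<kappa> * (x \<bullet> b)}"
    then have y: "0 < y \<bullet> b" "y \<bullet> b < c" "norm (y - (y \<bullet> b) *\<^sub>R b) \<le> \<kappa> * (y \<bullet> b)" by auto
    define z where "z = y \<bullet> b"
    have bb: "b \<bullet> b = 1" using b by simp
    have "(norm y)\<^sup>2 = (norm (y - z *\<^sub>R b))\<^sup>2 + z\<^sup>2"
      unfolding power2_norm_eq_inner
      by (simp add: inner_diff_left inner_diff_right z_def inner_commute[of b y] bb power2_eq_square)
    also have "\<dots> \<le> (\<kappa> * z)\<^sup>2 + z\<^sup>2"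
      using y by (intro add_right_mono power_mono) (auto simp: z_def)
    also have "\<dots> = (z / c)\<^sup>2"
      using c c2 by (simp add: \<kappa>_def power_mult_distrib power_divide field_simps)
    finally have ny: "norm y \<le> z / c"
      by (rule power2_le_imp_le) (use y c in \<open>simp add: z_def\<close>)
    have n1: "norm y < 1" 
    proof -
      have "z / c < 1" using y(2) c by (simp add: z_def)
      then show ?thesis using ny by linarith
    qed
    have y0: "y \<noteq> 0" using y by auto
    let ?w = "y /\<^sub>R norm y"
    have nw: "norm ?w = 1" using y0 by simp
    have "c \<le> z / norm y" using ny y0 c by (simp add: field_simps)
    then have "c \<le> ?w \<bullet> b" by (simp add: z_def divide_inverse mult.commute)
    then have "(norm (?w - b))\<^sup>2 \<le> r\<^sup>2"
      using inner_normalized_eq[OF nw norm_Basis[OF b]] by (simp add: c_def)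
    then have "norm (?w - b) \<le> r" by (rule power2_le_imp_le) (use r in simp)
    then show "y \<in> {x \<in> ball 0 1. x /\<^sub>R norm x \<in> cball b r}"
      using n1 by (simp add: dist_norm norm_minus_commute)
  qed auto
  also have "\<dots> = emeasure surface_measure (cball b r)"
    by (simp add: emeasure_surface_measure)
  also have "\<dots> = emeasure surface_measure (cball x r)"
    using e[of "cball x r"] pre by simp
  finally show ?thesis .
qed

text \<open>
  The closure is taken because the sets of a covering need not be measurable; it has the same diameter.
\<close>

lemma surface_measure_le_gauge:
  fixes C :: "(real^'n) set"
  assumes C: "bounded C" "diameter C \<le> \<delta>" and \<delta>: "\<delta> \<le> 1"
  shows "emeasure surface_measure (closure C) \<le> ennreal (cap_distortion \<delta> ^ (CARD('n) - 1)) * hausdorff_gauge (CARD('n) - 1) C"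
proof (cases "C = {}")
  case False
  let ?d = "CARD('n) - 1"
  have d0: "0 \<le> diameter C" using C(1) by (rule diameter_ge_0)
  have "emeasure surface_measure (closure C) = emeasure surface_measure (closure C \<inter> sphere 0 1)"
    by (simp add: emeasure_surface_measure_Int)
  also have "\<dots> \<le> ennreal (unit_ball_vol (real ?d) * (diameter C * cap_distortion \<delta> / 2) ^ ?d)"
  proof (rule surface_measure_le_diameter)
    fix w v assume "w \<in> closure C \<inter> sphere 0 1" "v \<in> closure C \<inter> sphere 0 1"
    then show "norm (w - v) \<le> diameter C"
      using diameter_bounded_bound[of "closure C" w v] C(1) by (simp add: diameter_closure dist_norm bounded_closure)
  qed (use C \<delta> in auto)
  also have "\<dots> = ennreal (cap_distortion \<delta> ^ ?d) * hausdorff_gauge ?d C"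
  proof -
    have l: "0 \<le> cap_distortion \<delta>"
    proof -
      have "0 \<le> \<delta>" using d0 C by simp
      moreover from this have "\<delta>\<^sup>2 \<le> 1" using \<delta> by (simp add: power_le_one)
      ultimately show ?thesis unfolding cap_distortion_def by (intro add_nonneg_nonneg divide_nonneg_nonneg) auto
    qed
    have "unit_ball_vol (real ?d) * (diameter C * cap_distortion \<delta> / 2) ^ ?d = cap_distortion \<delta> ^ ?d * (unit_ball_vol (real ?d) * (diameter C / 2) ^ ?d)"
      by (simp add: power_mult_distrib power_divide)
    moreover have "hausdorff_gauge ?d C = ennreal (unit_ball_vol (real ?d) * (diameter C / 2) ^ ?d)"
      using False by (simp add: hausdorff_gauge_def)
    ultimately show ?thesis using ennreal_mult'[of "cap_distortion \<delta> ^ ?d"] l by (simp only: zero_le_power)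
  qed
  finally show ?thesis .
qed simp

text \<open>
  Sum the preceding bound over a covering by sets of diameter at most \<open>\<delta>\<close>, and let \<open>\<delta>\<close> tend to \<open>0\<close>.
\<close>

lemma surface_measure_le_hausdorff_outer:
  fixes A :: "(real^'n) set"
  assumes A: "A \<in> sets borel"
  shows "emeasure surface_measure A \<le> hausdorff_outer (CARD('n) - 1) A"
proof -
  let ?d = "CARD('n) - 1"
  have le: "ennreal (1 / cap_distortion \<delta> ^ ?d) * emeasure surface_measure A \<le> hausdorff_outer ?d A" if \<delta>: "0 < \<delta>" "\<delta> \<le> 1" for \<delta>
  proof -
    have "\<delta>\<^sup>2 \<le> 1" using \<delta> by (simp add: power_le_one)
    then have l: "0 < cap_distortion \<delta>" using \<delta> unfolding cap_distortion_def by (intro add_pos_nonneg) auto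
    have "ennreal (1 / cap_distortion \<delta> ^ ?d) * emeasure surface_measure A \<le> hausdorff_pre ?d \<delta> A"
      unfolding hausdorff_pre_def
    proof (rule INF_greatest)
      fix C :: "nat \<Rightarrow> (real^'n) set" assume "C \<in> {C. A \<subseteq> (\<Union>i. C i) \<and> (\<forall>i. bounded (C i) \<and> diameter (C i) \<le> \<delta>)}"
      then have C: "A \<subseteq> (\<Union>i. C i)" "\<And>i. bounded (C i)" "\<And>i. diameter (C i) \<le> \<delta>" by auto
      have "emeasure surface_measure A \<le> emeasure surface_measure (\<Union>i. closure (C i))"
        by (intro emeasure_mono order_trans[OF C(1)] UN_mono order_refl closure_subset) auto
      also have "\<dots> \<le> (\<Sum>i. emeasure surface_measure (closure (C i)))"
        by (rule emeasure_subadditive_countably) auto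
      also have "\<dots> \<le> (\<Sum>i. ennreal (cap_distortion \<delta> ^ ?d) * hausdorff_gauge ?d (C i))"
        by (intro suminf_le summableI surface_measure_le_gauge C \<delta>)
      also have "\<dots> = ennreal (cap_distortion \<delta> ^ ?d) * (\<Sum>i. hausdorff_gauge ?d (C i))"
        by simp
      finally have "ennreal (1 / cap_distortion \<delta> ^ ?d) * emeasure surface_measure A \<le> ennreal (1 / cap_distortion \<delta> ^ ?d) * (ennreal (cap_distortion \<delta> ^ ?d) * (\<Sum>i. hausdorff_gauge ?d (C i)))"
        by (rule mult_left_mono) simp
      also have "\<dots> = (\<Sum>i. hausdorff_gauge ?d (C i))"
        using l by (simp add: mult.assoc[symmetric] ennreal_mult'[symmetric])
      finally show "ennreal (1 / cap_distortion \<delta> ^ ?d) * emeasure surface_measure A \<le> (\<Sum>i. hausdorff_gauge ?d (C i))" .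
    qed
    also have "\<dots> \<le> hausdorff_outer ?d A" using \<delta> by (intro hausdorff_outer_ge)
    finally show ?thesis .
  qed
  have "(\<lambda>m. inverse (real (Suc m))) \<longlonglongrightarrow> 0" by (rule LIMSEQ_inverse_real_of_nat)
  then have "(\<lambda>m. 1 / cap_distortion (inverse (real (Suc m))) ^ ?d) \<longlonglongrightarrow> 1 / (1 / (1 - 0\<^sup>2 / 2) + 0 / (1 - 0\<^sup>2 / 2)\<^sup>2) ^ ?d"
    unfolding cap_distortion_def by (intro tendsto_intros) auto
  then have "(\<lambda>m. 1 / cap_distortion (inverse (real (Suc m))) ^ ?d) \<longlonglongrightarrow> 1" by simp
  then have "(\<lambda>m. ennreal (1 / cap_distortion (inverse (real (Suc m))) ^ ?d) * emeasure surface_measure A) \<longlonglongrightarrow> ennreal 1 * emeasure surface_measure A"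
    by (intro tendsto_mult_ennreal tendsto_ennrealI tendsto_const) auto
  moreover have "ennreal (1 / cap_distortion (inverse (real (Suc m))) ^ ?d) * emeasure surface_measure A \<le> hausdorff_outer ?d A" for m
    by (rule le) (auto simp: inverse_le_1_iff)
  ultimately show ?thesis using LIMSEQ_le_const2 by fastforce
qed

lemma hausdorff_gauge_cball:
  fixes x :: "'a::euclidean_space"
  assumes "0 < r" shows "hausdorff_gauge d (cball x r) = ennreal (unit_ball_vol (real d) * r ^ d)"
  using assms by (simp add: hausdorff_gauge_def)

lemma cap_deficit_bounds:
  assumes "0 < r" "r \<le> \<delta>" "\<delta> \<le> 1"
  shows "0 < cap_deficit d \<delta>" "cap_deficit d \<delta> \<le> cap_deficit d r" "cap_deficit d r \<le> 1"
proof -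
  have r2: "0 < r\<^sup>2" "r\<^sup>2 \<le> \<delta>\<^sup>2" "\<delta>\<^sup>2 \<le> 1" using assms by (auto intro: power_mono simp: power_le_one)
  show "0 < cap_deficit d \<delta>" using r2 by (simp add: cap_deficit_def)
  show "cap_deficit d \<delta> \<le> cap_deficit d r"
    unfolding cap_deficit_def using r2 by (intro mult_mono power_mono) auto
  show "cap_deficit d r \<le> 1"
    unfolding cap_deficit_def using r2 by (intro mult_le_one power_le_one) auto
qed

lemma gauge_cball_le_surface_measure:
  fixes x :: "real^'n"
  assumes x: "norm x = 1" and r: "0 < r" "r \<le> \<delta>" "\<delta> \<le> 1"
  shows "hausdorff_gauge (CARD('n) - 1) (cball x r) \<le> ennreal (1 / cap_deficit (CARD('n) - 1) \<delta>) * emeasure surface_measure (cball x r)"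
proof -
  let ?d = "CARD('n) - 1"
  note b = cap_deficit_bounds[OF r, of ?d]
  have "hausdorff_gauge ?d (cball x r) = ennreal (1 / cap_deficit ?d \<delta>) * ennreal (unit_ball_vol (real ?d) * r ^ ?d * cap_deficit ?d \<delta>)"
    using b r by (simp add: hausdorff_gauge_cball ennreal_mult'[symmetric])
  also have "\<dots> \<le> ennreal (1 / cap_deficit ?d \<delta>) * ennreal (unit_ball_vol (real ?d) * r ^ ?d * cap_deficit ?d r)"
    using b r by (intro mult_left_mono ennreal_leI) auto
  also have "\<dots> \<le> ennreal (1 / cap_deficit ?d \<delta>) * emeasure surface_measure (cball x r)"
    by (rule mult_left_mono[OF surface_measure_cap_ge]) (use x r in auto)
  finally show ?thesis .
qed

text \<open>
  Vitali's covering lemma for balls centred on \<open>U \<inter> sphere 0 1\<close>: disjoint balls inside \<open>U\<close>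
  whose fivefold enlargements cover.  The family may be finite, so it is indexed by all naturals and
  padded with empty sets.
\<close>

lemma vitali_sphere_sequence:
  fixes U :: "(real^'n) set"
  assumes U: "open U" and \<delta>: "0 < \<delta>" "\<delta> \<le> 1/10"
  defines "d \<equiv> CARD('n) - 1"
  obtains B B5 :: "nat \<Rightarrow> (real^'n) set" where
    "disjoint_family B" "\<And>i. closed (B i)" "\<And>i. B i \<subseteq> U" "U \<inter> sphere 0 1 \<subseteq> (\<Union>i. B5 i)"
    "\<And>i. bounded (B i)" "\<And>i. bounded (B5 i)" "\<And>i. diameter (B i) \<le> 10 * \<delta>" "\<And>i. diameter (B5 i) \<le> 10 * \<delta>"
    "\<And>i. closed (B5 i)"
    "\<And>i. hausdorff_gauge d (B i) \<le> ennreal (1 / cap_deficit d \<delta>) * emeasure surface_measure (B i)"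
    "\<And>i. hausdorff_gauge d (B5 i) \<le> ennreal (5 ^ d / cap_deficit d \<delta>) * emeasure surface_measure (B i)"
proof -
  define K where "K = {(x, r). x \<in> U \<inter> sphere 0 1 \<and> 0 < r \<and> r \<le> \<delta> \<and> cball x r \<subseteq> U}"
  have cov: "U \<inter> sphere 0 1 \<subseteq> (\<Union>p\<in>K. cball (fst p) (snd p))"
  proof
    fix x assume x: "x \<in> U \<inter> sphere 0 1"
    then obtain e where e: "e > 0" "cball x e \<subseteq> U" using U open_contains_cball by blast
    have "(x, min e \<delta>) \<in> K" using x e \<delta> by (auto simp: K_def)
    moreover have "x \<in> cball x (min e \<delta>)" using e \<delta> by simp
    ultimately show "x \<in> (\<Union>p\<in>K. cball (fst p) (snd p))" by force
  qed
  have Kr: "0 < snd p \<and> snd p \<le> \<delta>" if "p \<in> K" for p using that by (auto simp: K_def)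
  obtain C where C: "countable C" "C \<subseteq> K"
     "pairwise (\<lambda>i j. disjnt (cball (fst i) (snd i)) (cball (fst j) (snd j))) C"
     "U \<inter> sphere 0 1 \<subseteq> (\<Union>i\<in>C. cball (fst i) (5 * snd i))"
    by (rule Vitali_covering_lemma_cballs[OF cov Kr]) auto
  define P where "P i = (i \<in> to_nat_on C ` C)" for i
  define c where "c i = from_nat_into C i" for i
  have cC: "c i \<in> C" if "P i" for i
    using that C(1) by (auto simp: P_def c_def)
  have c_inj: "c i = c j \<Longrightarrow> i = j" if "P i" "P j" for i j
    using that C(1) by (auto simp: P_def c_def)
  have c_surj: "\<exists>i. P i \<and> c i = p" if "p \<in> C" for p
    using that C(1) by (intro exI[of _ "to_nat_on C p"]) (auto simp: P_def c_def)
  define B where "B i = (if P i then cball (fst (c i)) (snd (c i)) else {})" for i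
  define B5 where "B5 i = (if P i then cball (fst (c i)) (5 * snd (c i)) else {})" for i
  have cK: "norm (fst (c i)) = 1" "0 < snd (c i)" "snd (c i) \<le> \<delta>" "cball (fst (c i)) (snd (c i)) \<subseteq> U" if "P i" for i
    using subsetD[OF C(2) cC[OF that]] by (auto simp: K_def)
  show thesis
  proof (rule that[of B B5])
    show "disjoint_family B"
      unfolding disjoint_family_on_def
    proof (intro ballI impI)
      fix i j :: nat assume "i \<noteq> j"
      show "B i \<inter> B j = {}"
      proof (cases "P i \<and> P j")
        case True
        then have "c i \<noteq> c j" using c_inj \<open>i \<noteq> j\<close> by blast
        then have "disjnt (cball (fst (c i)) (snd (c i))) (cball (fst (c j)) (snd (c j)))"
          using C(3) cC True by (simp add: pairwise_def)
        then show ?thesis using True by (simp add: B_def disjnt_def)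
      qed (auto simp: B_def)
    qed
    show "U \<inter> sphere 0 1 \<subseteq> (\<Union>i. B5 i)"
    proof
      fix x assume "x \<in> U \<inter> sphere 0 1"
      then obtain p where p: "p \<in> C" "x \<in> cball (fst p) (5 * snd p)" using C(4) by blast
      then obtain i where "P i" "c i = p" using c_surj by blast
      then have "x \<in> B5 i" using p by (simp add: B5_def)
      then show "x \<in> (\<Union>i. B5 i)" by blast
    qed
    fix i
    show "closed (B i)" "closed (B5 i)" "bounded (B i)" "bounded (B5 i)" by (auto simp: B_def B5_def)
    show "B i \<subseteq> U" using cK(4) by (auto simp: B_def)
    show "diameter (B i) \<le> 10 * \<delta>" "diameter (B5 i) \<le> 10 * \<delta>"
      using cK(2,3)[of i] \<delta> by (auto simp: B_def B5_def)
    show g: "hausdorff_gauge d (B i) \<le> ennreal (1 / cap_deficit d \<delta>) * emeasure surface_measure (B i)"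
      using gauge_cball_le_surface_measure[OF cK(1-3)] \<delta> by (auto simp: B_def d_def)
    have dp: "0 < cap_deficit d \<delta>" using cap_deficit_bounds(1)[of \<delta> \<delta> d] \<delta> by simp
    have "hausdorff_gauge d (B5 i) = ennreal (5 ^ d) * hausdorff_gauge d (B i)"
      using cK(2)[of i] by (auto simp: B_def B5_def hausdorff_gauge_cball power_mult_distrib ennreal_mult'[symmetric] ac_simps)
    also have "\<dots> \<le> ennreal (5 ^ d) * (ennreal (1 / cap_deficit d \<delta>) * emeasure surface_measure (B i))"
      by (rule mult_left_mono[OF g]) simp
    also have "\<dots> = ennreal (5 ^ d / cap_deficit d \<delta>) * emeasure surface_measure (B i)"
      using dp by (simp add: mult.assoc[symmetric] ennreal_mult'[symmetric])
    finally show "hausdorff_gauge d (B5 i) \<le> ennreal (5 ^ d / cap_deficit d \<delta>) * emeasure surface_measure (B i)" .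
  qed
qed

section \<open>Hausdorff measure of subsets of the sphere\<close>

lemma hausdorff_pre_finite_union:
  fixes B :: "nat \<Rightarrow> 'a::metric_space set"
  assumes "\<And>i. i < N \<Longrightarrow> bounded (B i)" "\<And>i. i < N \<Longrightarrow> diameter (B i) \<le> \<eta>" "\<eta> > 0"
  shows "hausdorff_pre d \<eta> (\<Union>i<N. B i) \<le> (\<Sum>i<N. hausdorff_gauge d (B i))"
proof -
  let ?C = "\<lambda>i::nat. if i < N then B i else {}"
  have "hausdorff_pre d \<eta> (\<Union>i<N. B i) \<le> (\<Sum>i. hausdorff_gauge d (?C i))"
    by (rule hausdorff_pre_le) (use assms in \<open>auto split: if_splits\<close>)
  also have "\<dots> = (\<Sum>i<N. hausdorff_gauge d (?C i))"
    by (rule suminf_finite) auto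
  also have "\<dots> = (\<Sum>i<N. hausdorff_gauge d (B i))" by (rule sum.cong) auto
  finally show ?thesis .
qed

text \<open>
  Covering by the enlarged balls costs a factor \<open>5\<^sup>d\<close> too much, but gives a constant to start from.
\<close>

lemma hausdorff_pre_crude:
  fixes U :: "(real^'n) set"
  assumes U: "open U" and \<delta>: "0 < \<delta>" "\<delta> \<le> 1/10"
  defines "d \<equiv> CARD('n) - 1"
  shows "hausdorff_pre d (10 * \<delta>) (U \<inter> sphere 0 1) \<le> ennreal (5 ^ d / cap_deficit d \<delta>) * emeasure surface_measure U"
proof -
  obtain B B5 :: "nat \<Rightarrow> (real^'n) set" where B:
    "disjoint_family B" "\<And>i. closed (B i)" "\<And>i. B i \<subseteq> U" "U \<inter> sphere 0 1 \<subseteq> (\<Union>i. B5 i)"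
    "\<And>i. bounded (B5 i)" "\<And>i. diameter (B5 i) \<le> 10 * \<delta>"
    "\<And>i. hausdorff_gauge d (B5 i) \<le> ennreal (5 ^ d / cap_deficit d \<delta>) * emeasure surface_measure (B i)"
  proof (rule vitali_sphere_sequence[OF U \<delta>, folded d_def], goal_cases)
    case (1 B B5)
    show ?case by (rule that[OF 1(2-5,7,9,12)])
  qed
  have "hausdorff_pre d (10 * \<delta>) (U \<inter> sphere 0 1) \<le> (\<Sum>i. hausdorff_gauge d (B5 i))"
    by (rule hausdorff_pre_le[OF B(4-6)])
  also have "\<dots> \<le> (\<Sum>i. ennreal (5 ^ d / cap_deficit d \<delta>) * emeasure surface_measure (B i))"
    by (intro suminf_le summableI B)
  also have "\<dots> = ennreal (5 ^ d / cap_deficit d \<delta>) * emeasure surface_measure (\<Union>i. B i)"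
    using B(1,2) by (simp add: suminf_emeasure image_subset_iff)
  also have "\<dots> \<le> ennreal (5 ^ d / cap_deficit d \<delta>) * emeasure surface_measure U"
    using B(3) U by (intro mult_left_mono emeasure_mono) auto
  finally show ?thesis .
qed

text \<open>
  Finitely many of the disjoint balls fill a fixed fraction \<open>\<theta>\<close> of \<open>U\<close>, and these are covered by
  themselves at the optimal price.  In \<open>\<theta>\<close>, the factor \<open>30 = 5 \<cdot> 6\<close> comes from the enlargement and from
  the distortion \<open>6\<close> of caps of radius \<open>1\<close>; the factor \<open>2\<close> allows the passage from all balls to
  finitely many, which keeps \<open>V\<close> closed.
\<close>

lemma fill_with_small_balls:
  fixes U :: "(real^'n) set"
  assumes U: "open U" and \<delta>: "0 < \<delta>" "\<delta> \<le> 1/10"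
  defines "d \<equiv> CARD('n) - 1"
  defines "\<theta> \<equiv> cap_deficit d \<delta> / (2 * 30 ^ d)"
  obtains V where "closed V" "V \<subseteq> U" "\<theta> * measure surface_measure U \<le> measure surface_measure V"
    "hausdorff_pre d (10 * \<delta>) V \<le> ennreal (1 / cap_deficit d \<delta> * measure surface_measure V)"
proof -
  obtain B B5 :: "nat \<Rightarrow> (real^'n) set" where B:
    "disjoint_family B" "\<And>i. closed (B i)" "\<And>i. B i \<subseteq> U" "U \<inter> sphere 0 1 \<subseteq> (\<Union>i. B5 i)"
    "\<And>i. bounded (B i)" "\<And>i. bounded (B5 i)" "\<And>i. diameter (B i) \<le> 10 * \<delta>" "\<And>i. diameter (B5 i) \<le> 10 * \<delta>"
    "\<And>i. closed (B5 i)"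
    "\<And>i. hausdorff_gauge d (B i) \<le> ennreal (1 / cap_deficit d \<delta>) * emeasure surface_measure (B i)"
    "\<And>i. hausdorff_gauge d (B5 i) \<le> ennreal (5 ^ d / cap_deficit d \<delta>) * emeasure surface_measure (B i)"
  proof (rule vitali_sphere_sequence[OF U \<delta>, folded d_def], goal_cases)
    case (1 B B5)
    show ?case by (rule that[OF 1(2-)])
  qed
  have mu: "0 < cap_deficit d \<delta>" using cap_deficit_bounds(1)[of \<delta> \<delta> d] \<delta> by simp
  let ?s = "\<lambda>A. measure (surface_measure :: (real^'n) measure) A"
  have th: "0 < \<theta>" using mu by (simp add: \<theta>_def)
  have six: "cap_distortion 1 = 6" by (simp add: cap_distortion_def power2_eq_square)
  have sB: "(\<Sum>i. emeasure surface_measure (B i)) = emeasure surface_measure (\<Union>i. B i)"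
    using B(1,2) by (simp add: suminf_emeasure image_subset_iff)
  have "emeasure surface_measure U = emeasure surface_measure (U \<inter> sphere 0 1)"
    using U by (simp add: emeasure_surface_measure_Int)
  also have "\<dots> \<le> emeasure surface_measure (\<Union>i. B5 i)"
    using B(4,9) by (intro emeasure_mono) auto
  also have "\<dots> \<le> (\<Sum>i. emeasure surface_measure (B5 i))"
    using B(9) by (intro emeasure_subadditive_countably) auto
  also have "\<dots> \<le> (\<Sum>i. ennreal (30 ^ d / cap_deficit d \<delta>) * emeasure surface_measure (B i))"
  proof (intro suminf_le summableI)
    fix i
    have "emeasure surface_measure (B5 i) = emeasure surface_measure (closure (B5 i))" using B(9) by simp
    also have "\<dots> \<le> ennreal (cap_distortion 1 ^ d) * hausdorff_gauge d (B5 i)"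
      unfolding d_def by (rule surface_measure_le_gauge) (use B(6) B(8)[of i] \<delta> in auto)
    also have "\<dots> \<le> ennreal (6 ^ d) * (ennreal (5 ^ d / cap_deficit d \<delta>) * emeasure surface_measure (B i))"
      unfolding six by (intro mult_left_mono B) auto
    also have "\<dots> = ennreal (6 ^ d * (5 ^ d / cap_deficit d \<delta>)) * emeasure surface_measure (B i)"
      by (subst ennreal_mult', simp, rule mult.assoc[symmetric])
    also have "6 ^ d * (5 ^ d / cap_deficit d \<delta>) = 30 ^ d / cap_deficit d \<delta>"
      by (simp add: power_mult_distrib[symmetric])
    finally show "emeasure surface_measure (B5 i) \<le> ennreal (30 ^ d / cap_deficit d \<delta>) * emeasure surface_measure (B i)" .
  qed
  also have "\<dots> = ennreal (30 ^ d / cap_deficit d \<delta>) * emeasure surface_measure (\<Union>i. B i)"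
    by (simp add: sB[symmetric])
  also have "\<dots> = ennreal (30 ^ d / cap_deficit d \<delta> * ?s (\<Union>i. B i))"
    unfolding surface_measure.emeasure_eq_measure by (rule ennreal_mult'[symmetric]) (use mu in simp)
  finally have "ennreal (?s U) \<le> ennreal (30 ^ d / cap_deficit d \<delta> * ?s (\<Union>i. B i))"
    unfolding surface_measure.emeasure_eq_measure .
  then have "?s U \<le> 30 ^ d / cap_deficit d \<delta> * ?s (\<Union>i. B i)"
    by (rule ennreal_le_iff[THEN iffD1, rotated]) (use mu in simp)
  then have big: "2 * \<theta> * ?s U \<le> ?s (\<Union>i. B i)"
    using mu by (simp add: \<theta>_def field_simps)
  define V where "V N = (\<Union>i<N. B i)" for N
  have "(\<lambda>N. ?s (V N)) \<longlonglongrightarrow> ?s (\<Union>N. V N)"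
  proof (rule surface_measure.finite_Lim_measure_incseq)
    show "range V \<subseteq> sets surface_measure" using B(2) by (auto simp: V_def)
    show "incseq V" unfolding V_def incseq_def by (intro allI impI UN_mono) auto
  qed
  also have "(\<Union>N. V N) = (\<Union>i. B i)" by (auto simp: V_def)
  finally have lim: "(\<lambda>N. ?s (V N)) \<longlonglongrightarrow> ?s (\<Union>i. B i)" .
  have "\<exists>N. \<theta> * ?s U \<le> ?s (V N)"
  proof (cases "?s U = 0")
    case False
    then have "\<theta> * ?s U < 2 * \<theta> * ?s U" using th by (simp add: zero_less_measure_iff)
    then have "\<theta> * ?s U < ?s (\<Union>i. B i)" using big by linarith
    then show ?thesis using order_tendstoD(1)[OF lim] eventually_sequentially by (meson less_imp_le order_refl)
  qed auto
  then obtain N where N: "\<theta> * ?s U \<le> ?s (V N)" by auto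
  show thesis
  proof (rule that[of "V N"])
    show "closed (V N)" unfolding V_def using B(2) by auto
    show "V N \<subseteq> U" unfolding V_def using B(3) by auto
    have "hausdorff_pre d (10 * \<delta>) (V N) \<le> (\<Sum>i<N. hausdorff_gauge d (B i))"
      unfolding V_def by (rule hausdorff_pre_finite_union) (use B \<delta> in auto)
    also have "\<dots> \<le> (\<Sum>i<N. ennreal (1 / cap_deficit d \<delta>) * emeasure surface_measure (B i))"
      by (intro sum_mono B)
    also have "\<dots> = ennreal (1 / cap_deficit d \<delta>) * (\<Sum>i<N. emeasure surface_measure (B i))"
      by (simp add: sum_distrib_left)
    also have "(\<Sum>i<N. emeasure surface_measure (B i)) = emeasure surface_measure (V N)"
      unfolding V_def using B(1,2) by (intro sum_emeasure) (auto simp: disjoint_family_on_def)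
    also have "ennreal (1 / cap_deficit d \<delta>) * emeasure surface_measure (V N) = ennreal (1 / cap_deficit d \<delta> * ?s (V N))"
      unfolding surface_measure.emeasure_eq_measure by (rule ennreal_mult'[symmetric]) (use mu in simp)
    finally show "hausdorff_pre d (10 * \<delta>) (V N) \<le> ennreal (1 / cap_deficit d \<delta> * ?s (V N))" .
  qed fact
qed

text \<open>
  Suppose that the estimate holds for all open sets with the constant \<open>a + k\<close>, where
  \<open>a = 1 / cap_deficit d \<delta>\<close>.  Pay \<open>a\<close> on the part \<open>V\<close> of \<open>U\<close> filled by small balls and \<open>a + k\<close> on the
  open set \<open>U - V\<close>: as \<open>V\<close> takes the fraction \<open>\<theta>\<close>, the estimate holds with \<open>a + (1 - \<theta>) k\<close>.  Iterating
  from the crude constant leaves \<open>a\<close>.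
\<close>

lemma hausdorff_pre_sharp:
  fixes U :: "(real^'n) set"
  assumes U: "open U" and \<delta>: "0 < \<delta>" "\<delta> \<le> 1/10"
  defines "d \<equiv> CARD('n) - 1"
  shows "hausdorff_pre d (10 * \<delta>) (U \<inter> sphere 0 1) \<le> ennreal (1 / cap_deficit d \<delta> * measure surface_measure U)"
proof -
  let ?s = "\<lambda>A. measure (surface_measure :: (real^'n) measure) A"
  let ?h = "\<lambda>A :: (real^'n) set. hausdorff_pre d (10 * \<delta>) A"
  define a where "a = 1 / cap_deficit d \<delta>"
  define b where "b = 5 ^ d * a - a"
  define \<theta> where "\<theta> = cap_deficit d \<delta> / (2 * 30 ^ d)"
  have mu: "0 < cap_deficit d \<delta>" "cap_deficit d \<delta> \<le> 1" using cap_deficit_bounds[of \<delta> \<delta> d] \<delta> by auto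
  have a: "a > 0" using mu by (simp add: a_def)
  have b: "b \<ge> 0" using a mult_right_mono[of 1 "5 ^ d" a] by (simp add: b_def)
  have "(1::real) \<le> 30 ^ d" by simp
  then have "cap_deficit d \<delta> < 2 * 30 ^ d" using mu by linarith
  then have th: "0 < \<theta>" "\<theta> < 1" using mu by (auto simp: \<theta>_def)
  have main: "\<forall>U. open U \<longrightarrow> ?h (U \<inter> sphere 0 1) \<le> ennreal ((a + (1 - \<theta>) ^ m * b) * ?s U)" for m
  proof (induction m)
    case 0
    show ?case
    proof (intro allI impI)
      fix U :: "(real^'n) set" assume "open U"
      then have "?h (U \<inter> sphere 0 1) \<le> ennreal (5 ^ d / cap_deficit d \<delta>) * emeasure surface_measure U"
        using hausdorff_pre_crude[OF _ \<delta>, where 'n='n] unfolding d_def by blast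
      also have "\<dots> = ennreal ((a + (1 - \<theta>) ^ 0 * b) * ?s U)"
        unfolding surface_measure.emeasure_eq_measure
        by (subst ennreal_mult'[symmetric]) (use mu in \<open>simp_all add: b_def a_def\<close>)
      finally show "?h (U \<inter> sphere 0 1) \<le> ennreal ((a + (1 - \<theta>) ^ 0 * b) * ?s U)" .
    qed
  next
    case (Suc m)
    define k where "k = (1 - \<theta>) ^ m * b"
    have k: "k \<ge> 0" using th b by (simp add: k_def)
    show ?case
    proof (intro allI impI)
      fix U :: "(real^'n) set" assume U: "open U"
      obtain V where V: "closed V" "V \<subseteq> U" "\<theta> * ?s U \<le> ?s V" "?h V \<le> ennreal (a * ?s V)"
      proof (rule fill_with_small_balls[OF U \<delta>, folded d_def, folded \<theta>_def a_def], goal_cases)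
        case (1 V)
        show ?case by (rule that[OF 1(2-)])
      qed
      have "U \<inter> sphere 0 1 \<subseteq> V \<union> ((U - V) \<inter> sphere 0 1)" by auto
      then have "?h (U \<inter> sphere 0 1) \<le> ?h (V \<union> ((U - V) \<inter> sphere 0 1))" by (rule hausdorff_pre_mono)
      also have "\<dots> \<le> ?h V + ?h ((U - V) \<inter> sphere 0 1)"
        by (rule hausdorff_pre_Un) (use \<delta> in simp)
      also have "\<dots> \<le> ennreal (a * ?s V) + ennreal ((a + k) * ?s (U - V))"
        using Suc.IH U V(1) unfolding k_def by (intro add_mono V(4)) (blast intro: open_Diff)
      also have "\<dots> = ennreal (a * ?s V + (a + k) * ?s (U - V))"
        using a k by (intro ennreal_plus[symmetric]) auto
      also have "\<dots> \<le> ennreal ((a + (1 - \<theta>) ^ Suc m * b) * ?s U)"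
      proof (rule ennreal_leI)
        have "?s (U - V) = ?s U - ?s V"
          using U V by (intro surface_measure.finite_measure_Diff) auto
        then have "a * ?s V + (a + k) * ?s (U - V) = a * ?s V + (a + k) * (?s U - ?s V)" by (rule arg_cong)
        also have "\<dots> = (a + k) * ?s U - k * ?s V" by (simp add: algebra_simps)
        also have "(a + k) * ?s U - k * ?s V \<le> (a + k) * ?s U - k * (\<theta> * ?s U)" using mult_left_mono[OF V(3) k] by linarith
        also have "\<dots> = (a + (1 - \<theta>) ^ Suc m * b) * ?s U" by (simp add: k_def algebra_simps)
        finally show "a * ?s V + (a + k) * ?s (U - V) \<le> (a + (1 - \<theta>) ^ Suc m * b) * ?s U" .
      qed
      finally show "?h (U \<inter> sphere 0 1) \<le> ennreal ((a + (1 - \<theta>) ^ Suc m * b) * ?s U)" .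
    qed
  qed
  have "(\<lambda>m. (1 - \<theta>) ^ m) \<longlonglongrightarrow> 0" using th by (intro LIMSEQ_realpow_zero) auto
  then have "(\<lambda>m. ennreal ((a + (1 - \<theta>) ^ m * b) * ?s U)) \<longlonglongrightarrow> ennreal ((a + 0 * b) * ?s U)"
    by (intro tendsto_ennrealI tendsto_mult tendsto_add tendsto_const)
  then have "?h (U \<inter> sphere 0 1) \<le> ennreal ((a + 0 * b) * ?s U)"
    by (rule LIMSEQ_le_const) (use main U in blast)
  then show ?thesis by (simp add: a_def)
qed

lemma hausdorff_outer_sphere_open:
  fixes U :: "(real^'n) set"
  assumes U: "open U"
  shows "hausdorff_outer (CARD('n) - 1) (U \<inter> sphere 0 1) \<le> emeasure surface_measure U"
proof (rule hausdorff_outer_le)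
  let ?d = "CARD('n) - 1"
  let ?s = "measure (surface_measure :: (real^'n) measure) U"
  fix \<epsilon> :: real assume e: "\<epsilon> > 0"
  \<comment> \<open>Radii that tend to \<open>0\<close> and whose coverings are admissible for \<open>\<epsilon>\<close>.\<close>
  define r where "r m = min \<epsilon> (inverse (real (Suc m))) / 10" for m
  have r: "0 < r m" "r m \<le> 1/10" "10 * r m \<le> \<epsilon>" for m
    using e inverse_le_1_iff[of "real (Suc m)"] by (auto simp: r_def min_le_iff_disj)
  have "r \<longlonglongrightarrow> min \<epsilon> 0 / 10" unfolding r_def by (intro tendsto_intros LIMSEQ_inverse_real_of_nat) auto
  then have r0: "r \<longlonglongrightarrow> 0" using e by simp
  have "(\<lambda>m. ennreal (1 / cap_deficit ?d (r m) * ?s)) \<longlonglongrightarrow> ennreal (1 / (sqrt (1 - 0\<^sup>2 / 4) ^ ?d * (1 - 0\<^sup>2 / 2)) * ?s)"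
    unfolding cap_deficit_def by (intro tendsto_ennrealI tendsto_intros r0) auto
  then have "(\<lambda>m. ennreal (1 / cap_deficit ?d (r m) * ?s)) \<longlonglongrightarrow> ennreal ?s" by simp
  moreover have "hausdorff_pre ?d \<epsilon> (U \<inter> sphere 0 1) \<le> ennreal (1 / cap_deficit ?d (r m) * ?s)" for m
  proof -
    have "hausdorff_pre ?d \<epsilon> (U \<inter> sphere 0 1) \<le> hausdorff_pre ?d (10 * r m) (U \<inter> sphere 0 1)"
      by (rule hausdorff_pre_antimono) (rule r)
    also have "\<dots> \<le> ennreal (1 / cap_deficit ?d (r m) * ?s)" by (rule hausdorff_pre_sharp[OF U r(1,2)])
    finally show ?thesis .
  qed
  ultimately have "hausdorff_pre ?d \<epsilon> (U \<inter> sphere 0 1) \<le> ennreal ?s"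
    by (intro LIMSEQ_le_const) auto
  then show "hausdorff_pre ?d \<epsilon> (U \<inter> sphere 0 1) \<le> emeasure surface_measure U"
    by (simp add: surface_measure.emeasure_eq_measure)
qed

text \<open>
  The upper bound passes from open sets to Borel sets by outer regularity of the cone measure.
\<close>

theorem hausdorff_measure_sphere:
  fixes A :: "(real^'n) set"
  assumes A: "A \<in> sets borel"
  shows "emeasure (hausdorff_measure (CARD('n) - 1)) (A \<inter> sphere 0 1) = emeasure surface_measure A"
proof -
  let ?d = "CARD('n) - 1"
  have AS: "A \<inter> sphere 0 1 \<in> sets borel" using A by auto
  have "hausdorff_outer ?d (A \<inter> sphere 0 1) = emeasure surface_measure A"
  proof (rule antisym)
    have "hausdorff_outer ?d (A \<inter> sphere 0 1) \<le> (INF U\<in>{U. A \<subseteq> U \<and> open U}. emeasure surface_measure U)"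
    proof (rule INF_greatest)
      fix U assume "U \<in> {U. A \<subseteq> U \<and> open U}"
      then have U: "A \<subseteq> U" "open U" by auto
      have "hausdorff_outer ?d (A \<inter> sphere 0 1) \<le> hausdorff_outer ?d (U \<inter> sphere 0 1)"
        using U by (intro hausdorff_outer_mono) auto
      also have "\<dots> \<le> emeasure surface_measure U" by (rule hausdorff_outer_sphere_open) fact
      finally show "hausdorff_outer ?d (A \<inter> sphere 0 1) \<le> emeasure surface_measure U" .
    qed
    also have "\<dots> = emeasure surface_measure A"
      by (rule outer_regular[symmetric]) (use A in auto)
    finally show "hausdorff_outer ?d (A \<inter> sphere 0 1) \<le> emeasure surface_measure A" .
    show "emeasure surface_measure A \<le> hausdorff_outer ?d (A \<inter> sphere 0 1)"
      using surface_measure_le_hausdorff_outer[OF AS] A by (simp add: emeasure_surface_measure_Int)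
  qed
  then show ?thesis using AS by (simp add: emeasure_hausdorff_measure)
qed

theorem nn_integral_hausdorff_sphere:
  fixes f :: "real^'n \<Rightarrow> ennreal"
  assumes [measurable]: "f \<in> borel_measurable borel"
  shows "(\<integral>\<^sup>+w\<in>sphere 0 1. f w \<partial>hausdorff_measure (CARD('n) - 1)) = (\<integral>\<^sup>+w. f w \<partial>surface_measure)"
proof -
  let ?H = "hausdorff_measure (CARD('n) - 1) :: (real^'n) measure"
  have S [measurable]: "sphere 0 1 \<in> sets (borel :: (real^'n) measure)" by simp
  have "density ?H (indicator (sphere 0 1)) = surface_measure"
  proof (rule measure_eqI)
    fix A assume "A \<in> sets (density ?H (indicator (sphere 0 1)))"
    then have A: "A \<in> sets borel" by simp
    have "emeasure (density ?H (indicator (sphere 0 1))) A = (\<integral>\<^sup>+w. indicator (sphere 0 1) w * indicator A w \<partial>?H)"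
      using A by (intro emeasure_density) auto
    also have "\<dots> = (\<integral>\<^sup>+w. indicator (A \<inter> sphere 0 1) w \<partial>?H)"
      by (intro nn_integral_cong) (auto simp: indicator_def)
    also have "\<dots> = emeasure ?H (A \<inter> sphere 0 1)" using A by (intro nn_integral_indicator) auto
    finally show "emeasure (density ?H (indicator (sphere 0 1))) A = emeasure surface_measure A"
      using hausdorff_measure_sphere[OF A] by simp
  qed simp
  then have "(\<integral>\<^sup>+w. f w \<partial>surface_measure) = (\<integral>\<^sup>+w. f w \<partial>density ?H (indicator (sphere 0 1)))" by simp
  also have "\<dots> = (\<integral>\<^sup>+w. indicator (sphere 0 1) w * f w \<partial>?H)"
    by (intro nn_integral_density) auto
  finally show ?thesis by (simp add: mult.commute)
qed

section \<open>Test functions and the fundamental lemma of the calculus of variations\<close>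

lemma C_k_const: "C_k k (\<lambda>x::'a::euclidean_space. c)"
proof (induction k arbitrary: c)
  case (Suc k)
  show ?case unfolding C_k.simps
    by (rule exI[of _ "\<lambda>_. 0"]) (use Suc in \<open>auto simp: gderiv_def\<close>)
qed auto

lemma C_k_add: "C_k k f \<Longrightarrow> C_k k g \<Longrightarrow> C_k k (\<lambda>x::'a::euclidean_space. f x + g x)"
proof (induction k arbitrary: f g)
  case 0 then show ?case by (auto intro: continuous_on_add)
next
  case (Suc k)
  from Suc.prems obtain Df Dg where "\<forall>x. GDERIV f x :> Df x" "\<forall>b\<in>Basis. C_k k (\<lambda>x. Df x \<bullet> b)"
    "\<forall>x. GDERIV g x :> Dg x" "\<forall>b\<in>Basis. C_k k (\<lambda>x. Dg x \<bullet> b)" by auto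
  note D = this[rule_format]
  show ?case unfolding C_k.simps
  proof (rule exI[of _ "\<lambda>x. Df x + Dg x"], intro conjI allI ballI)
    show "GDERIV (\<lambda>x. f x + g x) x :> Df x + Dg x" for x by (rule GDERIV_add[OF D(1,3)])
    show "C_k k (\<lambda>x. (Df x + Dg x) \<bullet> b)" if "b \<in> Basis" for b
      unfolding inner_add_left by (rule Suc.IH[OF D(2,4)]) fact+
  qed
qed

lemma GDERIV_continuous_on: "(\<And>x. GDERIV f x :> Df x) \<Longrightarrow> continuous_on UNIV f"
  unfolding gderiv_def continuous_on_eq_continuous_at[OF open_UNIV]
  by (auto intro: has_derivative_continuous)

lemma C_k_Suc_imp: "C_k (Suc k) f \<Longrightarrow> C_k k (f :: 'a::euclidean_space \<Rightarrow> real)"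
proof (induction k arbitrary: f)
  case 0 then show ?case by (auto intro: GDERIV_continuous_on)
next
  case (Suc k)
  then obtain Df where D: "\<And>x. GDERIV f x :> Df x" "\<And>b. b \<in> Basis \<Longrightarrow> C_k (Suc k) (\<lambda>x. Df x \<bullet> b)"
    by (metis C_k.simps(2))
  show ?case unfolding C_k.simps(2)[of k]
    by (rule exI[of _ Df]) (use D Suc.IH in auto)
qed

lemma C_k_mult: "C_k k f \<Longrightarrow> C_k k g \<Longrightarrow> C_k k (\<lambda>x::'a::euclidean_space. f x * g x)"
proof (induction k arbitrary: f g)
  case 0 then show ?case by (auto intro: continuous_on_mult)
next
  case (Suc k)
  from Suc.prems obtain Df Dg where "\<forall>x. GDERIV f x :> Df x" "\<forall>b\<in>Basis. C_k k (\<lambda>x. Df x \<bullet> b)"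
    "\<forall>x. GDERIV g x :> Dg x" "\<forall>b\<in>Basis. C_k k (\<lambda>x. Dg x \<bullet> b)" by auto
  note D = this[rule_format]
  note fg = C_k_Suc_imp[OF Suc.prems(1)] C_k_Suc_imp[OF Suc.prems(2)]
  show ?case unfolding C_k.simps
  proof (rule exI[of _ "\<lambda>x. f x *\<^sub>R Dg x + g x *\<^sub>R Df x"], intro conjI allI ballI)
    show "GDERIV (\<lambda>x. f x * g x) x :> f x *\<^sub>R Dg x + g x *\<^sub>R Df x" for x
      by (rule GDERIV_mult[OF D(1,3)])
    show "C_k k (\<lambda>x. (f x *\<^sub>R Dg x + g x *\<^sub>R Df x) \<bullet> b)" if "b \<in> Basis" for b
      unfolding inner_add_left inner_scaleR_left
      by (intro C_k_add Suc.IH fg D that)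
  qed
qed

lemma C_k_prod: "finite I \<Longrightarrow> (\<And>i. i \<in> I \<Longrightarrow> C_k k (f i)) \<Longrightarrow> C_k k (\<lambda>x::'a::euclidean_space. \<Prod>i\<in>I. f i x)"
  by (induction I rule: finite_induct) (auto intro: C_k_const C_k_mult)

text \<open>
  The functions \<open>p (1 / t) exp (- 1 / t)\<close>, extended by \<open>0\<close>.  Admitting a polynomial factor makes the family
  closed under differentiation, so that smoothness is an induction.
\<close>

definition exp_bump :: "real poly \<Rightarrow> real \<Rightarrow> real" where
  "exp_bump p t = (if t > 0 then poly p (1 / t) * exp (- (1 / t)) else 0)"

lemma exp_bump_tendsto_0: "(exp_bump p \<longlongrightarrow> 0) (at 0)"
proof -
  have "((\<lambda>x. poly p x * exp (- x)) \<longlongrightarrow> 0) at_top"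
  proof -
    have "((\<lambda>x::real. x ^ i / exp x) \<longlongrightarrow> 0) at_top" for i by (rule tendsto_power_div_exp_0)
    then have "((\<lambda>x. \<Sum>i\<le>degree p. coeff p i * (x ^ i / exp x)) \<longlongrightarrow> (\<Sum>i\<le>degree p. coeff p i * 0)) at_top"
      by (intro tendsto_intros)
    then show ?thesis
      by (simp add: poly_altdef sum_distrib_right exp_minus divide_inverse mult.assoc)
  qed
  then have "((\<lambda>t. poly p (inverse t) * exp (- (inverse t))) \<longlongrightarrow> 0) (at_right 0)"
    by (rule filterlim_compose[OF _ filterlim_inverse_at_top_right])
  then have r: "(exp_bump p \<longlongrightarrow> 0) (at_right 0)"
    by (rule Lim_transform_eventually) (auto simp: eventually_at_right_less exp_bump_def inverse_eq_divide intro!: eventually_mono[OF eventually_at_right_less])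
  have l: "(exp_bump p \<longlongrightarrow> 0) (at_left 0)"
    by (rule Lim_transform_eventually[OF tendsto_const]) (auto simp: eventually_at_filter exp_bump_def)
  show ?thesis using l r by (simp add: filterlim_split_at)
qed

text \<open>
  On \<open>t > 0\<close> the polynomial of the derivative is \<open>X\<^sup>2 (p - p')\<close>.  At \<open>0\<close> the difference quotient is again
  a function of the family, with the polynomial \<open>X p\<close>.
\<close>

lemma exp_bump_deriv: "(exp_bump p has_real_derivative exp_bump ([:0, 0, 1:] * (p - pderiv p)) t) (at t)"
proof -
  consider "t < 0" | "t > 0" | "t = 0" by linarith
  then show ?thesis
  proof cases
    case 1
    have "((\<lambda>_. 0) has_real_derivative 0) (at t)" by simp
    then show ?thesis
      using 1 by (subst DERIV_cong_ev[OF refl _ refl, of _ "\<lambda>_. 0"])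
        (auto simp: exp_bump_def intro!: eventually_mono[OF order_tendstoD(2)[OF tendsto_ident_at[of t UNIV]]] eventually_nhds_in_open[of "{..<0}" t, THEN eventually_mono])
  next
    case 2
    have "((\<lambda>t. poly p (1 / t) * exp (- (1 / t))) has_real_derivative exp_bump ([:0, 0, 1:] * (p - pderiv p)) t) (at t)"
      using 2 by (auto intro!: derivative_eq_intros DERIV_chain2[OF poly_DERIV] simp: exp_bump_def field_simps power2_eq_square)
    then show ?thesis
      using 2 by (subst DERIV_cong_ev[OF refl _ refl, of _ "\<lambda>t. poly p (1 / t) * exp (- (1 / t))"])
        (auto simp: exp_bump_def intro!: eventually_nhds_in_open[of "{0<..}" t, THEN eventually_mono])
  next
    case 3
    have "((\<lambda>h. (exp_bump p (0 + h) - exp_bump p 0) / h) \<longlongrightarrow> 0) (at 0)"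
    proof (rule Lim_transform_eventually[OF exp_bump_tendsto_0[of "pCons 0 p"]])
      show "\<forall>\<^sub>F h in at 0. exp_bump (pCons 0 p) h = (exp_bump p (0 + h) - exp_bump p 0) / h"
        by (auto simp: exp_bump_def eventually_at_filter)
    qed
    then show ?thesis using 3 by (simp add: DERIV_def exp_bump_def)
  qed
qed

lemma C_k_exp_bump_affine:
  "C_k k (\<lambda>x::'a::euclidean_space. exp_bump p (c * (x \<bullet> b) + d))"
proof (induction k arbitrary: p)
  case 0
  have "continuous_on UNIV (exp_bump p)"
    by (intro DERIV_continuous_on) (auto intro: DERIV_subset exp_bump_deriv)
  then show ?case
    by (auto intro!: continuous_on_compose2[of UNIV "exp_bump p"] continuous_intros)
next
  case (Suc k)
  let ?q = "[:0, 0, 1:] * (p - pderiv p)"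
  show ?case unfolding C_k.simps
  proof (rule exI[of _ "\<lambda>x. (exp_bump ?q (c * (x \<bullet> b) + d)) *\<^sub>R (c *\<^sub>R b)"], intro conjI allI ballI)
    fix x :: 'a
    have "((\<lambda>x. c * (x \<bullet> b) + d) has_derivative (\<lambda>h. c * (h \<bullet> b))) (at x)"
      by (auto intro!: derivative_eq_intros)
    then have "((\<lambda>x. exp_bump p (c * (x \<bullet> b) + d)) has_derivative (\<lambda>h. exp_bump ?q (c * (x \<bullet> b) + d) * (c * (h \<bullet> b)))) (at x)"
      using has_derivative_compose[OF _ exp_bump_deriv[unfolded has_field_derivative_def]] by blast
    then show "GDERIV (\<lambda>x. exp_bump p (c * (x \<bullet> b) + d)) x :> exp_bump ?q (c * (x \<bullet> b) + d) *\<^sub>R (c *\<^sub>R b)"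
      by (simp add: gderiv_def mult.assoc)
  next
    fix b' :: 'a assume "b' \<in> Basis"
    have "C_k k (\<lambda>x. exp_bump ?q (c * (x \<bullet> b) + d) * (c * (b \<bullet> b')))"
      by (intro C_k_mult Suc C_k_const)
    then show "C_k k (\<lambda>x. (exp_bump ?q (c * (x \<bullet> b) + d) *\<^sub>R (c *\<^sub>R b)) \<bullet> b')"
      unfolding inner_scaleR_left .
  qed
qed

definition box_bump :: "real \<Rightarrow> 'a::euclidean_space \<Rightarrow> 'a \<Rightarrow> 'a \<Rightarrow> real" where
  "box_bump m l u x = (\<Prod>b\<in>Basis. exp_bump 1 (m * (x \<bullet> b - l \<bullet> b)) * exp_bump 1 (m * (u \<bullet> b - x \<bullet> b)))"

lemma exp_bump_1_bounds: "0 \<le> exp_bump 1 t" "exp_bump 1 t \<le> 1"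
  by (auto simp: exp_bump_def)

lemma box_bump_bounds: "0 \<le> box_bump m l u x" "box_bump m l u x \<le> 1"
  unfolding box_bump_def
  by (auto intro!: prod_nonneg prod_le_1 mult_nonneg_nonneg mult_le_one exp_bump_1_bounds)

lemma box_bump_eq_0: "m > 0 \<Longrightarrow> x \<notin> box l u \<Longrightarrow> box_bump m l u x = 0"
proof -
  assume m: "m > 0" and "x \<notin> box l u"
  then obtain b where b: "b \<in> Basis" "x \<bullet> b \<le> l \<bullet> b \<or> u \<bullet> b \<le> x \<bullet> b"
    unfolding mem_box by (meson not_less)
  then have "exp_bump 1 (m * (x \<bullet> b - l \<bullet> b)) * exp_bump 1 (m * (u \<bullet> b - x \<bullet> b)) = 0"
    using m by (auto simp: exp_bump_def zero_less_mult_iff)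
  then show ?thesis unfolding box_bump_def using b(1) by (intro prod_zero finite_Basis) (rule bexI)
qed

lemma test_function_box_bump:
  assumes "m > 0" shows "test_function (box_bump m l (u::'a::euclidean_space))"
  unfolding test_function_def
proof
  have "C_k k (box_bump m l u)" for k
  proof -
    have "C_k k (\<lambda>x. \<Prod>b\<in>Basis. exp_bump 1 (m * (x \<bullet> b) + (- (m * (l \<bullet> b)))) * exp_bump 1 ((- m) * (x \<bullet> b) + m * (u \<bullet> b)))"
      by (intro C_k_prod C_k_mult C_k_exp_bump_affine finite_Basis)
    then show ?thesis by (simp add: box_bump_def[abs_def] algebra_simps)
  qed
  then show "\<forall>k. C_k k (box_bump m l u)" ..
  have "{x. box_bump m l u x \<noteq> 0} \<subseteq> cbox l u"
    using box_bump_eq_0[OF assms] box_subset_cbox by blast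
  then show "compact (closure {x. box_bump m l u x \<noteq> 0})"
    using bounded_subset[OF bounded_cbox] by (auto simp: compact_closure)
qed

lemma box_bump_tendsto: "(\<lambda>m. box_bump (real (Suc m)) l u x) \<longlonglongrightarrow> indicator (box l u) x"
proof -
  have e: "(\<lambda>m. exp_bump 1 (real (Suc m) * t)) \<longlonglongrightarrow> (if t > 0 then 1 else 0)" for t
  proof (cases "t > 0")
    case True
    have "(\<lambda>m. exp (- (inverse (real (Suc m)) * inverse t))) \<longlonglongrightarrow> exp (- (0 * inverse t))"
      by (intro tendsto_intros LIMSEQ_inverse_real_of_nat)
    then show ?thesis using True by (simp add: exp_bump_def divide_inverse)
  next
    case False
    then have "exp_bump 1 (real (Suc m) * t) = 0" for m
      by (simp add: exp_bump_def zero_less_mult_iff)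
    then show ?thesis using False by simp
  qed
  have "(\<lambda>m. box_bump (real (Suc m)) l u x) \<longlonglongrightarrow> (\<Prod>b\<in>Basis. (if x \<bullet> b - l \<bullet> b > 0 then 1 else 0) * (if u \<bullet> b - x \<bullet> b > 0 then 1 else 0))"
    unfolding box_bump_def by (intro tendsto_prod tendsto_mult e)
  also have "(\<Prod>b\<in>Basis. (if x \<bullet> b - l \<bullet> b > 0 then 1 else 0) * (if u \<bullet> b - x \<bullet> b > 0 then 1 else 0)) = (indicator (box l u) x :: real)"
  proof (cases "x \<in> box l u")
    case True then show ?thesis by (auto simp: mem_box intro!: prod.neutral)
  next
    case False
    then obtain b where "b \<in> Basis" "\<not> (l \<bullet> b < x \<bullet> b \<and> x \<bullet> b < u \<bullet> b)" by (auto simp: mem_box)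
    then have "(\<Prod>b\<in>Basis. (if x \<bullet> b - l \<bullet> b > 0 then 1 else 0) * (if u \<bullet> b - x \<bullet> b > 0 then 1 else 0)) = (0::real)"
      by (intro prod_zero finite_Basis bexI[of _ b]) auto
    then show ?thesis using False by simp
  qed
  finally show ?thesis .
qed

text \<open>
  Within a large box, the sets with vanishing integral form a Dynkin system that contains the boxes,
  and intersections of boxes are boxes.
\<close>

lemma AE_zero_of_box_integrals:
  fixes f :: "'a::euclidean_space \<Rightarrow> real"
  assumes int: "\<And>l u. set_integrable lborel (box l u) f"
    and zero: "\<And>l u. (LINT x:box l u|lborel. f x) = 0"
  shows "AE x in lborel. f x = 0"
proof -
  have "AE x in lborel. x \<in> box (- (real N *\<^sub>R One)) (real N *\<^sub>R One) \<longrightarrow> f x = 0" for N :: nat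
  proof -
    let ?K = "box (- (real N *\<^sub>R One)) (real N *\<^sub>R One) :: 'a set"
    \<comment> \<open>Cutting off makes the function integrable over the whole space, so complements can be handled.\<close>
    define F where "F x = indicator ?K x *\<^sub>R f x" for x
    have F: "integrable lborel F" using int unfolding F_def set_integrable_def by blast
    have FA: "set_integrable lborel A F" if "A \<in> sets lborel" for A
      unfolding set_integrable_def by (rule integrable_mult_indicator[OF that F])
    have "(LINT x:A|lborel. F x) = 0" if "A \<in> sigma_sets UNIV (range (\<lambda>(l, u). box l u :: 'a set))" for A
    proof (rule sigma_sets_induct_disjoint[OF _ _ that, where P="\<lambda>A. (LINT x:A|lborel. F x) = 0"], goal_cases)
      case 1
      show ?case
      proof (rule Int_stableI)
        fix a b assume "a \<in> range (\<lambda>(l, u). box l u :: 'a set)" "b \<in> range (\<lambda>(l, u). box l u :: 'a set)"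
        then obtain l u l' u' where "a = box l u" "b = box l' u'" by auto
        then obtain p q where "a \<inter> b = box p q" by (simp add: box_Int_box)
        then show "a \<inter> b \<in> range (\<lambda>(l, u). box l u :: 'a set)"
          by (intro range_eqI[where x="(p, q)"]) simp
      qed
    next
      case 2 show ?case by simp
    next
      case (3 A)
      then obtain l u where A: "A = box l u" by auto
      obtain l' u' where lu: "box l u \<inter> ?K = box l' u'" by (auto simp: box_Int_box)
      have "(LINT x:A|lborel. F x) = (LINT x:box l' u'|lborel. f x)"
        unfolding set_lebesgue_integral_def F_def A lu[symmetric] by (simp add: indicator_inter_arith mult.assoc)
      then show ?case using zero by simp
    next
      case 4 show ?case by (simp add: set_lebesgue_integral_def)
    next
      case (5 A)
      then have A: "A \<in> sets lborel" by (simp add: borel_eq_box)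
      have "(LINT x:UNIV|lborel. F x) = (LINT x:A \<union> (UNIV - A)|lborel. F x)" by simp
      also have "\<dots> = (LINT x:A|lborel. F x) + (LINT x:UNIV - A|lborel. F x)"
        by (rule set_integral_Un) (use A in \<open>auto intro!: FA\<close>)
      finally have "(LINT x:UNIV|lborel. F x) = (LINT x:A|lborel. F x) + (LINT x:UNIV - A|lborel. F x)" .
      moreover have "(LINT x:UNIV|lborel. F x) = (LINT x:?K|lborel. f x)"
        unfolding set_lebesgue_integral_def F_def by simp
      ultimately show ?case using 5 zero by simp
    next
      case (6 A)
      then have A: "A i \<in> sets lborel" for i by (auto simp: borel_eq_box)
      have "(LINT x:(\<Union>i. A i)|lborel. F x) = (\<Sum>i. LINT x:A i|lborel. F x)"
        by (rule lebesgue_integral_countable_add) (use 6 A in \<open>auto intro!: FA simp: disjoint_family_on_def\<close>)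
      then show ?case using 6 by simp
    qed
    then have "(LINT x:A|lborel. F x) = (LINT x:A|lborel. 0)" if "A \<in> sets lborel" for A
      using that by (simp add: borel_eq_box set_lebesgue_integral_def)
    then have "AE x in lborel. F x = 0"
      by (intro density_unique_real F) auto
    then show ?thesis by eventually_elim (auto simp: F_def)
  qed
  then have "AE x in lborel. \<forall>N::nat. x \<in> box (- (real N *\<^sub>R One)) (real N *\<^sub>R One) \<longrightarrow> f x = 0"
    unfolding AE_all_countable by (rule allI)
  then show ?thesis
  proof eventually_elim
    case (elim x)
    obtain N where N: "norm x < real N" using reals_Archimedean2 by blast
    have "x \<in> box (- (real N *\<^sub>R One)) (real N *\<^sub>R One)"
      unfolding mem_box
    proof
      fix b :: 'a assume b: "b \<in> Basis"
      have "\<bar>x \<bullet> b\<bar> < real N" using Basis_le_norm[OF b, of x] N by linarith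
      then show "(- (real N *\<^sub>R One)) \<bullet> b < x \<bullet> b \<and> x \<bullet> b < (real N *\<^sub>R One) \<bullet> b"
        using b by (simp add: abs_less_iff)
    qed
    then show ?case using elim by blast
  qed
qed

text \<open>
  The fundamental lemma of the calculus of variations.  The bumps tend to the indicator function of a
  box and vanish outside it, so all box integrals vanish.
\<close>

theorem AE_zero_of_test_functions:
  fixes f :: "'a::euclidean_space \<Rightarrow> real"
  assumes meas: "f \<in> borel_measurable borel"
    and li: "\<And>l u. integrable lborel (\<lambda>x. indicator (cbox l u) x * f x)"
    and test: "\<And>\<phi>. test_function \<phi> \<Longrightarrow> (\<integral>x. \<phi> x * f x \<partial>lborel) = 0"
  shows "AE x in lborel. f x = 0"
proof (rule AE_zero_of_box_integrals)
  fix l u :: 'a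
  show "set_integrable lborel (box l u) f"
  proof -
    have "integrable lborel (\<lambda>x. indicator (box l u) x *\<^sub>R (indicator (cbox l u) x * f x))"
      by (rule integrable_mult_indicator[OF _ li]) simp
    also have "(\<lambda>x. indicator (box l u) x *\<^sub>R (indicator (cbox l u) x * f x)) = (\<lambda>x. indicator (box l u) x *\<^sub>R f x)"
      using box_subset_cbox[of l u] by (auto simp: indicator_def fun_eq_iff)
    finally show ?thesis by (simp add: set_integrable_def)
  qed
  have "(\<lambda>m. \<integral>x. box_bump (real (Suc m)) l u x * f x \<partial>lborel) \<longlonglongrightarrow> (\<integral>x. indicator (box l u) x * f x \<partial>lborel)"
  proof (rule integral_dominated_convergence[where w="\<lambda>x. norm (indicator (cbox l u) x * f x)"])
    have "continuous_on UNIV (box_bump m l u)" if "m > 0" for m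
      using test_function_box_bump[OF that, of l u] unfolding test_function_def by (metis C_k.simps(1))
    then have "box_bump (real (Suc m)) l u \<in> borel_measurable borel" for m
      by (simp add: borel_measurable_continuous_onI)
    then show "(\<lambda>x. box_bump (real (Suc m)) l u x * f x) \<in> borel_measurable lborel" for m
      using meas by simp
    show "(\<lambda>x. indicator (box l u) x * f x) \<in> borel_measurable lborel"
      using meas by simp
    show "integrable lborel (\<lambda>x. norm (indicator (cbox l u) x * f x))"
      by (rule integrable_norm[OF li])
    show "AE x in lborel. (\<lambda>m. box_bump (real (Suc m)) l u x * f x) \<longlonglongrightarrow> indicator (box l u) x * f x"
      by (intro AE_I2 tendsto_mult box_bump_tendsto tendsto_const)
    show "AE x in lborel. norm (box_bump (real (Suc m)) l u x * f x) \<le> norm (indicator (cbox l u) x * f x)" for m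
    proof (rule AE_I2)
      fix x
      show "norm (box_bump (real (Suc m)) l u x * f x) \<le> norm (indicator (cbox l u) x * f x)"
      proof (cases "x \<in> box l u")
        case True
        then have "x \<in> cbox l u" using box_subset_cbox by blast
        then show ?thesis using box_bump_bounds[of "real (Suc m)" l u x]
          by (simp add: abs_mult mult_left_le_one_le)
      next
        case False
        then show ?thesis using box_bump_eq_0[of "real (Suc m)" x l u] by simp
      qed
    qed
  qed
  moreover have "(\<integral>x. box_bump (real (Suc m)) l u x * f x \<partial>lborel) = 0" for m
    by (rule test[OF test_function_box_bump]) simp
  ultimately have "(\<lambda>m::nat. 0) \<longlonglongrightarrow> (\<integral>x. indicator (box l u) x * f x \<partial>lborel)" by simp
  then show "(LINT x:box l u|lborel. f x) = 0"
    using LIMSEQ_unique[OF _ tendsto_const] by (auto simp: set_lebesgue_integral_def)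
qed

section \<open>Weakly differentiable functions along segments\<close>

text \<open>
  Borel measurability is part of the definition because these functions are composed with
  \<open>(x, t) \<mapsto> x + t h\<close>; a function that is only Lebesgue measurable need not remain measurable in the
  product of the Borel sigma-algebras.
\<close>

definition borel_loc_integrable :: "('a::euclidean_space \<Rightarrow> real) \<Rightarrow> bool" where
  "borel_loc_integrable w \<longleftrightarrow> w \<in> borel_measurable borel \<and> (\<forall>R. integrable lborel (\<lambda>x. indicator (cball 0 R) x * w x))"

lemma integral_shift:
  fixes f :: "'a::euclidean_space \<Rightarrow> real"
  assumes [measurable]: "f \<in> borel_measurable borel"
  shows "(\<integral>x. f (x + a) \<partial>lborel) = (\<integral>x. f x \<partial>lborel)"
proof -
  have "(\<integral>x. f x \<partial>lborel) = (\<integral>x. f x \<partial>distr lborel borel ((+) a))"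
    by (simp add: lborel_distr_plus)
  then show ?thesis by (simp add: integral_distr add.commute)
qed

lemma integrable_cutoff:
  assumes w: "borel_loc_integrable w" and [measurable]: "\<phi> \<in> borel_measurable borel"
    and b: "\<And>x. \<bar>\<phi> x\<bar> \<le> M" and s: "\<And>x. norm x > R \<Longrightarrow> \<phi> x = 0"
  shows "integrable lborel (\<lambda>x. \<phi> x * w x)"
proof (rule Bochner_Integration.integrable_bound)
  show "integrable lborel (\<lambda>x. M * (indicator (cball 0 R) x * w x))"
    using w by (auto simp: borel_loc_integrable_def)
  show "(\<lambda>x. \<phi> x * w x) \<in> borel_measurable lborel"
    using w by (auto simp: borel_loc_integrable_def)
  show "AE x in lborel. norm (\<phi> x * w x) \<le> norm (M * (indicator (cball 0 R) x * w x))"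
  proof (rule AE_I2)
    fix x
    have "0 \<le> M" using b[of x] by simp
    then show "norm (\<phi> x * w x) \<le> norm (M * (indicator (cball 0 R) x * w x))"
      using s[of x] b[of x] by (cases "norm x > R") (auto simp: abs_mult not_less intro: mult_right_mono)
  qed
qed

lemma borel_loc_integrable_shift:
  fixes w :: "'a::euclidean_space \<Rightarrow> real"
  assumes w: "borel_loc_integrable w"
  shows "borel_loc_integrable (\<lambda>x. w (x + a))"
  unfolding borel_loc_integrable_def
proof (intro conjI allI)
  have [measurable]: "w \<in> borel_measurable borel" using w by (simp add: borel_loc_integrable_def)
  show "(\<lambda>x. w (x + a)) \<in> borel_measurable borel" by measurable
  fix R
  have [measurable]: "cball a R \<in> sets borel" by simp
  have "integrable lborel (\<lambda>x. indicator (cball a R) x * w x)"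
  proof (rule integrable_cutoff[OF w, where M=1 and R="R + norm a"])
      fix x :: 'a assume "norm x > R + norm a"
      then have "norm (a - x) > R" using norm_triangle_sub[of x a] by (simp add: norm_minus_commute)
      then show "indicator (cball a R) x = (0::real)" by (simp add: dist_norm)
    qed (auto simp: indicator_def)
  then have "integrable (distr lborel borel ((+) a)) (\<lambda>x. indicator (cball a R) x * w x)"
    by (simp add: lborel_distr_plus)
  then have "integrable lborel (\<lambda>x. indicator (cball a R) (a + x) * w (a + x))"
    by (subst (asm) integrable_distr_eq) auto
  also have "(\<lambda>x. indicator (cball a R) (a + x) * w (a + x)) = (\<lambda>x. indicator (cball 0 R) x * w (x + a))"
    by (auto simp: fun_eq_iff indicator_def dist_norm add.commute)
  finally show "integrable lborel (\<lambda>x. indicator (cball 0 R) x * w (x + a))" .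
qed

lemma integrable_pair_unit_interval:
  fixes F :: "'a::euclidean_space \<times> real \<Rightarrow> real"
  assumes [measurable]: "F \<in> borel_measurable (lborel \<Otimes>\<^sub>M lborel)"
    and C: "\<And>t. 0 \<le> t \<Longrightarrow> t \<le> 1 \<Longrightarrow> (\<integral>\<^sup>+x. ennreal \<bar>F (x, t)\<bar> \<partial>lborel) \<le> C" and fin: "C < top"
  shows "integrable (lborel \<Otimes>\<^sub>M lborel) (\<lambda>(x, t). indicator {0..1} t * F (x, t))"
proof (rule integrableI_bounded)
  show "(\<lambda>(x, t). indicator {0..1} t * F (x, t)) \<in> borel_measurable (lborel \<Otimes>\<^sub>M lborel)" by measurable
  have "(\<integral>\<^sup>+p. ennreal (norm (case p of (x, t) \<Rightarrow> indicator {0..1} t * F (x, t))) \<partial>(lborel \<Otimes>\<^sub>M lborel))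
    = (\<integral>\<^sup>+t. \<integral>\<^sup>+x. ennreal (norm (indicator {0..1} t * F (x, t))) \<partial>lborel \<partial>lborel)"
    by (subst lborel_pair.nn_integral_snd[symmetric]) auto
  also have "\<dots> \<le> (\<integral>\<^sup>+t. C * indicator {0..1::real} t \<partial>lborel)"
  proof (rule nn_integral_mono)
    fix t
    show "(\<integral>\<^sup>+x. ennreal (norm (indicator {0..1} t * F (x, t))) \<partial>lborel) \<le> C * indicator {0..1} t"
      using C[of t] by (cases "t \<in> {0..1}") auto
  qed
  also have "\<dots> = C" by (simp add: nn_integral_cmult_indicator)
  also have "\<dots> < \<infinity>" using fin by simp
  finally show "(\<integral>\<^sup>+p. ennreal (norm (case p of (x, t) \<Rightarrow> indicator {0..1} t * F (x, t))) \<partial>(lborel \<Otimes>\<^sub>M lborel)) < \<infinity>" .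
qed

text \<open>
  The two integrability facts behind the exchanges of integrals along segments: the first with the
  function moved and the test function fixed, the second the other way round.
\<close>

lemma shear_integrable:
  assumes w: "borel_loc_integrable w" and [measurable]: "\<phi> \<in> borel_measurable borel"
    and b: "\<And>x. \<bar>\<phi> x\<bar> \<le> M" and s: "\<And>x. norm x > R \<Longrightarrow> \<phi> x = 0"
  shows "integrable (lborel \<Otimes>\<^sub>M lborel) (\<lambda>(x, t). indicator {0..1} t * (\<phi> x * w (x + t *\<^sub>R h)))"
    and "integrable (lborel \<Otimes>\<^sub>M lborel) (\<lambda>(x, t). indicator {0..1} t * (w x * \<phi> (x - t *\<^sub>R h)))"
proof -
  have [measurable]: "w \<in> borel_measurable borel" using w by (simp add: borel_loc_integrable_def)
  define C where "C = (\<integral>\<^sup>+x. ennreal (norm (M * (indicator (cball 0 (R + norm h)) x * w x))) \<partial>lborel)"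
  have "integrable lborel (\<lambda>x. M * (indicator (cball 0 (R + norm h)) x * w x))"
    using w by (auto simp: borel_loc_integrable_def)
  then have C: "C < top" unfolding C_def by (simp only: integrable_iff_bounded infinity_ennreal_def)
  have M: "0 \<le> M" using b[of 0] by simp
  have le: "(\<integral>\<^sup>+x. ennreal \<bar>w x * \<phi> (x - t *\<^sub>R h)\<bar> \<partial>lborel) \<le> C" if t: "0 \<le> t" "t \<le> 1" for t
    unfolding C_def
  proof (rule nn_integral_mono, rule ennreal_leI)
    fix x
    show "\<bar>w x * \<phi> (x - t *\<^sub>R h)\<bar> \<le> norm (M * (indicator (cball 0 (R + norm h)) x * w x))"
    proof (cases "norm x \<le> R + norm h")
      case True
      then show ?thesis using mult_left_mono[OF b[of "x - t *\<^sub>R h"], of "\<bar>w x\<bar>"] M by (simp add: abs_mult mult.commute)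
    next
      case False
      have "norm (t *\<^sub>R h) \<le> norm h" using t by (simp add: mult_left_le_one_le)
      then have "norm (x - t *\<^sub>R h) > R" using False norm_triangle_ineq2[of x "t *\<^sub>R h"] by linarith
      then show ?thesis using s by simp
    qed
  qed
  show "integrable (lborel \<Otimes>\<^sub>M lborel) (\<lambda>(x, t). indicator {0..1} t * (w x * \<phi> (x - t *\<^sub>R h)))"
    using integrable_pair_unit_interval[of "\<lambda>(x, t). w x * \<phi> (x - t *\<^sub>R h)" C] le C by simp
  have "(\<integral>\<^sup>+x. ennreal \<bar>\<phi> x * w (x + t *\<^sub>R h)\<bar> \<partial>lborel) \<le> C" if t: "0 \<le> t" "t \<le> 1" for t
  proof -
    have "(\<integral>\<^sup>+x. ennreal \<bar>\<phi> x * w (x + t *\<^sub>R h)\<bar> \<partial>lborel) = (\<integral>\<^sup>+x. ennreal \<bar>w (x + t *\<^sub>R h) * \<phi> (x + t *\<^sub>R h - t *\<^sub>R h)\<bar> \<partial>lborel)"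
      by (simp add: mult.commute)
    also have "\<dots> = (\<integral>\<^sup>+x. ennreal \<bar>w x * \<phi> (x - t *\<^sub>R h)\<bar> \<partial>lborel)"
      by (rule nn_integral_lborel_shift) simp
    finally show ?thesis using le[OF t] by simp
  qed
  then show "integrable (lborel \<Otimes>\<^sub>M lborel) (\<lambda>(x, t). indicator {0..1} t * (\<phi> x * w (x + t *\<^sub>R h)))"
    using integrable_pair_unit_interval[of "\<lambda>(x, t). \<phi> x * w (x + t *\<^sub>R h)" C] C by simp
qed

lemma GDERIV_shift:
  assumes "\<And>x. GDERIV f x :> Df x"
  shows "GDERIV (\<lambda>x. f (x - a)) x :> Df (x - a)"
proof -
  have "((\<lambda>x. x - a) has_derivative (\<lambda>h. h)) (at x)" by (auto intro!: derivative_eq_intros)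
  from has_derivative_compose[OF this, of f "\<lambda>h. h \<bullet> Df (x - a)"] show ?thesis
    using assms by (simp add: gderiv_def)
qed

lemma C_k_shift: "C_k k f \<Longrightarrow> C_k k (\<lambda>x::'a::euclidean_space. f (x - a))"
proof (induction k arbitrary: f)
  case 0
  then show ?case by (auto intro!: continuous_on_compose2[of UNIV f] continuous_intros)
next
  case (Suc k)
  then obtain Df where D: "\<forall>x. GDERIV f x :> Df x" "\<forall>b\<in>Basis. C_k k (\<lambda>x. Df x \<bullet> b)" by auto
  show ?case unfolding C_k.simps
    by (rule exI[of _ "\<lambda>x. Df (x - a)"]) (use D Suc.IH GDERIV_shift in blast)
qed

lemma test_function_support:
  assumes "test_function \<phi>"
  obtains R where "\<And>x. norm x > R \<Longrightarrow> \<phi> x = 0"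
proof -
  have "bounded {x. \<phi> x \<noteq> 0}"
    using assms bounded_subset[OF compact_imp_bounded closure_subset] by (auto simp: test_function_def)
  then obtain R where "\<And>x. \<phi> x \<noteq> 0 \<Longrightarrow> norm x \<le> R" by (auto simp: bounded_iff)
  then show thesis by (intro that[of R]) force
qed

lemma test_functionI:
  assumes "\<And>k. C_k k \<phi>" "\<And>x. norm x > R \<Longrightarrow> \<phi> x = 0"
  shows "test_function \<phi>"
proof -
  have "bounded {x. \<phi> x \<noteq> 0}"
    unfolding bounded_iff using assms(2) by (intro exI[of _ R]) force
  then show ?thesis using assms(1) by (simp add: test_function_def compact_closure)
qed

lemma test_function_shift:
  assumes "test_function \<phi>" shows "test_function (\<lambda>x. \<phi> (x - a))"
proof -
  obtain R where R: "\<And>x. norm x > R \<Longrightarrow> \<phi> x = 0" using test_function_support[OF assms] by blast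
  show ?thesis
  proof (rule test_functionI)
    show "C_k k (\<lambda>x. \<phi> (x - a))" for k
      by (rule C_k_shift) (use assms in \<open>simp add: test_function_def\<close>)
    show "\<phi> (x - a) = 0" if "norm x > R + norm a" for x
      by (rule R) (use that norm_triangle_ineq2[of x a] in linarith)
  qed
qed

lemma continuous_compact_support_bounded:
  fixes f :: "'a::euclidean_space \<Rightarrow> real"
  assumes c: "continuous_on UNIV f" and s: "\<And>x. norm x > R \<Longrightarrow> f x = 0"
  obtains M where "\<And>x. \<bar>f x\<bar> \<le> M"
proof -
  have "bounded (f ` cball 0 R)"
    by (rule compact_imp_bounded[OF compact_continuous_image[OF continuous_on_subset[OF c]]]) auto
  then obtain M where "\<forall>x\<in>cball 0 R. \<bar>f x\<bar> \<le> M" by (auto simp: bounded_iff)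
  then have M: "\<bar>f x\<bar> \<le> M" if "norm x \<le> R" for x using that by simp
  have "\<bar>f x\<bar> \<le> max M 0" for x
    using M[of x] s[of x] by (cases "norm x > R") (auto simp: not_less max_def)
  then show thesis by (rule that)
qed

lemma GDERIV_unique: "GDERIV f x :> a \<Longrightarrow> GDERIV f x :> b \<Longrightarrow> a = b"
proof -
  assume "GDERIV f x :> a" "GDERIV f x :> b"
  then have "(\<lambda>h. h \<bullet> a) = (\<lambda>h. h \<bullet> b)"
    unfolding gderiv_def by (rule has_derivative_unique)
  then have "(a - b) \<bullet> a = (a - b) \<bullet> b" by (rule fun_cong)
  then have "(a - b) \<bullet> (a - b) = 0" by (simp add: inner_diff_right)
  then show "a = b" by simp
qed

lemma test_function_gradient:
  assumes t: "test_function \<phi>" and D: "\<And>x. GDERIV \<phi> x :> D\<phi> x" and R: "\<And>x. norm x > R \<Longrightarrow> \<phi> x = 0"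
  shows "continuous_on UNIV \<phi>" "continuous_on UNIV D\<phi>" "norm x > R \<Longrightarrow> D\<phi> x = 0"
proof -
  have "C_k 0 \<phi>" "C_k (Suc 0) \<phi>" using t unfolding test_function_def by blast+
  then show "continuous_on UNIV \<phi>" by simp
  from \<open>C_k (Suc 0) \<phi>\<close> obtain Df where Df: "\<forall>x. GDERIV \<phi> x :> Df x" "\<forall>b\<in>Basis. continuous_on UNIV (\<lambda>x. Df x \<bullet> b)" by auto
  have eq: "D\<phi> = Df"
  proof
    fix x show "D\<phi> x = Df x" using GDERIV_unique[OF D] Df(1) by blast
  qed
  show "continuous_on UNIV D\<phi>"
    unfolding eq by (subst continuous_on_componentwise) (use Df in auto)
  assume x: "norm x > R"
  have "open (- cball (0::'a) R)" by (simp add: open_Compl)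
  have "GDERIV (\<lambda>_. 0) x :> 0" by (simp add: gderiv_def)
  then have "GDERIV \<phi> x :> 0"
    unfolding gderiv_def
    by (rule has_derivative_transform_within_open[OF _ \<open>open (- cball (0::'a) R)\<close>]) (use x R in auto)
  then show "D\<phi> x = 0" using GDERIV_unique[OF D] by blast
qed

text \<open>
  Testing the segment integral of \<open>w\<close> with \<open>\<phi>\<close> and moving the translations and the derivative to \<open>\<phi>\<close>
  produces \<open>\<integral>\<^sub>0\<^sup>1 D\<phi> (x - t h) \<bullet> h dt = \<phi> x - \<phi> (x - h)\<close>, which is the test function for the
  difference \<open>u (x + h) - u x\<close>.  The exceptional null set may depend on \<open>h\<close>.
\<close>

theorem weak_derivative_difference:
  fixes u w :: "'a::euclidean_space \<Rightarrow> real"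
  assumes u: "borel_loc_integrable u" and w: "borel_loc_integrable w"
    and weak: "\<And>\<phi> D\<phi>. test_function \<phi> \<Longrightarrow> (\<And>x. GDERIV \<phi> x :> D\<phi> x) \<Longrightarrow>
       (\<integral>x. u x * (D\<phi> x \<bullet> h) \<partial>lborel) = - (\<integral>x. \<phi> x * w x \<partial>lborel)"
  shows "AE x in lborel. u (x + h) - u x = (\<integral>t. indicator {0..1} t * w (x + t *\<^sub>R h) \<partial>lborel)"
proof -
  have um [measurable]: "u \<in> borel_measurable borel" using u by (simp add: borel_loc_integrable_def)
  have wm [measurable]: "w \<in> borel_measurable borel" using w by (simp add: borel_loc_integrable_def)
  define g where "g x = (\<integral>t. indicator {0..1} t * w (x + t *\<^sub>R h) \<partial>lborel)" for x
  have gm [measurable]: "g \<in> borel_measurable borel"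
    unfolding g_def by measurable
  have cut_g: "integrable lborel (\<lambda>x. \<phi> x * g x)"
    and fub_g: "(\<integral>x. \<phi> x * g x \<partial>lborel) = (\<integral>t. indicator {0..1} t * (\<integral>x. \<phi> x * w (x + t *\<^sub>R h) \<partial>lborel) \<partial>lborel)"
    if p: "\<phi> \<in> borel_measurable borel" "\<And>x. \<bar>\<phi> x\<bar> \<le> M" "\<And>x. norm x > R \<Longrightarrow> \<phi> x = 0" for \<phi> M R
  proof -
    note int = shear_integrable(1)[OF w p, where h=h]
    have eq: "(\<integral>t. (case (x, t) of (x, t) \<Rightarrow> indicator {0..1} t * (\<phi> x * w (x + t *\<^sub>R h))) \<partial>lborel) = \<phi> x * g x" for x
    proof -
      have "(\<integral>t. (case (x, t) of (x, t) \<Rightarrow> indicator {0..1} t * (\<phi> x * w (x + t *\<^sub>R h))) \<partial>lborel) = (\<integral>t. \<phi> x * (indicator {0..1} t * w (x + t *\<^sub>R h)) \<partial>lborel)"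
        by (intro Bochner_Integration.integral_cong) (auto simp: mult_ac)
      also have "\<dots> = \<phi> x * g x" unfolding g_def by (rule integral_mult_right_zero)
      finally show ?thesis .
    qed
    show "integrable lborel (\<lambda>x. \<phi> x * g x)"
      using lborel_pair.integrable_fst'[OF int] unfolding eq .
    have "(\<integral>x. \<phi> x * g x \<partial>lborel) = (\<integral>x. (\<integral>t. (case (x, t) of (x, t) \<Rightarrow> indicator {0..1} t * (\<phi> x * w (x + t *\<^sub>R h))) \<partial>lborel) \<partial>lborel)"
      unfolding eq ..
    also have "\<dots> = (\<integral>t. (\<integral>x. indicator {0..1} t * (\<phi> x * w (x + t *\<^sub>R h)) \<partial>lborel) \<partial>lborel)"
      using lborel_pair.Fubini_integral[OF int] by simp
    finally show "(\<integral>x. \<phi> x * g x \<partial>lborel) = (\<integral>t. indicator {0..1} t * (\<integral>x. \<phi> x * w (x + t *\<^sub>R h) \<partial>lborel) \<partial>lborel)"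
      by simp
  qed
  have "AE x in lborel. u (x + h) - u x - g x = 0"
  proof (rule AE_zero_of_test_functions)
    show "(\<lambda>x. u (x + h) - u x - g x) \<in> borel_measurable borel" by measurable
  next
    fix a b :: 'a
    have "bounded (cbox a b)" by (rule bounded_cbox)
    then obtain R where R: "\<And>x. x \<in> cbox a b \<Longrightarrow> norm x \<le> R" by (auto simp: bounded_iff)
    have p: "indicator (cbox a b) \<in> borel_measurable borel" "\<bar>indicator (cbox a b) x :: real\<bar> \<le> 1" "norm x > R \<Longrightarrow> indicator (cbox a b) x = (0::real)" for x
      using R[of x] by (auto simp: indicator_def)
    have "integrable lborel (\<lambda>x. indicator (cbox a b) x * u (x + h) - indicator (cbox a b) x * u x - indicator (cbox a b) x * g x)"
      by (intro Bochner_Integration.integrable_diff integrable_cutoff[OF borel_loc_integrable_shift[OF u] p] integrable_cutoff[OF u p] cut_g[OF p])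
    then show "integrable lborel (\<lambda>x. indicator (cbox a b) x * (u (x + h) - u x - g x))"
      by (simp add: algebra_simps)
  next
    fix \<phi> :: "'a \<Rightarrow> real" assume t: "test_function \<phi>"
    obtain R where R: "\<And>x. norm x > R \<Longrightarrow> \<phi> x = 0" using test_function_support[OF t] by blast
    have "C_k (Suc 0) \<phi>" using t unfolding test_function_def by blast
    then obtain D\<phi> where "\<forall>x. GDERIV \<phi> x :> D\<phi> x" by auto
    then have D: "\<And>x. GDERIV \<phi> x :> D\<phi> x" by blast
    note gr = test_function_gradient[OF t D R]
    have pm [measurable]: "\<phi> \<in> borel_measurable borel" using gr(1) by (rule borel_measurable_continuous_onI)
    obtain M where M: "\<And>x. \<bar>\<phi> x\<bar> \<le> M" using continuous_compact_support_bounded[OF gr(1) R] by blast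
    define \<psi> where "\<psi> x = D\<phi> x \<bullet> h" for x
    have ps: "continuous_on UNIV \<psi>" unfolding \<psi>_def by (intro continuous_intros gr(2))
    have psR: "norm x > R \<Longrightarrow> \<psi> x = 0" for x using gr(3) by (simp add: \<psi>_def)
    have psm [measurable]: "\<psi> \<in> borel_measurable borel" using ps by (rule borel_measurable_continuous_onI)
    obtain N where N: "\<And>x. \<bar>\<psi> x\<bar> \<le> N" using continuous_compact_support_bounded[OF ps psR] by blast
    have ftc: "(\<integral>t. indicator {0..1} t * \<psi> (x - t *\<^sub>R h) \<partial>lborel) = \<phi> x - \<phi> (x - h)" for x
    proof -
      have "(\<integral>t. indicator {0..1} t *\<^sub>R \<psi> (x - t *\<^sub>R h) \<partial>lborel) = (- \<phi> (x - 1 *\<^sub>R h)) - (- \<phi> (x - 0 *\<^sub>R h))"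
      proof (rule integral_FTC_Icc)
        fix t :: real
        have 1: "((\<lambda>t. x - t *\<^sub>R h) has_derivative (\<lambda>s. - (s *\<^sub>R h))) (at t within {0..1})" by (auto intro!: derivative_eq_intros)
        have "((\<lambda>t. \<phi> (x - t *\<^sub>R h)) has_derivative (\<lambda>s. (- (s *\<^sub>R h)) \<bullet> D\<phi> (x - t *\<^sub>R h))) (at t within {0..1})"
          by (rule has_derivative_compose[OF 1]) (use D in \<open>simp add: gderiv_def\<close>)
        then have "((\<lambda>t. - \<phi> (x - t *\<^sub>R h)) has_derivative (\<lambda>s. - ((- (s *\<^sub>R h)) \<bullet> D\<phi> (x - t *\<^sub>R h)))) (at t within {0..1})"
          by (rule has_derivative_minus)
        then show "((\<lambda>t. - \<phi> (x - t *\<^sub>R h)) has_vector_derivative \<psi> (x - t *\<^sub>R h)) (at t within {0..1})"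
          by (simp add: has_vector_derivative_def \<psi>_def inner_commute)
      qed (auto intro!: continuous_on_compose2[OF ps] continuous_intros)
      then show ?thesis by simp
    qed
    have "(\<integral>x. \<phi> x * g x \<partial>lborel) = (\<integral>t. indicator {0..1} t * (\<integral>x. \<phi> x * w (x + t *\<^sub>R h) \<partial>lborel) \<partial>lborel)"
      by (rule fub_g[OF pm M R])
    also have "\<dots> = (\<integral>t. indicator {0..1} t * (- (\<integral>x. u x * \<psi> (x - t *\<^sub>R h) \<partial>lborel)) \<partial>lborel)"
    proof -
      have "(\<integral>x. \<phi> x * w (x + t *\<^sub>R h) \<partial>lborel) = - (\<integral>x. u x * \<psi> (x - t *\<^sub>R h) \<partial>lborel)" for t
      proof -
        have "(\<integral>x. \<phi> x * w (x + t *\<^sub>R h) \<partial>lborel) = (\<integral>x. \<phi> ((x + t *\<^sub>R h) - t *\<^sub>R h) * w (x + t *\<^sub>R h) \<partial>lborel)" by simp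
        also have "\<dots> = (\<integral>x. \<phi> (x - t *\<^sub>R h) * w x \<partial>lborel)"
          by (rule integral_shift[of "\<lambda>x. \<phi> (x - t *\<^sub>R h) * w x"]) simp
        also have "\<dots> = - (\<integral>x. u x * \<psi> (x - t *\<^sub>R h) \<partial>lborel)"
          using weak[OF test_function_shift[OF t] GDERIV_shift[OF D]] by (simp add: \<psi>_def)
        finally show ?thesis .
      qed
      then show ?thesis by simp
    qed
    also have "\<dots> = - (\<integral>t. (\<integral>x. indicator {0..1} t * (u x * \<psi> (x - t *\<^sub>R h)) \<partial>lborel) \<partial>lborel)"
      by simp
    also have "(\<integral>t. (\<integral>x. indicator {0..1} t * (u x * \<psi> (x - t *\<^sub>R h)) \<partial>lborel) \<partial>lborel) = (\<integral>x. (\<integral>t. indicator {0..1} t * (u x * \<psi> (x - t *\<^sub>R h)) \<partial>lborel) \<partial>lborel)"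
      using lborel_pair.Fubini_integral[OF shear_integrable(2)[OF u psm N psR, where h=h]] by simp
    also have "\<dots> = (\<integral>x. u x * (\<phi> x - \<phi> (x - h)) \<partial>lborel)"
    proof (rule Bochner_Integration.integral_cong[OF refl])
      fix x
      have "(\<integral>t. indicator {0..1} t * (u x * \<psi> (x - t *\<^sub>R h)) \<partial>lborel) = (\<integral>t. u x * (indicator {0..1} t * \<psi> (x - t *\<^sub>R h)) \<partial>lborel)"
        by (intro Bochner_Integration.integral_cong) (auto simp: mult_ac)
      then show "(\<integral>t. indicator {0..1} t * (u x * \<psi> (x - t *\<^sub>R h)) \<partial>lborel) = u x * (\<phi> x - \<phi> (x - h))"
        by (simp add: ftc)
    qed
    also have "\<dots> = (\<integral>x. \<phi> x * u x \<partial>lborel) - (\<integral>x. \<phi> (x - h) * u x \<partial>lborel)"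
    proof -
      have sh: "norm x > R + norm h \<Longrightarrow> \<phi> (x - h) = 0" for x
        by (rule R) (use norm_triangle_ineq2[of x h] in linarith)
      have "integrable lborel (\<lambda>x. \<phi> x * u x)" by (rule integrable_cutoff[OF u pm M R])
      moreover have "integrable lborel (\<lambda>x. \<phi> (x - h) * u x)" by (rule integrable_cutoff[OF u _ M sh]) simp
      ultimately show ?thesis by (simp add: algebra_simps)
    qed
    also have "(\<integral>x. \<phi> (x - h) * u x \<partial>lborel) = (\<integral>x. \<phi> x * u (x + h) \<partial>lborel)"
      using integral_shift[of "\<lambda>x. \<phi> (x - h) * u x" h] by simp
    finally have gval: "(\<integral>x. \<phi> x * g x \<partial>lborel) = (\<integral>x. \<phi> x * u (x + h) \<partial>lborel) - (\<integral>x. \<phi> x * u x \<partial>lborel)" by simp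
    have "(\<integral>x. \<phi> x * (u (x + h) - u x - g x) \<partial>lborel) = (\<integral>x. \<phi> x * u (x + h) - \<phi> x * u x - \<phi> x * g x \<partial>lborel)"
      by (simp add: algebra_simps)
    also have "\<dots> = (\<integral>x. \<phi> x * u (x + h) \<partial>lborel) - (\<integral>x. \<phi> x * u x \<partial>lborel) - (\<integral>x. \<phi> x * g x \<partial>lborel)"
      using integrable_cutoff[OF borel_loc_integrable_shift[OF u, where a=h] pm M R] integrable_cutoff[OF u pm M R] cut_g[OF pm M R] by simp
    finally show "(\<integral>x. \<phi> x * (u (x + h) - u x - g x) \<partial>lborel) = 0" using gval by simp
  qed
  then show ?thesis unfolding g_def by eventually_elim simp
qed

section \<open>Continuity of translations in the mean\<close>

lemma integrable_unit_interval_powr: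
  fixes \<phi> :: "real \<Rightarrow> real"
  assumes p: "p \<ge> 1" and [measurable]: "\<phi> \<in> borel_measurable borel"
    and fin: "(\<integral>\<^sup>+t. indicator {0..1} t * ennreal (\<bar>\<phi> t\<bar> powr p) \<partial>lborel) \<noteq> top"
  shows "integrable lborel (\<lambda>t. indicator {0..1} t * \<bar>\<phi> t\<bar> powr p)"
    and "integrable lborel (\<lambda>t. indicator {0..1} t * \<phi> t)"
proof -
  show Rint: "integrable lborel (\<lambda>t. indicator {0..1} t * \<bar>\<phi> t\<bar> powr p)"
  proof (rule integrableI_bounded)
    have "(\<integral>\<^sup>+t. ennreal (norm (indicator {0..1} t * \<bar>\<phi> t\<bar> powr p)) \<partial>lborel) = (\<integral>\<^sup>+t. indicator {0..1} t * ennreal (\<bar>\<phi> t\<bar> powr p) \<partial>lborel)"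
      by (intro nn_integral_cong) (simp add: indicator_def)
    then show "(\<integral>\<^sup>+t. ennreal (norm (indicator {0..1} t * \<bar>\<phi> t\<bar> powr p)) \<partial>lborel) < \<infinity>"
      using fin by (simp add: less_top)
  qed simp
  have one: "integrable lborel (\<lambda>t::real. indicator {0..1} t :: real)" by simp
  show "integrable lborel (\<lambda>t. indicator {0..1} t * \<phi> t)"
  proof (rule Bochner_Integration.integrable_bound[OF Bochner_Integration.integrable_add[OF one Rint]])
    show "AE t in lborel. norm (indicator {0..1} t * \<phi> t) \<le> norm (indicator {0..1} t + indicator {0..1} t * \<bar>\<phi> t\<bar> powr p)"
    proof (rule AE_I2)
      fix t :: real
      have "\<bar>\<phi> t\<bar> \<le> 1 + \<bar>\<phi> t\<bar> powr p"
      proof (cases "\<bar>\<phi> t\<bar> \<le> 1")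
        case False
        then have "\<bar>\<phi> t\<bar> powr 1 \<le> \<bar>\<phi> t\<bar> powr p" using p by (intro powr_mono) auto
        then show ?thesis by simp
      qed (simp add: add_increasing2)
      then show "norm (indicator {0..1} t * \<phi> t) \<le> norm (indicator {0..1} t + indicator {0..1} t * \<bar>\<phi> t\<bar> powr p)"
        by (cases "t \<in> {0..1}") auto
    qed
  qed simp
qed

text \<open>
  With \<open>m = \<integral>\<^sub>0\<^sup>1 \<bar>\<phi>\<bar>\<close>, integrate Young's inequality \<open>\<bar>\<phi>\<bar> m\<^bsup>p - 1\<^esup> \<le> \<bar>\<phi>\<bar>\<^sup>p / p + m\<^sup>p / q\<close>.
\<close>

lemma jensen_unit_interval:
  fixes \<phi> :: "real \<Rightarrow> real"
  assumes p: "p > 1" and [measurable]: "\<phi> \<in> borel_measurable borel"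
  shows "ennreal (\<bar>\<integral>t. indicator {0..1} t * \<phi> t \<partial>lborel\<bar> powr p) \<le> (\<integral>\<^sup>+t. indicator {0..1} t * ennreal (\<bar>\<phi> t\<bar> powr p) \<partial>lborel)"
    (is "_ \<le> ?R")
proof (cases "?R = top")
  case False
  have one: "integrable lborel (\<lambda>t::real. indicator {0..1} t :: real)" by simp
  note Rint = integrable_unit_interval_powr(1)[OF less_imp_le[OF p] assms(2) False]
  have fint: "integrable lborel (\<lambda>t. indicator {0..1} t * \<bar>\<phi> t\<bar>)"
    using integrable_abs[OF integrable_unit_interval_powr(2)[OF less_imp_le[OF p] assms(2) False]]
    by (simp add: abs_mult)
  define m where "m = (\<integral>t. indicator {0..1} t * \<bar>\<phi> t\<bar> \<partial>lborel)"
  define I where "I = (\<integral>t. indicator {0..1} t * \<bar>\<phi> t\<bar> powr p \<partial>lborel)"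
  have m0: "0 \<le> m" unfolding m_def by simp
  have "\<bar>\<integral>t. indicator {0..1} t * \<phi> t \<partial>lborel\<bar> \<le> (\<integral>t. \<bar>indicator {0..1} t * \<phi> t\<bar> \<partial>lborel)"
    by (rule integral_abs_bound)
  also have "\<dots> = m" unfolding m_def by (simp add: abs_mult)
  finally have le_m: "\<bar>\<integral>t. indicator {0..1} t * \<phi> t \<partial>lborel\<bar> \<le> m" .
  define q where "q = p / (p - 1)"
  have q: "q > 1" "1 / p + 1 / q = 1" "(p - 1) * q = p" using p by (auto simp: q_def field_simps)
  have "m powr p = m * m powr (p - 1)"
  proof (cases "m = 0")
    case False
    then have "m powr p = m powr (1 + (p - 1))" by simp
    also have "\<dots> = m * m powr (p - 1)" using m0 False by (subst powr_add) simp
    finally show ?thesis .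
  qed simp
  also have "\<dots> = (\<integral>t. indicator {0..1} t * \<bar>\<phi> t\<bar> * m powr (p - 1) \<partial>lborel)"
    unfolding m_def by simp
  also have "\<dots> \<le> (\<integral>t. indicator {0..1} t * \<bar>\<phi> t\<bar> powr p * (1 / p) + indicator {0..1} t * (m powr p / q) \<partial>lborel)"
  proof (rule integral_mono)
    show "integrable lborel (\<lambda>t. indicator {0..1} t * \<bar>\<phi> t\<bar> * m powr (p - 1))"
      by (intro integrable_mult_left) (rule fint)
    show "integrable lborel (\<lambda>t. indicator {0..1} t * \<bar>\<phi> t\<bar> powr p * (1 / p) + indicator {0..1} t * (m powr p / q))"
      by (intro Bochner_Integration.integrable_add integrable_mult_left Rint one)
    fix t
    have "\<bar>\<phi> t\<bar> * m powr (p - 1) \<le> \<bar>\<phi> t\<bar> powr p / p + (m powr (p - 1)) powr q / q"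
      by (rule Youngs_inequality) (use p q in auto)
    then show "indicator {0..1} t * \<bar>\<phi> t\<bar> * m powr (p - 1) \<le> indicator {0..1} t * \<bar>\<phi> t\<bar> powr p * (1 / p) + indicator {0..1} t * (m powr p / q)"
      by (simp add: indicator_def powr_powr q)
  qed
  also have "\<dots> = I * (1 / p) + m powr p / q"
    unfolding I_def by (subst Bochner_Integration.integral_add) (auto intro!: integrable_mult_left Rint one)
  finally have "m powr p * (1 - 1 / q) \<le> I * (1 / p)" by (simp add: algebra_simps)
  also have "1 - 1 / q = 1 / p" using q by simp
  finally have mI: "m powr p \<le> I" using p by (simp add: divide_le_cancel)
  have "ennreal (\<bar>\<integral>t. indicator {0..1} t * \<phi> t \<partial>lborel\<bar> powr p) \<le> ennreal (m powr p)"
    using le_m p by (intro ennreal_leI powr_mono2) auto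
  also have "\<dots> \<le> ennreal I" using mI by (rule ennreal_leI)
  also have "\<dots> = (\<integral>\<^sup>+t. ennreal (indicator {0..1} t * \<bar>\<phi> t\<bar> powr p) \<partial>lborel)"
    unfolding I_def by (rule nn_integral_eq_integral[symmetric, OF Rint]) auto
  also have "\<dots> = ?R" by (intro nn_integral_cong) (simp add: indicator_def)
  finally show ?thesis .
qed simp

lemma tendsto_zero_ennreal_approx:
  fixes a :: "nat \<Rightarrow> ennreal"
  assumes "\<And>e::real. e > 0 \<Longrightarrow> \<exists>F. F \<longlonglongrightarrow> 0 \<and> (\<forall>j. a j \<le> F j + ennreal e)"
  shows "a \<longlonglongrightarrow> 0"
proof (rule order_tendstoI)
  fix y :: ennreal assume "0 < y"
  then obtain z where z: "0 < z" "z < y" using dense by blast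
  then have "z < top" using less_le_trans[of z y top] by simp
  then obtain c where c: "z = ennreal c" "c > 0" using z by (cases z) (auto simp: ennreal_zero_less_top)
  obtain F where F: "F \<longlonglongrightarrow> 0" "\<And>j. a j \<le> F j + ennreal (c/2)" using assms[of "c/2"] c by auto
  have "\<forall>\<^sub>F j in sequentially. F j < ennreal (c/2)" by (rule order_tendstoD(2)[OF F(1)]) (use c in simp)
  then show "\<forall>\<^sub>F j in sequentially. a j < y"
  proof eventually_elim
    case (elim j)
    have "a j \<le> ennreal (c/2) + ennreal (c/2)" using F(2)[of j] elim by (meson add_right_mono less_imp_le order_trans)
    also have "\<dots> = z" using c by (simp add: ennreal_plus[symmetric] del: ennreal_plus)
    finally show ?case using z by simp
  qed
qed simp

definition L1_translation_continuous :: "('a::euclidean_space \<Rightarrow> real) \<Rightarrow> bool" where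
  "L1_translation_continuous f \<longleftrightarrow> (\<forall>k::nat \<Rightarrow> 'a. k \<longlonglongrightarrow> 0 \<longrightarrow> (\<lambda>j. \<integral>\<^sup>+x. ennreal \<bar>f (x + k j) - f x\<bar> \<partial>lborel) \<longlonglongrightarrow> 0)"

lemma translation_error_le:
  fixes f g :: "'a::euclidean_space \<Rightarrow> real"
  assumes [measurable]: "f \<in> borel_measurable borel" "g \<in> borel_measurable borel"
  shows "(\<integral>\<^sup>+x. ennreal \<bar>f (x + a) - f x\<bar> \<partial>lborel) \<le> (\<integral>\<^sup>+x. ennreal \<bar>g (x + a) - g x\<bar> \<partial>lborel) + 2 * (\<integral>\<^sup>+x. ennreal \<bar>f x - g x\<bar> \<partial>lborel)"
proof -
  have "(\<integral>\<^sup>+x. ennreal \<bar>f (x + a) - f x\<bar> \<partial>lborel) \<le> (\<integral>\<^sup>+x. ennreal \<bar>g (x + a) - g x\<bar> + (ennreal \<bar>f (x + a) - g (x + a)\<bar> + ennreal \<bar>f x - g x\<bar>) \<partial>lborel)"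
    by (intro nn_integral_mono) (simp add: ennreal_plus[symmetric] del: ennreal_plus)
  also have "\<dots> = (\<integral>\<^sup>+x. ennreal \<bar>g (x + a) - g x\<bar> \<partial>lborel) + ((\<integral>\<^sup>+x. ennreal \<bar>f (x + a) - g (x + a)\<bar> \<partial>lborel) + (\<integral>\<^sup>+x. ennreal \<bar>f x - g x\<bar> \<partial>lborel))"
    by (simp add: nn_integral_add)
  also have "(\<integral>\<^sup>+x. ennreal \<bar>f (x + a) - g (x + a)\<bar> \<partial>lborel) = (\<integral>\<^sup>+x. ennreal \<bar>f x - g x\<bar> \<partial>lborel)"
    by (rule nn_integral_lborel_shift) simp
  finally show ?thesis by (simp add: mult_2)
qed

lemma L1_translation_continuous_approx:
  assumes f: "f \<in> borel_measurable borel"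
    and g: "\<And>e::real. e > 0 \<Longrightarrow> \<exists>g\<in>borel_measurable borel. L1_translation_continuous g \<and> (\<integral>\<^sup>+x. ennreal \<bar>f x - g x\<bar> \<partial>lborel) \<le> ennreal e"
  shows "L1_translation_continuous f"
  unfolding L1_translation_continuous_def
proof (intro allI impI)
  fix k :: "nat \<Rightarrow> 'a" assume k: "k \<longlonglongrightarrow> 0"
  show "(\<lambda>j. \<integral>\<^sup>+x. ennreal \<bar>f (x + k j) - f x\<bar> \<partial>lborel) \<longlonglongrightarrow> 0"
  proof (rule tendsto_zero_ennreal_approx)
    fix e :: real assume e: "e > 0"
    then obtain g where g: "g \<in> borel_measurable borel" "L1_translation_continuous g" "(\<integral>\<^sup>+x. ennreal \<bar>f x - g x\<bar> \<partial>lborel) \<le> ennreal (e/2)"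
      using g[of "e/2"] by auto
    show "\<exists>F. F \<longlonglongrightarrow> 0 \<and> (\<forall>j. (\<integral>\<^sup>+x. ennreal \<bar>f (x + k j) - f x\<bar> \<partial>lborel) \<le> F j + ennreal e)"
    proof (intro exI conjI allI)
      show "(\<lambda>j. \<integral>\<^sup>+x. ennreal \<bar>g (x + k j) - g x\<bar> \<partial>lborel) \<longlonglongrightarrow> 0"
        using g(2) k by (simp add: L1_translation_continuous_def)
      fix j
      have "2 * (\<integral>\<^sup>+x. ennreal \<bar>f x - g x\<bar> \<partial>lborel) \<le> 2 * ennreal (e/2)" by (rule mult_left_mono[OF g(3)]) simp
      also have "\<dots> = ennreal e" using e by (simp add: mult_2 ennreal_plus[symmetric] del: ennreal_plus)
      finally show "(\<integral>\<^sup>+x. ennreal \<bar>f (x + k j) - f x\<bar> \<partial>lborel) \<le> (\<integral>\<^sup>+x. ennreal \<bar>g (x + k j) - g x\<bar> \<partial>lborel) + ennreal e"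
        using translation_error_le[OF f g(1), of "k j"] by (meson add_left_mono order_trans)
    qed
  qed
qed

text \<open>
  By translation invariance the integrals of the positive and of the negative part of the difference
  agree, and one of them tends to \<open>0\<close> by dominated convergence because \<open>U\<close> is open.
\<close>

lemma L1_translation_continuous_open:
  fixes U :: "'a::euclidean_space set"
  assumes U: "open U" "emeasure lborel U < \<infinity>"
  shows "L1_translation_continuous (indicator U)"
  unfolding L1_translation_continuous_def
proof (intro allI impI)
  fix k :: "nat \<Rightarrow> 'a" assume k: "k \<longlonglongrightarrow> 0"
  have [measurable]: "U \<in> sets borel" using U by simp
  define A where "A j = (\<integral>\<^sup>+x. (indicator U x - indicator U (x + k j) :: ennreal) \<partial>lborel)" for j
  have "A \<longlonglongrightarrow> (\<integral>\<^sup>+x. 0 \<partial>(lborel :: 'a measure))"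
    unfolding A_def
  proof (rule nn_integral_dominated_convergence[where w="indicator U"])
    show "AE x in lborel. (\<lambda>j. indicator U x - indicator U (x + k j) :: ennreal) \<longlonglongrightarrow> 0"
    proof (rule AE_I2)
      fix x
      show "(\<lambda>j. indicator U x - indicator U (x + k j) :: ennreal) \<longlonglongrightarrow> 0"
      proof (cases "x \<in> U")
        case True
        have "(\<lambda>j. x + k j) \<longlonglongrightarrow> x + 0" by (intro tendsto_intros k)
        then have "\<forall>\<^sub>F j in sequentially. x + k j \<in> U" using U(1) True by (auto dest: topological_tendstoD)
        then have "\<forall>\<^sub>F j in sequentially. 0 = (indicator U x - indicator U (x + k j) :: ennreal)"
          by eventually_elim (use True in simp)
        then show ?thesis by (rule Lim_transform_eventually[OF tendsto_const])
      qed simp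
    qed
    show "(\<integral>\<^sup>+x. indicator U x \<partial>lborel) < \<infinity>" using U by simp
  qed (use U in \<open>auto simp: indicator_def\<close>)
  then have A0: "A \<longlonglongrightarrow> 0" by simp
  have eq: "(\<integral>\<^sup>+x. ennreal \<bar>indicator U (x + k j) - indicator U x\<bar> \<partial>lborel) = A j + A j" for j
  proof -
    define B where "B = (\<integral>\<^sup>+x. (indicator U (x + k j) - indicator U x :: ennreal) \<partial>lborel)"
    have s: "(\<integral>\<^sup>+x. indicator U (x + k j) \<partial>lborel) = emeasure lborel U"
      by (subst nn_integral_lborel_shift) auto
    have "emeasure lborel U + B = (\<integral>\<^sup>+x. indicator U x + (indicator U (x + k j) - indicator U x) \<partial>lborel)"
      unfolding B_def by (subst nn_integral_add) auto
    also have "\<dots> = (\<integral>\<^sup>+x. indicator U (x + k j) + (indicator U x - indicator U (x + k j)) \<partial>lborel)"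
      by (intro nn_integral_cong) (auto simp: indicator_def)
    also have "\<dots> = emeasure lborel U + A j"
      unfolding A_def by (subst nn_integral_add) (auto simp: s)
    finally have BA: "B = A j" using U(2) by (simp add: ennreal_add_left_cancel less_top[symmetric])
    have "(\<integral>\<^sup>+x. ennreal \<bar>indicator U (x + k j) - indicator U x\<bar> \<partial>lborel) = (\<integral>\<^sup>+x. (indicator U x - indicator U (x + k j)) + (indicator U (x + k j) - indicator U x) \<partial>lborel)"
      by (intro nn_integral_cong) (auto simp: indicator_def)
    also have "\<dots> = A j + B" unfolding A_def B_def by (rule nn_integral_add) auto
    finally show ?thesis using BA by simp
  qed
  have "(\<lambda>j. A j + A j) \<longlonglongrightarrow> 0 + 0" by (intro tendsto_add A0)
  then show "(\<lambda>j. \<integral>\<^sup>+x. ennreal \<bar>indicator U (x + k j) - indicator U x\<bar> \<partial>lborel) \<longlonglongrightarrow> 0"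
    unfolding eq by simp
qed

lemma L1_translation_continuous_cmult:
  assumes "L1_translation_continuous f" and [measurable]: "f \<in> borel_measurable borel"
  shows "L1_translation_continuous (\<lambda>x. f x * c)"
  unfolding L1_translation_continuous_def
proof (intro allI impI)
  fix k :: "nat \<Rightarrow> 'a" assume k: "k \<longlonglongrightarrow> 0"
  have eq: "(\<integral>\<^sup>+x. ennreal \<bar>f (x + k j) * c - f x * c\<bar> \<partial>lborel) = ennreal \<bar>c\<bar> * (\<integral>\<^sup>+x. ennreal \<bar>f (x + k j) - f x\<bar> \<partial>lborel)" for j
    by (subst nn_integral_cmult[symmetric])
       (auto intro!: nn_integral_cong simp: ennreal_mult'[symmetric] abs_mult[symmetric] algebra_simps)
  have "(\<lambda>j. ennreal \<bar>c\<bar> * (\<integral>\<^sup>+x. ennreal \<bar>f (x + k j) - f x\<bar> \<partial>lborel)) \<longlonglongrightarrow> ennreal \<bar>c\<bar> * 0"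
    by (rule ennreal_tendsto_cmult) (use assms(1) k in \<open>auto simp: L1_translation_continuous_def\<close>)
  then show "(\<lambda>j. \<integral>\<^sup>+x. ennreal \<bar>f (x + k j) * c - f x * c\<bar> \<partial>lborel) \<longlonglongrightarrow> 0" unfolding eq by simp
qed

text \<open>
  From open sets to Borel sets by outer regularity, and from there to integrable functions by linearity
  and approximation.
\<close>

theorem L1_translation_continuous_integrable:
  fixes f :: "'a::euclidean_space \<Rightarrow> real"
  assumes "integrable lborel f"
  shows "L1_translation_continuous f"
  using assms
proof (induction f rule: integrable_induct)
  case (base A c)
  have A: "A \<in> sets borel" using base by simp
  have "L1_translation_continuous (indicator A)"
  proof (rule L1_translation_continuous_approx)
    fix e :: real assume "e > 0"
    then obtain U where U: "open U" "A \<subseteq> U" "emeasure lborel (U - A) < ennreal e"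
      using outer_regular_lborel[OF A, of e] by auto
    have "emeasure lborel U = emeasure lborel A + emeasure lborel (U - A)"
      using U A by (subst plus_emeasure) (auto intro!: arg_cong[where f="emeasure lborel"])
    also have "\<dots> < \<infinity>" using U(3) base(2) less_trans[OF U(3), of top] by (simp add: less_top)
    finally have "L1_translation_continuous (indicator U)" by (rule L1_translation_continuous_open[OF U(1)])
    moreover have "(\<integral>\<^sup>+x. ennreal \<bar>indicator A x - indicator U x\<bar> \<partial>lborel) = emeasure lborel (U - A)"
    proof -
      have "(\<integral>\<^sup>+x. ennreal \<bar>indicator A x - indicator U x\<bar> \<partial>lborel) = (\<integral>\<^sup>+x. indicator (U - A) x \<partial>lborel)"
        using U(2) by (intro nn_integral_cong) (auto simp: indicator_def)
      then show ?thesis using U A by simp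
    qed
    ultimately show "\<exists>g\<in>borel_measurable borel. L1_translation_continuous g \<and> (\<integral>\<^sup>+x. ennreal \<bar>indicator A x - g x\<bar> \<partial>lborel) \<le> ennreal e"
      using U by (intro bexI[of _ "indicator U"]) auto
  qed (use A in simp)
  then have "L1_translation_continuous (\<lambda>x. indicator A x * c)"
    by (rule L1_translation_continuous_cmult) (use A in simp)
  then show ?case by simp
next
  case (add f g)
  have [measurable]: "f \<in> borel_measurable borel" "g \<in> borel_measurable borel" using add by auto
  show ?case
    unfolding L1_translation_continuous_def
  proof (intro allI impI)
    fix k :: "nat \<Rightarrow> 'a" assume k: "k \<longlonglongrightarrow> 0"
    have "(\<lambda>j. (\<integral>\<^sup>+x. ennreal \<bar>f (x + k j) - f x\<bar> \<partial>lborel) + (\<integral>\<^sup>+x. ennreal \<bar>g (x + k j) - g x\<bar> \<partial>lborel)) \<longlonglongrightarrow> 0 + 0"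
      using add k by (intro tendsto_add) (auto simp: L1_translation_continuous_def)
    then have lim: "(\<lambda>j. (\<integral>\<^sup>+x. ennreal \<bar>f (x + k j) - f x\<bar> \<partial>lborel) + (\<integral>\<^sup>+x. ennreal \<bar>g (x + k j) - g x\<bar> \<partial>lborel)) \<longlonglongrightarrow> 0" by simp
    show "(\<lambda>j. \<integral>\<^sup>+x. ennreal \<bar>f (x + k j) + g (x + k j) - (f x + g x)\<bar> \<partial>lborel) \<longlonglongrightarrow> 0"
    proof (rule tendsto_sandwich[OF _ _ tendsto_const lim])
      show "\<forall>\<^sub>F j in sequentially. (\<integral>\<^sup>+x. ennreal \<bar>f (x + k j) + g (x + k j) - (f x + g x)\<bar> \<partial>lborel) \<le> (\<integral>\<^sup>+x. ennreal \<bar>f (x + k j) - f x\<bar> \<partial>lborel) + (\<integral>\<^sup>+x. ennreal \<bar>g (x + k j) - g x\<bar> \<partial>lborel)"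
      proof (rule always_eventually, rule allI)
        fix j
        have "(\<integral>\<^sup>+x. ennreal \<bar>f (x + k j) + g (x + k j) - (f x + g x)\<bar> \<partial>lborel) \<le> (\<integral>\<^sup>+x. ennreal \<bar>f (x + k j) - f x\<bar> + ennreal \<bar>g (x + k j) - g x\<bar> \<partial>lborel)"
          by (intro nn_integral_mono) (simp add: ennreal_plus[symmetric] del: ennreal_plus)
        also have "\<dots> = (\<integral>\<^sup>+x. ennreal \<bar>f (x + k j) - f x\<bar> \<partial>lborel) + (\<integral>\<^sup>+x. ennreal \<bar>g (x + k j) - g x\<bar> \<partial>lborel)"
          by (rule nn_integral_add) auto
        finally show "(\<integral>\<^sup>+x. ennreal \<bar>f (x + k j) + g (x + k j) - (f x + g x)\<bar> \<partial>lborel) \<le> (\<integral>\<^sup>+x. ennreal \<bar>f (x + k j) - f x\<bar> \<partial>lborel) + (\<integral>\<^sup>+x. ennreal \<bar>g (x + k j) - g x\<bar> \<partial>lborel)" .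
      qed
    qed simp
  qed
next
  case (lim f s)
  have [measurable]: "f \<in> borel_measurable borel" "\<And>i. s i \<in> borel_measurable borel" using lim by auto
  show ?case
  proof (rule L1_translation_continuous_approx)
    fix e :: real assume e: "e > 0"
    have "(\<lambda>i. \<integral>\<^sup>+x. ennreal \<bar>f x - s i x\<bar> \<partial>lborel) \<longlonglongrightarrow> (\<integral>\<^sup>+x. ennreal 0 \<partial>(lborel :: 'a measure))"
    proof (rule nn_integral_dominated_convergence[where w="\<lambda>x. ennreal (3 * \<bar>f x\<bar>)"])
      show "(\<integral>\<^sup>+x. ennreal (3 * \<bar>f x\<bar>) \<partial>lborel) < \<infinity>"
        using lim(4) by (simp add: integrable_iff_bounded ennreal_mult' nn_integral_cmult ennreal_mult_less_top)
      show "AE x in lborel. (\<lambda>i. ennreal \<bar>f x - s i x\<bar>) \<longlonglongrightarrow> ennreal 0"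
      proof (rule AE_I2)
        fix x
        have "(\<lambda>i. \<bar>f x - s i x\<bar>) \<longlonglongrightarrow> \<bar>f x - f x\<bar>" by (intro tendsto_intros lim(2)) simp
        then show "(\<lambda>i. ennreal \<bar>f x - s i x\<bar>) \<longlonglongrightarrow> ennreal 0" by (intro tendsto_ennrealI) simp
      qed
      show "AE x in lborel. ennreal \<bar>f x - s i x\<bar> \<le> ennreal (3 * \<bar>f x\<bar>)" for i
      proof (intro AE_I2 ennreal_leI)
        fix x show "\<bar>f x - s i x\<bar> \<le> 3 * \<bar>f x\<bar>" using lim(3)[of x i] by simp
      qed
    qed auto
    then have "\<forall>\<^sub>F i in sequentially. (\<integral>\<^sup>+x. ennreal \<bar>f x - s i x\<bar> \<partial>lborel) < ennreal e"
      using e by (intro order_tendstoD(2)) auto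
    then obtain i where "(\<integral>\<^sup>+x. ennreal \<bar>f x - s i x\<bar> \<partial>lborel) < ennreal e" by (auto simp: eventually_sequentially)
    then show "\<exists>g\<in>borel_measurable borel. L1_translation_continuous g \<and> (\<integral>\<^sup>+x. ennreal \<bar>f x - g x\<bar> \<partial>lborel) \<le> ennreal e"
      using lim(5) by (intro bexI[of _ "s i"]) (auto simp: less_imp_le)
  qed simp
qed

text \<open>
  The map \<open>f \<mapsto> signed_powr p \<circ> f\<close> carries \<open>L\<^sup>p\<close> to \<open>L\<^sup>1\<close>, which reduces continuity of translations in
  \<open>L\<^sup>p\<close> to the case of \<open>L\<^sup>1\<close>.
\<close>

definition signed_powr :: "real \<Rightarrow> real \<Rightarrow> real" where
  "signed_powr p a = sgn a * \<bar>a\<bar> powr p"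

lemma powr_superadditive:
  fixes x y :: real
  assumes "p \<ge> 1" "x \<ge> 0" "y \<ge> 0"
  shows "x powr p + y powr p \<le> (x + y) powr p"
proof -
  have e: "a powr p = a * a powr (p - 1)" if "a \<ge> 0" for a :: real
  proof (cases "a = 0")
    case False
    then have "a powr p = a powr (1 + (p - 1))" by simp
    also have "\<dots> = a * a powr (p - 1)" using that False by (subst powr_add) simp
    finally show ?thesis .
  qed simp
  have "x * x powr (p - 1) + y * y powr (p - 1) \<le> x * (x + y) powr (p - 1) + y * (x + y) powr (p - 1)"
    using assms by (intro add_mono mult_left_mono powr_mono2) auto
  then show ?thesis using assms by (simp add: e algebra_simps)
qed

lemma powr_sum_le:
  fixes x y :: real
  assumes "p \<ge> 0" "x \<ge> 0" "y \<ge> 0"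
  shows "(x + y) powr p \<le> 2 powr p * (x powr p + y powr p)"
proof -
  have "(x + y) powr p \<le> (2 * max x y) powr p" using assms by (intro powr_mono2) auto
  also have "\<dots> = 2 powr p * max x y powr p" using assms by (simp add: powr_mult)
  also have "max x y powr p \<le> x powr p + y powr p" by (simp add: max_def)
  finally show ?thesis by simp
qed

lemma diff_powr_le_signed_powr:
  assumes p: "p \<ge> 1"
  shows "\<bar>a - b\<bar> powr p \<le> 2 powr p * \<bar>signed_powr p a - signed_powr p b\<bar>"
proof -
  have two: "1 \<le> 2 powr p" using p by (simp add: ge_one_powr_ge_zero)
  have pos: "\<bar>a - b\<bar> powr p \<le> 2 powr p * \<bar>a powr p - b powr p\<bar>" if "0 \<le> a" "0 \<le> b" for a b :: real
  proof -
    have w: "\<bar>a - b\<bar> powr p \<le> a powr p - b powr p" if "b \<le> a" "0 \<le> b" for a b :: real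
      using powr_superadditive[OF p, of "a - b" b] that by simp
    have "\<bar>a - b\<bar> powr p \<le> \<bar>a powr p - b powr p\<bar>"
    proof (cases "b \<le> a")
      case True then show ?thesis using w[of b a] that by linarith
    next
      case False then show ?thesis using w[of a b] that by (simp add: abs_minus_commute)
    qed
    also have "\<dots> \<le> 2 powr p * \<bar>a powr p - b powr p\<bar>" using mult_right_mono[OF two, of "\<bar>a powr p - b powr p\<bar>"] by simp
    finally show ?thesis .
  qed
  consider "0 \<le> a" "0 \<le> b" | "a < 0" "b < 0" | "0 \<le> a" "b < 0" | "a < 0" "0 \<le> b" by linarith
  then show ?thesis
  proof cases
    case 1
    have "signed_powr p a = a powr p" "signed_powr p b = b powr p" using 1 by (auto simp: signed_powr_def sgn_if)
    then show ?thesis using pos[OF 1] by simp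
  next
    case 2
    have "signed_powr p a = - ((-a) powr p)" "signed_powr p b = - ((-b) powr p)" using 2 by (auto simp: signed_powr_def)
    then show ?thesis using pos[of "-a" "-b"] 2 by (simp add: abs_minus_commute)
  next
    case 3
    have "signed_powr p a = a powr p" "signed_powr p b = - ((-b) powr p)" using 3 by (auto simp: signed_powr_def sgn_if)
    then show ?thesis using powr_sum_le[of p a "-b"] 3 p by simp
  next
    case 4
    have "signed_powr p a = - ((-a) powr p)" "signed_powr p b = b powr p" using 4 by (auto simp: signed_powr_def sgn_if)
    then show ?thesis using powr_sum_le[of p "-a" b] 4 p by (simp add: abs_minus_commute add.commute)
  qed
qed

theorem Lp_translation_continuous:
  fixes f :: "'a::euclidean_space \<Rightarrow> real" and k :: "nat \<Rightarrow> 'a"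
  assumes p: "p \<ge> 1" and [measurable]: "f \<in> borel_measurable borel"
    and fin: "(\<integral>\<^sup>+x. ennreal (\<bar>f x\<bar> powr p) \<partial>lborel) < \<infinity>" and k: "k \<longlonglongrightarrow> 0"
  shows "(\<lambda>j. \<integral>\<^sup>+x. ennreal (\<bar>f (x + k j) - f x\<bar> powr p) \<partial>lborel) \<longlonglongrightarrow> 0"
proof -
  define S where "S x = signed_powr p (f x)" for x
  have [measurable]: "S \<in> borel_measurable borel" unfolding S_def signed_powr_def by measurable
  have "\<bar>S x\<bar> = \<bar>f x\<bar> powr p" for x by (auto simp: S_def signed_powr_def abs_mult sgn_if)
  then have "integrable lborel S" using fin by (simp add: integrable_iff_bounded)
  then have "L1_translation_continuous S" by (rule L1_translation_continuous_integrable)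
  then have "(\<lambda>j. \<integral>\<^sup>+x. ennreal \<bar>S (x + k j) - S x\<bar> \<partial>lborel) \<longlonglongrightarrow> 0"
    using k by (simp add: L1_translation_continuous_def)
  then have "(\<lambda>j. ennreal (2 powr p) * (\<integral>\<^sup>+x. ennreal \<bar>S (x + k j) - S x\<bar> \<partial>lborel)) \<longlonglongrightarrow> ennreal (2 powr p) * 0"
    by (intro ennreal_tendsto_cmult) auto
  then have lim: "(\<lambda>j. ennreal (2 powr p) * (\<integral>\<^sup>+x. ennreal \<bar>S (x + k j) - S x\<bar> \<partial>lborel)) \<longlonglongrightarrow> 0" by simp
  show ?thesis
  proof (rule tendsto_sandwich[OF _ _ tendsto_const lim])
    show "\<forall>\<^sub>F j in sequentially. (\<integral>\<^sup>+x. ennreal (\<bar>f (x + k j) - f x\<bar> powr p) \<partial>lborel) \<le> ennreal (2 powr p) * (\<integral>\<^sup>+x. ennreal \<bar>S (x + k j) - S x\<bar> \<partial>lborel)"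
    proof (rule always_eventually, rule allI)
      fix j
      have "(\<integral>\<^sup>+x. ennreal (\<bar>f (x + k j) - f x\<bar> powr p) \<partial>lborel) \<le> (\<integral>\<^sup>+x. ennreal (2 powr p) * ennreal \<bar>S (x + k j) - S x\<bar> \<partial>lborel)"
        using diff_powr_le_signed_powr[OF p] by (intro nn_integral_mono) (simp add: S_def ennreal_mult'[symmetric])
      then show "(\<integral>\<^sup>+x. ennreal (\<bar>f (x + k j) - f x\<bar> powr p) \<partial>lborel) \<le> ennreal (2 powr p) * (\<integral>\<^sup>+x. ennreal \<bar>S (x + k j) - S x\<bar> \<partial>lborel)"
        by (simp add: nn_integral_cmult)
    qed
  qed simp
qed

section \<open>Segment averages and energies of difference quotients\<close>

lemma tendsto_by_subsequences:
  fixes a :: "nat \<Rightarrow> 'b::topological_space"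
  assumes "\<And>r::nat \<Rightarrow> nat. strict_mono r \<Longrightarrow> \<exists>r'::nat \<Rightarrow> nat. strict_mono r' \<and> (\<lambda>j. a (r (r' j))) \<longlonglongrightarrow> L"
  shows "a \<longlonglongrightarrow> L"
proof (rule topological_tendstoI, rule ccontr)
  fix S assume S: "open S" "L \<in> S" and "\<not> (\<forall>\<^sub>F j in sequentially. a j \<in> S)"
  then have "\<forall>N. \<exists>n\<ge>N. n \<in> {n. a n \<notin> S}" by (auto simp: eventually_sequentially)
  then have "infinite {n. a n \<notin> S}" by (simp add: infinite_nat_iff_unbounded_le)
  then obtain r :: "nat \<Rightarrow> nat" where r: "strict_mono r" "\<And>n. a (r n) \<notin> S"
    using infinite_enumerate by blast
  obtain r' :: "nat \<Rightarrow> nat" where r': "(\<lambda>j. a (r (r' j))) \<longlonglongrightarrow> L" using assms[OF r(1)] by blast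
  have "\<forall>\<^sub>F j in sequentially. a (r (r' j)) \<in> S" using topological_tendstoD[OF r' S] .
  then have "\<forall>\<^sub>F j in sequentially. False" by eventually_elim (use r(2) in blast)
  then show False by simp
qed

text \<open>
  Pratt's form of dominated convergence, with majorants that vary: apply Fatou's lemma to \<open>F\<close> and to
  \<open>B - F\<close>.
\<close>

lemma generalized_dominated_convergence:
  fixes F B :: "nat \<Rightarrow> 'a \<Rightarrow> ennreal"
  assumes [measurable]: "\<And>j. F j \<in> borel_measurable M" "\<And>j. B j \<in> borel_measurable M"
      "F' \<in> borel_measurable M" "B' \<in> borel_measurable M"
    and le: "\<And>j. AE x in M. F j x \<le> B j x"
    and F: "AE x in M. (\<lambda>j. F j x) \<longlonglongrightarrow> F' x" and B: "AE x in M. (\<lambda>j. B j x) \<longlonglongrightarrow> B' x"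
    and B_le: "\<And>j. (\<integral>\<^sup>+x. B j x \<partial>M) \<le> (\<integral>\<^sup>+x. B' x \<partial>M)" and fin: "(\<integral>\<^sup>+x. B' x \<partial>M) < \<infinity>"
  shows "(\<lambda>j. \<integral>\<^sup>+x. F j x \<partial>M) \<longlonglongrightarrow> (\<integral>\<^sup>+x. F' x \<partial>M)"
proof -
  define a where "a j = (\<integral>\<^sup>+x. F j x \<partial>M)" for j
  define A where "A = (\<integral>\<^sup>+x. F' x \<partial>M)"
  define \<beta> where "\<beta> = (\<integral>\<^sup>+x. B' x \<partial>M)"
  have leAE: "AE x in M. \<forall>j. F j x \<le> B j x" using le by (simp add: AE_all_countable)
  have F'B': "AE x in M. F' x \<le> B' x"
    using leAE F B by eventually_elim (auto intro: LIMSEQ_le)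
  have finB': "AE x in M. B' x \<noteq> \<infinity>" by (rule nn_integral_PInf_AE) (use fin in auto)
  have A\<beta>: "A \<le> \<beta>" unfolding A_def \<beta>_def by (rule nn_integral_mono_AE[OF F'B'])
  have a\<beta>: "a j \<le> \<beta>" for j
    unfolding a_def \<beta>_def using nn_integral_mono_AE[OF le[of j]] B_le[of j] by (rule order_trans)
  have \<beta>: "\<beta> < top" using fin by (simp add: \<beta>_def)
  have "A = (\<integral>\<^sup>+x. liminf (\<lambda>j. F j x) \<partial>M)"
    unfolding A_def by (rule nn_integral_cong_AE) (use F in eventually_elim, auto dest: lim_imp_Liminf[OF sequentially_bot])
  also have "\<dots> \<le> liminf a" unfolding a_def by (rule nn_integral_liminf) simp
  finally have lo: "A \<le> liminf a" .
  have "\<beta> - A = (\<integral>\<^sup>+x. B' x - F' x \<partial>M)"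
    unfolding A_def \<beta>_def using A\<beta> \<beta> by (intro nn_integral_diff[symmetric] F'B') (auto simp: A_def \<beta>_def top_unique)
  also have "\<dots> = (\<integral>\<^sup>+x. liminf (\<lambda>j. B j x - F j x) \<partial>M)"
  proof (rule nn_integral_cong_AE)
    show "AE x in M. B' x - F' x = liminf (\<lambda>j. B j x - F j x)"
      using F B finB' F'B'
    proof eventually_elim
      case (elim x)
      have "(\<lambda>j. B j x - F j x) \<longlonglongrightarrow> B' x - F' x"
        using elim by (intro tendsto_diff_ennreal_general) auto
      then show ?case using lim_imp_Liminf[OF sequentially_bot] by metis
    qed
  qed
  also have "\<dots> \<le> liminf (\<lambda>j. \<integral>\<^sup>+x. B j x - F j x \<partial>M)" by (rule nn_integral_liminf) simp
  also have "\<dots> \<le> liminf (\<lambda>j. \<beta> - a j)"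
  proof (rule Liminf_mono, rule always_eventually, rule allI)
    fix j
    have "(\<integral>\<^sup>+x. B j x - F j x \<partial>M) = (\<integral>\<^sup>+x. B j x \<partial>M) - a j"
      unfolding a_def using a\<beta>[of j] \<beta> by (intro nn_integral_diff le) (auto simp: a_def top_unique)
    also have "\<dots> \<le> \<beta> - a j" unfolding \<beta>_def by (intro ennreal_minus_mono B_le order_refl)
    finally show "(\<integral>\<^sup>+x. B j x - F j x \<partial>M) \<le> \<beta> - a j" .
  qed
  finally have hi: "\<beta> - A \<le> liminf (\<lambda>j. \<beta> - a j)" .
  have "a \<longlonglongrightarrow> A"
  proof (rule order_tendstoI)
    fix y assume "y < A"
    then show "\<forall>\<^sub>F j in sequentially. y < a j" using lo less_LiminfD less_le_trans by blast
  next
    fix y assume y: "A < y"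
    show "\<forall>\<^sub>F j in sequentially. a j < y"
    proof (cases "y \<le> \<beta>")
      case True
      have "\<beta> - y < \<beta> - A"
        using y True \<beta> A\<beta> by (cases y; cases A; cases \<beta>) (auto simp: ennreal_minus ennreal_less_iff top_unique)
      then have "\<forall>\<^sub>F j in sequentially. \<beta> - y < \<beta> - a j" using hi less_LiminfD less_le_trans by blast
      then show ?thesis
      proof eventually_elim
        case (elim j)
        show ?case
        proof (rule ccontr)
          assume "\<not> a j < y"
          then have "\<beta> - a j \<le> \<beta> - y" by (intro ennreal_minus_mono) auto
          with elim show False by simp
        qed
      qed
    next
      case False
      then have "\<beta> < y" by simp
      then show ?thesis using a\<beta> by (intro always_eventually allI) (rule le_less_trans)
    qed
  qed
  then show ?thesis unfolding a_def A_def .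
qed

text \<open>
  If \<open>f\<close> is the directional derivative of \<open>u\<close> along \<open>h\<close>, this is the increment of \<open>u\<close> from \<open>x\<close> to \<open>x + h\<close>.
\<close>

definition seg_avg :: "'a::euclidean_space \<Rightarrow> ('a \<Rightarrow> real) \<Rightarrow> 'a \<Rightarrow> real" where
  "seg_avg h f x = (\<integral>t. indicator {0..1} t * f (x + t *\<^sub>R h) \<partial>lborel)"

lemma seg_avg_measurable [measurable]:
  assumes [measurable]: "f \<in> borel_measurable borel"
  shows "seg_avg h f \<in> borel_measurable borel"
  unfolding seg_avg_def by measurable

context
  fixes f :: "'a::euclidean_space \<Rightarrow> real" and p :: real
  assumes p: "p > 1" and fm [measurable]: "f \<in> borel_measurable borel"
begin

lemma nn_integral_segments:
  "(\<integral>\<^sup>+x. \<integral>\<^sup>+t. indicator {0..1} t * ennreal (\<bar>f (x + t *\<^sub>R h)\<bar> powr p) \<partial>lborel \<partial>lborel) = (\<integral>\<^sup>+x. ennreal (\<bar>f x\<bar> powr p) \<partial>lborel)"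
proof -
  have "(\<integral>\<^sup>+x. \<integral>\<^sup>+t. indicator {0..1} t * ennreal (\<bar>f (x + t *\<^sub>R h)\<bar> powr p) \<partial>lborel \<partial>lborel)
     = (\<integral>\<^sup>+t. \<integral>\<^sup>+x. indicator {0..1} t * ennreal (\<bar>f (x + t *\<^sub>R h)\<bar> powr p) \<partial>lborel \<partial>lborel)"
    by (rule lborel_pair.Fubini'[symmetric]) measurable
  also have "\<dots> = (\<integral>\<^sup>+t. (\<integral>\<^sup>+x. ennreal (\<bar>f x\<bar> powr p) \<partial>lborel) * indicator {0..1::real} t \<partial>lborel)"
  proof (rule nn_integral_cong)
    fix t :: real
    have "(\<integral>\<^sup>+x. indicator {0..1} t * ennreal (\<bar>f (x + t *\<^sub>R h)\<bar> powr p) \<partial>lborel) = indicator {0..1} t * (\<integral>\<^sup>+x. ennreal (\<bar>f (x + t *\<^sub>R h)\<bar> powr p) \<partial>lborel)"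
      by (rule nn_integral_cmult) measurable
    also have "(\<integral>\<^sup>+x. ennreal (\<bar>f (x + t *\<^sub>R h)\<bar> powr p) \<partial>lborel) = (\<integral>\<^sup>+x. ennreal (\<bar>f x\<bar> powr p) \<partial>lborel)"
      by (rule nn_integral_lborel_shift) measurable
    finally show "(\<integral>\<^sup>+x. indicator {0..1} t * ennreal (\<bar>f (x + t *\<^sub>R h)\<bar> powr p) \<partial>lborel) = (\<integral>\<^sup>+x. ennreal (\<bar>f x\<bar> powr p) \<partial>lborel) * indicator {0..1} t"
      by (simp add: mult.commute)
  qed
  also have "\<dots> = (\<integral>\<^sup>+x. ennreal (\<bar>f x\<bar> powr p) \<partial>lborel)"
    by (subst nn_integral_cmult_indicator) auto
  finally show ?thesis .
qed

text \<open>
  Jensen's inequality on each segment, then Fubini and translation invariance.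
\<close>

lemma seg_avg_Lp_le:
  "(\<integral>\<^sup>+x. ennreal (\<bar>seg_avg h f x\<bar> powr p) \<partial>lborel) \<le> (\<integral>\<^sup>+x. ennreal (\<bar>f x\<bar> powr p) \<partial>lborel)"
proof -
  have "(\<integral>\<^sup>+x. ennreal (\<bar>seg_avg h f x\<bar> powr p) \<partial>lborel) \<le> (\<integral>\<^sup>+x. \<integral>\<^sup>+t. indicator {0..1} t * ennreal (\<bar>f (x + t *\<^sub>R h)\<bar> powr p) \<partial>lborel \<partial>lborel)"
    unfolding seg_avg_def by (intro nn_integral_mono jensen_unit_interval[OF p]) measurable
  then show ?thesis unfolding nn_integral_segments .
qed

lemma AE_segment_integrable:
  assumes fin: "(\<integral>\<^sup>+x. ennreal (\<bar>f x\<bar> powr p) \<partial>lborel) < \<infinity>"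
  shows "AE x in lborel. integrable lborel (\<lambda>t. indicator {0..1} t * f (x + t *\<^sub>R h))"
proof -
  have "AE x in lborel. (\<integral>\<^sup>+t. indicator {0..1} t * ennreal (\<bar>f (x + t *\<^sub>R h)\<bar> powr p) \<partial>lborel) \<noteq> \<infinity>"
    by (rule nn_integral_PInf_AE, measurable) (use fin in \<open>simp add: nn_integral_segments less_top[symmetric]\<close>)
  then show ?thesis
    by eventually_elim (use p in \<open>auto intro!: integrable_unit_interval_powr(2)[of p]\<close>)
qed

lemma seg_avg_error:
  assumes fin: "(\<integral>\<^sup>+x. ennreal (\<bar>f x\<bar> powr p) \<partial>lborel) < \<infinity>"
  shows "(\<integral>\<^sup>+x. ennreal (\<bar>seg_avg h f x - f x\<bar> powr p) \<partial>lborel)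
    \<le> (\<integral>\<^sup>+t. indicator {0..1} t * (\<integral>\<^sup>+x. ennreal (\<bar>f (x + t *\<^sub>R h) - f x\<bar> powr p) \<partial>lborel) \<partial>lborel)"
proof -
  have "(\<integral>\<^sup>+x. ennreal (\<bar>seg_avg h f x - f x\<bar> powr p) \<partial>lborel) \<le> (\<integral>\<^sup>+x. \<integral>\<^sup>+t. indicator {0..1} t * ennreal (\<bar>f (x + t *\<^sub>R h) - f x\<bar> powr p) \<partial>lborel \<partial>lborel)"
  proof (rule nn_integral_mono_AE)
    show "AE x in lborel. ennreal (\<bar>seg_avg h f x - f x\<bar> powr p) \<le> (\<integral>\<^sup>+t. indicator {0..1} t * ennreal (\<bar>f (x + t *\<^sub>R h) - f x\<bar> powr p) \<partial>lborel)"
      using AE_segment_integrable[OF fin, of h]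
    proof eventually_elim
      case (elim x)
      have c: "integrable lborel (\<lambda>t::real. indicator {0..1} t * f x)" by (rule integrable_mult_left) simp
      have "(\<integral>t. indicator {0..1} t * (f (x + t *\<^sub>R h) - f x) \<partial>lborel) = (\<integral>t. indicator {0..1} t * f (x + t *\<^sub>R h) - indicator {0..1} t * f x \<partial>lborel)"
        by (simp add: algebra_simps)
      also have "\<dots> = seg_avg h f x - (\<integral>t. indicator {0..1::real} t * f x \<partial>lborel)"
        unfolding seg_avg_def using elim c by (rule Bochner_Integration.integral_diff)
      also have "(\<integral>t. indicator {0..1::real} t * f x \<partial>lborel) = f x" by simp
      finally show ?case
        using jensen_unit_interval[OF p, of "\<lambda>t. f (x + t *\<^sub>R h) - f x"] by simp
    qed
  qed
  also have "\<dots> = (\<integral>\<^sup>+t. \<integral>\<^sup>+x. indicator {0..1} t * ennreal (\<bar>f (x + t *\<^sub>R h) - f x\<bar> powr p) \<partial>lborel \<partial>lborel)"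
    by (rule lborel_pair.Fubini'[symmetric]) measurable
  also have "\<dots> = (\<integral>\<^sup>+t. indicator {0..1} t * (\<integral>\<^sup>+x. ennreal (\<bar>f (x + t *\<^sub>R h) - f x\<bar> powr p) \<partial>lborel) \<partial>lborel)"
    by (intro nn_integral_cong nn_integral_cmult) measurable
  finally show ?thesis .
qed

lemma seg_avg_Lp_tendsto:
  fixes h :: "nat \<Rightarrow> 'a"
  assumes fin: "(\<integral>\<^sup>+x. ennreal (\<bar>f x\<bar> powr p) \<partial>lborel) < \<infinity>" and h: "h \<longlonglongrightarrow> 0"
  shows "(\<lambda>j. \<integral>\<^sup>+x. ennreal (\<bar>seg_avg (h j) f x - f x\<bar> powr p) \<partial>lborel) \<longlonglongrightarrow> 0"
proof -
  define N where "N = (\<integral>\<^sup>+x. ennreal (\<bar>f x\<bar> powr p) \<partial>lborel)"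
  have bound: "(\<integral>\<^sup>+x. ennreal (\<bar>f (x + k) - f x\<bar> powr p) \<partial>lborel) \<le> ennreal (2 powr p) * (N + N)" for k
  proof -
    have "(\<integral>\<^sup>+x. ennreal (\<bar>f (x + k) - f x\<bar> powr p) \<partial>lborel) \<le> (\<integral>\<^sup>+x. ennreal (2 powr p) * (ennreal (\<bar>f (x + k)\<bar> powr p) + ennreal (\<bar>f x\<bar> powr p)) \<partial>lborel)"
    proof (rule nn_integral_mono)
      fix x
      have "\<bar>f (x + k) - f x\<bar> powr p \<le> (\<bar>f (x + k)\<bar> + \<bar>f x\<bar>) powr p" using p by (intro powr_mono2) auto
      also have "\<dots> \<le> 2 powr p * (\<bar>f (x + k)\<bar> powr p + \<bar>f x\<bar> powr p)" using p by (intro powr_sum_le) auto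
      finally show "ennreal (\<bar>f (x + k) - f x\<bar> powr p) \<le> ennreal (2 powr p) * (ennreal (\<bar>f (x + k)\<bar> powr p) + ennreal (\<bar>f x\<bar> powr p))"
        by (simp add: ennreal_mult'[symmetric] ennreal_plus[symmetric] del: ennreal_plus)
    qed
    also have "\<dots> = ennreal (2 powr p) * ((\<integral>\<^sup>+x. ennreal (\<bar>f (x + k)\<bar> powr p) \<partial>lborel) + N)"
      unfolding N_def by (subst nn_integral_cmult, measurable, subst nn_integral_add) auto
    also have "(\<integral>\<^sup>+x. ennreal (\<bar>f (x + k)\<bar> powr p) \<partial>lborel) = N"
      unfolding N_def by (rule nn_integral_lborel_shift) measurable
    finally show ?thesis .
  qed
  have "(\<lambda>j. \<integral>\<^sup>+t. indicator {0..1} t * (\<integral>\<^sup>+x. ennreal (\<bar>f (x + t *\<^sub>R h j) - f x\<bar> powr p) \<partial>lborel) \<partial>lborel) \<longlonglongrightarrow> (\<integral>\<^sup>+t. 0 \<partial>(lborel :: real measure))"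
  proof (rule nn_integral_dominated_convergence[where w="\<lambda>t. ennreal (2 powr p) * (N + N) * indicator {0..1} t"])
    show "AE t in lborel. (\<lambda>j. indicator {0..1} t * (\<integral>\<^sup>+x. ennreal (\<bar>f (x + t *\<^sub>R h j) - f x\<bar> powr p) \<partial>lborel)) \<longlonglongrightarrow> 0"
    proof (rule AE_I2)
      fix t :: real
      have "(\<lambda>j. t *\<^sub>R h j) \<longlonglongrightarrow> t *\<^sub>R 0" by (intro tendsto_intros h)
      then have "(\<lambda>j. \<integral>\<^sup>+x. ennreal (\<bar>f (x + t *\<^sub>R h j) - f x\<bar> powr p) \<partial>lborel) \<longlonglongrightarrow> 0"
        using p by (intro Lp_translation_continuous fin) auto
      then have "(\<lambda>j. indicator {0..1} t * (\<integral>\<^sup>+x. ennreal (\<bar>f (x + t *\<^sub>R h j) - f x\<bar> powr p) \<partial>lborel)) \<longlonglongrightarrow> indicator {0..1} t * 0"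
        by (intro ennreal_tendsto_cmult) (auto simp: indicator_def)
      then show "(\<lambda>j. indicator {0..1} t * (\<integral>\<^sup>+x. ennreal (\<bar>f (x + t *\<^sub>R h j) - f x\<bar> powr p) \<partial>lborel)) \<longlonglongrightarrow> 0" by simp
    qed
    show "AE t in lborel. indicator {0..1} t * (\<integral>\<^sup>+x. ennreal (\<bar>f (x + t *\<^sub>R h j) - f x\<bar> powr p) \<partial>lborel) \<le> ennreal (2 powr p) * (N + N) * indicator {0..1} t" for j
      using bound by (intro AE_I2) (auto simp: indicator_def)
    show "(\<integral>\<^sup>+t. ennreal (2 powr p) * (N + N) * indicator {0..1::real} t \<partial>lborel) < \<infinity>"
      using fin by (subst nn_integral_cmult_indicator) (auto simp: N_def ennreal_mult_less_top)
  qed measurable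
  then have lim: "(\<lambda>j. \<integral>\<^sup>+t. indicator {0..1} t * (\<integral>\<^sup>+x. ennreal (\<bar>f (x + t *\<^sub>R h j) - f x\<bar> powr p) \<partial>lborel) \<partial>lborel) \<longlonglongrightarrow> 0" by simp
  show ?thesis
    by (rule tendsto_sandwich[OF _ _ tendsto_const lim]) (auto intro!: always_eventually seg_avg_error[OF fin])
qed

lemma seg_avg_AE_subseq:
  fixes h :: "nat \<Rightarrow> 'a"
  assumes fin: "(\<integral>\<^sup>+x. ennreal (\<bar>f x\<bar> powr p) \<partial>lborel) < \<infinity>" and h: "h \<longlonglongrightarrow> 0"
  shows "\<exists>r::nat \<Rightarrow> nat. strict_mono r \<and> (AE x in lborel. (\<lambda>j. seg_avg (h (r j)) f x) \<longlonglongrightarrow> f x)"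
proof -
  define E where "E j x = \<bar>seg_avg (h j) f x - f x\<bar> powr p" for j x
  have [measurable]: "E j \<in> borel_measurable borel" for j unfolding E_def by measurable
  have lim: "(\<lambda>j. \<integral>\<^sup>+x. ennreal (E j x) \<partial>lborel) \<longlonglongrightarrow> 0"
    unfolding E_def by (rule seg_avg_Lp_tendsto[OF fin h])
  have "\<forall>\<^sub>F j in sequentially. (\<integral>\<^sup>+x. ennreal (E j x) \<partial>lborel) < 1" by (rule order_tendstoD(2)[OF lim]) simp
  \<comment> \<open>From \<open>J\<close> on the convergence itself shows that the terms are integrable.\<close>
  then obtain J where J: "\<And>j. j \<ge> J \<Longrightarrow> (\<integral>\<^sup>+x. ennreal (E j x) \<partial>lborel) < 1" by (auto simp: eventually_sequentially)
  have int: "integrable lborel (E (j + J))" for j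
  proof (rule integrableI_bounded)
    have "(\<integral>\<^sup>+x. ennreal (norm (E (j + J) x)) \<partial>lborel) = (\<integral>\<^sup>+x. ennreal (E (j + J) x) \<partial>lborel)" by (simp add: E_def)
    also have "\<dots> < 1" by (rule J) simp
    finally show "(\<integral>\<^sup>+x. ennreal (norm (E (j + J) x)) \<partial>lborel) < \<infinity>" by (rule less_trans) simp
  qed simp
  have "(\<lambda>j. \<integral>x. norm (E (j + J) x) \<partial>lborel) \<longlonglongrightarrow> 0"
  proof -
    have e: "ennreal (\<integral>x. norm (E (j + J) x) \<partial>lborel) = (\<integral>\<^sup>+x. ennreal (E (j + J) x) \<partial>lborel)" for j
    proof -
      have n: "norm (E i x) = E i x" for i x by (simp add: E_def)
      show ?thesis unfolding n by (rule nn_integral_eq_integral[symmetric, OF int]) (simp add: E_def)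
    qed
    have "(\<lambda>j. ennreal (\<integral>x. norm (E (j + J) x) \<partial>lborel)) \<longlonglongrightarrow> ennreal 0"
      unfolding e using LIMSEQ_ignore_initial_segment[OF lim, of J] by simp
    then show ?thesis by (subst (asm) tendsto_ennreal_iff) auto
  qed
  from tendsto_L1_AE_subseq[OF int this] obtain r :: "nat \<Rightarrow> nat" where r: "strict_mono r" "AE x in lborel. (\<lambda>j. E (r j + J) x) \<longlonglongrightarrow> 0"
    by auto
  show ?thesis
  proof (intro exI[of _ "\<lambda>j. r j + J"] conjI)
    show "strict_mono (\<lambda>j. r j + J)" using r(1) by (simp add: strict_mono_def)
    show "AE x in lborel. (\<lambda>j. seg_avg (h (r j + J)) f x) \<longlonglongrightarrow> f x"
      using r(2)
    proof eventually_elim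
      case (elim x)
      have "(\<lambda>j. E (r j + J) x powr (1 / p)) \<longlonglongrightarrow> 0"
        using p by (intro tendsto_zero_powrI[OF elim tendsto_const]) (auto simp: E_def)
      then have "(\<lambda>j. \<bar>seg_avg (h (r j + J)) f x - f x\<bar>) \<longlonglongrightarrow> 0"
        using p by (simp add: E_def powr_powr)
      then show ?case by (simp add: tendsto_rabs_zero_iff LIM_zero_iff)
    qed
  qed
qed

end

text \<open>
  Every subsequence has a further one along which the segment averages converge almost everywhere.  On
  it the growth bound serves as a varying majorant: averaging does not increase the \<open>p\<close>-th and \<open>q\<close>-th
  moments, so the integrals of the majorants do not exceed the integral of their limit.
\<close>

theorem quotient_energy_tendsto:
  fixes \<Phi> :: "'a::euclidean_space \<Rightarrow> 'a \<Rightarrow> real \<Rightarrow> real" and f :: "'a \<Rightarrow> real" and h :: "nat \<Rightarrow> 'a" and D :: "nat \<Rightarrow> 'a \<Rightarrow> real"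
  assumes \<Phi>m: "(\<lambda>(x, y, t). \<Phi> x y t) \<in> borel_measurable borel"
    and cont: "\<And>x (y :: nat \<Rightarrow> 'a) (t :: nat \<Rightarrow> real) T. y \<longlonglongrightarrow> x \<Longrightarrow> t \<longlonglongrightarrow> T \<Longrightarrow> (\<And>j. 0 \<le> t j) \<Longrightarrow> (\<lambda>j. \<Phi> x (y j) (t j)) \<longlonglongrightarrow> \<Phi> x x T"
    and bound: "\<And>x y t. 0 \<le> t \<Longrightarrow> \<Phi> x y t \<le> C * (t powr p + t powr q)" and C: "0 \<le> C"
    and pq: "1 < p" "1 < q" and fm [measurable]: "f \<in> borel_measurable borel"
    and fin: "(\<integral>\<^sup>+x. ennreal (\<bar>f x\<bar> powr p) \<partial>lborel) < \<infinity>" "(\<integral>\<^sup>+x. ennreal (\<bar>f x\<bar> powr q) \<partial>lborel) < \<infinity>"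
    and h: "h \<longlonglongrightarrow> 0" and Dm [measurable]: "\<And>j. D j \<in> borel_measurable borel"
    and D: "\<And>j. AE x in lborel. D j x = \<bar>seg_avg (h j) f x\<bar>"
  shows "(\<lambda>j. \<integral>\<^sup>+x. ennreal (\<Phi> x (x + h j) (D j x)) \<partial>lborel) \<longlonglongrightarrow> (\<integral>\<^sup>+x. ennreal (\<Phi> x x \<bar>f x\<bar>) \<partial>lborel)"
proof (rule tendsto_by_subsequences)
  fix r :: "nat \<Rightarrow> nat" assume r: "strict_mono r"
  have "(\<lambda>j. h (r j)) \<longlonglongrightarrow> 0" using LIMSEQ_subseq_LIMSEQ[OF h r] by (simp add: comp_def)
  from seg_avg_AE_subseq[OF pq(1) fm fin(1) this] obtain r' :: "nat \<Rightarrow> nat" where r': "strict_mono r'"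
    "AE x in lborel. (\<lambda>j. seg_avg (h (r (r' j))) f x) \<longlonglongrightarrow> f x" by blast
  define R where "R j = r (r' j)" for j
  have hR: "(\<lambda>j. h (R j)) \<longlonglongrightarrow> 0"
    using LIMSEQ_subseq_LIMSEQ[OF h strict_mono_o[OF r r'(1)]] by (simp add: comp_def R_def)
  have [measurable]: "(\<lambda>x. \<Phi> x (a x) (b x)) \<in> borel_measurable borel"
    if "a \<in> borel_measurable borel" "b \<in> borel_measurable borel" for a b
    using measurable_compose[of "\<lambda>x. (x, a x, b x)" borel borel "\<lambda>(x, y, t). \<Phi> x y t" borel] \<Phi>m that
    by (simp add: borel_prod[symmetric])
  have DR: "AE x in lborel. \<forall>j. D (R j) x = \<bar>seg_avg (h (R j)) f x\<bar>" using D by (simp add: AE_all_countable)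
  have Dlim: "AE x in lborel. (\<lambda>j. D (R j) x) \<longlonglongrightarrow> \<bar>f x\<bar> \<and> (\<forall>j. 0 \<le> D (R j) x)"
    using DR r'(2)
  proof eventually_elim
    case (elim x)
    have "(\<lambda>j. \<bar>seg_avg (h (R j)) f x\<bar>) \<longlonglongrightarrow> \<bar>f x\<bar>" using elim(2) unfolding R_def by (rule tendsto_rabs)
    then show ?case using elim(1) by simp
  qed
  have "(\<lambda>j. \<integral>\<^sup>+x. ennreal (\<Phi> x (x + h (R j)) (D (R j) x)) \<partial>lborel) \<longlonglongrightarrow> (\<integral>\<^sup>+x. ennreal (\<Phi> x x \<bar>f x\<bar>) \<partial>lborel)"
  proof (rule generalized_dominated_convergence[where B="\<lambda>j x. ennreal (C * (D (R j) x powr p + D (R j) x powr q))" and B'="\<lambda>x. ennreal (C * (\<bar>f x\<bar> powr p + \<bar>f x\<bar> powr q))"])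
    show "AE x in lborel. ennreal (\<Phi> x (x + h (R j)) (D (R j) x)) \<le> ennreal (C * (D (R j) x powr p + D (R j) x powr q))" for j
      using Dlim by eventually_elim (auto intro!: ennreal_leI bound)
    show "AE x in lborel. (\<lambda>j. ennreal (\<Phi> x (x + h (R j)) (D (R j) x))) \<longlonglongrightarrow> ennreal (\<Phi> x x \<bar>f x\<bar>)"
      using Dlim
    proof eventually_elim
      case (elim x)
      have "(\<lambda>j. x + h (R j)) \<longlonglongrightarrow> x + 0" by (intro tendsto_intros hR)
      then show ?case using elim by (intro tendsto_ennrealI cont) auto
    qed
    show "AE x in lborel. (\<lambda>j. ennreal (C * (D (R j) x powr p + D (R j) x powr q))) \<longlonglongrightarrow> ennreal (C * (\<bar>f x\<bar> powr p + \<bar>f x\<bar> powr q))"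
      using Dlim
    proof eventually_elim
      case (elim x)
      then show ?case using pq by (intro tendsto_ennrealI tendsto_mult tendsto_add tendsto_const tendsto_powr') auto
    qed
    have eq: "(\<integral>\<^sup>+x. ennreal (C * (\<bar>g x\<bar> powr p + \<bar>g x\<bar> powr q)) \<partial>lborel) = ennreal C * ((\<integral>\<^sup>+x. ennreal (\<bar>g x\<bar> powr p) \<partial>lborel) + (\<integral>\<^sup>+x. ennreal (\<bar>g x\<bar> powr q) \<partial>lborel))"
      if [measurable]: "g \<in> borel_measurable borel" for g :: "'a \<Rightarrow> real"
      using C by (simp add: ennreal_mult' nn_integral_cmult nn_integral_add)
    show "(\<integral>\<^sup>+x. ennreal (C * (D (R j) x powr p + D (R j) x powr q)) \<partial>lborel) \<le> (\<integral>\<^sup>+x. ennreal (C * (\<bar>f x\<bar> powr p + \<bar>f x\<bar> powr q)) \<partial>lborel)" for j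
    proof -
      have "(\<integral>\<^sup>+x. ennreal (C * (D (R j) x powr p + D (R j) x powr q)) \<partial>lborel) = (\<integral>\<^sup>+x. ennreal (C * (\<bar>seg_avg (h (R j)) f x\<bar> powr p + \<bar>seg_avg (h (R j)) f x\<bar> powr q)) \<partial>lborel)"
        by (rule nn_integral_cong_AE) (use DR in eventually_elim, simp)
      also have "\<dots> \<le> (\<integral>\<^sup>+x. ennreal (C * (\<bar>f x\<bar> powr p + \<bar>f x\<bar> powr q)) \<partial>lborel)"
        by (subst (1 2) eq) (auto intro!: mult_left_mono add_mono seg_avg_Lp_le pq)
      finally show ?thesis .
    qed
    show "(\<integral>\<^sup>+x. ennreal (C * (\<bar>f x\<bar> powr p + \<bar>f x\<bar> powr q)) \<partial>lborel) < \<infinity>"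
      using fin by (subst eq) (auto simp: ennreal_mult_less_top)
  qed measurable
  then show "\<exists>r'. strict_mono r' \<and> (\<lambda>j. \<integral>\<^sup>+x. ennreal (\<Phi> x (x + h (r (r' j))) (D (r (r' j)) x)) \<partial>lborel) \<longlonglongrightarrow> (\<integral>\<^sup>+x. ennreal (\<Phi> x x \<bar>f x\<bar>) \<partial>lborel)"
    using r'(1) unfolding R_def by blast
qed

section \<open>Growth, continuity and measurability of Young functions\<close>

lemma real_sequence_exp_limit:
  fixes p c :: real
  shows "(\<lambda>m. (1 + p * (exp (c / real (Suc m)) - 1)) ^ Suc m) \<longlonglongrightarrow> exp (p * c)"
proof -
  define x where "x m = p * (exp (c / real (Suc m)) - 1)" for m
  have inv0: "(\<lambda>m. c / real (Suc m)) \<longlonglongrightarrow> 0"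
    using tendsto_mult[OF tendsto_const[of c] LIMSEQ_inverse_real_of_nat] by (simp add: divide_inverse)
  have x0: "x \<longlonglongrightarrow> 0"
  proof -
    have "x \<longlonglongrightarrow> p * (exp 0 - 1)" unfolding x_def by (intro tendsto_intros inv0)
    then show ?thesis by simp
  qed
  have Sx: "(\<lambda>m. real (Suc m) * x m) \<longlonglongrightarrow> p * c"
  proof (cases "c = 0")
    case True then show ?thesis by (simp add: x_def)
  next
    case False
    have d: "((\<lambda>h::real. (exp h - 1) / h) \<longlongrightarrow> 1) (at 0)"
      using DERIV_exp[of 0] by (simp add: DERIV_def)
    have "filterlim (\<lambda>m. c / real (Suc m)) (at 0) sequentially"
      using inv0 False by (simp add: filterlim_at)
    from filterlim_compose[OF d this]
    have "(\<lambda>m. (exp (c / real (Suc m)) - 1) / (c / real (Suc m))) \<longlonglongrightarrow> 1" .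
    then have "(\<lambda>m. p * c * ((exp (c / real (Suc m)) - 1) / (c / real (Suc m)))) \<longlonglongrightarrow> p * c * 1"
      by (intro tendsto_intros)
    moreover have "p * c * ((exp (c / real (Suc m)) - 1) / (c / real (Suc m))) = real (Suc m) * x m" for m
      using False by (simp add: x_def)
    ultimately show ?thesis by simp
  qed
  have Sx2: "(\<lambda>m. real (Suc m) * (2 * (x m)\<^sup>2)) \<longlonglongrightarrow> 0"
  proof -
    have "(\<lambda>m. real (Suc m) * x m * (2 * x m)) \<longlonglongrightarrow> p * c * (2 * 0)"
      by (intro tendsto_mult Sx x0 tendsto_const)
    then show ?thesis by (simp add: power2_eq_square mult_ac)
  qed
  have ev: "\<forall>\<^sub>F m in sequentially. \<bar>x m\<bar> < 1/2"
    using order_tendstoD(2)[OF tendsto_rabs[OF x0], of "1/2"] by simp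
  have ln_lim: "(\<lambda>m. real (Suc m) * ln (1 + x m)) \<longlonglongrightarrow> p * c"
  proof (rule tendsto_sandwich)
    show "\<forall>\<^sub>F m in sequentially. real (Suc m) * x m - real (Suc m) * (2 * (x m)\<^sup>2) \<le> real (Suc m) * ln (1 + x m)"
      using ev
    proof eventually_elim
      case (elim m)
      have "\<bar>ln (1 + x m) - x m\<bar> \<le> 2 * (x m)\<^sup>2" by (rule abs_ln_one_plus_x_minus_x_bound) (use elim in simp)
      then have "x m - 2 * (x m)\<^sup>2 \<le> ln (1 + x m)" by linarith
      then have "real (Suc m) * (x m - 2 * (x m)\<^sup>2) \<le> real (Suc m) * ln (1 + x m)" by (intro mult_left_mono) auto
      then show ?case by (simp only: right_diff_distrib)
    qed
    show "\<forall>\<^sub>F m in sequentially. real (Suc m) * ln (1 + x m) \<le> real (Suc m) * x m"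
      using ev
    proof eventually_elim
      case (elim m)
      then have "ln (1 + x m) \<le> x m" by (intro ln_add_one_self_le_self2) linarith
      then show ?case by (intro mult_left_mono) auto
    qed
    show "(\<lambda>m. real (Suc m) * x m - real (Suc m) * (2 * (x m)\<^sup>2)) \<longlonglongrightarrow> p * c"
      using tendsto_diff[OF Sx Sx2] by simp
  qed (rule Sx)
  have "(\<lambda>m. exp (real (Suc m) * ln (1 + x m))) \<longlonglongrightarrow> exp (p * c)" by (rule tendsto_exp[OF ln_lim])
  moreover have "\<forall>\<^sub>F m in sequentially. exp (real (Suc m) * ln (1 + x m)) = (1 + x m) ^ Suc m"
    using ev
  proof eventually_elim
    case (elim m)
    have "exp (real (Suc m) * ln (1 + x m)) = exp (ln (1 + x m)) ^ Suc m" by (rule exp_of_nat_mult)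
    then show ?case using elim by simp
  qed
  ultimately show ?thesis unfolding x_def by (rule Lim_transform_eventually)
qed

context
  fixes g G :: "real \<Rightarrow> real" and p q :: real
  assumes mono_g: "mono_on {0..} g" and g0: "g 0 = 0"
    and G: "\<And>t. 0 \<le> t \<Longrightarrow> G t = integral {0..t} g"
begin

lemma young_g_nonneg: "0 \<le> t \<Longrightarrow> 0 \<le> g t"
  using mono_onD[OF mono_g, of 0 t] g0 by auto

lemma young_g_integrable: "0 \<le> a \<Longrightarrow> g integrable_on {a..b}"
  by (rule integrable_on_mono_on[OF mono_on_subset[OF mono_g]]) auto

lemma young_increment:
  assumes "0 \<le> a" "a \<le> b"
  shows "(b - a) * g a \<le> G b - G a" "G b - G a \<le> (b - a) * g b"
proof -
  have "integral {0..a} g + integral {a..b} g = integral {0..b} g"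
    using assms young_g_integrable[of 0 b] by (intro Henstock_Kurzweil_Integration.integral_combine) auto
  then have eq: "G b - G a = integral {a..b} g" using assms by (simp add: G)
  have "integral {a..b} (\<lambda>_. g a) \<le> integral {a..b} g"
    using assms mono_onD[OF mono_g] by (intro integral_le young_g_integrable) auto
  then show "(b - a) * g a \<le> G b - G a" using assms eq by simp
  have "integral {a..b} g \<le> integral {a..b} (\<lambda>_. g b)"
    using assms mono_onD[OF mono_g] by (intro integral_le young_g_integrable) auto
  then show "G b - G a \<le> (b - a) * g b" using assms eq by simp
qed

lemma young_mono: "0 \<le> a \<Longrightarrow> a \<le> b \<Longrightarrow> G a \<le> G b"
proof -
  assume ab: "0 \<le> a" "a \<le> b"
  then have "0 \<le> (b - a) * g a" by (intro mult_nonneg_nonneg young_g_nonneg) auto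
  then show ?thesis using young_increment(1)[OF ab] by linarith
qed

lemma young_zero: "G 0 = 0"
  using G[of 0] by simp

lemma young_nonneg: "0 \<le> t \<Longrightarrow> 0 \<le> G t"
  using young_mono[of 0 t] young_zero by simp

lemma young_continuous: "continuous_on {0..T} G"
proof -
  have "continuous_on {0..T} (\<lambda>t. integral {0..t} g)"
    by (rule indefinite_integral_continuous_1[OF young_g_integrable]) simp
  then show ?thesis by (rule continuous_on_eq) (simp add: G)
qed

lemma young_step_product:
  assumes step: "\<And>i. i < n \<Longrightarrow> f i * c \<le> f (Suc i)" and c: "0 \<le> (c::real)"
  shows "f 0 * c ^ n \<le> f (n::nat)"
  using step
proof (induction n)
  case (Suc n)
  then have "f 0 * c ^ n * c \<le> f n * c" using c by (intro mult_right_mono) auto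
  also have "\<dots> \<le> f (Suc n)" using Suc.prems by simp
  finally show ?case by (simp add: mult_ac)
qed simp

text \<open>
  Formally the logarithmic derivative of \<open>G\<close> lies between \<open>p / t\<close> and \<open>q / t\<close>.  As \<open>g\<close> may jump, \<open>G\<close> need
  not be differentiable, and \<open>G t\<close> is compared with \<open>G 1\<close> along a geometric partition with ratio
  \<open>e = t\<^bsup>-1/(m + 1)\<^esup>\<close> instead.  Each step multiplies \<open>G\<close> by at least \<open>1 + p (e - 1)\<close> if \<open>t \<le> 1\<close>, and by
  at least \<open>1 + q (e - 1)\<close> if \<open>t > 1\<close>; the products tend to \<open>t\<^sup>-\<^sup>p\<close> and \<open>t\<^sup>-\<^sup>q\<close>.
\<close>

lemma young_growth:
  assumes lo: "\<And>t. 0 < t \<Longrightarrow> p * G t \<le> t * g t" and hi: "\<And>t. 0 < t \<Longrightarrow> t * g t \<le> q * G t"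
    and pq: "0 < p" "0 < q" and t: "0 \<le> t"
  shows "G t \<le> G 1 * (t powr p + t powr q)"
proof (cases "t = 0")
  case True then show ?thesis using young_zero by simp
next
  case False
  then have t: "0 < t" using t by simp
  define c where "c = - ln t"
  define e where "e m = exp (c / real (Suc m))" for m
  have e: "0 < e m" for m by (simp add: e_def)
  have em: "t * e m ^ Suc m = 1" for m
  proof -
    have "e m ^ Suc m = exp (real (Suc m) * (c / real (Suc m)))" unfolding e_def by (rule exp_of_nat_mult[symmetric])
    also have "\<dots> = inverse t" using t by (simp add: c_def exp_minus)
    finally show ?thesis using t by simp
  qed
  have G1: "0 \<le> G 1" by (rule young_nonneg) simp
  show ?thesis
  proof (cases "t \<le> 1")
    case True
    have e1: "1 \<le> e m" for m using t True by (auto simp: e_def c_def intro!: divide_nonpos_pos)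
    have "G t * (1 + p * (e m - 1)) ^ Suc m \<le> G 1" for m
    proof -
      let ?f = "\<lambda>i. G (t * e m ^ i)"
      have "?f 0 * (1 + p * (e m - 1)) ^ Suc m \<le> ?f (Suc m)"
      proof (rule young_step_product[where f="?f"])
        fix i
        let ?a = "t * e m ^ i"
        have a: "0 < ?a" using t e[of m] by simp
        have ab: "?a \<le> ?a * e m" using mult_left_mono[OF e1[of m] less_imp_le[OF a]] by simp
        have "p * G ?a * (e m - 1) \<le> ?a * g ?a * (e m - 1)" using lo[OF a] e1[of m] by (intro mult_right_mono) auto
        also have "\<dots> = (?a * e m - ?a) * g ?a" by (simp add: algebra_simps)
        also have "\<dots> \<le> G (?a * e m) - G ?a" by (rule young_increment(1)) (use a ab in auto)
        finally show "?f i * (1 + p * (e m - 1)) \<le> ?f (Suc i)" by (simp add: algebra_simps)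
      qed (use e1[of m] pq in auto)
      then show ?thesis unfolding em by simp
    qed
    moreover have "(\<lambda>m. G t * (1 + p * (e m - 1)) ^ Suc m) \<longlonglongrightarrow> G t * exp (p * c)"
      unfolding e_def by (intro tendsto_mult tendsto_const real_sequence_exp_limit)
    ultimately have "G t * exp (p * c) \<le> G 1" by (intro LIMSEQ_le_const2) auto
    then have "G t \<le> G 1 * t powr p"
      using t by (simp add: c_def powr_def exp_minus field_simps)
    also have "\<dots> \<le> G 1 * (t powr p + t powr q)" using G1 by (intro mult_left_mono) auto
    finally show ?thesis .
  next
    case False
    have e1: "e m \<le> 1" for m using t False by (simp add: e_def c_def divide_le_0_iff)
    have "e \<longlonglongrightarrow> 1"
    proof -
      have "(\<lambda>m. c / real (Suc m)) \<longlonglongrightarrow> 0"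
        using tendsto_mult[OF tendsto_const[of c] LIMSEQ_inverse_real_of_nat] by (simp add: divide_inverse)
      then have "e \<longlonglongrightarrow> exp 0" unfolding e_def by (rule tendsto_exp)
      then show ?thesis by simp
    qed
    then have "(\<lambda>m. 1 + q * (e m - 1)) \<longlonglongrightarrow> 1 + q * (1 - 1)" by (intro tendsto_intros)
    then have "\<forall>\<^sub>F m in sequentially. 0 < 1 + q * (e m - 1)" by (rule order_tendstoD) simp
    then have "\<forall>\<^sub>F m in sequentially. G t * (1 + q * (e m - 1)) ^ Suc m \<le> G 1"
    proof eventually_elim
      case (elim m)
      let ?f = "\<lambda>i. G (t * e m ^ i)"
      have "?f 0 * (1 + q * (e m - 1)) ^ Suc m \<le> ?f (Suc m)"
      proof (rule young_step_product[where f="?f"])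
        fix i
        let ?b = "t * e m ^ i"
        have b: "0 < ?b" using t e[of m] by simp
        have ab: "?b * e m \<le> ?b" "0 \<le> ?b * e m" using b e1[of m] e[of m] by (auto simp: mult_left_le)
        have "G ?b - G (?b * e m) \<le> (?b - ?b * e m) * g ?b" by (rule young_increment(2)) (use b ab in auto)
        also have "\<dots> = (1 - e m) * (?b * g ?b)" by (simp add: algebra_simps)
        also have "\<dots> \<le> (1 - e m) * (q * G ?b)" using hi[OF b] e1[of m] by (intro mult_left_mono) auto
        finally show "?f i * (1 + q * (e m - 1)) \<le> ?f (Suc i)" by (simp add: algebra_simps)
      qed (use elim in simp)
      then show ?case unfolding em by simp
    qed
    moreover have "(\<lambda>m. G t * (1 + q * (e m - 1)) ^ Suc m) \<longlonglongrightarrow> G t * exp (q * c)"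
      unfolding e_def by (intro tendsto_mult tendsto_const real_sequence_exp_limit)
    ultimately have "G t * exp (q * c) \<le> G 1"
      by (intro tendsto_upperbound[where F=sequentially]) auto
    then have "G t \<le> G 1 * t powr q"
      using t by (simp add: c_def powr_def exp_minus field_simps)
    also have "\<dots> \<le> G 1 * (t powr p + t powr q)" using G1 by (intro mult_left_mono) auto
    finally show ?thesis .
  qed
qed

end

lemma ball_average_tendsto:
  fixes k :: "'a::euclidean_space \<Rightarrow> real"
  assumes k: "continuous_on UNIV k"
  shows "(\<lambda>m. (\<integral>z. k z * indicator (ball y (inverse (real (Suc m)))) z \<partial>lborel) / measure lborel (ball y (inverse (real (Suc m))))) \<longlonglongrightarrow> k y"
proof (rule LIMSEQ_I)
  fix e :: real assume e: "0 < e"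
  have km [measurable]: "k \<in> borel_measurable borel" by (rule borel_measurable_continuous_onI[OF k])
  obtain d where d: "d > 0" "\<And>z. dist z y < d \<Longrightarrow> dist (k z) (k y) < e / 2"
    using k e unfolding continuous_on_iff by (metis UNIV_I half_gt_zero)
  obtain N where N: "inverse (real (Suc N)) < d" using reals_Archimedean[OF d(1)] by auto
  show "\<exists>N. \<forall>m\<ge>N. norm ((\<integral>z. k z * indicator (ball y (inverse (real (Suc m)))) z \<partial>lborel) / measure lborel (ball y (inverse (real (Suc m)))) - k y) < e"
  proof (intro exI allI impI)
    fix m assume "m \<ge> N"
    then have "inverse (real (Suc m)) \<le> inverse (real (Suc N))" by (intro le_imp_inverse_le) auto
    then have m: "inverse (real (Suc m)) < d" using N by linarith
    let ?B = "ball y (inverse (real (Suc m)))"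
    have near: "\<bar>k z - k y\<bar> \<le> e / 2" if "z \<in> ?B" for z
    proof -
      have "dist z y < d" using that m by (simp add: dist_commute)
      from d(2)[OF this] show ?thesis by (simp only: dist_real_def)
    qed
    have B: "0 < measure lborel ?B" by (rule content_ball_pos) simp
    have Bfin: "emeasure lborel ?B < \<infinity>" by (rule emeasure_lborel_ball_finite)
    have [measurable]: "?B \<in> sets borel" by simp
    have indB: "integrable lborel (\<lambda>z. indicator ?B z :: real)" using Bfin by simp
    have int: "integrable lborel (\<lambda>z. (k z - k y) * indicator ?B z)"
    proof (rule Bochner_Integration.integrable_bound[OF integrable_mult_right[OF indB, of "e/2"]])
      show "AE z in lborel. norm ((k z - k y) * indicator ?B z) \<le> norm (e / 2 * indicator ?B z)"
        using near e by (intro AE_I2) (auto simp: indicator_def abs_mult)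
    qed measurable
    have "(\<integral>z. k z * indicator ?B z \<partial>lborel) = (\<integral>z. (k z - k y) * indicator ?B z + k y * indicator ?B z \<partial>lborel)"
      by (simp add: algebra_simps)
    also have "\<dots> = (\<integral>z. (k z - k y) * indicator ?B z \<partial>lborel) + k y * measure lborel ?B"
      by (subst Bochner_Integration.integral_add[OF int integrable_mult_right[OF indB]]) simp
    finally have eq: "(\<integral>z. k z * indicator ?B z \<partial>lborel) = (\<integral>z. (k z - k y) * indicator ?B z \<partial>lborel) + k y * measure lborel ?B" .
    have "\<bar>\<integral>z. (k z - k y) * indicator ?B z \<partial>lborel\<bar> \<le> (\<integral>z. \<bar>(k z - k y) * indicator ?B z\<bar> \<partial>lborel)"
      by (rule integral_abs_bound)
    also have "\<dots> \<le> (\<integral>z. e / 2 * indicator ?B z \<partial>lborel)"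
      using near e by (intro integral_mono integrable_abs int integrable_mult_right indB) (auto simp: indicator_def abs_mult)
    also have "\<dots> = e / 2 * measure lborel ?B" by simp
    finally have le: "\<bar>\<integral>z. (k z - k y) * indicator ?B z \<partial>lborel\<bar> \<le> e / 2 * measure lborel ?B" .
    have "(\<integral>z. k z * indicator ?B z \<partial>lborel) / measure lborel ?B - k y = (\<integral>z. (k z - k y) * indicator ?B z \<partial>lborel) / measure lborel ?B"
      unfolding eq using B by (simp add: add_divide_distrib)
    then have "norm ((\<integral>z. k z * indicator ?B z \<partial>lborel) / measure lborel ?B - k y) \<le> e / 2"
      using le B by (simp add: divide_le_eq)
    also have "\<dots> < e" using e by simp
    finally show "norm ((\<integral>z. k z * indicator ?B z \<partial>lborel) / measure lborel ?B - k y) < e" .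
  qed
qed

text \<open>
  \<open>K\<close> agrees almost everywhere with a Borel function \<open>K'\<close>.  For almost every \<open>x\<close> the sections agree almost
  everywhere, and continuity in \<open>y\<close> recovers \<open>K x y\<close> as the limit of averages of \<open>K'\<close> over small balls,
  which are Borel in \<open>(x, y)\<close>.
\<close>

lemma borel_modification_continuous_sections:
  fixes K :: "'a::euclidean_space \<Rightarrow> 'a \<Rightarrow> real"
  assumes Km: "(\<lambda>(x, y). K x y) \<in> borel_measurable lebesgue" and cont: "\<And>x. continuous_on UNIV (K x)"
  shows "\<exists>Z\<in>null_sets lborel. (\<lambda>(x, y). if x \<in> Z then 0 else K x y) \<in> borel_measurable borel"
proof -
  obtain K' where K': "K' \<in> borel_measurable lborel" "AE p in lborel. (case p of (x, y) \<Rightarrow> K x y) = K' p"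
    using completion_ex_borel_measurable_real[OF Km] by blast
  have [measurable]: "K' \<in> borel_measurable (borel \<Otimes>\<^sub>M borel)" using K'(1) by (simp add: borel_prod)
  have "AE p in lborel \<Otimes>\<^sub>M lborel. (case p of (x, y) \<Rightarrow> K x y) = K' p" using K'(2) unfolding lborel_prod .
  from lborel_pair.AE_pair[OF this] have "AE x in lborel. AE y in lborel. K x y = K' (x, y)" by simp
  then obtain Z where Z: "Z \<in> null_sets lborel" "\<And>x. x \<notin> Z \<Longrightarrow> AE y in lborel. K x y = K' (x, y)"
    by (auto elim!: AE_E3)
  have Zs [measurable]: "Z \<in> sets borel" using Z(1) by auto
  define A where "A m p = (\<integral>z. K' (fst p, z) * indicator {z. dist (snd p) z < inverse (real (Suc m))} z \<partial>lborel) / measure lborel (ball (0::'a) (inverse (real (Suc m))))" for m and p :: "'a \<times> 'a"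
  have [measurable]: "A m \<in> borel_measurable (borel \<Otimes>\<^sub>M borel)" for m
    unfolding A_def by measurable
  have "(\<lambda>p. if fst p \<in> Z then 0 else K (fst p) (snd p)) \<in> borel_measurable (borel \<Otimes>\<^sub>M borel)"
  proof (rule borel_measurable_LIMSEQ_real)
    show "(\<lambda>p. if fst p \<in> Z then 0 else A m p) \<in> borel_measurable (borel \<Otimes>\<^sub>M borel)" for m by measurable
    fix p :: "'a \<times> 'a"
    show "(\<lambda>m. if fst p \<in> Z then 0 else A m p) \<longlonglongrightarrow> (if fst p \<in> Z then 0 else K (fst p) (snd p))"
    proof (cases "fst p \<in> Z")
      case False
      have km [measurable]: "K (fst p) \<in> borel_measurable borel" by (rule borel_measurable_continuous_onI[OF cont])
      have [measurable]: "(\<lambda>z. K' (fst p, z)) \<in> borel_measurable borel" by measurable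
      have "A m p = (\<integral>z. K (fst p) z * indicator (ball (snd p) (inverse (real (Suc m)))) z \<partial>lborel) / measure lborel (ball (snd p) (inverse (real (Suc m))))" for m
      proof -
        have [measurable]: "ball (snd p) (inverse (real (Suc m))) \<in> sets borel" by simp
        have "(\<integral>z. K' (fst p, z) * indicator {z. dist (snd p) z < inverse (real (Suc m))} z \<partial>lborel) = (\<integral>z. K (fst p) z * indicator (ball (snd p) (inverse (real (Suc m)))) z \<partial>lborel)"
        proof (rule integral_cong_AE)
          show "AE z in lborel. K' (fst p, z) * indicator {z. dist (snd p) z < inverse (real (Suc m))} z = K (fst p) z * indicator (ball (snd p) (inverse (real (Suc m)))) z"
            using Z(2)[OF False] by eventually_elim (simp add: indicator_def)
        qed measurable
        moreover have "measure lborel (ball (0::'a) (inverse (real (Suc m)))) = measure lborel (ball (snd p) (inverse (real (Suc m))))"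
          by (simp add: content_ball)
        ultimately show ?thesis by (simp add: A_def)
      qed
      then show ?thesis using False ball_average_tendsto[OF cont, of "fst p" "snd p"] by simp
    qed simp
  qed
  then have "(\<lambda>(x, y). if x \<in> Z then 0 else K x y) \<in> borel_measurable borel"
    by (simp add: borel_prod case_prod_unfold)
  then show ?thesis using Z(1) by blast
qed

text \<open>
  One null set serves all rational \<open>t\<close>, and continuity in \<open>t\<close> fills the gaps.  Nothing is known at negative
  arguments, whence \<open>max 0 t\<close>.
\<close>

lemma borel_modification_joint:
  fixes K :: "'a::euclidean_space \<Rightarrow> 'a \<Rightarrow> real \<Rightarrow> real"
  assumes Km: "\<And>t. 0 \<le> t \<Longrightarrow> (\<lambda>(x, y). K x y t) \<in> borel_measurable lebesgue"
    and cont: "\<And>x t. 0 \<le> t \<Longrightarrow> continuous_on UNIV (\<lambda>y. K x y t)"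
    and cont_t: "\<And>x y T. continuous_on {0..T} (K x y)"
  shows "\<exists>Z\<in>null_sets lborel. (\<lambda>(x, y, t). if x \<in> Z then 0 else K x y (max 0 t)) \<in> borel_measurable borel"
proof -
  define Q where "Q = {r::real. r \<in> \<rat> \<and> 0 \<le> r}"
  have Q: "countable Q" unfolding Q_def using countable_rat by (rule countable_subset[rotated]) auto
  have "\<forall>t\<in>Q. \<exists>Z. Z \<in> null_sets lborel \<and> (\<lambda>(x, y). if x \<in> Z then 0 else K x y t) \<in> borel_measurable borel"
    unfolding Bex_def[symmetric]
    by (intro ballI borel_modification_continuous_sections Km cont) (auto simp: Q_def)
  from bchoice[OF this]
  obtain Zt where "\<forall>t\<in>Q. Zt t \<in> null_sets lborel \<and> (\<lambda>(x, y). if x \<in> Zt t then 0 else K x y t) \<in> borel_measurable borel" ..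
  note Zt = bspec[OF this, THEN conjunct1] bspec[OF this, THEN conjunct2]
  define Z where "Z = (\<Union>t\<in>Q. Zt t)"
  have Z: "Z \<in> null_sets lborel" unfolding Z_def by (rule null_sets_UN'[OF Q Zt(1)])
  then have Zs [measurable]: "Z \<in> sets borel" by auto
  have KZ: "(\<lambda>p. if fst p \<in> Z then 0 else K (fst p) (snd p) t) \<in> borel_measurable (borel \<Otimes>\<^sub>M borel)" if "t \<in> Q" for t
  proof -
    have [measurable]: "(\<lambda>p. if fst p \<in> Zt t then 0 else K (fst p) (snd p) t) \<in> borel_measurable (borel \<Otimes>\<^sub>M borel)"
      using Zt(2)[OF that] by (simp add: borel_prod case_prod_unfold)
    have "(\<lambda>p. if fst p \<in> Z then 0 else (if fst p \<in> Zt t then 0 else K (fst p) (snd p) t)) \<in> borel_measurable (borel \<Otimes>\<^sub>M borel)"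
      by measurable
    moreover have "(\<lambda>p. if fst p \<in> Z then 0 else (if fst p \<in> Zt t then 0 else K (fst p) (snd p) t)) = (\<lambda>p. if fst p \<in> Z then 0 else K (fst p) (snd p) t)"
      using that by (auto simp: Z_def fun_eq_iff)
    ultimately show ?thesis by simp
  qed
  \<comment> \<open>The largest multiple of \<open>1 / (m + 1)\<close> not above \<open>max 0 t\<close>: countably many rational values.\<close>
  define r where "r m t = (real_of_int \<lfloor>max 0 t * real (Suc m)\<rfloor>) / real (Suc m)" for m t
  have r_bd: "0 \<le> r m t" "r m t \<le> max 0 t" "max 0 t - inverse (real (Suc m)) \<le> r m t" for m t
  proof -
    show "0 \<le> r m t" by (simp add: r_def)
    have "real_of_int \<lfloor>max 0 t * real (Suc m)\<rfloor> \<le> max 0 t * real (Suc m)" by linarith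
    then show "r m t \<le> max 0 t" unfolding r_def by (simp add: divide_le_eq)
    have "max 0 t * real (Suc m) - 1 \<le> real_of_int \<lfloor>max 0 t * real (Suc m)\<rfloor>" by linarith
    then have "(max 0 t * real (Suc m) - 1) / real (Suc m) \<le> r m t" unfolding r_def by (intro divide_right_mono) auto
    moreover have "(max 0 t * real (Suc m) - 1) / real (Suc m) = max 0 t - inverse (real (Suc m))"
      by (simp add: diff_divide_distrib inverse_eq_divide del: of_nat_Suc)
    ultimately show "max 0 t - inverse (real (Suc m)) \<le> r m t" by simp
  qed
  have "(\<lambda>q. if fst q \<in> Z then 0 else K (fst q) (fst (snd q)) (max 0 (snd (snd q)))) \<in> borel_measurable (borel \<Otimes>\<^sub>M (borel \<Otimes>\<^sub>M borel))"
  proof (rule borel_measurable_LIMSEQ_real)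
    fix m
    define F where "F i q = (if fst q \<in> Z then 0 else K (fst q) (fst (snd q)) (real_of_int (max 0 i) / real (Suc m)))" for i :: int and q :: "'a \<times> 'a \<times> real"
    have Fm: "F i \<in> borel_measurable (borel \<Otimes>\<^sub>M (borel \<Otimes>\<^sub>M borel))" for i
    proof -
      have "real_of_int (max 0 i) / real (Suc m) \<in> Q" by (auto simp: Q_def)
      from KZ[OF this] have 1: "(\<lambda>p. if fst p \<in> Z then 0 else K (fst p) (snd p) (real_of_int (max 0 i) / real (Suc m))) \<in> borel_measurable (borel \<Otimes>\<^sub>M borel)" .
      have 2: "(\<lambda>q::'a \<times> 'a \<times> real. (fst q, fst (snd q))) \<in> (borel \<Otimes>\<^sub>M (borel \<Otimes>\<^sub>M borel)) \<rightarrow>\<^sub>M (borel \<Otimes>\<^sub>M borel)" by measurable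
      show ?thesis using measurable_compose[OF 2 1] unfolding F_def[abs_def] fst_conv snd_conv .
    qed
    have "(\<lambda>q. F \<lfloor>max 0 (snd (snd q)) * real (Suc m)\<rfloor> q) \<in> borel_measurable (borel \<Otimes>\<^sub>M (borel \<Otimes>\<^sub>M borel))"
      by (rule measurable_compose_countable[where f=F], rule Fm, measurable)
    moreover have "real_of_int (max 0 \<lfloor>max 0 t * real (Suc m)\<rfloor>) / real (Suc m) = r m t" for t
      by (simp add: r_def max_def)
    ultimately show "(\<lambda>q. if fst q \<in> Z then 0 else K (fst q) (fst (snd q)) (r m (snd (snd q)))) \<in> borel_measurable (borel \<Otimes>\<^sub>M (borel \<Otimes>\<^sub>M borel))"
      by (simp add: F_def cong: if_cong)
  next
    fix q :: "'a \<times> 'a \<times> real"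
    let ?t = "snd (snd q)"
    have "(\<lambda>m. r m ?t) \<longlonglongrightarrow> max 0 ?t"
    proof (rule tendsto_sandwich[OF _ _ _ tendsto_const])
      have "(\<lambda>m. max 0 ?t - inverse (real (Suc m))) \<longlonglongrightarrow> max 0 ?t - 0"
        by (intro tendsto_intros LIMSEQ_inverse_real_of_nat)
      then show "(\<lambda>m. max 0 ?t - inverse (real (Suc m))) \<longlonglongrightarrow> max 0 ?t" by simp
    qed (use r_bd in \<open>auto intro!: always_eventually\<close>)
    then have "(\<lambda>m. K (fst q) (fst (snd q)) (r m ?t)) \<longlonglongrightarrow> K (fst q) (fst (snd q)) (max 0 ?t)"
      by (rule continuous_on_tendsto_compose[OF cont_t[of "max 0 ?t"]]) (use r_bd in \<open>auto intro!: always_eventually\<close>)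
    then show "(\<lambda>m. if fst q \<in> Z then 0 else K (fst q) (fst (snd q)) (r m ?t)) \<longlonglongrightarrow> (if fst q \<in> Z then 0 else K (fst q) (fst (snd q)) (max 0 ?t))"
      by simp
  qed
  then have "(\<lambda>(x, y, t). if x \<in> Z then 0 else K x y (max 0 t)) \<in> borel_measurable borel"
    by (simp add: borel_prod case_prod_unfold)
  then show ?thesis using Z by blast
qed

text \<open>
  Separate continuity suffices because of monotonicity: \<open>K (y j) (t j)\<close> is eventually squeezed between
  \<open>K (y j) s\<close> for fixed \<open>s\<close> slightly below and slightly above \<open>T\<close>.
\<close>

lemma monotone_joint_tendsto:
  fixes K :: "'a::topological_space \<Rightarrow> real \<Rightarrow> real"
  assumes cont: "\<And>t. 0 \<le> t \<Longrightarrow> continuous_on UNIV (\<lambda>y. K y t)"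
    and cont_t: "\<And>T. continuous_on {0..T} (K x)"
    and mono: "\<And>y s t. 0 \<le> s \<Longrightarrow> s \<le> t \<Longrightarrow> K y s \<le> K y t"
    and y: "y \<longlonglongrightarrow> x" and t: "t \<longlonglongrightarrow> T" and t0: "\<And>j. 0 \<le> t j"
  shows "(\<lambda>j. K (y j) (t j)) \<longlonglongrightarrow> K x T"
proof -
  have T0: "0 \<le> T" using LIMSEQ_le_const[OF t] t0 by blast
  have Ky: "(\<lambda>j. K (y j) s) \<longlonglongrightarrow> K x s" if "0 \<le> s" for s
    by (rule continuous_on_tendsto_compose[OF cont[OF that] y]) auto
  \<comment> \<open>An interval that reaches beyond \<open>T\<close> allows comparison from above.\<close>
  have "\<exists>\<delta>>0. \<forall>s\<in>{0..T + 1}. dist s T < \<delta> \<longrightarrow> dist (K x s) (K x T) < e" if "e > 0" for e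
    using cont_t[of "T + 1"] T0 that unfolding continuous_on_iff by auto
  note near = this
  show ?thesis
  proof (rule order_tendstoI)
    fix c assume c: "c < K x T"
    then obtain \<delta> where \<delta>: "\<delta> > 0" "\<And>s. s \<in> {0..T + 1} \<Longrightarrow> dist s T < \<delta> \<Longrightarrow> dist (K x s) (K x T) < K x T - c"
      using near[of "K x T - c"] by auto
    define s where "s = max 0 (T - \<delta> / 2)"
    have s: "0 \<le> s" "s \<le> T" "c < K x s" 
      using \<delta>(2)[of s] \<delta>(1) T0 by (auto simp: s_def dist_real_def max_def split: if_splits)
    have ev1: "\<forall>\<^sub>F j in sequentially. c < K (y j) s" by (rule order_tendstoD(1)[OF Ky[OF s(1)] s(3)])
    have ev2: "\<forall>\<^sub>F j in sequentially. s \<le> t j"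
    proof (cases "T - \<delta> / 2 \<le> 0")
      case True
      then show ?thesis using t0 by (simp add: s_def)
    next
      case False
      have "s < T" using False \<delta>(1) by (simp add: s_def)
      then have "\<forall>\<^sub>F j in sequentially. s < t j" by (rule order_tendstoD(1)[OF t])
      then show ?thesis by eventually_elim simp
    qed
    show "\<forall>\<^sub>F j in sequentially. c < K (y j) (t j)"
      using ev1 ev2
    proof eventually_elim
      case (elim j)
      then show ?case using mono[OF s(1), of "t j" "y j"] by linarith
    qed
  next
    fix c assume c: "K x T < c"
    then obtain \<delta> where \<delta>: "\<delta> > 0" "\<And>s. s \<in> {0..T + 1} \<Longrightarrow> dist s T < \<delta> \<Longrightarrow> dist (K x s) (K x T) < c - K x T"
      using near[of "c - K x T"] by auto
    define s where "s = T + min 1 (\<delta> / 2)"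
    have s: "0 \<le> s" "T < s" "K x s < c" 
      using \<delta>(2)[of s] \<delta>(1) T0 by (auto simp: s_def dist_real_def min_def split: if_splits)
    have ev1: "\<forall>\<^sub>F j in sequentially. K (y j) s < c" by (rule order_tendstoD(2)[OF Ky[OF s(1)] s(3)])
    have ev2: "\<forall>\<^sub>F j in sequentially. t j < s" by (rule order_tendstoD(2)[OF t s(2)])
    show "\<forall>\<^sub>F j in sequentially. K (y j) (t j) < c"
      using ev1 ev2
    proof eventually_elim
      case (elim j)
      then show ?case using mono[OF t0[of j], of s "y j"] by linarith
    qed
  qed
qed

section \<open>The limit of the scaled energy\<close>

text \<open>
  The substitution \<open>\<rho> = r\<^sup>a\<close> in the scale invariant measure \<open>dr / r\<close>.  It is done on compact
  intervals that exhaust \<open>(0, 1]\<close>, since \<open>\<rho>\<^bsup>1/a\<^esup>\<close> need not be differentiable at \<open>0\<close>.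
\<close>

lemma nn_integral_log_scaling:
  fixes f :: "real \<Rightarrow> ennreal"
  assumes [measurable]: "f \<in> borel_measurable borel" and a: "a > 0"
  shows "ennreal a * (\<integral>\<^sup>+r\<in>{0<..<1}. f r / ennreal r \<partial>lborel) = (\<integral>\<^sup>+\<rho>\<in>{0<..<1}. f (\<rho> powr (1 / a)) / ennreal \<rho> \<partial>lborel)"
proof -
  define e where "e m = inverse (real (Suc (Suc m)))" for m
  have e: "0 < e m" "e m < 1" for m by (auto simp: e_def inverse_less_1_iff)
  have e_anti: "e m' \<le> e m" if "m \<le> m'" for m m' using that by (auto simp: e_def intro!: le_imp_inverse_le)
  have e0: "e \<longlonglongrightarrow> 0"
    unfolding e_def using LIMSEQ_Suc[OF LIMSEQ_inverse_real_of_nat] by simp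
  have step: "ennreal a * (\<integral>\<^sup>+r. f r / ennreal r * indicator {e m powr (1 / a)..1} r \<partial>lborel) = (\<integral>\<^sup>+\<rho>. f (\<rho> powr (1 / a)) / ennreal \<rho> * indicator {e m..1} \<rho> \<partial>lborel)" for m
  proof -
    have "(\<integral>\<^sup>+r. f r / ennreal r * indicator {e m powr (1 / a)..1 powr (1 / a)} r \<partial>lborel)
      = (\<integral>\<^sup>+\<rho>. f (\<rho> powr (1 / a)) / ennreal (\<rho> powr (1 / a)) * ennreal (1 / a * \<rho> powr (1 / a - 1)) * indicator {e m..1} \<rho> \<partial>lborel)"
    proof (rule nn_integral_substitution_aux)
      fix \<rho> assume "\<rho> \<in> {e m..1}"
      then have "0 < \<rho>" using e[of m] by auto
      then show "((\<lambda>\<rho>. \<rho> powr (1 / a)) has_real_derivative 1 / a * \<rho> powr (1 / a - 1)) (at \<rho>)"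
        by (rule has_real_derivative_powr)
      show "0 \<le> 1 / a * \<rho> powr (1 / a - 1)" using a by simp
    next
      show "continuous_on {e m..1} (\<lambda>\<rho>. 1 / a * \<rho> powr (1 / a - 1))"
        using e[of m] by (intro continuous_intros) auto
    qed (use e[of m] in auto)
    also have "\<dots> = (\<integral>\<^sup>+\<rho>. ennreal (1 / a) * (f (\<rho> powr (1 / a)) / ennreal \<rho> * indicator {e m..1} \<rho>) \<partial>lborel)"
    proof (rule nn_integral_cong)
      fix \<rho> :: real
      show "f (\<rho> powr (1 / a)) / ennreal (\<rho> powr (1 / a)) * ennreal (1 / a * \<rho> powr (1 / a - 1)) * indicator {e m..1} \<rho> = ennreal (1 / a) * (f (\<rho> powr (1 / a)) / ennreal \<rho> * indicator {e m..1} \<rho>)"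
      proof (cases "\<rho> \<in> {e m..1}")
        case True
        then have r: "0 < \<rho>" using e[of m] by auto
        have "inverse (\<rho> powr (1 / a)) * (1 / a * \<rho> powr (1 / a - 1)) = 1 / a * inverse \<rho>"
          using r by (simp add: powr_diff field_simps)
        then have "ennreal (inverse (\<rho> powr (1 / a))) * ennreal (1 / a * \<rho> powr (1 / a - 1)) = ennreal (1 / a) * ennreal (inverse \<rho>)"
          using r a by (simp only: ennreal_mult'[symmetric] less_imp_le powr_ge_zero inverse_nonnegative_iff_nonnegative divide_nonneg_pos zero_le_one)
        then show ?thesis
          using r True by (simp add: divide_ennreal_def inverse_ennreal mult.assoc mult.left_commute)
      qed simp
    qed
    also have "\<dots> = ennreal (1 / a) * (\<integral>\<^sup>+\<rho>. f (\<rho> powr (1 / a)) / ennreal \<rho> * indicator {e m..1} \<rho> \<partial>lborel)"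
      by (rule nn_integral_cmult) measurable
    finally show ?thesis
      using a by (simp add: mult.assoc[symmetric] ennreal_mult'[symmetric])
  qed
  have open1: "(\<integral>\<^sup>+r. g r * indicator {0<..1} r \<partial>lborel) = (\<integral>\<^sup>+r\<in>{0<..<1::real}. g r \<partial>lborel)" for g :: "real \<Rightarrow> ennreal"
    by (rule nn_integral_cong_AE, rule AE_mp[OF AE_lborel_singleton[of 1]]) (auto simp: indicator_def intro!: AE_I2)
  have lim: "(\<lambda>m. \<integral>\<^sup>+r. g r * indicator {b m..1} r \<partial>lborel) \<longlonglongrightarrow> (\<integral>\<^sup>+r\<in>{0<..<1::real}. g r \<partial>lborel)"
    if [measurable]: "g \<in> borel_measurable borel" and b: "b \<longlonglongrightarrow> 0" "\<And>m. 0 < b m" "\<And>m m'. m \<le> m' \<Longrightarrow> b m' \<le> b m" for g :: "real \<Rightarrow> ennreal" and b :: "nat \<Rightarrow> real"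
    unfolding open1[symmetric]
  proof (rule nn_integral_LIMSEQ)
    show "incseq (\<lambda>m r. g r * indicator {b m..1} r)"
      using b(3) by (auto simp: incseq_def le_fun_def indicator_def intro: order_trans)
    show "(\<lambda>m. g r * indicator {b m..1} r) \<longlonglongrightarrow> g r * indicator {0<..1} r" for r
    proof (cases "0 < r")
      case True
      have "\<forall>\<^sub>F m in sequentially. b m < r" by (rule order_tendstoD(2)[OF b(1) True])
      then have "\<forall>\<^sub>F m in sequentially. g r * indicator {0<..1} r = g r * indicator {b m..1} r"
        by eventually_elim (use True in \<open>auto simp: indicator_def\<close>)
      then show ?thesis by (rule Lim_transform_eventually[OF tendsto_const])
    next
      case False
      have "\<not> b m \<le> r" for m using b(2)[of m] False by linarith
      then show ?thesis using False by simp
    qed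
  qed measurable
  have "(\<lambda>m. e m powr (1 / a)) \<longlonglongrightarrow> 0"
    by (rule tendsto_zero_powrI[OF e0 tendsto_const]) (use a e in \<open>auto simp: less_imp_le\<close>)
  then have "(\<lambda>m. ennreal a * (\<integral>\<^sup>+r. f r / ennreal r * indicator {e m powr (1 / a)..1} r \<partial>lborel)) \<longlonglongrightarrow> ennreal a * (\<integral>\<^sup>+r\<in>{0<..<1}. f r / ennreal r \<partial>lborel)"
    using e e_anti a by (intro ennreal_tendsto_cmult lim powr_mono2) (auto simp: less_imp_le less_imp_neq[symmetric])
  moreover have "(\<lambda>m. \<integral>\<^sup>+\<rho>. f (\<rho> powr (1 / a)) / ennreal \<rho> * indicator {e m..1} \<rho> \<partial>lborel) \<longlonglongrightarrow> (\<integral>\<^sup>+\<rho>\<in>{0<..<1}. f (\<rho> powr (1 / a)) / ennreal \<rho> \<partial>lborel)"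
    by (intro lim e0 e e_anti) measurable
  ultimately show ?thesis unfolding step by (rule LIMSEQ_unique)
qed

lemma nn_integral_tail:
  "(\<integral>\<^sup>+r. ennreal (r powr (- 3 / 2)) * indicator {1..} r \<partial>lborel) = 2"
proof -
  have "(\<integral>\<^sup>+r. ennreal (r powr (- 3 / 2)) * indicator {1..} r \<partial>lborel) = ennreal (0 - (- 2 * 1 powr (- 1 / 2)))"
  proof (rule nn_integral_FTC_atLeast[where F="\<lambda>r. - 2 * r powr (- 1 / 2)"])
    fix x :: real assume "1 \<le> x"
    then show "((\<lambda>r. - 2 * r powr (- 1 / 2)) has_real_derivative x powr (- 3 / 2)) (at x)"
      by (auto intro!: derivative_eq_intros)
  next
    have "((\<lambda>r::real. r powr (- 1 / 2)) \<longlongrightarrow> 0) at_top"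
      by (rule tendsto_neg_powr[OF _ filterlim_ident]) simp
    then have "((\<lambda>r::real. - 2 * r powr (- 1 / 2)) \<longlongrightarrow> - 2 * 0) at_top" by (intro tendsto_intros)
    then show "((\<lambda>r::real. - 2 * r powr (- 1 / 2)) \<longlongrightarrow> 0) at_top" by simp
  qed auto
  then show ?thesis by simp
qed

text \<open>
  The analytic core, for a Borel density \<open>\<Phi>\<close> with the continuity and the growth of a Young function and for
  Borel representatives \<open>u\<close> of the function and \<open>v\<close> of its gradient.  The weak derivative enters
  through the formula \<open>diff\<close> for increments.
\<close>

locale energy_density =
  fixes \<Phi> :: "real^'n \<Rightarrow> real^'n \<Rightarrow> real \<Rightarrow> real" and C p q :: real
    and u :: "real^'n \<Rightarrow> real" and v :: "real^'n \<Rightarrow> real^'n"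
  assumes \<Phi>m: "(\<lambda>(x, y, t). \<Phi> x y t) \<in> borel_measurable borel"
    and cont: "\<And>x (y :: nat \<Rightarrow> real^'n) (t :: nat \<Rightarrow> real) T. y \<longlonglongrightarrow> x \<Longrightarrow> t \<longlonglongrightarrow> T \<Longrightarrow> (\<And>j. 0 \<le> t j) \<Longrightarrow> (\<lambda>j. \<Phi> x (y j) (t j)) \<longlonglongrightarrow> \<Phi> x x T"
    and bound: "\<And>x y t. 0 \<le> t \<Longrightarrow> \<Phi> x y t \<le> C * (t powr p + t powr q)" and C: "0 \<le> C"
    and pq: "1 < p" "1 < q"
    and um [measurable]: "u \<in> borel_measurable borel" and vm [measurable]: "v \<in> borel_measurable borel"
    and diff: "\<And>h. AE x in lborel. u (x + h) - u x = seg_avg h (\<lambda>x. v x \<bullet> h) x"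
    and u_fin: "(\<integral>\<^sup>+x. ennreal (\<bar>u x\<bar> powr p) \<partial>lborel) < \<infinity>" "(\<integral>\<^sup>+x. ennreal (\<bar>u x\<bar> powr q) \<partial>lborel) < \<infinity>"
    and v_fin: "(\<integral>\<^sup>+x. ennreal (norm (v x) powr p) \<partial>lborel) < \<infinity>" "(\<integral>\<^sup>+x. ennreal (norm (v x) powr q) \<partial>lborel) < \<infinity>"
begin

lemma \<Phi>_compose [measurable (raw)]:
  assumes "a \<in> M \<rightarrow>\<^sub>M borel" "b \<in> M \<rightarrow>\<^sub>M borel" "c \<in> borel_measurable M"
  shows "(\<lambda>z. \<Phi> (a z) (b z) (c z)) \<in> borel_measurable M"
proof -
  have 1: "(\<lambda>z. (a z, b z, c z)) \<in> M \<rightarrow>\<^sub>M (borel \<Otimes>\<^sub>M (borel \<Otimes>\<^sub>M borel))" using assms by measurable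
  have 2: "(\<lambda>(x, y, t). \<Phi> x y t) \<in> borel_measurable (borel \<Otimes>\<^sub>M (borel \<Otimes>\<^sub>M borel))"
    using \<Phi>m by (simp add: borel_prod)
  show ?thesis using measurable_compose[OF 1 2] by simp
qed

definition energy :: "real \<Rightarrow> ennreal" where
  "energy s = (\<integral>\<^sup>+(x, y). ennreal (\<Phi> x y (\<bar>u x - u y\<bar> / norm (x - y) powr s) / norm (x - y) ^ CARD('n)) \<partial>(lborel \<Otimes>\<^sub>M lborel))"

text \<open>
  In the energy \<open>\<rho> = r\<^bsup>1 - s\<^esup>\<close>.  The two are kept apart because the limit is taken in \<open>r\<close> at fixed \<open>\<rho>\<close>.
\<close>

definition increment_energy :: "real \<Rightarrow> real \<Rightarrow> real^'n \<Rightarrow> ennreal" where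
  "increment_energy r \<rho> w = (\<integral>\<^sup>+x. ennreal (\<Phi> x (x + r *\<^sub>R w) (\<rho> * (\<bar>u (x + r *\<^sub>R w) - u x\<bar> / r))) \<partial>lborel)"

definition limit_energy :: ennreal where
  "limit_energy = (\<integral>\<^sup>+\<rho>\<in>{0<..<1}. (\<integral>\<^sup>+w. (\<integral>\<^sup>+x. ennreal (\<Phi> x x (\<rho> * \<bar>v x \<bullet> w\<bar>)) \<partial>lborel) \<partial>surface_measure) / ennreal \<rho> \<partial>lborel)"

lemma increment_energy_measurable [measurable (raw)]:
  assumes [measurable]: "a \<in> borel_measurable M" "b \<in> borel_measurable M" "c \<in> M \<rightarrow>\<^sub>M borel"
  shows "(\<lambda>z. increment_energy (a z) (b z) (c z)) \<in> borel_measurable M"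
  unfolding increment_energy_def by measurable

lemma energy_shift: "energy s = (\<integral>\<^sup>+h. \<integral>\<^sup>+x. ennreal (\<Phi> x (x + h) (\<bar>u (x + h) - u x\<bar> / norm h powr s) / norm h ^ CARD('n)) \<partial>lborel \<partial>lborel)"
proof -
  define F where "F x y = ennreal (\<Phi> x y (\<bar>u x - u y\<bar> / norm (x - y) powr s) / norm (x - y) ^ CARD('n))" for x y
  have Fm [measurable]: "(\<lambda>p. F (fst p) (snd p)) \<in> borel_measurable (borel \<Otimes>\<^sub>M borel)" unfolding F_def by measurable
  have Fy [measurable]: "F x \<in> borel_measurable borel" for x unfolding F_def by measurable
  have "energy s = (\<integral>\<^sup>+x. \<integral>\<^sup>+y. F x y \<partial>lborel \<partial>lborel)"
    unfolding energy_def by (subst lborel.nn_integral_fst[symmetric]) (auto simp: F_def[abs_def] case_prod_unfold)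
  also have "\<dots> = (\<integral>\<^sup>+x. \<integral>\<^sup>+h. F x (x + h) \<partial>lborel \<partial>lborel)"
  proof (rule nn_integral_cong)
    fix x
    show "(\<integral>\<^sup>+y. F x y \<partial>lborel) = (\<integral>\<^sup>+h. F x (x + h) \<partial>lborel)"
      using nn_integral_lborel_shift[OF Fy, of x x] by (simp add: add.commute)
  qed
  also have "\<dots> = (\<integral>\<^sup>+h. \<integral>\<^sup>+x. F x (x + h) \<partial>lborel \<partial>lborel)"
    by (rule lborel_pair.Fubini'[symmetric]) (unfold F_def, measurable)
  finally show ?thesis by (simp add: F_def norm_minus_commute abs_minus_commute)
qed

text \<open>
  The factors \<open>r\<^bsup>n - 1\<^esup>\<close> of polar coordinates and \<open>r\<^sup>-\<^sup>n\<close> of the kernel combine to \<open>1 / r\<close>.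
\<close>

lemma energy_polar: "energy s = (\<integral>\<^sup>+r\<in>{0<..}. (\<integral>\<^sup>+w. increment_energy r (r powr (1 - s)) w \<partial>surface_measure) / ennreal r \<partial>lborel)"
proof -
  define I where "I h = (\<integral>\<^sup>+x. ennreal (\<Phi> x (x + h) (\<bar>u (x + h) - u x\<bar> / norm h powr s) / norm h ^ CARD('n)) \<partial>lborel)" for h
  have [measurable]: "I \<in> borel_measurable borel" unfolding I_def by measurable
  have "energy s = (\<integral>\<^sup>+r\<in>{0<..}. ennreal (r ^ (CARD('n) - 1)) * (\<integral>\<^sup>+w. I (r *\<^sub>R w) \<partial>surface_measure) \<partial>lborel)"
    unfolding energy_shift I_def[symmetric] using nn_integral_polar[of I] by simp
  also have "\<dots> = (\<integral>\<^sup>+r\<in>{0<..}. (\<integral>\<^sup>+w. increment_energy r (r powr (1 - s)) w \<partial>surface_measure) / ennreal r \<partial>lborel)"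
  proof (rule nn_integral_cong)
    fix r :: real
    show "ennreal (r ^ (CARD('n) - 1)) * (\<integral>\<^sup>+w. I (r *\<^sub>R w) \<partial>surface_measure) * indicator {0<..} r = (\<integral>\<^sup>+w. increment_energy r (r powr (1 - s)) w \<partial>surface_measure) / ennreal r * indicator {0<..} r"
    proof (cases "0 < r")
      case True
      have "I (r *\<^sub>R w) = ennreal (1 / r ^ CARD('n)) * increment_energy r (r powr (1 - s)) w" if w: "norm w = 1" for w
      proof -
        have nr: "norm (r *\<^sub>R w) = r" using w True by simp
        have "I (r *\<^sub>R w) = (\<integral>\<^sup>+x. ennreal (1 / r ^ CARD('n)) * ennreal (\<Phi> x (x + r *\<^sub>R w) (r powr (1 - s) * (\<bar>u (x + r *\<^sub>R w) - u x\<bar> / r))) \<partial>lborel)"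
          unfolding I_def nr
        proof (rule nn_integral_cong)
          fix x
          have "\<bar>u (x + r *\<^sub>R w) - u x\<bar> / r powr s = r powr (1 - s) * (\<bar>u (x + r *\<^sub>R w) - u x\<bar> / r)"
            using True by (simp add: powr_diff)
          then show "ennreal (\<Phi> x (x + r *\<^sub>R w) (\<bar>u (x + r *\<^sub>R w) - u x\<bar> / r powr s) / r ^ CARD('n)) = ennreal (1 / r ^ CARD('n)) * ennreal (\<Phi> x (x + r *\<^sub>R w) (r powr (1 - s) * (\<bar>u (x + r *\<^sub>R w) - u x\<bar> / r)))"
            using True by (simp add: ennreal_mult'[symmetric])
        qed
        then show ?thesis unfolding increment_energy_def by (subst (asm) nn_integral_cmult) auto
      qed
      then have "(\<integral>\<^sup>+w. I (r *\<^sub>R w) \<partial>surface_measure) = (\<integral>\<^sup>+w. ennreal (1 / r ^ CARD('n)) * increment_energy r (r powr (1 - s)) w \<partial>surface_measure)"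
        by (intro nn_integral_cong_AE eventually_mono[OF AE_surface_measure]) auto
      also have "\<dots> = ennreal (1 / r ^ CARD('n)) * (\<integral>\<^sup>+w. increment_energy r (r powr (1 - s)) w \<partial>surface_measure)"
        by (rule nn_integral_cmult) measurable
      finally have "ennreal (r ^ (CARD('n) - 1)) * (\<integral>\<^sup>+w. I (r *\<^sub>R w) \<partial>surface_measure) = (ennreal (r ^ (CARD('n) - 1)) * ennreal (1 / r ^ CARD('n))) * (\<integral>\<^sup>+w. increment_energy r (r powr (1 - s)) w \<partial>surface_measure)"
        by (simp add: mult.assoc)
      also have "ennreal (r ^ (CARD('n) - 1)) * ennreal (1 / r ^ CARD('n)) = ennreal (inverse r)"
      proof -
        have "r ^ CARD('n) = r ^ (CARD('n) - 1) * r" by (rule power_minus_mult[symmetric]) simp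
        then have "r ^ (CARD('n) - 1) * (1 / r ^ CARD('n)) = inverse r" using True by (simp add: field_simps)
        then show ?thesis using True by (simp add: ennreal_mult'[symmetric])
      qed
      finally show ?thesis using True by (simp add: divide_ennreal_def inverse_ennreal mult.commute)
    qed simp
  qed
  finally show ?thesis .
qed

lemma increment_energy_le:
  assumes r: "0 < r" and \<rho>: "0 \<le> \<rho>"
  shows "increment_energy r \<rho> w \<le> ennreal C * (ennreal (\<rho> powr p) * (\<integral>\<^sup>+x. ennreal ((\<bar>u (x + r *\<^sub>R w) - u x\<bar> / r) powr p) \<partial>lborel)
     + ennreal (\<rho> powr q) * (\<integral>\<^sup>+x. ennreal ((\<bar>u (x + r *\<^sub>R w) - u x\<bar> / r) powr q) \<partial>lborel))"
proof -
  let ?d = "\<lambda>x. \<bar>u (x + r *\<^sub>R w) - u x\<bar> / r"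
  have "increment_energy r \<rho> w \<le> (\<integral>\<^sup>+x. ennreal C * (ennreal (\<rho> powr p) * ennreal (?d x powr p) + ennreal (\<rho> powr q) * ennreal (?d x powr q)) \<partial>lborel)"
    unfolding increment_energy_def
  proof (rule nn_integral_mono)
    fix x
    have d: "0 \<le> ?d x" using r by simp
    have "\<Phi> x (x + r *\<^sub>R w) (\<rho> * ?d x) \<le> C * ((\<rho> * ?d x) powr p + (\<rho> * ?d x) powr q)"
      by (rule bound) (use \<rho> d in \<open>rule mult_nonneg_nonneg\<close>)
    also have "\<dots> = C * (\<rho> powr p * ?d x powr p + \<rho> powr q * ?d x powr q)"
      unfolding powr_mult ..
    finally have "ennreal (\<Phi> x (x + r *\<^sub>R w) (\<rho> * ?d x)) \<le> ennreal (C * (\<rho> powr p * ?d x powr p + \<rho> powr q * ?d x powr q))"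
      by (rule ennreal_leI)
    also have "\<dots> = ennreal C * (ennreal (\<rho> powr p) * ennreal (?d x powr p) + ennreal (\<rho> powr q) * ennreal (?d x powr q))"
      using C by (simp add: ennreal_mult' ennreal_plus)
    finally show "ennreal (\<Phi> x (x + r *\<^sub>R w) (\<rho> * ?d x)) \<le> ennreal C * (ennreal (\<rho> powr p) * ennreal (?d x powr p) + ennreal (\<rho> powr q) * ennreal (?d x powr q))" .
  qed
  also have "\<dots> = ennreal C * (ennreal (\<rho> powr p) * (\<integral>\<^sup>+x. ennreal (?d x powr p) \<partial>lborel) + ennreal (\<rho> powr q) * (\<integral>\<^sup>+x. ennreal (?d x powr q) \<partial>lborel))"
    by (subst nn_integral_cmult, measurable, subst nn_integral_add, measurable, subst (1 2) nn_integral_cmult) auto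
  finally show ?thesis .
qed

lemma difference_quotient_eq:
  assumes r: "0 < r"
  shows "AE x in lborel. \<bar>u (x + r *\<^sub>R w) - u x\<bar> / r = \<bar>seg_avg (r *\<^sub>R w) (\<lambda>x. v x \<bullet> w) x\<bar>"
  using diff[of "r *\<^sub>R w"]
proof eventually_elim
  case (elim x)
  have "seg_avg (r *\<^sub>R w) (\<lambda>x. v x \<bullet> r *\<^sub>R w) x = r * seg_avg (r *\<^sub>R w) (\<lambda>x. v x \<bullet> w) x"
    unfolding seg_avg_def by (subst integral_mult_right_zero[symmetric]) (simp add: mult_ac)
  then show ?case using elim r by (simp add: abs_mult)
qed

lemma directional_Lp_le:
  assumes "norm w = 1" "0 \<le> a"
  shows "(\<integral>\<^sup>+x. ennreal (\<bar>v x \<bullet> w\<bar> powr a) \<partial>lborel) \<le> (\<integral>\<^sup>+x. ennreal (norm (v x) powr a) \<partial>lborel)"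
proof (intro nn_integral_mono ennreal_leI powr_mono2)
  fix x show "\<bar>v x \<bullet> w\<bar> \<le> norm (v x)" using Cauchy_Schwarz_ineq2[of "v x" w] assms by simp
qed (use assms in auto)

text \<open>
  The difference quotient is a segment average of \<open>v \<bullet> w\<close>, and averaging contracts the norm.  The bound is
  uniform in the step \<open>r\<close>.
\<close>

lemma quotient_Lp_le:
  assumes r: "0 < r" and w: "norm w = 1" and a: "1 < a"
  shows "(\<integral>\<^sup>+x. ennreal ((\<bar>u (x + r *\<^sub>R w) - u x\<bar> / r) powr a) \<partial>lborel) \<le> (\<integral>\<^sup>+x. ennreal (norm (v x) powr a) \<partial>lborel)"
proof -
  have "(\<integral>\<^sup>+x. ennreal ((\<bar>u (x + r *\<^sub>R w) - u x\<bar> / r) powr a) \<partial>lborel) = (\<integral>\<^sup>+x. ennreal (\<bar>seg_avg (r *\<^sub>R w) (\<lambda>x. v x \<bullet> w) x\<bar> powr a) \<partial>lborel)"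
    by (rule nn_integral_cong_AE) (use difference_quotient_eq[OF r, of w] in eventually_elim, simp)
  also have "\<dots> \<le> (\<integral>\<^sup>+x. ennreal (\<bar>v x \<bullet> w\<bar> powr a) \<partial>lborel)"
    by (rule seg_avg_Lp_le[OF a]) measurable
  also have "\<dots> \<le> (\<integral>\<^sup>+x. ennreal (norm (v x) powr a) \<partial>lborel)" by (rule directional_Lp_le) (use w a in auto)
  finally show ?thesis .
qed

definition gradient_bound :: ennreal where
  "gradient_bound = ennreal C * ((\<integral>\<^sup>+x. ennreal (norm (v x) powr p) \<partial>lborel) + (\<integral>\<^sup>+x. ennreal (norm (v x) powr q) \<partial>lborel))"

lemma gradient_bound_finite: "gradient_bound < \<infinity>"
  using v_fin by (simp add: gradient_bound_def ennreal_mult_less_top)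

text \<open>
  Both exponents exceed \<open>1\<close>, so the growth bound gains a factor \<open>\<rho>\<close>, which compensates \<open>d\<rho> / \<rho>\<close>.
\<close>

lemma increment_energy_small_le:
  assumes r: "0 < r" and \<rho>: "0 < \<rho>" "\<rho> < 1" and w: "norm w = 1"
  shows "increment_energy r \<rho> w \<le> ennreal \<rho> * gradient_bound"
proof -
  have pow: "ennreal (\<rho> powr a) \<le> ennreal \<rho>" if "1 < a" for a
    using powr_mono'[of 1 a \<rho>] that \<rho> by (intro ennreal_leI) auto
  have "increment_energy r \<rho> w \<le> ennreal C * (ennreal (\<rho> powr p) * (\<integral>\<^sup>+x. ennreal ((\<bar>u (x + r *\<^sub>R w) - u x\<bar> / r) powr p) \<partial>lborel)
     + ennreal (\<rho> powr q) * (\<integral>\<^sup>+x. ennreal ((\<bar>u (x + r *\<^sub>R w) - u x\<bar> / r) powr q) \<partial>lborel))"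
    by (rule increment_energy_le) (use r \<rho> in auto)
  also have "\<dots> \<le> ennreal C * (ennreal \<rho> * (\<integral>\<^sup>+x. ennreal (norm (v x) powr p) \<partial>lborel) + ennreal \<rho> * (\<integral>\<^sup>+x. ennreal (norm (v x) powr q) \<partial>lborel))"
    using pq by (intro mult_left_mono add_mono mult_mono pow quotient_Lp_le r w) auto
  also have "\<dots> = ennreal \<rho> * gradient_bound" by (simp add: gradient_bound_def distrib_left mult_ac)
  finally show ?thesis .
qed

definition function_bound :: ennreal where
  "function_bound = ennreal C * (ennreal (2 powr p) * (2 * (\<integral>\<^sup>+x. ennreal (\<bar>u x\<bar> powr p) \<partial>lborel)) + ennreal (2 powr q) * (2 * (\<integral>\<^sup>+x. ennreal (\<bar>u x\<bar> powr q) \<partial>lborel)))"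

lemma function_bound_finite: "function_bound < \<infinity>"
  using u_fin by (simp add: function_bound_def ennreal_mult_less_top)

lemma increment_Lp_le:
  assumes a: "0 \<le> a"
  shows "(\<integral>\<^sup>+x. ennreal (\<bar>u (x + h) - u x\<bar> powr a) \<partial>lborel) \<le> ennreal (2 powr a) * (2 * (\<integral>\<^sup>+x. ennreal (\<bar>u x\<bar> powr a) \<partial>lborel))"
proof -
  have "(\<integral>\<^sup>+x. ennreal (\<bar>u (x + h) - u x\<bar> powr a) \<partial>lborel) \<le> (\<integral>\<^sup>+x. ennreal (2 powr a) * (ennreal (\<bar>u (x + h)\<bar> powr a) + ennreal (\<bar>u x\<bar> powr a)) \<partial>lborel)"
  proof (rule nn_integral_mono)
    fix x
    have "\<bar>u (x + h) - u x\<bar> powr a \<le> (\<bar>u (x + h)\<bar> + \<bar>u x\<bar>) powr a" using a by (intro powr_mono2) auto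
    also have "\<dots> \<le> 2 powr a * (\<bar>u (x + h)\<bar> powr a + \<bar>u x\<bar> powr a)" using a by (intro powr_sum_le) auto
    finally show "ennreal (\<bar>u (x + h) - u x\<bar> powr a) \<le> ennreal (2 powr a) * (ennreal (\<bar>u (x + h)\<bar> powr a) + ennreal (\<bar>u x\<bar> powr a))"
      by (simp add: ennreal_mult'[symmetric] ennreal_plus[symmetric] del: ennreal_plus)
  qed
  also have "\<dots> = ennreal (2 powr a) * ((\<integral>\<^sup>+x. ennreal (\<bar>u (x + h)\<bar> powr a) \<partial>lborel) + (\<integral>\<^sup>+x. ennreal (\<bar>u x\<bar> powr a) \<partial>lborel))"
    by (subst nn_integral_cmult, measurable, subst nn_integral_add) auto
  also have "(\<integral>\<^sup>+x. ennreal (\<bar>u (x + h)\<bar> powr a) \<partial>lborel) = (\<integral>\<^sup>+x. ennreal (\<bar>u x\<bar> powr a) \<partial>lborel)"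
    by (rule nn_integral_lborel_shift) measurable
  finally show ?thesis by (simp add: mult_2)
qed

text \<open>
  For \<open>\<rho> = r\<^bsup>1 - s\<^esup>\<close> one has \<open>\<rho> / r = r\<^bsup>-s\<^esup>\<close>, and \<open>s\<close> times either exponent is at least \<open>1/2\<close>.
  Together with \<open>dr / r\<close> this decays integrably at infinity, uniformly in \<open>s \<ge> 1/2\<close>.
\<close>

lemma increment_energy_large_le:
  assumes r: "1 \<le> r" and s: "1 / 2 \<le> s"
  shows "increment_energy r (r powr (1 - s)) w \<le> ennreal (r powr (- 1 / 2)) * function_bound"
proof -
  have r0: "0 < r" using r by simp
  have pow: "ennreal ((r powr (1 - s)) powr a) * (\<integral>\<^sup>+x. ennreal ((\<bar>u (x + r *\<^sub>R w) - u x\<bar> / r) powr a) \<partial>lborel)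
     \<le> ennreal (r powr (- 1 / 2)) * (ennreal (2 powr a) * (2 * (\<integral>\<^sup>+x. ennreal (\<bar>u x\<bar> powr a) \<partial>lborel)))" if a: "1 < a" for a
  proof -
    have "ennreal ((r powr (1 - s)) powr a) * (\<integral>\<^sup>+x. ennreal ((\<bar>u (x + r *\<^sub>R w) - u x\<bar> / r) powr a) \<partial>lborel)
      = (\<integral>\<^sup>+x. ennreal ((r powr (1 - s)) powr a) * ennreal ((\<bar>u (x + r *\<^sub>R w) - u x\<bar> / r) powr a) \<partial>lborel)"
      by (rule nn_integral_cmult[symmetric]) measurable
    also have "\<dots> \<le> (\<integral>\<^sup>+x. ennreal (r powr (- 1 / 2)) * ennreal (\<bar>u (x + r *\<^sub>R w) - u x\<bar> powr a) \<partial>lborel)"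
    proof (rule nn_integral_mono)
      fix x
      have "(r powr (1 - s)) powr a * (\<bar>u (x + r *\<^sub>R w) - u x\<bar> / r) powr a = r powr (- (s * a)) * \<bar>u (x + r *\<^sub>R w) - u x\<bar> powr a"
      proof -
        have "(r powr (1 - s)) powr a / r powr a = r powr (- (s * a))"
          using r0 by (simp add: powr_powr powr_diff[symmetric] algebra_simps)
        moreover have "(r powr (1 - s)) powr a * (\<bar>u (x + r *\<^sub>R w) - u x\<bar> / r) powr a = ((r powr (1 - s)) powr a / r powr a) * \<bar>u (x + r *\<^sub>R w) - u x\<bar> powr a"
          using r0 by (simp add: powr_divide)
        ultimately show ?thesis by (simp only:)
      qed
      also have "\<dots> \<le> r powr (- 1 / 2) * \<bar>u (x + r *\<^sub>R w) - u x\<bar> powr a"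
      proof (intro mult_right_mono powr_mono)
        have "1 / 2 * 1 \<le> s * a" using s a by (intro mult_mono) auto
        then show "- (s * a) \<le> - 1 / 2" by simp
      qed (use r in auto)
      finally show "ennreal ((r powr (1 - s)) powr a) * ennreal ((\<bar>u (x + r *\<^sub>R w) - u x\<bar> / r) powr a) \<le> ennreal (r powr (- 1 / 2)) * ennreal (\<bar>u (x + r *\<^sub>R w) - u x\<bar> powr a)"
        by (simp only: ennreal_mult'[symmetric] powr_ge_zero ennreal_leI)
    qed
    also have "\<dots> = ennreal (r powr (- 1 / 2)) * (\<integral>\<^sup>+x. ennreal (\<bar>u (x + r *\<^sub>R w) - u x\<bar> powr a) \<partial>lborel)"
      by (rule nn_integral_cmult) measurable
    also have "\<dots> \<le> ennreal (r powr (- 1 / 2)) * (ennreal (2 powr a) * (2 * (\<integral>\<^sup>+x. ennreal (\<bar>u x\<bar> powr a) \<partial>lborel)))"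
      using a by (intro mult_left_mono increment_Lp_le) auto
    finally show ?thesis .
  qed
  have "increment_energy r (r powr (1 - s)) w \<le> ennreal C * (ennreal (r powr (- 1 / 2)) * (ennreal (2 powr p) * (2 * (\<integral>\<^sup>+x. ennreal (\<bar>u x\<bar> powr p) \<partial>lborel)))
     + ennreal (r powr (- 1 / 2)) * (ennreal (2 powr q) * (2 * (\<integral>\<^sup>+x. ennreal (\<bar>u x\<bar> powr q) \<partial>lborel))))"
    by (rule order_trans[OF increment_energy_le[OF r0]], simp, intro mult_left_mono add_mono pow pq) auto
  also have "\<dots> = ennreal (r powr (- 1 / 2)) * function_bound"
    unfolding function_bound_def distrib_left[symmetric] by (rule mult.left_commute)
  finally show ?thesis .
qed

lemma increment_energy_tendsto:
  fixes r :: "nat \<Rightarrow> real"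
  assumes r: "r \<longlonglongrightarrow> 0" "\<And>j. 0 < r j" and \<rho>: "0 < \<rho>" "\<rho> < 1" and w: "norm w = 1"
  shows "(\<lambda>j. increment_energy (r j) \<rho> w) \<longlonglongrightarrow> (\<integral>\<^sup>+x. ennreal (\<Phi> x x (\<rho> * \<bar>v x \<bullet> w\<bar>)) \<partial>lborel)"
  unfolding increment_energy_def
proof (rule quotient_energy_tendsto[where \<Phi>="\<lambda>x y t. \<Phi> x y (\<rho> * t)" and f="\<lambda>x. v x \<bullet> w" and h="\<lambda>j. r j *\<^sub>R w" and D="\<lambda>j x. \<bar>u (x + r j *\<^sub>R w) - u x\<bar> / r j" and C=C and p=p and q=q])
  have "(\<lambda>z. \<Phi> (fst z) (fst (snd z)) (\<rho> * snd (snd z))) \<in> borel_measurable borel"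
    by (intro \<Phi>_compose) (simp_all add: borel_prod[symmetric])
  then show "(\<lambda>(x, y, t). \<Phi> x y (\<rho> * t)) \<in> borel_measurable borel" by (simp add: case_prod_unfold)
  show "(\<lambda>j. \<Phi> x (y j) (\<rho> * t j)) \<longlonglongrightarrow> \<Phi> x x (\<rho> * T)"
    if "y \<longlonglongrightarrow> x" "t \<longlonglongrightarrow> T" "\<And>j. 0 \<le> t j" for x and y :: "nat \<Rightarrow> real^'n" and t :: "nat \<Rightarrow> real" and T
    using that \<rho> by (intro cont tendsto_intros) auto
  show "\<Phi> x y (\<rho> * t) \<le> C * (t powr p + t powr q)" if t: "0 \<le> t" for x y t
  proof -
    have le: "(\<rho> * t) powr a \<le> t powr a" if "1 < a" for a
      using t \<rho> that by (intro powr_mono2) (auto simp: mult_left_le_one_le)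
    have "\<Phi> x y (\<rho> * t) \<le> C * ((\<rho> * t) powr p + (\<rho> * t) powr q)" using t \<rho> by (intro bound) auto
    also have "\<dots> \<le> C * (t powr p + t powr q)" using C pq by (intro mult_left_mono add_mono le) auto
    finally show ?thesis .
  qed
  show "(\<integral>\<^sup>+x. ennreal (\<bar>v x \<bullet> w\<bar> powr p) \<partial>lborel) < \<infinity>"
    by (rule le_less_trans[OF directional_Lp_le[OF w] v_fin(1)]) (use pq in simp)
  show "(\<integral>\<^sup>+x. ennreal (\<bar>v x \<bullet> w\<bar> powr q) \<partial>lborel) < \<infinity>"
    by (rule le_less_trans[OF directional_Lp_le[OF w] v_fin(2)]) (use pq in simp)
  have "(\<lambda>j. r j *\<^sub>R w) \<longlonglongrightarrow> 0 *\<^sub>R w" by (intro tendsto_intros r)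
  then show "(\<lambda>j. r j *\<^sub>R w) \<longlonglongrightarrow> 0" by simp
  show "AE x in lborel. \<bar>u (x + r j *\<^sub>R w) - u x\<bar> / r j = \<bar>seg_avg (r j *\<^sub>R w) (\<lambda>x. v x \<bullet> w) x\<bar>" for j
    by (rule difference_quotient_eq[OF r(2)])
qed (use C pq in \<open>auto\<close>)

lemma surface_mass_finite: "emeasure (surface_measure :: (real^'n) measure) UNIV < \<infinity>"
  by (metis surface_measure.emeasure_finite infinity_ennreal_def less_top)

lemma sphere_mean_tendsto:
  fixes r :: "nat \<Rightarrow> real"
  assumes r: "r \<longlonglongrightarrow> 0" "\<And>j. 0 < r j" and \<rho>: "0 < \<rho>" "\<rho> < 1"
  shows "(\<lambda>j. \<integral>\<^sup>+w. increment_energy (r j) \<rho> w \<partial>surface_measure) \<longlonglongrightarrow> (\<integral>\<^sup>+w. (\<integral>\<^sup>+x. ennreal (\<Phi> x x (\<rho> * \<bar>v x \<bullet> w\<bar>)) \<partial>lborel) \<partial>surface_measure)"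
proof (rule nn_integral_dominated_convergence[where w="\<lambda>_. ennreal \<rho> * gradient_bound"])
  show "AE w in surface_measure. increment_energy (r j) \<rho> w \<le> ennreal \<rho> * gradient_bound" for j
    using AE_surface_measure by eventually_elim (rule increment_energy_small_le[OF r(2) \<rho>])
  show "AE w in surface_measure. (\<lambda>j. increment_energy (r j) \<rho> w) \<longlonglongrightarrow> (\<integral>\<^sup>+x. ennreal (\<Phi> x x (\<rho> * \<bar>v x \<bullet> w\<bar>)) \<partial>lborel)"
    using AE_surface_measure by eventually_elim (rule increment_energy_tendsto[OF r \<rho>])
  show "(\<integral>\<^sup>+w. ennreal \<rho> * gradient_bound \<partial>(surface_measure :: (real^'n) measure)) < \<infinity>"
    using gradient_bound_finite surface_mass_finite by (simp add: ennreal_mult_less_top)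
qed measurable

text \<open>
  After the substitution \<open>\<rho> = r\<^bsup>1 - s\<^esup>\<close> the prefactor is gone, and for fixed \<open>\<rho> < 1\<close> the step
  \<open>\<rho>\<^bsup>1/(1 - s)\<^esup>\<close> tends to \<open>0\<close>.
\<close>

lemma small_scales_tendsto:
  fixes s :: "nat \<Rightarrow> real"
  assumes s: "s \<longlonglongrightarrow> 1" "\<And>j. s j < 1"
  shows "(\<lambda>j. ennreal (1 - s j) * (\<integral>\<^sup>+r\<in>{0<..<1}. (\<integral>\<^sup>+w. increment_energy r (r powr (1 - s j)) w \<partial>surface_measure) / ennreal r \<partial>lborel)) \<longlonglongrightarrow> limit_energy"
proof -
  have eq: "ennreal (1 - s j) * (\<integral>\<^sup>+r\<in>{0<..<1}. (\<integral>\<^sup>+w. increment_energy r (r powr (1 - s j)) w \<partial>surface_measure) / ennreal r \<partial>lborel)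
     = (\<integral>\<^sup>+\<rho>\<in>{0<..<1}. (\<integral>\<^sup>+w. increment_energy (\<rho> powr (1 / (1 - s j))) \<rho> w \<partial>surface_measure) / ennreal \<rho> \<partial>lborel)" for j
  proof -
    have "ennreal (1 - s j) * (\<integral>\<^sup>+r\<in>{0<..<1}. (\<integral>\<^sup>+w. increment_energy r (r powr (1 - s j)) w \<partial>surface_measure) / ennreal r \<partial>lborel)
      = (\<integral>\<^sup>+\<rho>\<in>{0<..<1}. (\<integral>\<^sup>+w. increment_energy (\<rho> powr (1 / (1 - s j))) ((\<rho> powr (1 / (1 - s j))) powr (1 - s j)) w \<partial>surface_measure) / ennreal \<rho> \<partial>lborel)"
      by (rule nn_integral_log_scaling, measurable) (use s in simp)
    also have "\<dots> = (\<integral>\<^sup>+\<rho>\<in>{0<..<1}. (\<integral>\<^sup>+w. increment_energy (\<rho> powr (1 / (1 - s j))) \<rho> w \<partial>surface_measure) / ennreal \<rho> \<partial>lborel)"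
    proof (rule nn_integral_cong)
      fix \<rho> :: real
      have "s j \<noteq> 1" using s(2)[of j] by simp
      then have "(\<rho> powr (1 / (1 - s j))) powr (1 - s j) = \<rho>" if "0 < \<rho>" using that by (simp add: powr_powr)
      then show "(\<integral>\<^sup>+w. increment_energy (\<rho> powr (1 / (1 - s j))) ((\<rho> powr (1 / (1 - s j))) powr (1 - s j)) w \<partial>surface_measure) / ennreal \<rho> * indicator {0<..<1} \<rho>
        = (\<integral>\<^sup>+w. increment_energy (\<rho> powr (1 / (1 - s j))) \<rho> w \<partial>surface_measure) / ennreal \<rho> * indicator {0<..<1} \<rho>"
        by (cases "\<rho> \<in> {0<..<1}") auto
    qed
    finally show ?thesis .
  qed
  define K where "K = gradient_bound * emeasure (surface_measure :: (real^'n) measure) UNIV"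
  have K: "K < \<infinity>" using gradient_bound_finite surface_mass_finite by (simp add: K_def ennreal_mult_less_top)
  show ?thesis
    unfolding eq limit_energy_def
  proof (rule nn_integral_dominated_convergence[where w="\<lambda>\<rho>. K * indicator {0<..<1} \<rho>"])
    show "AE \<rho> in lborel. (\<integral>\<^sup>+w. increment_energy (\<rho> powr (1 / (1 - s j))) \<rho> w \<partial>surface_measure) / ennreal \<rho> * indicator {0<..<1} \<rho> \<le> K * indicator {0<..<1} \<rho>" for j
    proof (rule AE_I2)
      fix \<rho> :: real
      show "(\<integral>\<^sup>+w. increment_energy (\<rho> powr (1 / (1 - s j))) \<rho> w \<partial>surface_measure) / ennreal \<rho> * indicator {0<..<1} \<rho> \<le> K * indicator {0<..<1} \<rho>"
      proof (cases "0 < \<rho> \<and> \<rho> < 1")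
        case True
        then have \<rho>: "0 < \<rho>" "\<rho> < 1" by auto
        have "(\<integral>\<^sup>+w. increment_energy (\<rho> powr (1 / (1 - s j))) \<rho> w \<partial>surface_measure) \<le> (\<integral>\<^sup>+w. ennreal \<rho> * gradient_bound \<partial>(surface_measure :: (real^'n) measure))"
          by (rule nn_integral_mono_AE) (use AE_surface_measure in eventually_elim, rule increment_energy_small_le[OF _ \<rho>], use \<rho> in simp)
        also have "\<dots> = ennreal \<rho> * K" by (simp add: K_def mult.assoc)
        finally have "(\<integral>\<^sup>+w. increment_energy (\<rho> powr (1 / (1 - s j))) \<rho> w \<partial>surface_measure) / ennreal \<rho> \<le> ennreal \<rho> * K / ennreal \<rho>"
          by (rule divide_right_mono_ennreal)
        also have "\<dots> = K"
          using \<rho> by (simp add: divide_ennreal_def inverse_ennreal mult.commute[of _ K] mult.assoc ennreal_mult'[symmetric])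
        finally show ?thesis using \<rho> by simp
      qed auto
    qed
    show "(\<integral>\<^sup>+\<rho>. K * indicator {0<..<1::real} \<rho> \<partial>lborel) < \<infinity>"
      using K by (subst nn_integral_cmult_indicator) auto
    show "AE \<rho> in lborel. (\<lambda>j. (\<integral>\<^sup>+w. increment_energy (\<rho> powr (1 / (1 - s j))) \<rho> w \<partial>surface_measure) / ennreal \<rho> * indicator {0<..<1} \<rho>)
       \<longlonglongrightarrow> (\<integral>\<^sup>+w. (\<integral>\<^sup>+x. ennreal (\<Phi> x x (\<rho> * \<bar>v x \<bullet> w\<bar>)) \<partial>lborel) \<partial>surface_measure) / ennreal \<rho> * indicator {0<..<1} \<rho>"
    proof (rule AE_I2)
      fix \<rho> :: real
      show "(\<lambda>j. (\<integral>\<^sup>+w. increment_energy (\<rho> powr (1 / (1 - s j))) \<rho> w \<partial>surface_measure) / ennreal \<rho> * indicator {0<..<1} \<rho>)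
       \<longlonglongrightarrow> (\<integral>\<^sup>+w. (\<integral>\<^sup>+x. ennreal (\<Phi> x x (\<rho> * \<bar>v x \<bullet> w\<bar>)) \<partial>lborel) \<partial>surface_measure) / ennreal \<rho> * indicator {0<..<1} \<rho>"
      proof (cases "0 < \<rho> \<and> \<rho> < 1")
        case True
        then have \<rho>: "0 < \<rho>" "\<rho> < 1" by auto
        have "(\<lambda>j. \<rho> powr (1 / (1 - s j))) \<longlonglongrightarrow> 0"
        proof -
          have "(\<lambda>j. 1 - s j) \<longlonglongrightarrow> 1 - 1" by (intro tendsto_intros s)
          then have "filterlim (\<lambda>j. 1 - s j) (at_right 0) sequentially"
            using s(2) by (simp add: filterlim_at less_imp_neq)
          then have "filterlim (\<lambda>j. inverse (1 - s j)) at_top sequentially"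
            by (rule filterlim_compose[OF filterlim_inverse_at_top_right])
          then have "filterlim (\<lambda>j. ln \<rho> * inverse (1 - s j)) at_bot sequentially"
            using \<rho> by (intro filterlim_tendsto_neg_mult_at_bot[OF tendsto_const]) auto
          then have "(\<lambda>j. exp (ln \<rho> * inverse (1 - s j))) \<longlonglongrightarrow> 0"
            by (rule filterlim_compose[OF exp_at_bot])
          then show ?thesis using \<rho> by (simp add: powr_def divide_inverse mult.commute)
        qed
        then have "(\<lambda>j. \<integral>\<^sup>+w. increment_energy (\<rho> powr (1 / (1 - s j))) \<rho> w \<partial>surface_measure) \<longlonglongrightarrow> (\<integral>\<^sup>+w. (\<integral>\<^sup>+x. ennreal (\<Phi> x x (\<rho> * \<bar>v x \<bullet> w\<bar>)) \<partial>lborel) \<partial>surface_measure)"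
          by (rule sphere_mean_tendsto) (use \<rho> in auto)
        then have "(\<lambda>j. ennreal (inverse \<rho>) * (\<integral>\<^sup>+w. increment_energy (\<rho> powr (1 / (1 - s j))) \<rho> w \<partial>surface_measure)) \<longlonglongrightarrow> ennreal (inverse \<rho>) * (\<integral>\<^sup>+w. (\<integral>\<^sup>+x. ennreal (\<Phi> x x (\<rho> * \<bar>v x \<bullet> w\<bar>)) \<partial>lborel) \<partial>surface_measure)"
          by (intro ennreal_tendsto_cmult) auto
        then show ?thesis using \<rho> by (simp add: divide_ennreal_def inverse_ennreal mult.commute)
      qed auto
    qed
  qed measurable
qed

lemma large_scales_tendsto:
  fixes s :: "nat \<Rightarrow> real"
  assumes s: "s \<longlonglongrightarrow> 1" "\<And>j. 1 / 2 < s j" "\<And>j. s j < 1"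
  shows "(\<lambda>j. ennreal (1 - s j) * (\<integral>\<^sup>+r\<in>{1..}. (\<integral>\<^sup>+w. increment_energy r (r powr (1 - s j)) w \<partial>surface_measure) / ennreal r \<partial>lborel)) \<longlonglongrightarrow> 0"
proof -
  define K where "K = function_bound * emeasure (surface_measure :: (real^'n) measure) UNIV"
  have K: "K < \<infinity>" using function_bound_finite surface_mass_finite by (simp add: K_def ennreal_mult_less_top)
  have le: "(\<integral>\<^sup>+r\<in>{1..}. (\<integral>\<^sup>+w. increment_energy r (r powr (1 - s j)) w \<partial>surface_measure) / ennreal r \<partial>lborel) \<le> K * 2" for j
  proof -
    have "(\<integral>\<^sup>+r\<in>{1..}. (\<integral>\<^sup>+w. increment_energy r (r powr (1 - s j)) w \<partial>surface_measure) / ennreal r \<partial>lborel) \<le> (\<integral>\<^sup>+r. K * (ennreal (r powr (- 3 / 2)) * indicator {1..} r) \<partial>lborel)"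
    proof (rule nn_integral_mono)
      fix r :: real
      show "(\<integral>\<^sup>+w. increment_energy r (r powr (1 - s j)) w \<partial>surface_measure) / ennreal r * indicator {1..} r \<le> K * (ennreal (r powr (- 3 / 2)) * indicator {1..} r)"
      proof (cases "1 \<le> r")
        case True
        have "(\<integral>\<^sup>+w. increment_energy r (r powr (1 - s j)) w \<partial>surface_measure) \<le> (\<integral>\<^sup>+w. ennreal (r powr (- 1 / 2)) * function_bound \<partial>(surface_measure :: (real^'n) measure))"
          by (intro nn_integral_mono increment_energy_large_le True less_imp_le s)
        also have "\<dots> = K * ennreal (r powr (- 1 / 2))" by (simp add: K_def mult_ac)
        finally have "(\<integral>\<^sup>+w. increment_energy r (r powr (1 - s j)) w \<partial>surface_measure) / ennreal r \<le> K * ennreal (r powr (- 1 / 2)) / ennreal r"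
          by (rule divide_right_mono_ennreal)
        also have "\<dots> = K * ennreal (r powr (- 3 / 2))"
        proof -
          have "r powr (- 1 / 2) * inverse r = r powr (- 1 / 2) * r powr (- 1)" using True by (simp add: powr_minus)
          also have "\<dots> = r powr (- 3 / 2)" by (subst powr_add[symmetric]) simp
          finally have "r powr (- 1 / 2) * inverse r = r powr (- 3 / 2)" .
          then show ?thesis using True by (simp add: divide_ennreal_def inverse_ennreal mult.assoc ennreal_mult'[symmetric])
        qed
        finally show ?thesis using True by simp
      qed auto
    qed
    also have "\<dots> = K * 2" by (subst nn_integral_cmult) (auto simp: nn_integral_tail[simplified])
    finally show ?thesis .
  qed
  have "(\<lambda>j. 1 - s j) \<longlonglongrightarrow> 1 - 1" by (intro tendsto_intros s)
  then have "(\<lambda>j. ennreal (1 - s j)) \<longlonglongrightarrow> ennreal 0" by (intro tendsto_ennrealI) simp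
  then have "(\<lambda>j. (K * 2) * ennreal (1 - s j)) \<longlonglongrightarrow> (K * 2) * ennreal 0"
    using K by (intro ennreal_tendsto_cmult) (auto simp: ennreal_mult_less_top)
  then have lim: "(\<lambda>j. ennreal (1 - s j) * (K * 2)) \<longlonglongrightarrow> 0" by (simp add: mult.commute)
  show ?thesis
    by (rule tendsto_sandwich[OF _ _ tendsto_const lim]) (auto intro!: always_eventually mult_left_mono le)
qed

theorem scaled_energy_tendsto: "((\<lambda>s. ennreal (1 - s) * energy s) \<longlongrightarrow> limit_energy) (at_left 1)"
proof (rule tendsto_at_left_sequentially[of "1/2"])
  fix s :: "nat \<Rightarrow> real" assume s: "\<And>j. s j < 1" "\<And>j. 1 / 2 < s j" "s \<longlonglongrightarrow> 1"
  let ?f = "\<lambda>j r. (\<integral>\<^sup>+w. increment_energy r (r powr (1 - s j)) w \<partial>surface_measure) / ennreal r"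
  have eq: "ennreal (1 - s j) * energy (s j) = ennreal (1 - s j) * (\<integral>\<^sup>+r\<in>{0<..<1}. ?f j r \<partial>lborel) + ennreal (1 - s j) * (\<integral>\<^sup>+r\<in>{1..}. ?f j r \<partial>lborel)" for j
  proof -
    have "energy (s j) = (\<integral>\<^sup>+r. ?f j r * indicator {0<..<1} r + ?f j r * indicator {1..} r \<partial>lborel)"
      unfolding energy_polar by (intro nn_integral_cong) (auto simp: indicator_def)
    also have "\<dots> = (\<integral>\<^sup>+r\<in>{0<..<1}. ?f j r \<partial>lborel) + (\<integral>\<^sup>+r\<in>{1..}. ?f j r \<partial>lborel)"
      by (rule nn_integral_add) measurable
    finally show ?thesis by (simp add: distrib_left)
  qed
  have "(\<lambda>j. ennreal (1 - s j) * (\<integral>\<^sup>+r\<in>{0<..<1}. ?f j r \<partial>lborel) + ennreal (1 - s j) * (\<integral>\<^sup>+r\<in>{1..}. ?f j r \<partial>lborel)) \<longlonglongrightarrow> limit_energy + 0"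
    by (intro tendsto_add small_scales_tendsto large_scales_tendsto s)
  then show "(\<lambda>j. ennreal (1 - s j) * energy (s j)) \<longlonglongrightarrow> limit_energy" unfolding eq by simp
qed simp

text \<open>
  Fubini, and rotation of \<open>v x\<close> to the \<open>k\<close>-th axis for each \<open>x\<close>.
\<close>

lemma limit_energy_eq:
  fixes k :: 'n
  shows "limit_energy = (\<integral>\<^sup>+x. (\<integral>\<^sup>+\<rho>\<in>{0<..<1}. (\<integral>\<^sup>+w. ennreal (\<Phi> x x (norm (v x) * \<bar>w $ k\<bar> * \<rho>)) \<partial>surface_measure) / ennreal \<rho> \<partial>lborel) \<partial>lborel)"
proof -
  interpret SL: pair_sigma_finite "surface_measure :: (real^'n) measure" "lborel :: (real^'n) measure" ..
  have "limit_energy = (\<integral>\<^sup>+\<rho>. (\<integral>\<^sup>+x. (\<integral>\<^sup>+w. ennreal (\<Phi> x x (\<rho> * \<bar>v x \<bullet> w\<bar>)) \<partial>surface_measure) / ennreal \<rho> * indicator {0<..<1} \<rho> \<partial>lborel) \<partial>lborel)"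
    unfolding limit_energy_def
  proof (rule nn_integral_cong)
    fix \<rho> :: real
    have "(\<integral>\<^sup>+w. (\<integral>\<^sup>+x. ennreal (\<Phi> x x (\<rho> * \<bar>v x \<bullet> w\<bar>)) \<partial>lborel) \<partial>surface_measure) = (\<integral>\<^sup>+x. (\<integral>\<^sup>+w. ennreal (\<Phi> x x (\<rho> * \<bar>v x \<bullet> w\<bar>)) \<partial>surface_measure) \<partial>lborel)"
      by (rule SL.Fubini'[symmetric]) measurable
    then show "(\<integral>\<^sup>+w. (\<integral>\<^sup>+x. ennreal (\<Phi> x x (\<rho> * \<bar>v x \<bullet> w\<bar>)) \<partial>lborel) \<partial>surface_measure) / ennreal \<rho> * indicator {0<..<1} \<rho>
       = (\<integral>\<^sup>+x. (\<integral>\<^sup>+w. ennreal (\<Phi> x x (\<rho> * \<bar>v x \<bullet> w\<bar>)) \<partial>surface_measure) / ennreal \<rho> * indicator {0<..<1} \<rho> \<partial>lborel)"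
      by (simp add: divide_ennreal_def nn_integral_multc)
  qed
  also have "\<dots> = (\<integral>\<^sup>+x. (\<integral>\<^sup>+\<rho>. (\<integral>\<^sup>+w. ennreal (\<Phi> x x (\<rho> * \<bar>v x \<bullet> w\<bar>)) \<partial>surface_measure) / ennreal \<rho> * indicator {0<..<1} \<rho> \<partial>lborel) \<partial>lborel)"
    by (rule lborel_pair.Fubini') measurable
  also have "\<dots> = (\<integral>\<^sup>+x. (\<integral>\<^sup>+\<rho>\<in>{0<..<1}. (\<integral>\<^sup>+w. ennreal (\<Phi> x x (norm (v x) * \<bar>w $ k\<bar> * \<rho>)) \<partial>surface_measure) / ennreal \<rho> \<partial>lborel) \<partial>lborel)"
  proof (intro nn_integral_cong)
    fix x and \<rho> :: real
    have "(\<integral>\<^sup>+w. ennreal (\<Phi> x x (\<rho> * \<bar>v x \<bullet> w\<bar>)) \<partial>surface_measure) = (\<integral>\<^sup>+w. ennreal (\<Phi> x x (\<rho> * \<bar>norm (v x) * w $ k\<bar>)) \<partial>surface_measure)"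
      by (rule nn_integral_surface_measure_inner[of "\<lambda>z. ennreal (\<Phi> x x (\<rho> * \<bar>z\<bar>))"]) measurable
    also have "\<dots> = (\<integral>\<^sup>+w. ennreal (\<Phi> x x (norm (v x) * \<bar>w $ k\<bar> * \<rho>)) \<partial>surface_measure)"
      by (simp add: abs_mult mult_ac)
    finally show "(\<integral>\<^sup>+w. ennreal (\<Phi> x x (\<rho> * \<bar>v x \<bullet> w\<bar>)) \<partial>surface_measure) / ennreal \<rho> * indicator {0<..<1} \<rho>
      = (\<integral>\<^sup>+w. ennreal (\<Phi> x x (norm (v x) * \<bar>w $ k\<bar> * \<rho>)) \<partial>surface_measure) / ennreal \<rho> * indicator {0<..<1} \<rho>" by simp
  qed
  finally show ?thesis .
qed

end

section \<open>Weak gradients and the nonlocal energy\<close>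

lemma locally_integrable_measurable:
  fixes f :: "'a::euclidean_space \<Rightarrow> 'b::euclidean_space"
  assumes f: "locally_integrable f"
  shows "f \<in> borel_measurable lebesgue"
proof (rule borel_measurable_LIMSEQ_metric)
  show "(\<lambda>x. indicator (cball 0 (real i)) x *\<^sub>R f x) \<in> borel_measurable lebesgue" for i
  proof -
    have "integrable lebesgue (\<lambda>x. indicator (cball 0 (real i)) x *\<^sub>R f x)"
      using f unfolding locally_integrable_def set_integrable_def by (auto simp: compact_cball)
    then show ?thesis by (rule borel_measurable_integrable)
  qed
  fix x :: 'a
  obtain N where N: "norm x \<le> real N" using real_arch_simple by blast
  have "\<forall>\<^sub>F i in sequentially. f x = indicator (cball 0 (real i)) x *\<^sub>R f x"
    unfolding eventually_sequentially
  proof (intro exI allI impI)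
    fix i assume "N \<le> i"
    then have "norm x \<le> real i" using N by (meson of_nat_le_iff order_trans)
    then show "f x = indicator (cball 0 (real i)) x *\<^sub>R f x" by simp
  qed
  then show "(\<lambda>i. indicator (cball 0 (real i)) x *\<^sub>R f x) \<longlonglongrightarrow> f x"
    by (rule Lim_transform_eventually[OF tendsto_const])
qed

lemma locally_integrable_inner:
  fixes f :: "'a::euclidean_space \<Rightarrow> 'b::euclidean_space"
  assumes "locally_integrable f"
  shows "locally_integrable (\<lambda>x. f x \<bullet> e)"
  unfolding locally_integrable_def set_integrable_def
proof (intro allI impI)
  fix K :: "'a set" assume "compact K"
  then have "integrable lebesgue (\<lambda>x. indicator K x *\<^sub>R f x)"
    using assms unfolding locally_integrable_def set_integrable_def by blast
  then have "integrable lebesgue (\<lambda>x. (indicator K x *\<^sub>R f x) \<bullet> e)" by (rule integrable_inner_left)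
  then show "integrable lebesgue (\<lambda>x. indicator K x *\<^sub>R (f x \<bullet> e))" by simp
qed

lemma borel_version_locally_integrable:
  fixes f :: "'a::euclidean_space \<Rightarrow> real"
  assumes f: "locally_integrable f"
  obtains f' where "borel_loc_integrable f'" "AE x in lborel. f x = f' x"
proof -
  obtain f' where f': "f' \<in> borel_measurable lborel" "AE x in lborel. f x = f' x"
    using completion_ex_borel_measurable_real[OF locally_integrable_measurable[OF f]] by blast
  have [measurable]: "f' \<in> borel_measurable borel" using f'(1) by simp
  have "integrable lborel (\<lambda>x. indicator (cball 0 R) x * f' x)" for R
  proof -
    have [measurable]: "cball (0::'a) R \<in> sets borel" by simp
    have m: "(\<lambda>x. indicator (cball 0 R) x * f' x) \<in> borel_measurable lborel" by measurable
    have int: "integrable lebesgue (\<lambda>x. indicator (cball 0 R) x *\<^sub>R f x)"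
      using f unfolding locally_integrable_def set_integrable_def by (auto simp: compact_cball)
    have "integrable lebesgue (\<lambda>x. indicator (cball 0 R) x * f' x)"
    proof (rule integrable_cong_AE_imp[OF int measurable_completion[OF m]])
      show "AE x in lebesgue. indicator (cball 0 R) x *\<^sub>R f x = indicator (cball 0 R) x * f' x"
        using AE_completion[OF f'(2)] by eventually_elim simp
    qed
    then show ?thesis using integrable_completion[OF m] by simp
  qed
  then have "borel_loc_integrable f'" by (simp add: borel_loc_integrable_def)
  then show thesis using f'(2) by (rule that)
qed

lemma weak_gradient_directional:
  fixes u :: "'a::euclidean_space \<Rightarrow> real"
  assumes wg: "has_weak_gradient u a"
    and u': "u' \<in> borel_measurable borel" "AE x in lborel. u x = u' x"
    and w: "w \<in> borel_measurable borel" "AE x in lborel. a x \<bullet> h = w x"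
    and t: "test_function \<phi>" and D: "\<And>x. GDERIV \<phi> x :> D\<phi> x"
  shows "(\<integral>x. u' x * (D\<phi> x \<bullet> h) \<partial>lborel) = - (\<integral>x. \<phi> x * w x \<partial>lborel)"
proof -
  have li: "locally_integrable u" "locally_integrable a"
    and wk: "(\<integral>x. u x *\<^sub>R D\<phi> x \<partial>lebesgue) = - (\<integral>x. \<phi> x *\<^sub>R a x \<partial>lebesgue)"
    using wg t D by (auto simp: has_weak_gradient_def)
  obtain R where R: "\<And>x. norm x > R \<Longrightarrow> \<phi> x = 0" using test_function_support[OF t] by blast
  note gr = test_function_gradient[OF t D R]
  obtain M where M: "\<And>x. \<bar>\<phi> x\<bar> \<le> M" using continuous_compact_support_bounded[OF gr(1) R] by blast
  have "continuous_on UNIV (\<lambda>x. norm (D\<phi> x))" by (intro continuous_intros gr(2))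
  then obtain N where N: "\<And>x. \<bar>norm (D\<phi> x)\<bar> \<le> N"
    by (rule continuous_compact_support_bounded[where R=R]) (use gr(3) in auto)
  have D0: "norm x > R \<Longrightarrow> D\<phi> x = 0" for x by (rule gr(3))
  have [measurable]: "\<phi> \<in> borel_measurable borel" "D\<phi> \<in> borel_measurable borel"
    using gr(1,2) by (auto intro: borel_measurable_continuous_onI)
  note [measurable] = u'(1) w(1)
  have lm: "\<phi> \<in> borel_measurable lebesgue" "D\<phi> \<in> borel_measurable lebesgue"
    by (auto intro!: measurable_completion)
  note um = locally_integrable_measurable[OF li(1)] and am = locally_integrable_measurable[OF li(2)]
  have i1: "integrable lebesgue (\<lambda>x. u x *\<^sub>R D\<phi> x)"
  proof (rule Bochner_Integration.integrable_bound)
    show "integrable lebesgue (\<lambda>x. N *\<^sub>R (indicator (cball 0 R) x *\<^sub>R u x))"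
      using li(1) unfolding locally_integrable_def set_integrable_def by (intro integrable_scaleR_right) (auto simp: compact_cball)
    show "AE x in lebesgue. norm (u x *\<^sub>R D\<phi> x) \<le> norm (N *\<^sub>R (indicator (cball 0 R) x *\<^sub>R u x))"
    proof (rule AE_I2)
      fix x
      show "norm (u x *\<^sub>R D\<phi> x) \<le> norm (N *\<^sub>R (indicator (cball 0 R) x *\<^sub>R u x))"
        using mult_left_mono[of "norm (D\<phi> x)" "\<bar>N\<bar>" "\<bar>u x\<bar>"] N[of x] D0[of x]
        by (cases "norm x > R") (auto simp: mult.commute not_less)
    qed
    show "(\<lambda>x. u x *\<^sub>R D\<phi> x) \<in> borel_measurable lebesgue" using um lm by simp
  qed
  have i2: "integrable lebesgue (\<lambda>x. \<phi> x *\<^sub>R a x)"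
  proof (rule Bochner_Integration.integrable_bound)
    show "integrable lebesgue (\<lambda>x. M *\<^sub>R (indicator (cball 0 R) x *\<^sub>R a x))"
      using li(2) unfolding locally_integrable_def set_integrable_def by (intro integrable_scaleR_right) (auto simp: compact_cball)
    show "AE x in lebesgue. norm (\<phi> x *\<^sub>R a x) \<le> norm (M *\<^sub>R (indicator (cball 0 R) x *\<^sub>R a x))"
    proof (rule AE_I2)
      fix x
      show "norm (\<phi> x *\<^sub>R a x) \<le> norm (M *\<^sub>R (indicator (cball 0 R) x *\<^sub>R a x))"
        using mult_right_mono[of "\<bar>\<phi> x\<bar>" "\<bar>M\<bar>" "norm (a x)"] M[of x] R[of x]
        by (cases "norm x > R") (auto simp: not_less)
    qed
    show "(\<lambda>x. \<phi> x *\<^sub>R a x) \<in> borel_measurable lebesgue" using am lm by simp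
  qed
  have "(\<integral>x. u' x * (D\<phi> x \<bullet> h) \<partial>lborel) = (\<integral>x. u' x * (D\<phi> x \<bullet> h) \<partial>lebesgue)"
    by (rule integral_completion[symmetric]) measurable
  also have "\<dots> = (\<integral>x. (u x *\<^sub>R D\<phi> x) \<bullet> h \<partial>lebesgue)"
  proof (rule integral_cong_AE)
    show "(\<lambda>x. u' x * (D\<phi> x \<bullet> h)) \<in> borel_measurable lebesgue" by (rule measurable_completion) measurable
    show "(\<lambda>x. (u x *\<^sub>R D\<phi> x) \<bullet> h) \<in> borel_measurable lebesgue" using um lm by simp
    show "AE x in lebesgue. u' x * (D\<phi> x \<bullet> h) = (u x *\<^sub>R D\<phi> x) \<bullet> h"
      using AE_completion[OF u'(2)] by eventually_elim simp
  qed
  also have "\<dots> = (\<integral>x. u x *\<^sub>R D\<phi> x \<partial>lebesgue) \<bullet> h" by (rule integral_inner_left) (rule i1)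
  also have "\<dots> = - ((\<integral>x. \<phi> x *\<^sub>R a x \<partial>lebesgue) \<bullet> h)" unfolding wk by simp
  also have "(\<integral>x. \<phi> x *\<^sub>R a x \<partial>lebesgue) \<bullet> h = (\<integral>x. (\<phi> x *\<^sub>R a x) \<bullet> h \<partial>lebesgue)"
    by (rule integral_inner_left[symmetric]) (rule i2)
  also have "\<dots> = (\<integral>x. \<phi> x * w x \<partial>lebesgue)"
  proof (rule integral_cong_AE)
    show "(\<lambda>x. \<phi> x * w x) \<in> borel_measurable lebesgue" by (rule measurable_completion) measurable
    show "(\<lambda>x. (\<phi> x *\<^sub>R a x) \<bullet> h) \<in> borel_measurable lebesgue" using am lm by simp
    show "AE x in lebesgue. (\<phi> x *\<^sub>R a x) \<bullet> h = \<phi> x * w x"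
      using AE_completion[OF w(2)] by eventually_elim simp
  qed
  also have "\<dots> = (\<integral>x. \<phi> x * w x \<partial>lborel)"
    by (rule integral_completion) measurable
  finally show ?thesis .
qed

text \<open>
  Membership in the two Sobolev spaces provides gradients that may differ from each other and from a
  given one.  They agree almost everywhere, so a single function carries both integrability
  properties.
\<close>

lemma weak_gradient_unique:
  fixes u :: "'a::euclidean_space \<Rightarrow> real"
  assumes a: "has_weak_gradient u a" and b: "has_weak_gradient u b"
  shows "AE x in lborel. a x = b x"
proof -
  have li: "locally_integrable u" "locally_integrable a" "locally_integrable b"
    using a b by (auto simp: has_weak_gradient_def)
  obtain u' where u': "borel_loc_integrable u'" "AE x in lborel. u x = u' x"
    by (rule borel_version_locally_integrable[OF li(1)])
  have u'm: "u' \<in> borel_measurable borel" using u' by (simp add: borel_loc_integrable_def)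
  have "AE x in lborel. a x \<bullet> e = b x \<bullet> e" for e
  proof -
    obtain a' where a': "borel_loc_integrable a'" "AE x in lborel. a x \<bullet> e = a' x"
      by (rule borel_version_locally_integrable[OF locally_integrable_inner[OF li(2), of e]])
    obtain b' where b': "borel_loc_integrable b'" "AE x in lborel. b x \<bullet> e = b' x"
      by (rule borel_version_locally_integrable[OF locally_integrable_inner[OF li(3), of e]])
    have m: "a' \<in> borel_measurable borel" "b' \<in> borel_measurable borel"
      using a' b' by (auto simp: borel_loc_integrable_def)
    have "AE x in lborel. a' x - b' x = 0"
    proof (rule AE_zero_of_test_functions)
      show "(\<lambda>x. a' x - b' x) \<in> borel_measurable borel" using m by simp
    next
      fix l r :: 'a
      have "bounded (cbox l r)" by (rule bounded_cbox)
      then obtain R where R: "\<And>x. x \<in> cbox l r \<Longrightarrow> norm x \<le> R" by (auto simp: bounded_iff)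
      have p: "indicator (cbox l r) \<in> borel_measurable borel" "\<bar>indicator (cbox l r) x :: real\<bar> \<le> 1" "norm x > R \<Longrightarrow> indicator (cbox l r) x = (0::real)" for x
        using R[of x] by (auto simp: indicator_def)
      have "integrable lborel (\<lambda>x. indicator (cbox l r) x * a' x - indicator (cbox l r) x * b' x)"
        by (intro Bochner_Integration.integrable_diff integrable_cutoff[OF a'(1) p] integrable_cutoff[OF b'(1) p])
      then show "integrable lborel (\<lambda>x. indicator (cbox l r) x * (a' x - b' x))" by (simp add: right_diff_distrib)
    next
      fix \<phi> :: "'a \<Rightarrow> real" assume t: "test_function \<phi>"
      obtain R where R: "\<And>x. norm x > R \<Longrightarrow> \<phi> x = 0" using test_function_support[OF t] by blast
      have "C_k (Suc 0) \<phi>" using t unfolding test_function_def by blast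
      then obtain D\<phi> where "\<forall>x. GDERIV \<phi> x :> D\<phi> x" by auto
      then have D: "\<And>x. GDERIV \<phi> x :> D\<phi> x" by blast
      note gr = test_function_gradient[OF t D R]
      have pm: "\<phi> \<in> borel_measurable borel" using gr(1) by (rule borel_measurable_continuous_onI)
      obtain M where M: "\<And>x. \<bar>\<phi> x\<bar> \<le> M" using continuous_compact_support_bounded[OF gr(1) R] by blast
      have "(\<integral>x. \<phi> x * (a' x - b' x) \<partial>lborel) = (\<integral>x. \<phi> x * a' x - \<phi> x * b' x \<partial>lborel)"
        by (simp add: right_diff_distrib)
      also have "\<dots> = (\<integral>x. \<phi> x * a' x \<partial>lborel) - (\<integral>x. \<phi> x * b' x \<partial>lborel)"
        by (intro Bochner_Integration.integral_diff integrable_cutoff[OF a'(1) pm M R] integrable_cutoff[OF b'(1) pm M R])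
      also have "\<dots> = 0"
        using weak_gradient_directional[OF a u'm u'(2) m(1) a'(2) t D] weak_gradient_directional[OF b u'm u'(2) m(2) b'(2) t D]
        by simp
      finally show "(\<integral>x. \<phi> x * (a' x - b' x) \<partial>lborel) = 0" .
    qed
    then show ?thesis using a'(2) b'(2) by eventually_elim simp
  qed
  then have "AE x in lborel. \<forall>e\<in>Basis. a x \<bullet> e = b x \<bullet> e"
    by (intro AE_finite_allI finite_Basis)
  then show ?thesis by eventually_elim (rule euclidean_eqI, blast)
qed

lemma AE_lborel_prod_notin:
  fixes N :: "'a::euclidean_space set"
  assumes N: "N \<in> null_sets lborel"
  shows "AE p in (lborel \<Otimes>\<^sub>M lborel :: ('a \<times> 'a) measure). fst p \<notin> N \<and> snd p \<notin> N"
proof -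
  have "emeasure (lborel \<Otimes>\<^sub>M lborel) (N \<times> (UNIV :: 'a set)) = 0"
    using N by (subst lborel.emeasure_pair_measure_Times) auto
  moreover have "emeasure (lborel \<Otimes>\<^sub>M lborel) ((UNIV :: 'a set) \<times> N) = 0"
    using N by (subst lborel.emeasure_pair_measure_Times) auto
  ultimately have "N \<times> UNIV \<union> UNIV \<times> N \<in> null_sets (lborel \<Otimes>\<^sub>M lborel :: ('a \<times> 'a) measure)"
    using N by (intro null_sets.Un null_setsI) auto
  then show ?thesis by (rule AE_I') auto
qed

lemma sobolev_W1_Lp_borel:
  fixes f :: "'a::euclidean_space \<Rightarrow> 'b::euclidean_space"
  assumes "Lp_function p f" and eq: "AE x in lborel. f x = f' x"
  shows "(\<integral>\<^sup>+x. ennreal (norm (f' x) powr p) \<partial>lborel) < \<infinity>"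
proof -
  have "(\<integral>\<^sup>+x. ennreal (norm (f x) powr p) \<partial>lebesgue) < \<infinity>"
    using assms(1) unfolding Lp_function_def by (simp add: integrable_iff_bounded)
  also have "(\<integral>\<^sup>+x. ennreal (norm (f x) powr p) \<partial>lebesgue) = (\<integral>\<^sup>+x. ennreal (norm (f x) powr p) \<partial>lborel)"
    by (rule nn_integral_completion)
  also have "\<dots> = (\<integral>\<^sup>+x. ennreal (norm (f' x) powr p) \<partial>lborel)"
    by (rule nn_integral_cong_AE) (use eq in eventually_elim, simp)
  finally show ?thesis .
qed

text \<open>
  The density is set to \<open>0\<close> at the exceptional points \<open>x\<close>, where continuity and growth then hold trivially.
\<close>

lemma young_energy_density:
  fixes G g :: "real^'n \<Rightarrow> real^'n \<Rightarrow> real \<Rightarrow> real"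
  assumes young: "generalized_young_function G g"
    and H1: "\<And>x y. G x y 1 \<le> C"
    and H2: "\<And>x t. 0 \<le> t \<Longrightarrow> continuous_on UNIV (\<lambda>y. G x y t)"
    and exponents: "1 < pm" "pm \<le> pp"
    and H3: "\<And>x y t. 0 < t \<Longrightarrow> pm \<le> t * g x y t / G x y t \<and> t * g x y t / G x y t \<le> pp"
  obtains \<Phi> Z where "Z \<in> null_sets lborel" "\<And>x y t. x \<notin> Z \<Longrightarrow> 0 \<le> t \<Longrightarrow> \<Phi> x y t = G x y t"
    "(\<lambda>(x, y, t). \<Phi> x y t) \<in> borel_measurable borel"
    "\<And>x (y :: nat \<Rightarrow> real^'n) (t :: nat \<Rightarrow> real) T. y \<longlonglongrightarrow> x \<Longrightarrow> t \<longlonglongrightarrow> T \<Longrightarrow> (\<And>j. 0 \<le> t j) \<Longrightarrow> (\<lambda>j. \<Phi> x (y j) (t j)) \<longlonglongrightarrow> \<Phi> x x T"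
    "\<And>x y t. 0 \<le> t \<Longrightarrow> \<Phi> x y t \<le> C * (t powr pm + t powr pp)" "0 \<le> C"
proof -
  have g: "mono_on {0..} (g x y)" "g x y 0 = 0" "\<And>t. 0 \<le> t \<Longrightarrow> G x y t = integral {0..t} (g x y)" for x y
    using young by (auto simp: generalized_young_function_def)
  have Gm: "(\<lambda>(x, y). G x y t) \<in> borel_measurable lebesgue" if "0 \<le> t" for t
    using young that by (auto simp: generalized_young_function_def)
  note cont_t = young_continuous[OF g]
  note mono_t = young_mono[OF g]
  note nonneg = young_nonneg[OF g]
  have Gpos: "0 < G x y t" if "0 < t" for x y t
  proof -
    have "G x y t \<noteq> 0" using H3[OF that, of x y] exponents by auto
    then show ?thesis using nonneg[of t x y] that by simp
  qed
  have growth: "G x y t \<le> G x y 1 * (t powr pm + t powr pp)" if "0 \<le> t" for x y t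
  proof (rule young_growth[OF g])
    show "pm * G x y t \<le> t * g x y t" if "0 < t" for t
      using H3[OF that, of x y] Gpos[OF that, of x y] by (simp add: pos_le_divide_eq)
    show "t * g x y t \<le> pp * G x y t" if "0 < t" for t
      using H3[OF that, of x y] Gpos[OF that, of x y] by (simp add: pos_divide_le_eq)
  qed (use exponents that in auto)
  have C: "0 \<le> C" using H1[of 0 0] Gpos[of 1 0 0] by simp
  obtain Z where Z: "Z \<in> null_sets lborel" "(\<lambda>(x, y, t). if x \<in> Z then 0 else G x y (max 0 t)) \<in> borel_measurable borel"
    using borel_modification_joint[OF Gm H2 cont_t] by blast
  define \<Phi> where "\<Phi> x y t = (if x \<in> Z then 0 else G x y (max 0 t))" for x y t
  show thesis
  proof (rule that[of Z \<Phi>])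
    show "\<Phi> x y t = G x y t" if "x \<notin> Z" "0 \<le> t" for x y t using that by (simp add: \<Phi>_def)
    show "(\<lambda>(x, y, t). \<Phi> x y t) \<in> borel_measurable borel" unfolding \<Phi>_def by (rule Z(2))
    show "(\<lambda>j. \<Phi> x (y j) (t j)) \<longlonglongrightarrow> \<Phi> x x T"
      if y: "y \<longlonglongrightarrow> x" and t: "t \<longlonglongrightarrow> T" "\<And>j. 0 \<le> t j" for x and y :: "nat \<Rightarrow> real^'n" and t :: "nat \<Rightarrow> real" and T
    proof (cases "x \<in> Z")
      case False
      have T: "0 \<le> T" using LIMSEQ_le_const[OF t(1)] t(2) by blast
      have "(\<lambda>j. G x (y j) (t j)) \<longlonglongrightarrow> G x x T"
        by (rule monotone_joint_tendsto[OF H2 cont_t mono_t y t])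
      then show ?thesis using False T t(2) by (simp add: \<Phi>_def)
    qed (simp add: \<Phi>_def)
    show "\<Phi> x y t \<le> C * (t powr pm + t powr pp)" if t: "0 \<le> t" for x y t
    proof (cases "x \<in> Z")
      case True
      then show ?thesis using C by (simp add: \<Phi>_def)
    next
      case False
      have "G x y t \<le> G x y 1 * (t powr pm + t powr pp)" by (rule growth[OF t])
      also have "\<dots> \<le> C * (t powr pm + t powr pp)" by (intro mult_right_mono H1) auto
      finally show ?thesis using False t by (simp add: \<Phi>_def)
    qed
  qed fact+
qed

theorem corollary3p4:
  fixes G g :: "real^'n \<Rightarrow> real^'n \<Rightarrow> real \<Rightarrow> real"
    and pm pp :: real
    and u :: "real^'n \<Rightarrow> real"
    and grad_u :: "real^'n \<Rightarrow> real^'n"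
    and k :: 'n
  assumes young: "generalized_young_function G g"
    and H1: "\<exists>C1 C2. 0 < C1 \<and> C1 \<le> C2 \<and> (\<forall>x y. C1 \<le> G x y 1 \<and> G x y 1 \<le> C2)"
    and H2: "\<forall>x. \<forall>t\<ge>0. continuous_on UNIV (\<lambda>y. G x y t)"
    and exponents: "1 < pm" "pm \<le> pp"
    and H3: "\<forall>x y. \<forall>t>0. pm \<le> t * g x y t / G x y t \<and> t * g x y t / G x y t \<le> pp"
    and u: "u \<in> sobolev_W1 pm \<inter> sobolev_W1 pp"
    and grad_u: "has_weak_gradient u grad_u"
  shows "((\<lambda>s. ennreal (1 - s) * J_energy s G u) \<longlongrightarrow>
            (\<integral>\<^sup>+x. H0 k G x (norm (grad_u x)) \<partial>lebesgue)) (at_left 1)"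
proof -
  obtain C where C: "\<And>x y. G x y 1 \<le> C" using H1 by blast
  have H2': "\<And>x t. 0 \<le> t \<Longrightarrow> continuous_on UNIV (\<lambda>y. G x y t)" using H2 by blast
  have H3': "\<And>x y t. 0 < t \<Longrightarrow> pm \<le> t * g x y t / G x y t \<and> t * g x y t / G x y t \<le> pp" using H3 by blast
  \<comment> \<open>From here on \<open>\<Phi>\<close>, \<open>u'\<close> and \<open>v\<close> are Borel versions of \<open>G\<close>, \<open>u\<close> and the gradient.\<close>
  obtain \<Phi> Z where Z: "Z \<in> null_sets lborel" "\<And>x y t. x \<notin> Z \<Longrightarrow> 0 \<le> t \<Longrightarrow> \<Phi> x y t = G x y t"
    and \<Phi>: "(\<lambda>(x, y, t). \<Phi> x y t) \<in> borel_measurable borel"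
      "\<And>x (y :: nat \<Rightarrow> real^'n) (t :: nat \<Rightarrow> real) T. y \<longlonglongrightarrow> x \<Longrightarrow> t \<longlonglongrightarrow> T \<Longrightarrow> (\<And>j. 0 \<le> t j) \<Longrightarrow> (\<lambda>j. \<Phi> x (y j) (t j)) \<longlonglongrightarrow> \<Phi> x x T"
      "\<And>x y t. 0 \<le> t \<Longrightarrow> \<Phi> x y t \<le> C * (t powr pm + t powr pp)" "0 \<le> C"
  proof (rule young_energy_density[OF young C H2' exponents H3'], goal_cases)
    case 3
    show ?case by (rule 3(1)[OF 3(2-)])
  qed
  have li: "locally_integrable u" "locally_integrable grad_u" using grad_u by (auto simp: has_weak_gradient_def)
  obtain u' where u': "borel_loc_integrable u'" "AE x in lborel. u x = u' x"
    by (rule borel_version_locally_integrable[OF li(1)])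
  have u'm: "u' \<in> borel_measurable borel" using u' by (simp add: borel_loc_integrable_def)
  have "\<forall>e. \<exists>w. borel_loc_integrable w \<and> (AE x in lborel. grad_u x \<bullet> e = w x)"
    using borel_version_locally_integrable[OF locally_integrable_inner[OF li(2)]] by metis
  then obtain w where w: "\<And>e. borel_loc_integrable (w e)" "\<And>e. AE x in lborel. grad_u x \<bullet> e = w e x"
    by metis
  have wm: "w e \<in> borel_measurable borel" for e using w(1) by (simp add: borel_loc_integrable_def)
  define v where "v x = (\<Sum>e\<in>Basis. w e x *\<^sub>R e)" for x
  have vm: "v \<in> borel_measurable borel" unfolding v_def using wm by measurable
  have "AE x in lborel. \<forall>e\<in>Basis. grad_u x \<bullet> e = w e x" using w(2) by (intro AE_finite_allI finite_Basis)
  then have gv: "AE x in lborel. grad_u x = v x"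
  proof eventually_elim
    case (elim x)
    have "grad_u x = (\<Sum>e\<in>Basis. (grad_u x \<bullet> e) *\<^sub>R e)" by (rule euclidean_representation[symmetric])
    also have "\<dots> = v x" unfolding v_def by (rule sum.cong) (use elim in auto)
    finally show ?case .
  qed
  have Lp: "(\<integral>\<^sup>+x. ennreal (\<bar>u' x\<bar> powr a) \<partial>lborel) < \<infinity> \<and> (\<integral>\<^sup>+x. ennreal (norm (v x) powr a) \<partial>lborel) < \<infinity>"
    if a: "u \<in> sobolev_W1 a" for a
  proof -
    obtain v' where v': "Lp_function a u" "has_weak_gradient u v'" "Lp_function a v'"
      using a by (auto simp: sobolev_W1_def)
    have "AE x in lborel. v' x = v x"
      using weak_gradient_unique[OF v'(2) grad_u] gv by eventually_elim simp
    then show ?thesis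
      using sobolev_W1_Lp_borel[OF v'(1) u'(2)] sobolev_W1_Lp_borel[OF v'(3)] by simp
  qed
  \<comment> \<open>The increments of \<open>u'\<close> are segment integrals of \<open>v\<close>, which is what the locale asks for.\<close>
  have diff: "AE x in lborel. u' (x + h) - u' x = seg_avg h (\<lambda>x. v x \<bullet> h) x" for h
    unfolding seg_avg_def
  proof (rule weak_derivative_difference[OF u'(1)])
    have vh: "AE x in lborel. grad_u x \<bullet> h = v x \<bullet> h" using gv by eventually_elim simp
    obtain f where f: "borel_loc_integrable f" "AE x in lborel. grad_u x \<bullet> h = f x"
      by (rule borel_version_locally_integrable[OF locally_integrable_inner[OF li(2), of h]])
    have vhm: "(\<lambda>x. v x \<bullet> h) \<in> borel_measurable borel" using vm by measurable
    have fv: "AE x in lborel. v x \<bullet> h = f x" using vh f(2) by eventually_elim simp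
    show "borel_loc_integrable (\<lambda>x. v x \<bullet> h)"
      unfolding borel_loc_integrable_def
    proof (intro conjI allI vhm)
      fix R
      have int: "integrable lborel (\<lambda>x. indicator (cball 0 R) x * f x)" using f(1) by (simp add: borel_loc_integrable_def)
      have [measurable]: "cball (0::real^'n) R \<in> sets borel" by simp
      note [measurable] = vhm
      show "integrable lborel (\<lambda>x. indicator (cball 0 R) x * (v x \<bullet> h))"
      proof (rule integrable_cong_AE_imp[OF int])
        show "AE x in lborel. indicator (cball 0 R) x * f x = indicator (cball 0 R) x * (v x \<bullet> h)"
          using fv by eventually_elim simp
      qed measurable
    qed
    fix \<phi> :: "real^'n \<Rightarrow> real" and D\<phi> :: "real^'n \<Rightarrow> real^'n"
    assume "test_function \<phi>" "\<And>x. GDERIV \<phi> x :> D\<phi> x"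
    then show "(\<integral>x. u' x * (D\<phi> x \<bullet> h) \<partial>lborel) = - (\<integral>x. \<phi> x * (v x \<bullet> h) \<partial>lborel)"
      by (rule weak_gradient_directional[OF grad_u u'm u'(2) vhm vh])
  qed
  interpret E: energy_density \<Phi> C pm pp u' v
    by unfold_locales (use \<Phi> exponents u'm vm diff Lp u in auto)
  have ae: "AE x in lborel. x \<notin> Z \<and> u x = u' x \<and> grad_u x = v x"
    using AE_not_in[OF Z(1)] u'(2) gv by eventually_elim simp
  \<comment> \<open>One null set outside of which all versions agree; neither energy sees it.\<close>
  obtain N where "{x \<in> space lborel. \<not> (x \<notin> Z \<and> u x = u' x \<and> grad_u x = v x)} \<subseteq> N" "N \<in> null_sets lborel"
    using ae[unfolded eventually_ae_filter] by (elim bexE)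
  then have N: "N \<in> null_sets lborel" "\<And>x. x \<notin> N \<Longrightarrow> x \<notin> Z \<and> u x = u' x \<and> grad_u x = v x"
    by auto
  have J: "J_energy s G u = E.energy s" for s
  proof -
    have "J_energy s G u = (\<integral>\<^sup>+(x, y). ennreal (G x y (\<bar>u x - u y\<bar> / norm (x - y) powr s) / norm (x - y) ^ CARD('n)) \<partial>(lborel \<Otimes>\<^sub>M lborel))"
      unfolding J_energy_def lborel_prod by (rule nn_integral_completion)
    also have "\<dots> = E.energy s"
      unfolding E.energy_def
    proof (rule nn_integral_cong_AE)
      show "AE p in lborel \<Otimes>\<^sub>M lborel. (case p of (x, y) \<Rightarrow> ennreal (G x y (\<bar>u x - u y\<bar> / norm (x - y) powr s) / norm (x - y) ^ CARD('n)))
         = (case p of (x, y) \<Rightarrow> ennreal (\<Phi> x y (\<bar>u' x - u' y\<bar> / norm (x - y) powr s) / norm (x - y) ^ CARD('n)))"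
        using AE_lborel_prod_notin[OF N(1)]
      proof eventually_elim
        case (elim p)
        then show ?case using N(2)[of "fst p"] N(2)[of "snd p"] Z(2)[of "fst p"] by (simp add: case_prod_unfold)
      qed
    qed
    finally show ?thesis .
  qed
  have "(\<integral>\<^sup>+x. H0 k G x (norm (grad_u x)) \<partial>lebesgue) = (\<integral>\<^sup>+x. H0 k G x (norm (grad_u x)) \<partial>lborel)"
    by (rule nn_integral_completion)
  also have "\<dots> = E.limit_energy"
    unfolding E.limit_energy_eq[of k]
  proof (rule nn_integral_cong_AE)
    have "AE x in lborel. x \<notin> N" by (rule AE_not_in[OF N(1)])
    then show "AE x in lborel. H0 k G x (norm (grad_u x)) = (\<integral>\<^sup>+\<rho>\<in>{0<..<1}. (\<integral>\<^sup>+w. ennreal (\<Phi> x x (norm (v x) * \<bar>w $ k\<bar> * \<rho>)) \<partial>surface_measure) / ennreal \<rho> \<partial>lborel)"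
    proof eventually_elim
      case (elim x)
      have "H0 k G x (norm (grad_u x)) = (\<integral>\<^sup>+r\<in>{0<..<1}. (\<integral>\<^sup>+w\<in>sphere 0 1. ennreal (G x x (norm (v x) * \<bar>w $ k\<bar> * r)) \<partial>hausdorff_measure (CARD('n) - 1)) / ennreal r \<partial>lborel)"
        unfolding H0_def using N(2)[OF elim] by (simp add: nn_integral_completion)
      also have "\<dots> = (\<integral>\<^sup>+r\<in>{0<..<1}. (\<integral>\<^sup>+w. ennreal (\<Phi> x x (norm (v x) * \<bar>w $ k\<bar> * r)) \<partial>surface_measure) / ennreal r \<partial>lborel)"
      proof (rule nn_integral_cong)
        fix r :: real
        show "(\<integral>\<^sup>+w\<in>sphere 0 1. ennreal (G x x (norm (v x) * \<bar>w $ k\<bar> * r)) \<partial>hausdorff_measure (CARD('n) - 1)) / ennreal r * indicator {0<..<1} r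
          = (\<integral>\<^sup>+w. ennreal (\<Phi> x x (norm (v x) * \<bar>w $ k\<bar> * r)) \<partial>surface_measure) / ennreal r * indicator {0<..<1} r"
        proof (cases "0 < r")
          case True
          have "(\<integral>\<^sup>+w\<in>sphere 0 1. ennreal (G x x (norm (v x) * \<bar>w $ k\<bar> * r)) \<partial>hausdorff_measure (CARD('n) - 1))
            = (\<integral>\<^sup>+w\<in>sphere 0 1. ennreal (\<Phi> x x (norm (v x) * \<bar>w $ k\<bar> * r)) \<partial>hausdorff_measure (CARD('n) - 1))"
            using True N(2)[OF elim] by (intro nn_integral_cong) (simp add: Z(2))
          also have "\<dots> = (\<integral>\<^sup>+w. ennreal (\<Phi> x x (norm (v x) * \<bar>w $ k\<bar> * r)) \<partial>surface_measure)"
            by (rule nn_integral_hausdorff_sphere) measurable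
          finally show ?thesis by simp
        qed simp
      qed
      finally show ?case .
    qed
  qed
  finally show ?thesis unfolding J using E.scaled_energy_tendsto by simp
qed

end
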